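(* Let $M$ be an $m$-dimensional manifold and $\mathcal{F}$ a fibration-covered codimension one foliation of $M$ such that $\widetilde{M}/\widetilde{\mathcal{F}}$ is a 1-connected 1-manifold. Then: (a) $K_{st}^{\mathcal{F}}$ satisfies the weak Kan property in degrees $2,\ldots,m$, and (b) $K^{\mathcal{F}}$ satisfies the weak Kan property in degrees $3,\ldots,m$.
   Context: Conventions: all manifolds and foliations are $C^\infty$ (tangentially and transversally); all manifolds are orientable. $\widetilde{M}$ is the universal covering of $M$, $\widetilde{\mathcal{F}}$ the pull-back foliation, and $\widetilde{M}/\widetilde{\mathcal{F}}$ its leaf space; a "1-connected 1-manifold" here is a simply connected, possibly non-Hausdorff, 1-manifold. $\mathcal{F}$ is fibration-covered if there is some covering $\widehat{M}\to M$, with pull-back foliation $\widehat{\mathcal{F}}$, such that the projection $\widehat{M}\to\widehat{M}/\widehat{\mathcal{F}}$ to the leaf space is a locally trivial fibration. Transverse simplices. Singular simplices $\sigma:\Delta^n\to M$ are continuous. $\mathcal{F}$ induces an equivalence relation on $\Delta^n$: $x\sim y$ iff $\sigma(x),\sigma(y)$ lie in the same connected component of $L\cap\sigma(\Delta^n)$ for some leaf $L$. $\sigma$ is foliated if $\sim$ is induced by a foliation of $\Delta^n$, denoted $\mathcal{F}|_\sigma$. A foliation of $\Delta^n$ is affine if there is an affine map $f:\Delta^n\to\mathbb{R}$ such that $x,y$ are in the same leaf iff $f(x)=f(y)$; it is conjugate to an affine foliation if there is a simplicial homeomorphism $H:\Delta^n\to\Delta^n$ (i.e. mapping faces to faces)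 pulling it back to an affine foliation. For $n\ge2$, $\sigma$ is transverse to $\mathcal{F}$ if it is foliated and either is contained in a leaf or $\mathcal{F}|_\sigma$ is conjugate to an affine foliation. A simplex $\sigma:\Delta^n\to M$ is said to satisfy local surjectivity if for each foliation chart $\phi:U\to\mathbb{R}^{m-1}\times\mathbb{R}^1$ with $m$-th coordinate $\phi_m$ and each $p\in\mathrm{int}(\Delta^n)\cap\sigma^{-1}(U)$, $\phi_m\circ\sigma|_{\sigma^{-1}(U)}$ is locally surjective at $p$, i.e. its image contains a neighborhood of $\phi_m(\sigma(p))$. A 1-simplex is transverse if it is contained in a leaf or satisfies local surjectivity. A simplex is strongly transverse if it is transverse and either is contained in a leaf or satisfies local surjectivity (every 0-simplex lies in a leaf). $K^{\mathcal{F}}$ and $K^{\mathcal{F}}_{st}$ denote the sets of all transverse, resp. strongly transverse, singular simplices in $M$. Weak Kan property. Let $S_k(M)$ be the set of singular $k$-simplices with face maps $\partial_i$. A set $T\subset S_*(M)$, with $T_n=T\cap S_n(M)$, satisfies the weak Kan property in degree $n$ if for every $k\in\{0,\dots,n+1\}$ and every collection of $n+1$ simplices $\{\tau_0,\ldots,\tau_{k-1},\tau_{k+1},\ldots,\tau_{n+1}\}\subset T_n$ with $\partial_i\tau_j=\partial_{j-1}\tau_i$ for all $i<j$, there is $\sigma\in S_{n+1}(M)$ with $\partial_i\sigma=\tau_i$ for all $i\ne k$ and $\partial_k\sigma\in T_n$ (not necessarily $\sigma\in T_{n+1}$).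
   Formalization: The relation x~y on the simplex uses connected components of the preimage of a leaf L under σ in Δ^n, not of L∩σ(Δ^n) in M (with which the claim fails on a foliated torus); local surjectivity at p requires every neighbourhood of p to have image containing a neighbourhood. *)

theory Defs
  imports "HOL-Analysis.Analysis" "HOL-Homology.Homology"
begin

section \<open>Smooth manifolds\<close>

primrec higher_differentiable_on ::
  "nat \<Rightarrow> 'a::real_normed_vector set \<Rightarrow> ('a \<Rightarrow> 'b::real_normed_vector) \<Rightarrow> bool" where
  "higher_differentiable_on 0 S f \<longleftrightarrow> continuous_on S f"
| "higher_differentiable_on (Suc k) S f \<longleftrightarrow>
     (\<forall>x\<in>S. f differentiable (at x)) \<and>
     (\<forall>v. higher_differentiable_on k S (\<lambda>x. frechet_derivative f (at x) v))"

text \<open>Only used for open subsets of finite-dimensional spaces, where this is the usual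
  notion of a \<open>C\<^sup>\<infinity>\<close> map.\<close>

definition smooth_on :: "'a::real_normed_vector set \<Rightarrow> ('a \<Rightarrow> 'b::real_normed_vector) \<Rightarrow> bool" where
  "smooth_on S f \<longleftrightarrow> (\<forall>k. higher_differentiable_on k S f)"

text \<open>A chart is a pair \<open>(U, \<phi>)\<close>; the values of \<open>\<phi>\<close> outside \<open>U\<close> are irrelevant.
  The dimension of the manifold is \<open>CARD('m)\<close>.\<close>

type_synonym ('a, 'm) chart = "'a set \<times> ('a \<Rightarrow> real ^ 'm)"

definition is_chart :: "'a topology \<Rightarrow> ('a, 'm::finite) chart \<Rightarrow> bool" where
  "is_chart M = (\<lambda>(U, \<phi>). openin M U \<and> open (\<phi> ` U) \<and>
     homeomorphic_map (subtopology M U) (top_of_set (\<phi> ` U)) \<phi>)"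

definition overlap :: "('a, 'm::finite) chart \<Rightarrow> ('a, 'm) chart \<Rightarrow> (real ^ 'm) set" where
  "overlap c d = snd c ` (fst c \<inter> fst d)"

definition transition :: "('a, 'm::finite) chart \<Rightarrow> ('a, 'm) chart \<Rightarrow> real ^ 'm \<Rightarrow> real ^ 'm" where
  "transition c d = snd d \<circ> the_inv_into (fst c) (snd c)"

definition smoothly_compatible :: "('a, 'm::finite) chart \<Rightarrow> ('a, 'm) chart \<Rightarrow> bool" where
  "smoothly_compatible c d \<longleftrightarrow>
     smooth_on (overlap c d) (transition c d) \<and> smooth_on (overlap d c) (transition d c)"

definition smooth_manifold :: "'a topology \<Rightarrow> ('a, 'm::finite) chart set \<Rightarrow> bool" where
  "smooth_manifold M A \<longleftrightarrow>
     Hausdorff_space M \<and> second_countable M \<and>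
     (\<forall>c\<in>A. is_chart M c) \<and> \<Union> (fst ` A) = topspace M \<and>
     (\<forall>c\<in>A. \<forall>d\<in>A. smoothly_compatible c d)"

definition smooth_chart :: "'a topology \<Rightarrow> ('a, 'm::finite) chart set \<Rightarrow> ('a, 'm) chart \<Rightarrow> bool" where
  "smooth_chart M A c \<longleftrightarrow> is_chart M c \<and> (\<forall>d\<in>A. smoothly_compatible c d)"

definition orientable :: "'a topology \<Rightarrow> ('a, 'm::finite) chart set \<Rightarrow> bool" where
  "orientable M A \<longleftrightarrow>
     (\<exists>B. (\<forall>c\<in>B. smooth_chart M A c) \<and> \<Union> (fst ` B) = topspace M \<and>
       (\<forall>c\<in>B. \<forall>d\<in>B. \<forall>z\<in>overlap c d.
          det (matrix (frechet_derivative (transition c d) (at z))) > 0))"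


section \<open>Codimension one foliations\<close>

text \<open>The last coordinate of \<open>\<real>\<^sup>m = \<real>\<^sup>m\<^sup>-\<^sup>1 \<times> \<real>\<close>. The order on the index type serves only to
  single it out.\<close>

definition last_coord :: "real ^ 'm::{finite,linorder} \<Rightarrow> real" where
  "last_coord x = x $ Max UNIV"

text \<open>The condition is local because the overlap of two charts may meet a horizontal
  hyperplane in several components.\<close>

definition foliated_compatible ::
  "('a, 'm::{finite,linorder}) chart \<Rightarrow> ('a, 'm) chart \<Rightarrow> bool" where
  "foliated_compatible c d \<longleftrightarrow>
     smoothly_compatible c d \<and>
     (\<forall>z\<in>overlap c d. \<exists>W. open W \<and> z \<in> W \<and> W \<subseteq> overlap c d \<and>
        (\<forall>u\<in>W. \<forall>v\<in>W. last_coord u = last_coord v \<longrightarrow>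
           last_coord (transition c d u) = last_coord (transition c d v)))"

text \<open>A codimension one foliation is given by its maximal foliated atlas, so the members
  of \<open>F\<close> are exactly its foliation charts \<open>\<phi> : U \<rightarrow> \<real>\<^sup>m\<^sup>-\<^sup>1 \<times> \<real>\<close>. These are onto, so that
  plaques are connected.\<close>

definition codim_one_foliation ::
  "'a topology \<Rightarrow> ('a, 'm::{finite,linorder}) chart set \<Rightarrow> ('a, 'm) chart set \<Rightarrow> bool" where
  "codim_one_foliation M A F \<longleftrightarrow>
     (\<forall>c\<in>F. smooth_chart M A c \<and> snd c ` fst c = UNIV) \<and>
     \<Union> (fst ` F) = topspace M \<and>
     (\<forall>c\<in>F. \<forall>d\<in>F. foliated_compatible c d) \<and>
     (\<forall>c. smooth_chart M A c \<and> snd c ` fst c = UNIV \<and>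
          (\<forall>d\<in>F. foliated_compatible c d \<and> foliated_compatible d c) \<longrightarrow> c \<in> F)"

definition same_plaque :: "('a, 'm::{finite,linorder}) chart set \<Rightarrow> 'a rel" where
  "same_plaque F =
     {(x, y). \<exists>(U, \<phi>)\<in>F. x \<in> U \<and> y \<in> U \<and> last_coord (\<phi> x) = last_coord (\<phi> y)}"

definition leaf :: "('a, 'm::{finite,linorder}) chart set \<Rightarrow> 'a \<Rightarrow> 'a set" where
  "leaf F x = (same_plaque F)\<^sup>* `` {x}"

definition leaves :: "'a topology \<Rightarrow> ('a, 'm::{finite,linorder}) chart set \<Rightarrow> 'a set set" where
  "leaves M F = leaf F ` topspace M"

definition leaf_space :: "'a topology \<Rightarrow> ('a, 'm::{finite,linorder}) chart set \<Rightarrow> 'a set topology" where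
  "leaf_space M F =
     topology (\<lambda>W. W \<subseteq> leaves M F \<and> openin M {x \<in> topspace M. leaf F x \<in> W})"

lemma openin_leaf_space:
  "openin (leaf_space M F) W \<longleftrightarrow>
     W \<subseteq> leaves M F \<and> openin M {x \<in> topspace M. leaf F x \<in> W}"
proof -
  have "istopology (\<lambda>W. W \<subseteq> leaves M F \<and> openin M {x \<in> topspace M. leaf F x \<in> W})"
    unfolding istopology_def
  proof (intro conjI allI impI)
    fix S T
    assume "S \<subseteq> leaves M F \<and> openin M {x \<in> topspace M. leaf F x \<in> S}"
      and "T \<subseteq> leaves M F \<and> openin M {x \<in> topspace M. leaf F x \<in> T}"
    moreover have "{x \<in> topspace M. leaf F x \<in> S \<inter> T} =
        {x \<in> topspace M. leaf F x \<in> S} \<inter> {x \<in> topspace M. leaf F x \<in> T}"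
      by blast
    ultimately show "S \<inter> T \<subseteq> leaves M F"
      and "openin M {x \<in> topspace M. leaf F x \<in> S \<inter> T}"
      by auto
  next
    fix K
    assume K: "\<forall>S\<in>K. S \<subseteq> leaves M F \<and> openin M {x \<in> topspace M. leaf F x \<in> S}"
    have "{x \<in> topspace M. leaf F x \<in> \<Union>K} = (\<Union>S\<in>K. {x \<in> topspace M. leaf F x \<in> S})"
      by blast
    with K show "openin M {x \<in> topspace M. leaf F x \<in> \<Union>K}" by auto
    from K show "\<Union>K \<subseteq> leaves M F" by blast
  qed
  then show ?thesis
    by (simp add: leaf_space_def topology_inverse')
qed


section \<open>Coverings and fibrations\<close>

text \<open>The counterpart of \<^const>\<open>covering_space\<close> for abstract topologies.\<close>

definition covering_map :: "'c topology \<Rightarrow> 'a topology \<Rightarrow> ('c \<Rightarrow> 'a) \<Rightarrow> bool" where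
  "covering_map E B p \<longleftrightarrow>
     continuous_map E B p \<and> p ` topspace E = topspace B \<and>
     (\<forall>x\<in>topspace B. \<exists>T. x \<in> T \<and> openin B T \<and>
        (\<exists>\<V>. \<Union>\<V> = {e \<in> topspace E. p e \<in> T} \<and> (\<forall>V\<in>\<V>. openin E V) \<and>
           pairwise disjnt \<V> \<and>
           (\<forall>V\<in>\<V>. homeomorphic_map (subtopology E V) (subtopology B T) p)))"

text \<open>The counterpart of \<^const>\<open>simply_connected\<close>. Any two loops are required to be freely
  homotopic; applied to constant loops this gives path-connectedness.\<close>

definition simply_connected_space :: "'a topology \<Rightarrow> bool" where
  "simply_connected_space X \<longleftrightarrow>
     topspace X \<noteq> {} \<and>
     (\<forall>g h. pathin X g \<and> g 1 = g 0 \<and> pathin X h \<and> h 1 = h 0 \<longrightarrow>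
        homotopic_with (\<lambda>r. r 1 = r 0) (top_of_set {0..1::real}) X g h)"

definition universal_covering :: "'c topology \<Rightarrow> 'a topology \<Rightarrow> ('c \<Rightarrow> 'a) \<Rightarrow> bool" where
  "universal_covering E B p \<longleftrightarrow> covering_map E B p \<and> simply_connected_space E"

text \<open>A foliated atlas of the pull-back foliation. It need not be maximal, but its leaves and
  leaf space are those of the pull-back foliation.\<close>

definition pullback_atlas ::
  "'c topology \<Rightarrow> 'a topology \<Rightarrow> ('c \<Rightarrow> 'a) \<Rightarrow> ('a, 'm::finite) chart set \<Rightarrow> ('c, 'm) chart set" where
  "pullback_atlas E M p F =
     {(V, \<phi> \<circ> p) | V \<phi>. openin E V \<and> (p ` V, \<phi>) \<in> F \<and>
        homeomorphic_map (subtopology E V) (subtopology M (p ` V)) p}"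

text \<open>There is no loss in taking the fibre \<open>Z\<close> in the type of the total space, since it is
  homeomorphic to a subspace of it.\<close>

definition locally_trivial_fibration :: "'c topology \<Rightarrow> 'b topology \<Rightarrow> ('c \<Rightarrow> 'b) \<Rightarrow> bool" where
  "locally_trivial_fibration E B q \<longleftrightarrow>
     continuous_map E B q \<and>
     (\<forall>b\<in>topspace B. \<exists>V (Z :: 'c topology) h. openin B V \<and> b \<in> V \<and>
        homeomorphic_map (subtopology E {e \<in> topspace E. q e \<in> V})
          (prod_topology (subtopology B V) Z) h \<and>
        (\<forall>e\<in>topspace E. q e \<in> V \<longrightarrow> fst (h e) = q e))"

text \<open>The type argument is the type of the points of the covering space.\<close>

definition fibration_covered ::
  "'c itself \<Rightarrow> 'a topology \<Rightarrow> ('a, 'm::{finite,linorder}) chart set \<Rightarrow> bool" where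
  "fibration_covered TYPE('c) M F \<longleftrightarrow>
     (\<exists>(E :: 'c topology) p. covering_map E M p \<and>
        locally_trivial_fibration E (leaf_space E (pullback_atlas E M p F))
          (leaf (pullback_atlas E M p F)))"

text \<open>Manifolds in this sense need not be Hausdorff.\<close>

definition one_manifold :: "'a topology \<Rightarrow> bool" where
  "one_manifold X \<longleftrightarrow>
     second_countable X \<and>
     (\<forall>x\<in>topspace X. \<exists>U. openin X U \<and> x \<in> U \<and> subtopology X U homeomorphic_space euclideanreal)"


section \<open>Transverse simplices\<close>

abbreviation simplex_top :: "nat \<Rightarrow> (nat \<Rightarrow> real) topology" where
  "simplex_top n \<equiv> subtopology (powertop_real UNIV) (standard_simplex n)"

definition simplex_interior :: "nat \<Rightarrow> (nat \<Rightarrow> real) set" where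
  "simplex_interior n = {x \<in> standard_simplex n. \<forall>i\<le>n. 0 < x i}"

definition affine_on_simplex :: "nat \<Rightarrow> ((nat \<Rightarrow> real) \<Rightarrow> real) \<Rightarrow> bool" where
  "affine_on_simplex n f \<longleftrightarrow>
     (\<forall>x\<in>standard_simplex n. \<forall>y\<in>standard_simplex n. \<forall>t\<in>{0..1}.
        f (\<lambda>i. (1 - t) * x i + t * y i) = (1 - t) * f x + t * f y)"

text \<open>A foliation of the simplex is represented by its leaf relation \<open>R\<close>. It is described
  locally by functions \<open>g\<close> that are conjugate to affine ones and whose level sets agree on
  overlaps; constant functions are allowed, so that the whole simplex can be a single leaf.\<close>

definition simplex_foliation :: "nat \<Rightarrow> (nat \<Rightarrow> real) rel \<Rightarrow> bool" where
  "simplex_foliation n R \<longleftrightarrow>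
     (\<exists>G. \<Union> (fst ` G) = standard_simplex n \<and>
        (\<forall>(W, g)\<in>G. openin (simplex_top n) W \<and>
           (\<exists>h f. openin (simplex_top n) (h ` W) \<and>
              homeomorphic_map (subtopology (simplex_top n) W)
                (subtopology (simplex_top n) (h ` W)) h \<and>
              affine_on_simplex n f \<and> (\<forall>x\<in>W. g x = f (h x)))) \<and>
        (\<forall>(W, g)\<in>G. \<forall>(W', g')\<in>G. \<forall>z\<in>W \<inter> W'. \<exists>N. openin (simplex_top n) N \<and> z \<in> N \<and>
           N \<subseteq> W \<inter> W' \<and> (\<forall>x\<in>N. \<forall>y\<in>N. g x = g y \<longleftrightarrow> g' x = g' y)) \<and>
        R = {(x, y). \<exists>(W, g)\<in>G. connected_component_of
               (subtopology (simplex_top n) {z \<in> W. g z = g x}) x y}\<^sup>+)"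

definition affine_foliation :: "nat \<Rightarrow> (nat \<Rightarrow> real) rel \<Rightarrow> bool" where
  "affine_foliation n R \<longleftrightarrow>
     (\<exists>f. affine_on_simplex n f \<and>
        R = {(x, y). x \<in> standard_simplex n \<and> y \<in> standard_simplex n \<and> f x = f y})"

definition simplex_face :: "nat \<Rightarrow> nat set \<Rightarrow> (nat \<Rightarrow> real) set" where
  "simplex_face n I = {x \<in> standard_simplex n. \<forall>i. i \<notin> I \<longrightarrow> x i = 0}"

definition simplicial_homeomorphism :: "nat \<Rightarrow> ((nat \<Rightarrow> real) \<Rightarrow> nat \<Rightarrow> real) \<Rightarrow> bool" where
  "simplicial_homeomorphism n H \<longleftrightarrow>
     homeomorphic_map (simplex_top n) (simplex_top n) H \<and>
     (\<forall>I\<subseteq>{..n}. \<exists>J\<subseteq>{..n}. H ` simplex_face n I = simplex_face n J)"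

definition conjugate_to_affine :: "nat \<Rightarrow> (nat \<Rightarrow> real) rel \<Rightarrow> bool" where
  "conjugate_to_affine n R \<longleftrightarrow>
     (\<exists>H. simplicial_homeomorphism n H \<and>
        affine_foliation n
          {(x, y). x \<in> standard_simplex n \<and> y \<in> standard_simplex n \<and> (H x, H y) \<in> R})"

text \<open>The relation on the simplex induced by \<open>F\<close>. The intersection of a leaf \<open>L\<close> with the
  singular simplex \<open>\<sigma>\<close> is parametrized by \<open>\<sigma> -` L\<close>, and its components are taken in the
  simplex. (Taking components of the subset \<open>L \<inter> \<sigma> ` standard_simplex n\<close> of the manifold
  instead would give the same relation when \<open>\<sigma>\<close> is an embedding, but it would
  identify unrelated parts of a non-injective \<open>\<sigma>\<close> that happen to have overlapping images.)\<close>

definition induced_rel ::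
  "'a topology \<Rightarrow> ('a, 'm::{finite,linorder}) chart set \<Rightarrow> nat \<Rightarrow> ((nat \<Rightarrow> real) \<Rightarrow> 'a) \<Rightarrow> (nat \<Rightarrow> real) rel" where
  "induced_rel M F n \<sigma> =
     {(x, y). \<exists>L\<in>leaves M F. connected_component_of
        (subtopology (simplex_top n) {z \<in> standard_simplex n. \<sigma> z \<in> L}) x y}"

definition foliated_simplex ::
  "'a topology \<Rightarrow> ('a, 'm::{finite,linorder}) chart set \<Rightarrow> nat \<Rightarrow> ((nat \<Rightarrow> real) \<Rightarrow> 'a) \<Rightarrow> bool" where
  "foliated_simplex M F n \<sigma> \<longleftrightarrow> simplex_foliation n (induced_rel M F n \<sigma>)"

definition contained_in_leaf ::
  "'a topology \<Rightarrow> ('a, 'm::{finite,linorder}) chart set \<Rightarrow> nat \<Rightarrow> ((nat \<Rightarrow> real) \<Rightarrow> 'a) \<Rightarrow> bool" where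
  "contained_in_leaf M F n \<sigma> \<longleftrightarrow> (\<exists>L\<in>leaves M F. \<sigma> ` standard_simplex n \<subseteq> L)"

text \<open>Local surjectivity at \<open>p\<close> concerns the germ of \<open>\<phi>\<^sub>m \<circ> \<sigma>\<close> at \<open>p\<close>: the image of every
  neighbourhood of \<open>p\<close> in \<open>\<sigma> -` U\<close> contains a neighbourhood of \<open>\<phi>\<^sub>m (\<sigma> p)\<close>.\<close>

definition local_surjectivity ::
  "('a, 'm::{finite,linorder}) chart set \<Rightarrow> nat \<Rightarrow> ((nat \<Rightarrow> real) \<Rightarrow> 'a) \<Rightarrow> bool" where
  "local_surjectivity F n \<sigma> \<longleftrightarrow>
     (\<forall>(U, \<phi>)\<in>F. \<forall>p\<in>simplex_interior n. \<sigma> p \<in> U \<longrightarrow>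
        (\<forall>W. openin (simplex_top n) W \<and> p \<in> W \<and> \<sigma> ` W \<subseteq> U \<longrightarrow>
           (\<exists>T. open T \<and> last_coord (\<phi> (\<sigma> p)) \<in> T \<and>
              T \<subseteq> (\<lambda>x. last_coord (\<phi> (\<sigma> x))) ` W)))"

definition transverse ::
  "'a topology \<Rightarrow> ('a, 'm::{finite,linorder}) chart set \<Rightarrow> nat \<Rightarrow> ((nat \<Rightarrow> real) \<Rightarrow> 'a) \<Rightarrow> bool" where
  "transverse M F n \<sigma> \<longleftrightarrow>
     (if n \<le> 1 then contained_in_leaf M F n \<sigma> \<or> local_surjectivity F n \<sigma>
      else foliated_simplex M F n \<sigma> \<and>
        (contained_in_leaf M F n \<sigma> \<or> conjugate_to_affine n (induced_rel M F n \<sigma>)))"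

definition strongly_transverse ::
  "'a topology \<Rightarrow> ('a, 'm::{finite,linorder}) chart set \<Rightarrow> nat \<Rightarrow> ((nat \<Rightarrow> real) \<Rightarrow> 'a) \<Rightarrow> bool" where
  "strongly_transverse M F n \<sigma> \<longleftrightarrow>
     transverse M F n \<sigma> \<and> (contained_in_leaf M F n \<sigma> \<or> local_surjectivity F n \<sigma>)"

text \<open>Sets of singular simplices are graded by the dimension.\<close>

definition transverse_simplices ::
  "'a topology \<Rightarrow> ('a, 'm::{finite,linorder}) chart set \<Rightarrow> nat \<Rightarrow> ((nat \<Rightarrow> real) \<Rightarrow> 'a) set" where
  "transverse_simplices M F n = {\<sigma> \<in> singular_simplex_set n M. transverse M F n \<sigma>}"

definition strongly_transverse_simplices ::
  "'a topology \<Rightarrow> ('a, 'm::{finite,linorder}) chart set \<Rightarrow> nat \<Rightarrow> ((nat \<Rightarrow> real) \<Rightarrow> 'a) set" where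
  "strongly_transverse_simplices M F n =
     {\<sigma> \<in> singular_simplex_set n M. strongly_transverse M F n \<sigma>}"


section \<open>The weak Kan property\<close>

definition weak_kan :: "'a topology \<Rightarrow> (nat \<Rightarrow> ((nat \<Rightarrow> real) \<Rightarrow> 'a) set) \<Rightarrow> nat \<Rightarrow> bool" where
  "weak_kan M T n \<longleftrightarrow>
     (\<forall>k\<le>n + 1. \<forall>\<tau>.
        (\<forall>j\<in>{..n + 1} - {k}. \<tau> j \<in> T n) \<and>
        (\<forall>i\<in>{..n + 1} - {k}. \<forall>j\<in>{..n + 1} - {k}. i < j \<longrightarrow>
           singular_face n i (\<tau> j) = singular_face n (j - 1) (\<tau> i)) \<longrightarrow>
        (\<exists>\<sigma>\<in>singular_simplex_set (n + 1) M.
           (\<forall>i\<in>{..n + 1} - {k}. singular_face (n + 1) i \<sigma> = \<tau> i) \<and>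
           singular_face (n + 1) k \<sigma> \<in> T n))"

end

theory Submission
  imports Defs
begin

text \<open>
  A transverse simplex carries a level function: a function conjugate to an affine one whose level
  sets are the components of its intersections with the leaves. On a horn with apex \<open>k\<close> the level
  functions of the facets are compared along the edges that start at \<open>k\<close>. If \<open>n \<ge> 3\<close>, any three
  such edges lie in a common facet, so the level functions glue to one function \<open>\<phi>\<close> on the horn.
  If \<open>n = 2\<close>, this is where local surjectivity is needed: after lifting to the universal covering,
  whose leaf space is a one-manifold, the leaf map is open, hence injective, on short transversals,
  and two curves that pass through the same leaves from the same starting point stay on the same levels.

  The function \<open>\<phi>\<close> extends to a function conjugate to an affine one on the missing face, and by
  Tietze to a function \<open>\<Phi>\<close> on the whole simplex. In the covering whose leaf map \<open>q\<close> is a fibration,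
  the lifted horn satisfies \<open>q \<circ> S = U \<circ> \<phi>\<close> for a path \<open>U\<close> of leaves. Lifting the homotopy from
  \<open>U \<circ> \<phi> \<circ> r\<close>, where \<open>r\<close> retracts the simplex onto the horn, to \<open>U \<circ> \<Phi>\<close> gives a map of the
  simplex into that covering. Its projection fills the horn, and \<open>\<phi>\<close> is a level function of the missing face.
\<close>


section \<open>Simplices\<close>

text \<open>Transversality controls the components of intersections with leaves, not the leaves: a
  leaf may return to a simplex on many levels, and the level functions of two facets have unrelated
  scales. So functions conjugate to affine ones must survive a change of scale and an extension from
  a boundary. The former is done by exponential tilting of barycentric coordinates, the latter by
  coning, one dimension after the other. Gluing also needs one facet whose scale serves all levels.
  If two edges at \<open>k\<close> lead to the same side of the level of \<open>k\<close>, the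
  longer one repeats all levels of the shorter, and the facet without the shorter one will do. Of
  three edges two lead to the same side, unless a level function is constant on one of them. A leaf
  meets a chart in countably many plaques, so a path inside a leaf lifts into one leaf of any
  covering. This links components below with leaves above. The universal covering serves only the
  arguments with local surjectivity. On the missing face a connected part of a leaf might cross many
  levels. This is excluded because a facet of the horn that shares with it both vertices of extreme
  value has the same levels.\<close>

definition splx :: "nat set \<Rightarrow> (nat \<Rightarrow> real) set" where
  "splx I = {x. (\<forall>i. 0 \<le> x i) \<and> (\<forall>i. i \<notin> I \<longrightarrow> x i = 0) \<and> sum x I = 1}"

definition vtx :: "nat \<Rightarrow> nat \<Rightarrow> real" where
  "vtx i = (\<lambda>j. if j = i then 1 else 0)"

definition lin :: "nat set \<Rightarrow> (nat \<Rightarrow> real) \<Rightarrow> (nat \<Rightarrow> real) \<Rightarrow> real" where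
  "lin I a x = (\<Sum>i\<in>I. a i * x i)"

lemma splxD:
  assumes "x \<in> splx I"
  shows "0 \<le> x i" "i \<notin> I \<Longrightarrow> x i = 0" "sum x I = 1"
  using assms by (auto simp: splx_def)

lemma splx_empty [simp]: "splx {} = {}"
  by (auto simp: splx_def)

lemma splx_mono:
  assumes "J \<subseteq> I" "finite I"
  shows "splx J \<subseteq> splx I"
proof
  fix x assume x: "x \<in> splx J"
  then have "sum x J = sum x I"
    using assms by (intro sum.mono_neutral_left) (auto simp: splx_def)
  with x assms show "x \<in> splx I" by (auto simp: splx_def)
qed

lemma splx_subset_support:
  assumes "x \<in> splx I" "finite I" "\<And>i. i \<in> I \<Longrightarrow> i \<notin> J \<Longrightarrow> x i = 0"
  shows "x \<in> splx (I \<inter> J)"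
proof -
  have "sum x (I \<inter> J) = sum x I"
    using assms by (intro sum.mono_neutral_left) auto
  with assms show ?thesis by (auto simp: splx_def)
qed

lemma splx_Int:
  assumes "finite I" "finite J"
  shows "splx I \<inter> splx J = splx (I \<inter> J)"
proof
  show "splx I \<inter> splx J \<subseteq> splx (I \<inter> J)"
    using splx_subset_support[OF _ assms(1)] by (auto dest: splxD)
  show "splx (I \<inter> J) \<subseteq> splx I \<inter> splx J"
    using splx_mono[of "I \<inter> J"] assms by auto
qed

lemma vtx_in_splx: "finite I \<Longrightarrow> vtx i \<in> splx I \<longleftrightarrow> i \<in> I"
  by (auto simp: splx_def vtx_def)

lemma splx_singleton: "splx {i} = {vtx i}"
  by (fastforce simp: splx_def vtx_def)

lemma splx_le_1:
  assumes "x \<in> splx I" "finite I"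
  shows "x i \<le> 1"
proof (cases "i \<in> I")
  case True
  then show ?thesis
    using assms member_le_sum[of i I x] by (auto simp: splx_def)
next
  case False
  then show ?thesis using splxD(2)[OF assms(1)] by simp
qed

lemma standard_simplex_eq_splx: "standard_simplex n = splx {..n}"
proof
  show "splx {..n} \<subseteq> standard_simplex n"
  proof
    fix x assume x: "x \<in> splx {..n}"
    then have "\<And>i. x i \<le> 1" by (simp add: splx_le_1)
    with x show "x \<in> standard_simplex n"
      by (auto simp: splx_def standard_simplex_def)
  qed
qed (auto simp: splx_def standard_simplex_def)

lemma splx_convex:
  assumes "x \<in> splx I" "y \<in> splx I" "0 \<le> t" "t \<le> 1"
  shows "(\<lambda>i. (1 - t) * x i + t * y i) \<in> splx I"
  using assms by (simp add: splx_def sum.distrib flip: sum_distrib_left)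

lemma splx_support_ex:
  assumes "x \<in> splx I"
  obtains i where "i \<in> I" "0 < x i"
proof -
  have "sum x I \<noteq> 0" using assms by (simp add: splx_def)
  then obtain i where "i \<in> I" "x i \<noteq> 0" by (meson sum.neutral)
  with splxD(1)[OF assms, of i] that show ?thesis by force
qed

lemma lin_mono_face:
  assumes "J \<subseteq> I" "finite I" "x \<in> splx J"
  shows "lin I a x = lin J a x"
  unfolding lin_def using assms by (intro sum.mono_neutral_right) (auto simp: splx_def)

lemma lin_vtx: "finite I \<Longrightarrow> i \<in> I \<Longrightarrow> lin I a (vtx i) = a i"
  by (simp add: lin_def vtx_def if_distrib cong: if_cong)

lemma lin_convex:
  "lin I a (\<lambda>i. (1 - t) * x i + t * y i) = (1 - t) * lin I a x + t * lin I a y"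
  by (simp add: lin_def distrib_left sum.distrib sum_distrib_left mult.left_commute)

lemma lin_shift:
  assumes "x \<in> splx I"
  shows "lin I (\<lambda>i. a i - c) x = lin I a x - c"
proof -
  have "lin I (\<lambda>i. a i - c) x = lin I a x - c * sum x I"
    by (simp add: lin_def sum_subtractf sum_distrib_left algebra_simps)
  then show ?thesis using assms by (simp add: splx_def)
qed

lemma lin_const_on_support:
  assumes "x \<in> splx I" "\<And>i. i \<in> I \<Longrightarrow> 0 < x i \<Longrightarrow> a i = c"
  shows "lin I a x = c"
proof -
  have "lin I a x = (\<Sum>i\<in>I. c * x i)"
    unfolding lin_def using assms(2) splxD(1)[OF assms(1)]
    by (intro sum.cong) (auto simp: less_le)
  also have "\<dots> = c" using splxD(3)[OF assms(1)] by (simp flip: sum_distrib_left)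
  finally show ?thesis .
qed

lemma lin_less:
  assumes "x \<in> splx I" "finite I" "\<And>i. i \<in> I \<Longrightarrow> 0 < x i \<Longrightarrow> a i \<le> c"
    and "j \<in> I" "0 < x j" "a j < c"
  shows "lin I a x < c"
proof -
  have "lin I a x < (\<Sum>i\<in>I. c * x i)"
    unfolding lin_def
  proof (rule sum_strict_mono_ex1)
    show "\<forall>i\<in>I. a i * x i \<le> c * x i"
      using assms(3) splxD(1)[OF assms(1)] by (metis less_eq_real_def mult_eq_0_iff mult_right_mono)
    show "\<exists>i\<in>I. a i * x i < c * x i"
      using assms by (intro bexI[of _ j]) auto
  qed (use assms in auto)
  also have "\<dots> = c" using splxD(3)[OF assms(1)] by (simp flip: sum_distrib_left)
  finally show ?thesis .
qed

lemma lin_greater: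
  assumes "x \<in> splx I" "finite I" "\<And>i. i \<in> I \<Longrightarrow> 0 < x i \<Longrightarrow> c \<le> a i"
    and "j \<in> I" "0 < x j" "c < a j"
  shows "c < lin I a x"
proof -
  have "lin I (\<lambda>i. - a i) x < - c"
    using assms by (intro lin_less[where j=j]) auto
  then show ?thesis by (simp add: lin_def sum_negf)
qed

lemma lin_le:
  assumes "x \<in> splx I" "\<And>i. i \<in> I \<Longrightarrow> a i \<le> c"
  shows "lin I a x \<le> c"
proof -
  have "lin I a x \<le> (\<Sum>i\<in>I. c * x i)"
    unfolding lin_def using assms(2) splxD(1)[OF assms(1)] by (intro sum_mono mult_right_mono) auto
  also have "\<dots> = c" using splxD(3)[OF assms(1)] by (simp flip: sum_distrib_left)
  finally show ?thesis .
qed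

lemma lin_ge:
  assumes "x \<in> splx I" "\<And>i. i \<in> I \<Longrightarrow> c \<le> a i"
  shows "c \<le> lin I a x"
proof -
  have "(\<Sum>i\<in>I. c * x i) \<le> lin I a x"
    unfolding lin_def using assms(2) splxD(1)[OF assms(1)] by (intro sum_mono mult_right_mono) auto
  moreover have "(\<Sum>i\<in>I. c * x i) = c"
    using splxD(3)[OF assms(1)] by (simp flip: sum_distrib_left)
  ultimately show ?thesis by simp
qed

lemma continuous_on_coord [continuous_intros]:
  "continuous_on S (\<lambda>x. x i :: 'b::topological_space)"
  by (rule continuous_on_subset[OF continuous_on_product_coordinates]) auto

lemma continuous_on_lin [continuous_intros]: "continuous_on S (lin I a)"
  unfolding lin_def by (intro continuous_intros)

lemma closed_splx: "closed (splx I)"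
proof -
  have "splx I = (\<Inter>i. {x. 0 \<le> x i}) \<inter> (\<Inter>i\<in>-I. {x. x i = 0}) \<inter> {x. sum x I = 1}"
    by (auto simp: splx_def)
  moreover have "closed (\<Inter>i. {x::nat\<Rightarrow>real. 0 \<le> x i})"
    by (intro closed_INT ballI closed_Collect_le continuous_intros)
  moreover have "closed (\<Inter>i\<in>-I. {x::nat\<Rightarrow>real. x i = 0})"
    by (intro closed_INT ballI closed_Collect_eq continuous_intros)
  moreover have "closed {x::nat\<Rightarrow>real. sum x I = 1}"
    by (intro closed_Collect_eq continuous_intros)
  ultimately show ?thesis by (metis closed_Int)
qed

lemma compact_splx:
  assumes "finite I"
  shows "compact (splx I)"
proof -
  have "compactin (powertop_real UNIV) (UNIV \<rightarrow>\<^sub>E {0..1})"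
    by (simp add: compactin_PiE)
  then have "compact (UNIV \<rightarrow>\<^sub>E {0..1::real} :: (nat \<Rightarrow> real) set)"
    by (simp add: euclidean_product_topology)
  moreover have "splx I = (UNIV \<rightarrow>\<^sub>E {0..1}) \<inter> splx I"
    using splx_le_1[OF _ assms] by (auto simp: splxD)
  ultimately show ?thesis
    by (metis closed_splx compact_Int_closed)
qed

lemma simplex_top_eq: "simplex_top n = top_of_set (splx {..n})"
  by (simp add: standard_simplex_eq_splx euclidean_product_topology)

section \<open>Exponential tilting of barycentric coordinates\<close>

definition tilt :: "nat set \<Rightarrow> (nat \<Rightarrow> real) \<Rightarrow> real \<Rightarrow> (nat \<Rightarrow> real) \<Rightarrow> nat \<Rightarrow> real" where
  "tilt I a s x = (\<lambda>i. x i * exp (s * a i) / (\<Sum>l\<in>I. x l * exp (s * a l)))"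

lemma tilt_denom_pos:
  assumes "x \<in> splx I" "finite I"
  shows "0 < (\<Sum>l\<in>I. x l * exp (s * a l))"
proof -
  obtain i where "i \<in> I" "0 < x i" using splx_support_ex[OF assms(1)] .
  then show ?thesis
    using assms splxD(1)[OF assms(1)] by (intro sum_pos2[of I i]) auto
qed

lemma tilt_in_splx:
  assumes "x \<in> splx J" "J \<subseteq> I" "finite I"
  shows "tilt I a s x \<in> splx J"
proof -
  have xI: "x \<in> splx I" using splx_mono assms by blast
  note pos = tilt_denom_pos[OF xI assms(3), of s a]
  have "(\<Sum>i\<in>J. x i * exp (s * a i)) = (\<Sum>l\<in>I. x l * exp (s * a l))"
    using assms by (intro sum.mono_neutral_left) (auto simp: splx_def)
  then have "sum (tilt I a s x) J = 1"
    using pos by (simp add: tilt_def flip: sum_divide_distrib)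
  then show ?thesis
    using assms(1) pos by (auto simp: splx_def tilt_def)
qed

lemma tilt_support:
  assumes "x \<in> splx I" "finite I"
  shows "0 < tilt I a s x i \<longleftrightarrow> 0 < x i"
  using tilt_denom_pos[OF assms, of s a] by (auto simp: tilt_def zero_less_divide_iff zero_less_mult_iff)

lemma tilt_0:
  assumes "x \<in> splx I"
  shows "tilt I a 0 x = x"
  using splxD(3)[OF assms] by (simp add: tilt_def)

text \<open>Tilting is a flow, namely the gradient flow of \<open>lin I a\<close> for the Fisher
  metric. It preserves supports, so every orbit stays in one open face; a point can be moved to
  another level without leaving its face.\<close>

lemma tilt_tilt:
  assumes "x \<in> splx I" "finite I"
  shows "tilt I a s (tilt I a r x) = tilt I a (s + r) x"
proof
  fix i
  let ?Z = "\<Sum>l\<in>I. x l * exp (r * a l)"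
  have Z: "?Z > 0" by (rule tilt_denom_pos[OF assms])
  have "(\<Sum>l\<in>I. x l * exp (r * a l) / ?Z * exp (s * a l)) = (\<Sum>l\<in>I. x l * exp ((s + r) * a l)) / ?Z"
    by (simp add: sum_divide_distrib algebra_simps exp_add)
  then have "tilt I a s (tilt I a r x) i = (x i * exp (r * a i) / ?Z * exp (s * a i)) / ((\<Sum>l\<in>I. x l * exp ((s + r) * a l)) / ?Z)"
    by (simp add: tilt_def)
  also have "\<dots> = x i * exp ((s + r) * a i) / (\<Sum>l\<in>I. x l * exp ((s + r) * a l))"
    using Z by (simp add: field_simps exp_add)
  finally show "tilt I a s (tilt I a r x) i = tilt I a (s + r) x i"
    by (simp add: tilt_def)
qed

lemma tilt_const_support:
  assumes "x \<in> splx I" "finite I" "\<And>i. i \<in> I \<Longrightarrow> 0 < x i \<Longrightarrow> a i = c"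
  shows "tilt I a s x = x"
proof
  fix i
  have *: "x l * exp (s * a l) = x l * exp (s * c)" if "l \<in> I" for l
    using assms(3)[OF that] splxD(1)[OF assms(1), of l] by (cases "x l = 0") auto
  then have "(\<Sum>l\<in>I. x l * exp (s * a l)) = sum x I * exp (s * c)"
    unfolding sum_distrib_right by (intro sum.cong refl) simp
  then have "(\<Sum>l\<in>I. x l * exp (s * a l)) = exp (s * c)"
    using splxD(3)[OF assms(1)] by simp
  moreover have "x i * exp (s * a i) = x i * exp (s * c)"
    using * splxD(2)[OF assms(1), of i] by (cases "i \<in> I") auto
  ultimately show "tilt I a s x i = x i" by (simp only: tilt_def) simp
qed

text \<open>An instance of Chebyshev's sum inequality.\<close>

lemma lin_tilt_greater:
  assumes x: "x \<in> splx I" "finite I" and "0 < s"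
    and co: "\<And>i l. i \<in> I \<Longrightarrow> l \<in> I \<Longrightarrow> a i < a l \<Longrightarrow> b i < b l"
    and pq: "p \<in> I" "q \<in> I" "0 < x p" "0 < x q" "a p < a q"
    and eq: "\<And>i l. i \<in> I \<Longrightarrow> l \<in> I \<Longrightarrow> a i = a l \<Longrightarrow> b i = b l"
  shows "lin I b x < lin I b (tilt I a s x)"
proof -
  let ?e = "\<lambda>i. exp (s * a i)"
  let ?Z = "\<Sum>l\<in>I. x l * ?e l"
  have Z: "?Z > 0" by (rule tilt_denom_pos[OF x])
  have nn: "0 \<le> x i * x l * ((b i - b l) * (?e i - ?e l))" if "i \<in> I" "l \<in> I" for i l
  proof -
    have "0 \<le> (b i - b l) * (?e i - ?e l)"
    proof (cases "a i" "a l" rule: linorder_cases)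
      case less
      then have "b i - b l < 0" "?e i - ?e l < 0" using co that \<open>0 < s\<close> by auto
      then show ?thesis by (simp add: mult_nonpos_nonpos)
    next
      case greater
      then have "0 < b i - b l" "0 < ?e i - ?e l" using co that \<open>0 < s\<close> by auto
      then show ?thesis by simp
    qed auto
    then show ?thesis using splxD(1)[OF x(1)] by simp
  qed
  \<comment> \<open>Summed over all pairs, the products of differences give twice the covariance of
    \<open>b\<close> and the weights; the pair \<open>p\<close>, \<open>q\<close> makes it
    positive.\<close>
  have "0 < (\<Sum>i\<in>I. \<Sum>l\<in>I. x i * x l * ((b i - b l) * (?e i - ?e l)))"
  proof (rule sum_pos2[OF x(2) pq(1)])
    have "b p < b q" "?e p < ?e q" using co pq \<open>0 < s\<close> by auto
    then have "0 < (b p - b q) * (?e p - ?e q)" by (simp add: mult_neg_neg)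
    then show "0 < (\<Sum>l\<in>I. x p * x l * ((b p - b l) * (?e p - ?e l)))"
      using nn pq x by (intro sum_pos2[of I q]) auto
  qed (use nn in \<open>auto intro: sum_nonneg\<close>)
  also have "(\<Sum>i\<in>I. \<Sum>l\<in>I. x i * x l * ((b i - b l) * (?e i - ?e l)))
     = (\<Sum>i\<in>I. \<Sum>l\<in>I. (b i * x i * ?e i) * x l) + (\<Sum>i\<in>I. \<Sum>l\<in>I. x i * (b l * x l * ?e l))
       - (\<Sum>i\<in>I. \<Sum>l\<in>I. (b i * x i) * (x l * ?e l)) - (\<Sum>i\<in>I. \<Sum>l\<in>I. (x i * ?e i) * (b l * x l))"
    by (simp add: algebra_simps sum.distrib sum_subtractf)
  also have "\<dots> = 2 * (\<Sum>i\<in>I. b i * x i * ?e i) - 2 * (lin I b x * ?Z)"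
    using splxD(3)[OF x(1)] by (simp add: lin_def flip: sum_product)
  finally have "lin I b x * ?Z < (\<Sum>i\<in>I. b i * x i * ?e i)" by simp
  moreover have "lin I b (tilt I a s x) = (\<Sum>i\<in>I. b i * x i * ?e i) / ?Z"
    by (simp add: lin_def tilt_def sum_divide_distrib mult.assoc)
  ultimately show ?thesis using Z by (simp add: less_divide_eq)
qed

lemma lin_tilt_strict_mono:
  assumes x: "x \<in> splx I" "finite I" and "r < s"
    and co: "\<And>i l. i \<in> I \<Longrightarrow> l \<in> I \<Longrightarrow> a i < a l \<Longrightarrow> b i < b l"
    and pq: "p \<in> I" "q \<in> I" "0 < x p" "0 < x q" "a p < a q"
    and eq: "\<And>i l. i \<in> I \<Longrightarrow> l \<in> I \<Longrightarrow> a i = a l \<Longrightarrow> b i = b l"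
  shows "lin I b (tilt I a r x) < lin I b (tilt I a s x)"
proof -
  have "lin I b (tilt I a r x) < lin I b (tilt I a (s - r) (tilt I a r x))"
  proof (rule lin_tilt_greater[OF tilt_in_splx[OF x(1) order.refl x(2)] x(2), where p=p and q=q])
    show "0 < tilt I a r x p" "0 < tilt I a r x q"
      using pq by (simp_all add: tilt_support[OF x])
  qed (fact co eq pq | use \<open>r < s\<close> in simp)+
  then show ?thesis by (simp add: tilt_tilt[OF x])
qed

text \<open>As \<open>s\<close> grows, the mass concentrates on those vertices of the support where
  \<open>a\<close>, and with it \<open>b\<close>, is largest. So the value tends to the largest
  \<open>b q\<close> on the support, and \<open>b q\<close> is at least \<open>b p\<close>.\<close>

lemma lin_tilt_large:
  assumes x: "x \<in> splx I" "finite I" and c: "c < b p" "p \<in> I" "0 < x p"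
    and co: "\<And>i l. i \<in> I \<Longrightarrow> l \<in> I \<Longrightarrow> a i < a l \<Longrightarrow> b i < b l"
    and eq: "\<And>i l. i \<in> I \<Longrightarrow> l \<in> I \<Longrightarrow> a i = a l \<Longrightarrow> b i = b l"
  obtains s where "c < lin I b (tilt I a s x)"
proof -
  let ?S = "{i \<in> I. 0 < x i}"
  have S: "finite ?S" "?S \<noteq> {}" using x(2) c(2,3) by auto
  then have "Max (a ` ?S) \<in> a ` ?S" by (intro Max_in) auto
  then obtain q where q: "q \<in> I" "0 < x q" "a q = Max (a ` ?S)" by auto
  then have qmax: "\<And>i. i \<in> I \<Longrightarrow> 0 < x i \<Longrightarrow> a i \<le> a q"
    using S by auto
  have "((\<lambda>s. lin I (\<lambda>i. b i - b q) (tilt I a s x)) \<longlongrightarrow> (\<Sum>i\<in>I. 0)) at_top"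
    unfolding lin_def
  proof (rule tendsto_sum)
    fix i assume i: "i \<in> I"
    show "((\<lambda>s. (b i - b q) * tilt I a s x i) \<longlongrightarrow> 0) at_top"
    proof (cases "0 < x i \<and> a i \<noteq> a q")
      case False
      then have "x i = 0 \<or> b i - b q = 0"
        using splxD(1)[OF x(1), of i] eq[OF i q(1)] by auto
      then show ?thesis
      proof
        assume "x i = 0"
        then show ?thesis by (simp add: tilt_def)
      qed simp
    next
      case True
      with qmax[OF i] have lt: "a i - a q < 0" by simp
      \<comment> \<open>Only the summand of \<open>q\<close> is kept in the normalising sum; what
        remains decays exponentially because \<open>a i\<close> is below \<open>a q\<close>.\<close>
      have bound: "tilt I a s x i \<le> x i / x q * exp (s * (a i - a q))" for s
      proof -
        have "x q * exp (s * a q) \<le> (\<Sum>l\<in>I. x l * exp (s * a l))"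
          using q x splxD(1)[OF x(1)] by (intro member_le_sum) auto
        then have "tilt I a s x i \<le> x i * exp (s * a i) / (x q * exp (s * a q))"
          unfolding tilt_def using q x splxD(1)[OF x(1)] by (intro divide_left_mono) (auto intro: mult_pos_pos tilt_denom_pos)
        also have "\<dots> = x i / x q * exp (s * (a i - a q))"
          by (simp add: right_diff_distrib exp_diff)
        finally show ?thesis .
      qed
      have lim: "((\<lambda>s. x i / x q * exp (s * (a i - a q))) \<longlongrightarrow> x i / x q * 0) at_top"
      proof (intro tendsto_mult_left filterlim_compose[OF exp_at_bot])
        show "filterlim (\<lambda>s. s * (a i - a q)) at_bot at_top"
          using filterlim_tendsto_neg_mult_at_bot[OF tendsto_const lt filterlim_ident]
          by (simp add: mult.commute)
      qed
      have "((\<lambda>s. tilt I a s x i) \<longlongrightarrow> 0) at_top"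
      proof (rule tendsto_sandwich[OF _ _ tendsto_const lim[simplified mult_zero_right]])
        show "\<forall>\<^sub>F s in at_top. 0 \<le> tilt I a s x i"
          using tilt_in_splx[OF x(1) order.refl x(2)] splxD(1) by (intro always_eventually) blast
        show "\<forall>\<^sub>F s in at_top. tilt I a s x i \<le> x i / x q * exp (s * (a i - a q))"
          using bound by (intro always_eventually) blast
      qed
      then show ?thesis using tendsto_mult_left by fastforce
    qed
  qed
  moreover have "lin I (\<lambda>i. b i - b q) (tilt I a s x) = lin I b (tilt I a s x) - b q" for s
    by (rule lin_shift[OF tilt_in_splx[OF x(1) order.refl x(2)]])
  ultimately have "((\<lambda>s. lin I b (tilt I a s x) - b q) \<longlongrightarrow> 0) at_top" by simp
  moreover have "b p \<le> b q"
    using qmax[OF c(2,3)] co[OF c(2) q(1)] eq[OF c(2) q(1)] by (cases "a p = a q") auto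
  with c(1) have "c - b q < 0" by simp
  ultimately have "\<forall>\<^sub>F s in at_top. c - b q < lin I b (tilt I a s x) - b q"
    by (rule order_tendstoD)
  then obtain s where "c < lin I b (tilt I a s x)"
    by (auto simp: eventually_at_top_linorder)
  with that show ?thesis .
qed

lemma tilt_uminus: "tilt I (\<lambda>i. - a i) s x = tilt I a (- s) x"
  by (simp add: tilt_def)

lemma lin_uminus: "lin I (\<lambda>i. - a i) x = - lin I a x"
  by (simp add: lin_def sum_negf)

lemma continuous_on_tilt:
  assumes "finite I" "continuous_on S s" "continuous_on S f" "\<And>x. x \<in> S \<Longrightarrow> f x \<in> splx I"
  shows "continuous_on S (\<lambda>x. tilt I a (s x) (f x))"
proof (rule continuous_on_coordinatewise_then_product)
  fix i
  have c: "continuous_on S (\<lambda>x. f x j)" for j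
    using assms(3) by (rule continuous_on_product_then_coordinatewise)
  have "(\<Sum>l\<in>I. f x l * exp (s x * a l)) \<noteq> 0" if "x \<in> S" for x
    using tilt_denom_pos[OF assms(4)[OF that] assms(1), of "s x" a] by simp
  then show "continuous_on S (\<lambda>x. tilt I a (s x) (f x) i)"
    unfolding tilt_def by (intro continuous_intros assms(2) c) auto
qed

text \<open>Intermediate value theorem along an orbit. The lower end comes from
  \<open>lin_tilt_large\<close> for the negated coefficients, for which time runs backwards.\<close>

lemma tilt_ex:
  assumes x: "x \<in> splx I" "finite I" and c: "b q < c" "c < b p" "p \<in> I" "0 < x p" "q \<in> I" "0 < x q"
    and co: "\<And>i l. i \<in> I \<Longrightarrow> l \<in> I \<Longrightarrow> a i < a l \<Longrightarrow> b i < b l"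
    and eq: "\<And>i l. i \<in> I \<Longrightarrow> l \<in> I \<Longrightarrow> a i = a l \<Longrightarrow> b i = b l"
  obtains s where "lin I b (tilt I a s x) = c"
proof -
  obtain s where s: "c < lin I b (tilt I a s x)"
    using lin_tilt_large[of x I c b p a, OF x c(2,3,4) co eq] by blast
  have co': "- b i < - b l" if "i \<in> I" "l \<in> I" "- a i < - a l" for i l
    using co[of l i] that by simp
  have eq': "- b i = - b l" if "i \<in> I" "l \<in> I" "- a i = - a l" for i l
    using eq[of i l] that by simp
  obtain r where r: "- c < lin I (\<lambda>i. - b i) (tilt I (\<lambda>i. - a i) r x)"
    using lin_tilt_large[of x I "- c" "\<lambda>i. - b i" q "\<lambda>i. - a i", OF x _ c(5,6) co' eq'] c(1) by auto
  then have r: "lin I b (tilt I a (- r) x) < c"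
    by (simp add: tilt_uminus lin_uminus)
  have cont: "continuous_on UNIV (\<lambda>s. lin I b (tilt I a s x))"
    by (rule continuous_on_compose2[OF continuous_on_lin[of UNIV]])
      (use x in \<open>auto intro: continuous_on_tilt[OF _ continuous_on_id continuous_on_const]\<close>)
  have "connected (range (\<lambda>s. lin I b (tilt I a s x)))"
    by (rule connected_continuous_image[OF cont]) simp
  then have "c \<in> range (\<lambda>s. lin I b (tilt I a s x))"
    using s r by (meson connectedD_interval less_imp_le rangeI)
  then show ?thesis using that by blast
qed


section \<open>Functions conjugate to affine ones\<close>

text \<open>Every face is mapped to itself, whereas \<open>simplicial_homeomorphism\<close> may
  permute the faces; \<open>simplicial_homeomorphism_good\<close> absorbs the permutation. The
  inverse is a second argument, so that conjugations can be composed and reversed without choosing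
  inverses.\<close>

definition face_homeo where
  "face_homeo I h h' \<longleftrightarrow>
     (\<forall>J\<subseteq>I. h ` splx J \<subseteq> splx J \<and> h' ` splx J \<subseteq> splx J) \<and>
     (\<forall>x\<in>splx I. h' (h x) = x \<and> h (h' x) = x) \<and>
     continuous_on (splx I) h \<and> continuous_on (splx I) h'"

text \<open>The value \<open>lin\<close> takes at a vertex forces the coefficients to be the values of \<open>f\<close> there.\<close>

definition conj_affine :: "nat set \<Rightarrow> ((nat \<Rightarrow> real) \<Rightarrow> real) \<Rightarrow> bool" where
  "conj_affine I f \<longleftrightarrow> (\<exists>h h'. face_homeo I h h' \<and> (\<forall>x\<in>splx I. f (h x) = lin I (\<lambda>i. f (vtx i)) x))"

lemma face_homeoD:
  assumes "face_homeo I h h'"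
  shows "J \<subseteq> I \<Longrightarrow> x \<in> splx J \<Longrightarrow> h x \<in> splx J"
    and "J \<subseteq> I \<Longrightarrow> x \<in> splx J \<Longrightarrow> h' x \<in> splx J"
    and "x \<in> splx I \<Longrightarrow> h' (h x) = x" and "x \<in> splx I \<Longrightarrow> h (h' x) = x"
    and "continuous_on (splx I) h" and "continuous_on (splx I) h'"
  using assms unfolding face_homeo_def by blast+

lemma face_homeo_subset:
  assumes "face_homeo I h h'" "J \<subseteq> I" "finite I"
  shows "face_homeo J h h'"
  using assms splx_mono[of J I] unfolding face_homeo_def
  by (meson continuous_on_subset order.trans subset_iff)

lemma face_homeo_sym: "face_homeo I h h' \<Longrightarrow> face_homeo I h' h"
  unfolding face_homeo_def by blast

lemma face_homeo_id: "face_homeo I (\<lambda>x. x) (\<lambda>x. x)"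
  unfolding face_homeo_def by (auto intro: continuous_intros)

lemma face_homeo_comp:
  assumes "face_homeo I h h'" "face_homeo I g g'"
  shows "face_homeo I (h \<circ> g) (g' \<circ> h')"
  unfolding face_homeo_def
proof (intro conjI allI ballI impI)
  fix J assume "J \<subseteq> I"
  then show "(h \<circ> g) ` splx J \<subseteq> splx J" "(g' \<circ> h') ` splx J \<subseteq> splx J"
    using assms by (auto dest: face_homeoD)
next
  fix x assume "x \<in> splx I"
  then show "(g' \<circ> h') ((h \<circ> g) x) = x" "(h \<circ> g) ((g' \<circ> h') x) = x"
    using assms by (simp_all add: face_homeoD)
next
  show "continuous_on (splx I) (h \<circ> g)"
    using face_homeoD[OF assms(1)] face_homeoD[OF assms(2)]
    by (intro continuous_on_compose) (auto elim!: continuous_on_subset)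
  show "continuous_on (splx I) (g' \<circ> h')"
    using face_homeoD[OF assms(1)] face_homeoD[OF assms(2)]
    by (intro continuous_on_compose) (auto elim!: continuous_on_subset)
qed

lemma face_homeo_vtx:
  assumes "face_homeo I h h'" "i \<in> I"
  shows "h (vtx i) = vtx i" "h' (vtx i) = vtx i"
  using face_homeoD(1,2)[OF assms(1), of "{i}" "vtx i"] assms(2) by (auto simp: splx_singleton)

lemma conj_affineI:
  assumes h: "face_homeo I h h'" and "finite I" and f: "\<And>x. x \<in> splx I \<Longrightarrow> f (h x) = lin I a x"
  shows "conj_affine I f"
proof -
  have "f (vtx i) = a i" if "i \<in> I" for i
    using f[of "vtx i"] face_homeo_vtx[OF h that] that \<open>finite I\<close> by (simp add: vtx_in_splx lin_vtx)
  then have "lin I (\<lambda>i. f (vtx i)) x = lin I a x" for x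
    by (simp add: lin_def)
  with h f show ?thesis unfolding conj_affine_def by metis
qed

lemma conj_affineE1:
  assumes "conj_affine I f"
  obtains h h' where "face_homeo I h h'" "\<And>x. x \<in> splx I \<Longrightarrow> f (h x) = lin I (\<lambda>i. f (vtx i)) x"
  using assms unfolding conj_affine_def by blast

lemma conj_affineE2:
  assumes "conj_affine I f"
  obtains h h' where "face_homeo I h h'" "\<And>x. x \<in> splx I \<Longrightarrow> f x = lin I (\<lambda>i. f (vtx i)) (h' x)"
proof -
  obtain h h' where h: "face_homeo I h h'" "\<And>x. x \<in> splx I \<Longrightarrow> f (h x) = lin I (\<lambda>i. f (vtx i)) x"
    using conj_affineE1[OF assms] by blast
  have "f x = lin I (\<lambda>i. f (vtx i)) (h' x)" if "x \<in> splx I" for x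
    using h(2)[OF face_homeoD(2)[OF h(1) order.refl that]] face_homeoD(4)[OF h(1) that] by simp
  with h that show ?thesis by blast
qed

lemma conj_affine_subset:
  assumes "conj_affine I f" "J \<subseteq> I" "finite I"
  shows "conj_affine J f"
proof -
  obtain h h' where h: "face_homeo I h h'" "\<And>x. x \<in> splx I \<Longrightarrow> f (h x) = lin I (\<lambda>i. f (vtx i)) x"
    using conj_affineE1[OF assms(1)] by blast
  have "f (h x) = lin J (\<lambda>i. f (vtx i)) x" if "x \<in> splx J" for x
    using h(2)[of x] lin_mono_face[OF assms(2,3) that] splx_mono[OF assms(2,3)] that by auto
  then show ?thesis
    using face_homeo_subset[OF h(1) assms(2,3)] unfolding conj_affine_def by blast
qed

lemma conj_affine_cong:
  assumes "conj_affine I f" "finite I" "\<And>x. x \<in> splx I \<Longrightarrow> g x = f x"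
  shows "conj_affine I g"
proof -
  obtain h h' where h: "face_homeo I h h'" "\<And>x. x \<in> splx I \<Longrightarrow> f (h x) = lin I (\<lambda>i. f (vtx i)) x"
    using conj_affineE1[OF assms(1)] by blast
  show ?thesis
    by (rule conj_affineI[OF h(1) assms(2)]) (use h assms(3) face_homeoD(1)[OF h(1) order.refl] in auto)
qed

lemma conj_affine_uminus:
  assumes "conj_affine I f" "finite I"
  shows "conj_affine I (\<lambda>x. - f x)"
proof -
  obtain h h' where h: "face_homeo I h h'" "\<And>x. x \<in> splx I \<Longrightarrow> f (h x) = lin I (\<lambda>i. f (vtx i)) x"
    using conj_affineE1[OF assms(1)] by blast
  show ?thesis
    by (rule conj_affineI[OF h(1) assms(2), of _ "\<lambda>i. - f (vtx i)"]) (simp add: h(2) lin_uminus)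
qed

lemma conj_affine_continuous:
  assumes "conj_affine I f"
  shows "continuous_on (splx I) f"
proof -
  obtain h h' where h: "face_homeo I h h'" "\<And>x. x \<in> splx I \<Longrightarrow> f x = lin I (\<lambda>i. f (vtx i)) (h' x)"
    using conj_affineE2[OF assms] by blast
  have "continuous_on (splx I) (\<lambda>x. lin I (\<lambda>i. f (vtx i)) (h' x))"
    by (rule continuous_on_compose2[OF continuous_on_lin[of UNIV] face_homeoD(6)[OF h(1)]]) simp
  then show ?thesis using h(2) by (simp cong: continuous_on_cong)
qed

text \<open>Near a point whose support lies on one level \<open>c\<close> the tilt parameter is out
  of control, so the bound must not involve \<open>s\<close>. Terms on the side of \<open>c\<close>
  that the tilt favours are bounded through the signed sum; on the other side a coordinate grows at
  most by the factor \<open>1 / X\<close>.\<close>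

lemma tilt_limit_const:
  assumes x: "x \<in> splx I" "finite I" and X: "0 < (\<Sum>l\<in>{l\<in>I. b l = c}. x l)" and i: "i \<in> I"
  defines "X \<equiv> \<Sum>l\<in>{l\<in>I. b l = c}. x l"
  shows "(\<Sum>i\<in>I. tilt I b s x i * \<bar>b i - c\<bar>)
    \<le> \<bar>lin I b (tilt I b s x) - c\<bar> + 2 * (\<Sum>i\<in>I. x i * \<bar>b i - c\<bar>) / X"
proof -
  let ?y = "tilt I b s x"
  let ?Z = "\<Sum>l\<in>I. x l * exp (s * b l)"
  have y: "?y \<in> splx I" using tilt_in_splx x by blast
  have Z: "?Z > 0" by (rule tilt_denom_pos[OF x])
  have "X * exp (s * c) = (\<Sum>l\<in>{l\<in>I. b l = c}. x l * exp (s * b l))"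
    by (simp add: X_def sum_distrib_right)
  also have "\<dots> \<le> ?Z"
    using x splxD(1)[OF x(1)] by (intro sum_mono2) auto
  finally have XZ: "exp (s * c) / ?Z \<le> 1 / X"
    using Z X by (simp add: X_def field_simps)
  have y_le: "?y i \<le> x i / X" if "s * b i \<le> s * c" for i
  proof -
    have "?y i \<le> x i * exp (s * c) / ?Z"
      unfolding tilt_def using that Z splxD(1)[OF x(1)] by (intro divide_right_mono mult_left_mono) auto
    also have "\<dots> \<le> x i * (1 / X)"
      using mult_left_mono[OF XZ splxD(1)[OF x(1), of i]] by simp
    finally show ?thesis by simp
  qed
  have lin: "lin I b ?y - c = (\<Sum>i\<in>I. ?y i * (b i - c))"
    using lin_shift[OF y, of b c] by (simp add: lin_def mult.commute)
  \<comment> \<open>The sign of \<open>s\<close> tells which side of \<open>c\<close> gains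
    weight.\<close>
  define \<epsilon> :: real where "\<epsilon> = (if 0 \<le> s then 1 else - 1)"
  have pt: "?y i * \<bar>b i - c\<bar> \<le> \<epsilon> * (?y i * (b i - c)) + 2 * (x i * \<bar>b i - c\<bar> / X)" for i
  proof -
    have nn: "0 \<le> ?y i" "0 \<le> x i * \<bar>b i - c\<bar> / X"
      using splxD(1)[OF y] splxD(1)[OF x(1)] X by (auto simp: X_def)
    show ?thesis
    proof (cases "0 \<le> \<epsilon> * (b i - c)")
      case True
      then have "\<bar>b i - c\<bar> = \<epsilon> * (b i - c)" by (auto simp: \<epsilon>_def abs_if split: if_splits)
      then have "?y i * \<bar>b i - c\<bar> = \<epsilon> * (?y i * (b i - c))" by (simp only: mult.left_commute)
      then show ?thesis using nn(2) by linarith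
    next
      case False
      then have "s * b i \<le> s * c" and eq: "\<bar>b i - c\<bar> = - \<epsilon> * (b i - c)"
        by (auto simp: \<epsilon>_def abs_if mult_left_mono mult_left_mono_neg split: if_splits)
      then have "?y i * \<bar>b i - c\<bar> \<le> x i / X * \<bar>b i - c\<bar>"
        using y_le by (intro mult_right_mono) auto
      then have "?y i * \<bar>b i - c\<bar> \<le> x i * \<bar>b i - c\<bar> / X" by simp
      moreover have "\<epsilon> * (?y i * (b i - c)) = - (?y i * \<bar>b i - c\<bar>)"
        using eq by simp
      ultimately show ?thesis by linarith
    qed
  qed
  have "(\<Sum>i\<in>I. ?y i * \<bar>b i - c\<bar>) \<le> \<epsilon> * (lin I b ?y - c) + 2 * (\<Sum>i\<in>I. x i * \<bar>b i - c\<bar>) / X"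
    using sum_mono[of I, OF pt] by (simp add: sum.distrib lin sum_distrib_left sum_divide_distrib)
  also have "\<epsilon> * (lin I b ?y - c) \<le> \<bar>lin I b ?y - c\<bar>"
    by (cases "0 \<le> s") (auto simp: \<epsilon>_def abs_if)
  finally show ?thesis by simp
qed

text \<open>The tilt parameter is determined by the target level only where \<open>b\<close> is not
  constant on the support; there it is continuous by strict monotonicity. At the other points the
  parameter may blow up, and the continuity of \<open>Q\<close> has to be shown for its coordinates
  directly.\<close>

lemma continuous_on_tilt_to:
  assumes I: "finite I" and T: "continuous_on (splx I) T"
    and Q: "\<And>x. x \<in> splx I \<Longrightarrow> \<exists>s. Q x = tilt I b s x \<and> lin I b (Q x) = T x"
  shows "continuous_on (splx I) Q"
proof (rule continuous_on_coordinatewise_then_product, unfold continuous_on_def, rule ballI)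
  fix i x assume x: "x \<in> splx I"
  let ?F = "at x within splx I"
  have QS: "Q z \<in> splx I" if "z \<in> splx I" for z
    using Q[OF that] tilt_in_splx[OF that order.refl I] by metis
  obtain sel where sel: "\<And>z. z \<in> splx I \<Longrightarrow> Q z = tilt I b (sel z) z"
    using Q by metis
  have inS: "\<forall>\<^sub>F z in ?F. z \<in> splx I" by (simp add: eventually_at_filter)
  have coord: "((\<lambda>z. z i) \<longlongrightarrow> x i) ?F" for i
    using continuous_on_coord[of "splx I" i] x unfolding continuous_on_def by blast
  have Tt: "(T \<longlongrightarrow> T x) ?F" using T x unfolding continuous_on_def by blast
  show "((\<lambda>z. Q z i) \<longlongrightarrow> Q x i) ?F"
  proof (cases "\<exists>p\<in>I. \<exists>q\<in>I. 0 < x p \<and> 0 < x q \<and> b p < b q")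
    case True
    then obtain p q where pq: "p \<in> I" "q \<in> I" "0 < x p" "0 < x q" "b p < b q" by blast
    have supp: "\<forall>\<^sub>F z in ?F. 0 < z p \<and> 0 < z q"
      using order_tendstoD(1)[OF coord pq(3)] order_tendstoD(1)[OF coord pq(4)]
      by (rule eventually_conj)
    have lt: "((\<lambda>z. lin I b (tilt I b r z)) \<longlongrightarrow> lin I b (tilt I b r x)) ?F" for r
    proof -
      have "continuous_on (splx I) (\<lambda>z. lin I b (tilt I b r z))"
        by (rule continuous_on_compose2[OF continuous_on_lin[of UNIV]])
          (use I in \<open>auto intro: continuous_on_tilt[OF _ continuous_on_const continuous_on_id]\<close>)
      then show ?thesis using x unfolding continuous_on_def by blast
    qed
    have mono: "lin I b (tilt I b r z) < lin I b (tilt I b s z)"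
      if "r < s" "z \<in> splx I" "0 < z p" "0 < z q" for r s z
      by (rule lin_tilt_strict_mono[where p=p and q=q]) (use that pq I in auto)
    have less_iff: "sel z < r" if "z \<in> splx I" "0 < z p" "0 < z q" "T z < lin I b (tilt I b r z)" for z r
      using mono[of r "sel z" z] Q[OF that(1)] sel[OF that(1)] that by (metis less_asym linorder_neqE order.irrefl)
    have gr_iff: "r < sel z" if "z \<in> splx I" "0 < z p" "0 < z q" "lin I b (tilt I b r z) < T z" for z r
      using mono[of "sel z" r z] Q[OF that(1)] sel[OF that(1)] that by (metis less_asym linorder_neqE order.irrefl)
    have Tx: "T x = lin I b (tilt I b (sel x) x)" using Q[OF x] sel[OF x] by metis
    have "(sel \<longlongrightarrow> sel x) ?F"
    proof (rule order_tendstoI)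
      fix r assume "sel x < r"
      then have "0 < lin I b (tilt I b r x) - T x" using mono[OF _ x pq(3,4)] Tx by simp
      then have "\<forall>\<^sub>F z in ?F. 0 < lin I b (tilt I b r z) - T z"
        by (rule order_tendstoD(1)[OF tendsto_diff[OF lt Tt]])
      with inS supp show "\<forall>\<^sub>F z in ?F. sel z < r"
        by eventually_elim (auto intro: less_iff)
    next
      fix r assume "r < sel x"
      then have "0 < T x - lin I b (tilt I b r x)" using mono[OF _ x pq(3,4)] Tx by simp
      then have "\<forall>\<^sub>F z in ?F. 0 < T z - lin I b (tilt I b r z)"
        by (rule order_tendstoD(1)[OF tendsto_diff[OF Tt lt]])
      with inS supp show "\<forall>\<^sub>F z in ?F. r < sel z"
        by eventually_elim (auto intro: gr_iff)
    qed
    then have "((\<lambda>z. tilt I b (sel z) z i) \<longlongrightarrow> tilt I b (sel x) x i) ?F"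
      unfolding tilt_def using tilt_denom_pos[OF x I, of "sel x" b]
      by (intro tendsto_intros coord) auto
    moreover have "\<forall>\<^sub>F z in ?F. tilt I b (sel z) z i = Q z i"
      using inS by eventually_elim (simp add: sel)
    ultimately show ?thesis unfolding sel[OF x] by (rule Lim_transform_eventually)
  next
    \<comment> \<open>Here \<open>Q x = x\<close>. The coordinates off the level \<open>c\<close>
      tend to 0 by the uniform bound of \<open>tilt_limit_const\<close>. Those on it are all
      multiplied by the same factor, the quotient of the total masses on that level, which tends to
      1.\<close>
    case False
    obtain j where j: "j \<in> I" "0 < x j" by (rule splx_support_ex[OF x])
    define c where "c = b j"
    have c: "b i = c" if "i \<in> I" "0 < x i" for i
      using False that j unfolding c_def by (meson linorder_neqE)
    have x0: "x i = 0" if "i \<in> I" "b i \<noteq> c" for i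
      using c[OF that(1)] splxD(1)[OF x, of i] that by fastforce
    have Qx: "Q x = x" using sel[OF x] tilt_const_support[OF x I c] by simp
    have Txc: "T x = c" using Q[OF x] Qx lin_const_on_support[OF x c] by auto
    define X where "X z = (\<Sum>l\<in>{l\<in>I. b l = c}. z l)" for z :: "nat \<Rightarrow> real"
    have X1: "X x = 1"
    proof -
      have "X x = sum x I" unfolding X_def using I x0 by (intro sum.mono_neutral_left) auto
      then show ?thesis using splxD(3)[OF x] by simp
    qed
    have Xt: "(X \<longlongrightarrow> 1) ?F"
      using tendsto_sum[of "{l\<in>I. b l = c}" "\<lambda>l z. z l" x ?F] coord X1 unfolding X_def by simp
    have Xpos: "\<forall>\<^sub>F z in ?F. 0 < X z" by (rule order_tendstoD(1)[OF Xt]) simp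
    define D where "D z = \<bar>T z - c\<bar> + 2 * (\<Sum>i\<in>I. z i * \<bar>b i - c\<bar>) / X z" for z
    have "(\<Sum>i\<in>I. x i * \<bar>b i - c\<bar>) = 0"
      using x0 by (intro sum.neutral) auto
    moreover have "(D \<longlongrightarrow> \<bar>T x - c\<bar> + 2 * (\<Sum>i\<in>I. x i * \<bar>b i - c\<bar>) / 1) ?F"
      unfolding D_def by (intro tendsto_intros coord Tt Xt) auto
    ultimately have Dt: "(D \<longlongrightarrow> 0) ?F" using Txc by simp
    have QD: "Q z i * \<bar>b i - c\<bar> \<le> D z" if "z \<in> splx I" "0 < X z" "i \<in> I" for z i
    proof -
      have "Q z i * \<bar>b i - c\<bar> \<le> (\<Sum>i\<in>I. Q z i * \<bar>b i - c\<bar>)"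
        using that splxD(1)[OF QS[OF that(1)]] I by (intro member_le_sum) auto
      also have "\<dots> \<le> D z"
        using tilt_limit_const[OF that(1) I, where b=b and c=c and s="sel z"] that Q[OF that(1)] sel[OF that(1)]
        unfolding D_def X_def by auto
      finally show ?thesis .
    qed
    have off: "((\<lambda>z. Q z i) \<longlongrightarrow> 0) ?F" if i: "i \<in> I" "b i \<noteq> c" for i
    proof (rule tendsto_sandwich[of "\<lambda>z. 0" _ _ "\<lambda>z. D z / \<bar>b i - c\<bar>"])
      show "\<forall>\<^sub>F z in ?F. 0 \<le> Q z i"
        using inS by eventually_elim (use QS splxD(1) in blast)
      show "\<forall>\<^sub>F z in ?F. Q z i \<le> D z / \<bar>b i - c\<bar>"
        using inS Xpos by eventually_elim (use QD[OF _ _ i(1)] i in \<open>simp add: pos_le_divide_eq\<close>)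
      show "((\<lambda>z. D z / \<bar>b i - c\<bar>) \<longlongrightarrow> 0) ?F"
        using tendsto_divide[OF Dt tendsto_const, of "\<bar>b i - c\<bar>"] i by simp
    qed simp
    have XQ: "X z' = 1 - (\<Sum>l\<in>{l\<in>I. b l \<noteq> c}. z' l)" if "z' \<in> splx I" for z'
    proof -
      have "{l\<in>I. b l = c} \<union> {l\<in>I. b l \<noteq> c} = I" by auto
      then have "sum z' I = X z' + (\<Sum>l\<in>{l\<in>I. b l \<noteq> c}. z' l)"
        unfolding X_def using I by (subst sum.union_disjoint[symmetric]) auto
      then show ?thesis using splxD(3)[OF that] by simp
    qed
    have "((\<lambda>z. 1 - (\<Sum>l\<in>{l\<in>I. b l \<noteq> c}. Q z l)) \<longlongrightarrow> 1 - (\<Sum>l\<in>{l\<in>I. b l \<noteq> c}. 0)) ?F"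
      by (intro tendsto_intros off) auto
    then have "((\<lambda>z. 1 - (\<Sum>l\<in>{l\<in>I. b l \<noteq> c}. Q z l)) \<longlongrightarrow> 1) ?F" by simp
    then have XQt: "((\<lambda>z. X (Q z)) \<longlongrightarrow> 1) ?F"
      by (rule tendsto_cong[THEN iffD1, rotated])
        (use inS in \<open>eventually_elim, simp add: XQ QS\<close>)
    consider "i \<notin> I" | "i \<in> I" "b i \<noteq> c" | "i \<in> I" "b i = c" by blast
    then show ?thesis
    proof cases
      case 1
      have "\<forall>\<^sub>F z in ?F. Q z i = 0"
        using inS by eventually_elim (use 1 QS splxD(2) in blast)
      then show ?thesis using Qx splxD(2)[OF x 1] by (simp add: tendsto_eventually)
    next
      case 2
      then show ?thesis using off Qx x0 by simp
    next
      case 3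
      have "((\<lambda>z. z i * (X (Q z) / X z)) \<longlongrightarrow> x i * (1 / 1)) ?F"
        by (intro tendsto_intros coord XQt Xt) auto
      moreover have "\<forall>\<^sub>F z in ?F. z i * (X (Q z) / X z) = Q z i"
        using inS Xpos
      proof eventually_elim
        case (elim z)
        let ?Z = "\<Sum>l\<in>I. z l * exp (sel z * b l)"
        have "X (Q z) = X z * exp (sel z * c) / ?Z"
          unfolding X_def sel[OF elim(1)] tilt_def
          by (simp add: sum_distrib_right sum_divide_distrib)
        then have "X (Q z) / X z = exp (sel z * c) / ?Z" using elim by simp
        then show ?case using 3 sel[OF elim(1)] by (simp add: tilt_def)
      qed
      ultimately show ?thesis using Lim_transform_eventually Qx by fastforce
    qed
  qed
qed

section \<open>Change of scale for affine functions\<close>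

lemma splx_path_closed_segment:
  assumes "x \<in> splx I" "y \<in> splx I"
  shows "path (\<lambda>t i. (1 - t) * x i + t * y i)"
    and "path_image (\<lambda>t i. (1 - t) * x i + t * y i) \<subseteq> splx I"
  using assms by (auto simp: path_def path_image_def intro!: continuous_intros splx_convex)

lemma connected_lin_slab:
  "connected {x \<in> splx I. lin I a x \<in> {c..d}}"
proof (rule path_connected_imp_connected, unfold path_connected_def, intro ballI)
  fix x y assume x: "x \<in> {x \<in> splx I. lin I a x \<in> {c..d}}" and y: "y \<in> {x \<in> splx I. lin I a x \<in> {c..d}}"
  have "lin I a (\<lambda>i. (1 - t) * x i + t * y i) \<in> {c..d}" if "t \<in> {0..1}" for t
    unfolding lin_convex
    using convexD_alt[OF convex_real_interval(5), of "lin I a x" c d "lin I a y" t] x y that by simp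
  with x y show "\<exists>g. path g \<and> path_image g \<subseteq> {x \<in> splx I. lin I a x \<in> {c..d}} \<and> pathstart g = x \<and> pathfinish g = y"
    by (intro exI[of _ "\<lambda>t i. (1 - t) * x i + t * y i"])
      (auto simp: splx_path_closed_segment pathstart_def pathfinish_def path_image_def intro!: splx_convex)
qed

lemma connected_splx: "connected (splx I)"
proof (rule path_connected_imp_connected, unfold path_connected_def, intro ballI)
  fix x y assume x: "x \<in> splx I" and y: "y \<in> splx I"
  then show "\<exists>g. path g \<and> path_image g \<subseteq> splx I \<and> pathstart g = x \<and> pathfinish g = y"
    by (intro exI[of _ "\<lambda>t i. (1 - t) * x i + t * y i"])
      (auto simp: splx_path_closed_segment pathstart_def pathfinish_def path_image_def intro!: splx_convex)
qed

text \<open>Each point slides along its tilting orbit to the level \<open>\<rho> (lin I a x)\<close>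
  of \<open>lin I b\<close>. As \<open>\<rho>\<close> is increasing, \<open>a\<close> and
  \<open>b\<close> order the vertices alike, so \<open>lin I a\<close> and \<open>lin I b\<close>
  are both strictly monotone along every orbit that is not a single point. Hence the slide is a
  bijection of each orbit onto itself, and therefore of each face.\<close>

lemma reparametrise:
  assumes I: "finite I" and cont: "continuous_on (lin I a ` splx I) \<rho>"
    and mono: "strict_mono_on (lin I a ` splx I) \<rho>" and b: "\<And>i. i \<in> I \<Longrightarrow> b i = \<rho> (a i)"
  obtains h h' where "face_homeo I h h'" "\<And>x. x \<in> splx I \<Longrightarrow> lin I b (h x) = \<rho> (lin I a x)"
proof -
  let ?R = "lin I a ` splx I"
  have aR: "a i \<in> ?R" if "i \<in> I" for i
    using that I lin_vtx[of I i a] by (metis image_eqI vtx_in_splx)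
  have less: "\<rho> u < \<rho> v" if "u < v" "u \<in> ?R" "v \<in> ?R" for u v
    using mono that by (simp add: strict_mono_onD)
  have less_iff: "\<rho> u < \<rho> v \<longleftrightarrow> u < v" if "u \<in> ?R" "v \<in> ?R" for u v
    using less that by (metis less_asym linorder_neqE order.irrefl)
  have ba: "b i < b l \<longleftrightarrow> a i < a l" if "i \<in> I" "l \<in> I" for i l
    using that aR b less_iff by simp
  have ba_eq: "b i = b l \<longleftrightarrow> a i = a l" if "i \<in> I" "l \<in> I" for i l
    using ba[of i l] ba[of l i] that by (metis linorder_neqE order.irrefl)
  have inj: "u = v" if "\<rho> u = \<rho> v" "u \<in> ?R" "v \<in> ?R" for u v
    using less that by (metis linorder_neqE order.irrefl)
  define T where "T x = \<rho> (lin I a x)" for x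
  have Tc: "continuous_on (splx I) T"
    unfolding T_def by (rule continuous_on_compose2[OF cont continuous_on_lin]) simp
  have minmax: thesis if x: "x \<in> splx I"
    and const: "\<And>i0. i0 \<in> I \<Longrightarrow> 0 < x i0 \<Longrightarrow> (\<And>i. i \<in> I \<Longrightarrow> 0 < x i \<Longrightarrow> b i = b i0) \<Longrightarrow> thesis"
    and nonconst: "\<And>p q. p \<in> I \<Longrightarrow> 0 < x p \<Longrightarrow> q \<in> I \<Longrightarrow> 0 < x q \<Longrightarrow> b p < b q \<Longrightarrow>
      (\<And>i. i \<in> I \<Longrightarrow> 0 < x i \<Longrightarrow> b p \<le> b i \<and> b i \<le> b q) \<Longrightarrow> thesis" for x thesis
  proof -
    let ?S = "{i \<in> I. 0 < x i}"
    obtain i0 where i0: "i0 \<in> I" "0 < x i0" by (rule splx_support_ex[OF x])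
    have S: "finite (b ` ?S)" "b ` ?S \<noteq> {}" using I i0 by auto
    obtain p where p: "p \<in> I" "0 < x p" "b p = Min (b ` ?S)" using Min_in[OF S] by auto
    obtain q where q: "q \<in> I" "0 < x q" "b q = Max (b ` ?S)" using Max_in[OF S] by auto
    have all: "b p \<le> b i \<and> b i \<le> b q" if "i \<in> I" "0 < x i" for i
      using that S p q by auto
    show thesis
    proof (cases "b p < b q")
      case True
      then show ?thesis using nonconst p q all by blast
    next
      case False
      then have "b i = b p" if "i \<in> I" "0 < x i" for i using all[OF that] by simp
      then show ?thesis using const p by blast
    qed
  qed
  have ex: "\<exists>s. lin I b (tilt I b s x) = T x" if x: "x \<in> splx I" for x
  proof (rule minmax[OF x])
    fix i0 assume i0: "i0 \<in> I" "0 < x i0" "\<And>i. i \<in> I \<Longrightarrow> 0 < x i \<Longrightarrow> b i = b i0"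
    then have ai: "\<And>i. i \<in> I \<Longrightarrow> 0 < x i \<Longrightarrow> a i = a i0" using ba_eq by blast
    have lins: "lin I b x = b i0" "lin I a x = a i0"
      by (rule lin_const_on_support[OF x i0(3)], assumption+, rule lin_const_on_support[OF x ai])
    have "lin I b (tilt I b 0 x) = T x" using lins tilt_0[OF x] b[OF i0(1)] by (simp add: T_def)
    then show ?thesis ..
  next
    fix p q assume pq: "p \<in> I" "0 < x p" "q \<in> I" "0 < x q" "b p < b q"
      and all: "\<And>i. i \<in> I \<Longrightarrow> 0 < x i \<Longrightarrow> b p \<le> b i \<and> b i \<le> b q"
    then have a: "a p < a q" using ba by blast
    have all': "a p \<le> a i \<and> a i \<le> a q" if "i \<in> I" "0 < x i" for i
      using all[OF that] ba pq that by (meson linorder_not_less)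
    have "lin I a x < a q" by (rule lin_less[OF x I _ pq(1,2)]) (use all' a in auto)
    moreover have "a p < lin I a x" by (rule lin_greater[OF x I _ pq(3,4)]) (use all' a in auto)
    ultimately have "b p < T x" "T x < b q"
      using b pq less aR x by (auto simp: T_def)
    then show ?thesis
      using tilt_ex[OF x I _ _ pq(3,4,1,2), of b "T x" b] by blast
  qed
  define Q where "Q x = tilt I b (SOME s. lin I b (tilt I b s x) = T x) x" for x
  have QT: "\<exists>s. Q x = tilt I b s x \<and> lin I b (Q x) = T x" if "x \<in> splx I" for x
    using someI_ex[OF ex[OF that]] unfolding Q_def by blast
  have Qface: "Q x \<in> splx J" if "J \<subseteq> I" "x \<in> splx J" for J x
    unfolding Q_def using tilt_in_splx that I by blast
  \<comment> \<open>An orbit meets a level of \<open>lin I a\<close> or of \<open>lin I b\<close> at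
    most once. The function \<open>a\<close> serves the injectivity of \<open>Q\<close>, the
    function \<open>b\<close> its surjectivity.\<close>
  have tilt_unique: "tilt I b s x = x" if x: "x \<in> splx I" and eq: "lin I f (tilt I b s x) = lin I f x"
    and f: "f = a \<or> f = b" for f s x
  proof (rule minmax[OF x])
    fix i0 assume "i0 \<in> I" "0 < x i0" "\<And>i. i \<in> I \<Longrightarrow> 0 < x i \<Longrightarrow> b i = b i0"
    then show ?thesis using tilt_const_support[OF x I] by blast
  next
    fix p q assume pq: "p \<in> I" "0 < x p" "q \<in> I" "0 < x q" "b p < b q"
    have co: "f i < f l" if "i \<in> I" "l \<in> I" "b i < b l" for i l using f ba that by auto
    have ceq: "f i = f l" if "i \<in> I" "l \<in> I" "b i = b l" for i l using f ba_eq that by auto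
    have "lin I f (tilt I b u x) < lin I f (tilt I b v x)" if "u < v" for u v
      by (rule lin_tilt_strict_mono[OF x I that co pq(1,3,2,4,5) ceq])
    from this[of s 0] this[of 0 s] have "s = 0"
      using eq tilt_0[OF x] by (metis linorder_neqE order.irrefl)
    then show ?thesis using tilt_0[OF x] by simp
  qed
  have Q_inj: "inj_on Q (splx I)"
  proof (rule inj_onI)
    fix x y assume x: "x \<in> splx I" and y: "y \<in> splx I" and eq: "Q x = Q y"
    obtain s r where s: "Q x = tilt I b s x" "lin I b (Q x) = T x" and r: "Q y = tilt I b r y" "lin I b (Q y) = T y"
      using QT x y by metis
    have "y = tilt I b (- r) (tilt I b r y)" using tilt_tilt[OF y I] tilt_0[OF y] by simp
    also have "\<dots> = tilt I b (- r) (tilt I b s x)" using eq s r by simp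
    also have "\<dots> = tilt I b (s - r) x" using tilt_tilt[OF x I, of b "- r" s] by simp
    finally have yx: "y = tilt I b (s - r) x" .
    have "lin I a x = lin I a y"
      using inj[of "lin I a x" "lin I a y"] s r eq x y unfolding T_def by auto
    then show "x = y" using tilt_unique[OF x, of a "s - r"] yx by simp
  qed
  have Q_surj: "\<exists>y\<in>splx J. Q y = z" if J: "J \<subseteq> I" and z: "z \<in> splx J" for J z
  proof -
    have zI: "z \<in> splx I" using z splx_mono[OF J I] by blast
    \<comment> \<open>The preimage of \<open>z\<close> must lie on the orbit of \<open>z\<close>, at
      the point whose \<open>a\<close>-level is sent by \<open>\<rho>\<close> to the
      \<open>b\<close>-level of \<open>z\<close>.\<close>
    have "\<exists>s. \<rho> (lin I a (tilt I b s z)) = lin I b z"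
    proof (rule minmax[OF zI])
      fix i0 assume i0: "i0 \<in> I" "0 < z i0" "\<And>i. i \<in> I \<Longrightarrow> 0 < z i \<Longrightarrow> b i = b i0"
      then have ai: "\<And>i. i \<in> I \<Longrightarrow> 0 < z i \<Longrightarrow> a i = a i0" using ba_eq by blast
      have lins: "lin I b z = b i0" "lin I a z = a i0"
        by (rule lin_const_on_support[OF zI i0(3)], assumption+, rule lin_const_on_support[OF zI ai])
      have "\<rho> (lin I a (tilt I b 0 z)) = lin I b z" using lins tilt_0[OF zI] b[OF i0(1)] by simp
      then show ?thesis ..
    next
      fix p q assume pq: "p \<in> I" "0 < z p" "q \<in> I" "0 < z q" "b p < b q"
        and all: "\<And>i. i \<in> I \<Longrightarrow> 0 < z i \<Longrightarrow> b p \<le> b i \<and> b i \<le> b q"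
      have "lin I b z < b q" by (rule lin_less[OF zI I _ pq(1,2)]) (use all pq in auto)
      moreover have "b p < lin I b z" by (rule lin_greater[OF zI I _ pq(3,4)]) (use all pq in auto)
      ultimately have ivt: "\<rho> (a p) \<le> lin I b z" "lin I b z \<le> \<rho> (a q)" and strict: "lin I b z \<noteq> \<rho> (a p)" "lin I b z \<noteq> \<rho> (a q)"
        using b pq by auto
      have apq: "a p < a q" using ba pq by blast
      have "connected ?R"
        by (rule connected_continuous_image[OF continuous_on_lin connected_splx])
      then have sub: "{a p..a q} \<subseteq> ?R"
        using aR pq by (meson atLeastAtMost_iff connected_contains_Icc)
      obtain c where c: "a p \<le> c" "c \<le> a q" "\<rho> c = lin I b z"
        using IVT'[of \<rho> "a p" "lin I b z" "a q"] ivt apq continuous_on_subset[OF cont sub] by auto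
      then have "a p < c" "c < a q" using strict by (metis order_le_less)+
      then obtain s where "lin I a (tilt I b s z) = c"
        using tilt_ex[of z I a p c q b] zI I pq ba ba_eq by metis
      then show ?thesis using c by blast
    qed
    then obtain s where s: "\<rho> (lin I a (tilt I b s z)) = lin I b z" by blast
    define y where "y = tilt I b s z"
    have yJ: "y \<in> splx J" unfolding y_def using tilt_in_splx[OF z J I] .
    then have yI: "y \<in> splx I" using splx_mono[OF J I] by blast
    obtain r where r: "Q y = tilt I b r y" "lin I b (Q y) = T y" using QT[OF yI] by blast
    have "Q y = tilt I b (r + s) z" using r(1) tilt_tilt[OF zI I, of b r s] by (simp add: y_def)
    moreover have "lin I b (Q y) = lin I b z" using r(2) s unfolding T_def y_def by simp
    ultimately have "Q y = z" using tilt_unique[OF zI, of b "r + s"] by simp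
    with yJ show ?thesis by blast
  qed
  have Qc: "continuous_on (splx I) Q"
    by (rule continuous_on_tilt_to[OF I Tc QT])
  define Q' where "Q' = the_inv_into (splx I) Q"
  have Q'Q: "Q' (Q x) = x" if "x \<in> splx I" for x
    unfolding Q'_def by (rule the_inv_into_f_f[OF Q_inj that])
  have img: "Q ` splx J = splx J" if "J \<subseteq> I" for J
    using Qface[OF that] Q_surj[OF that] by force
  have "face_homeo I Q Q'"
    unfolding face_homeo_def
  proof (intro conjI allI ballI impI)
    fix J assume J: "J \<subseteq> I"
    show "Q ` splx J \<subseteq> splx J" using img[OF J] by simp
    have "Q' ` Q ` splx J \<subseteq> splx J"
      using Q'Q splx_mono[OF J I] by (auto simp: subset_iff)
    then show "Q' ` splx J \<subseteq> splx J" by (simp add: img[OF J])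
  next
    fix x assume x: "x \<in> splx I"
    then show "Q' (Q x) = x" by (rule Q'Q)
    obtain y where "y \<in> splx I" "x = Q y" using x img[of I] by auto
    then show "Q (Q' x) = x" by (simp add: Q'Q)
  next
    show "continuous_on (splx I) Q'"
      using continuous_on_inv[OF Qc compact_splx[OF I]] Q'Q img[of I] by auto
  qed (rule Qc)
  moreover have "lin I b (Q x) = \<rho> (lin I a x)" if "x \<in> splx I" for x
    using QT[OF that] unfolding T_def by blast
  ultimately show ?thesis using that by blast
qed

lemma lin_image_eq:
  assumes "conj_affine I f" "finite I"
  shows "lin I (\<lambda>i. f (vtx i)) ` splx I = f ` splx I"
proof -
  obtain h h' where h: "face_homeo I h h'" "\<And>x. x \<in> splx I \<Longrightarrow> f (h x) = lin I (\<lambda>i. f (vtx i)) x"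
    using conj_affineE1[OF assms(1)] by blast
  have "lin I (\<lambda>i. f (vtx i)) ` splx I = f ` h ` splx I"
    using h(2) by (simp add: image_image)
  moreover have "h ` splx I = splx I"
    using face_homeoD[OF h(1)] by (auto simp: image_iff) (metis order.refl)
  ultimately show ?thesis by simp
qed

text \<open>A continuous injection on an interval is strictly monotone. The decreasing case follows
  from the increasing one by negating \<open>\<rho>\<close> and then the result.\<close>

lemma conj_affine_comp:
  assumes f: "conj_affine I f" and I: "finite I" and cont: "continuous_on (f ` splx I) \<rho>" and inj: "inj_on \<rho> (f ` splx I)"
  shows "conj_affine I (\<lambda>x. \<rho> (f x))"
proof -
  have mono_case: "conj_affine I (\<lambda>x. \<rho> (f x))"
    if f: "conj_affine I f" and cont: "continuous_on (f ` splx I) \<rho>" and mono: "strict_mono_on (f ` splx I) \<rho>" for f \<rho>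
  proof -
    obtain h h' where h: "face_homeo I h h'" "\<And>x. x \<in> splx I \<Longrightarrow> f (h x) = lin I (\<lambda>i. f (vtx i)) x"
      using conj_affineE1[OF f] by blast
    obtain g g' where g: "face_homeo I g g'"
      "\<And>x. x \<in> splx I \<Longrightarrow> lin I (\<lambda>i. \<rho> (f (vtx i))) (g x) = \<rho> (lin I (\<lambda>i. f (vtx i)) x)"
      using reparametrise[OF I, of "\<lambda>i. f (vtx i)" \<rho> "\<lambda>i. \<rho> (f (vtx i))"] cont mono
      by (auto simp: lin_image_eq[OF f I])
    show ?thesis
    proof (rule conj_affineI[OF face_homeo_comp[OF h(1) face_homeo_sym[OF g(1)]] I])
      fix x assume x: "x \<in> splx I"
      then have g'x: "g' x \<in> splx I" using face_homeoD(2)[OF g(1)] by blast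
      then show "\<rho> (f ((h \<circ> g') x)) = lin I (\<lambda>i. \<rho> (f (vtx i))) x"
        using h(2)[OF g'x] g(2)[OF g'x] face_homeoD(4)[OF g(1) x] by simp
    qed
  qed
  have "is_interval (f ` splx I)"
    using connected_continuous_image[OF conj_affine_continuous[OF f] connected_splx] by (simp add: is_interval_connected_1)
  then consider "strict_mono_on (f ` splx I) \<rho>" | "strict_antimono_on (f ` splx I) \<rho>"
    using injective_eq_monotone_map cont inj by blast
  then show ?thesis
  proof cases
    case 1
    then show ?thesis using mono_case f cont by blast
  next
    case 2
    have "conj_affine I (\<lambda>x. - (- \<rho> (f x)))"
    proof (rule conj_affine_uminus[OF mono_case[OF f, of "\<lambda>t. - \<rho> t"] I])
      show "continuous_on (f ` splx I) (\<lambda>t. - \<rho> t)" by (intro continuous_intros cont)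
      show "strict_mono_on (f ` splx I) (\<lambda>t. - \<rho> t)"
        using 2 by (auto simp: monotone_on_def)
    qed
    then show ?thesis by simp
  qed
qed

section \<open>Coning maps of the boundary of a simplex\<close>

definition low :: "nat set \<Rightarrow> (nat \<Rightarrow> real) \<Rightarrow> real" where
  "low J x = Min (x ` J)"

text \<open>The boundary point on the ray from the barycentre through \<open>x\<close>.\<close>

definition radial :: "nat set \<Rightarrow> (nat \<Rightarrow> real) \<Rightarrow> nat \<Rightarrow> real" where
  "radial J x = (\<lambda>l. if l \<in> J then (x l - low J x) / (1 - card J * low J x) else 0)"

text \<open>The Alexander trick. A point is the barycentre with weight
  \<open>card J * low J x\<close> plus a multiple of the boundary point \<open>radial J x\<close>,
  and \<open>\<theta>\<close> moves only the latter. At the barycentre \<open>radial\<close> divides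
  by zero, but its image is multiplied by zero.\<close>

definition cone :: "nat set \<Rightarrow> ((nat \<Rightarrow> real) \<Rightarrow> nat \<Rightarrow> real) \<Rightarrow> (nat \<Rightarrow> real) \<Rightarrow> nat \<Rightarrow> real" where
  "cone J \<theta> x = (\<lambda>i. (if i \<in> J then low J x else 0) + (1 - card J * low J x) * \<theta> (radial J x) i)"

context
  fixes J :: "nat set"
  assumes J: "finite J" "J \<noteq> {}"
begin

lemma low_le: "i \<in> J \<Longrightarrow> low J x \<le> x i"
  using J by (simp add: low_def)

lemma low_ex: obtains i where "i \<in> J" "low J x = x i"
proof -
  have "low J x \<in> x ` J" using J unfolding low_def by (intro Min_in) auto
  with that show ?thesis by blast
qed

lemma low_eqI: "i \<in> J \<Longrightarrow> x i = m \<Longrightarrow> (\<And>l. l \<in> J \<Longrightarrow> m \<le> x l) \<Longrightarrow> low J x = m"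
  using low_le[of i x] low_ex[of x] by (metis order_antisym)

lemma low_nonneg: "x \<in> splx J \<Longrightarrow> 0 \<le> low J x"
  using low_ex[of x] splxD(1) by metis

lemma low_boundary: "i \<in> J \<Longrightarrow> x \<in> splx (J - {i}) \<Longrightarrow> low J x = 0"
  by (rule low_eqI) (auto simp: splx_def)

lemma card_low_le: assumes "x \<in> splx J" shows "card J * low J x \<le> 1"
proof -
  have "card J * low J x = (\<Sum>i\<in>J. low J x)" by simp
  also have "\<dots> \<le> sum x J" by (intro sum_mono low_le)
  finally show ?thesis using splxD(3)[OF assms] by simp
qed

lemma card_low_eq:
  assumes "x \<in> splx J" "card J * low J x = 1" "i \<in> J"
  shows "x i = low J x"
proof -
  have "(\<Sum>i\<in>J. x i - low J x) = 0"
    using assms splxD(3)[OF assms(1)] by (simp add: sum_subtractf)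
  then have "\<forall>i\<in>J. x i - low J x = 0"
    using sum_nonneg_eq_0_iff[of J "\<lambda>i. x i - low J x"] low_le J by simp
  with assms show ?thesis by simp
qed

lemma radial_in:
  assumes x: "x \<in> splx J" and t: "card J * low J x < 1"
  obtains i where "i \<in> J" "radial J x \<in> splx (J - {i})"
proof -
  obtain i where i: "i \<in> J" "low J x = x i" by (rule low_ex)
  have "sum (radial J x) J = (\<Sum>l\<in>J. x l - low J x) / (1 - card J * low J x)"
    by (simp add: radial_def sum_divide_distrib)
  also have "\<dots> = 1" using t splxD(3)[OF x] by (simp add: sum_subtractf)
  finally have "radial J x \<in> splx J"
    using t low_le by (auto simp: splx_def radial_def)
  moreover have "radial J x i = 0" by (simp add: radial_def i)
  ultimately have "radial J x \<in> splx (J \<inter> (J - {i}))"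
    using J i by (intro splx_subset_support) auto
  with i that show ?thesis by (simp add: Int_absorb1)
qed

lemma radial_eq:
  assumes "x \<in> splx J" "card J * low J x < 1"
  shows "x l = (if l \<in> J then low J x else 0) + (1 - card J * low J x) * radial J x l"
  using assms splxD(2)[OF assms(1)] by (auto simp: radial_def)

lemma radial_boundary:
  assumes "i \<in> J" "x \<in> splx (J - {i})"
  shows "radial J x = x"
  using low_boundary[OF assms] splxD(2)[OF assms(2)] by (auto simp: radial_def)

lemma cone_boundary:
  assumes "i \<in> J" "x \<in> splx (J - {i})"
  shows "cone J \<theta> x = \<theta> x"
  using low_boundary[OF assms] radial_boundary[OF assms] by (auto simp: cone_def)

lemma cone_centre:
  assumes "x \<in> splx J" "card J * low J x = 1"
  shows "cone J \<theta> x = x"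
  using assms card_low_eq[OF assms] splxD(2)[OF assms(1)] by (auto simp: cone_def)

lemma low_cone:
  assumes x: "x \<in> splx J" and y: "\<theta> (radial J x) \<in> splx (J - {i})" "i \<in> J"
  shows "low J (cone J \<theta> x) = low J x"
  using y card_low_le[OF x] splxD(1,2)[OF y(1)] by (intro low_eqI[of i]) (auto simp: cone_def)

lemma cone_in_splx:
  assumes x: "x \<in> splx J" and \<theta>: "\<And>i y. i \<in> J \<Longrightarrow> y \<in> splx (J - {i}) \<Longrightarrow> \<theta> y \<in> splx (J - {i})"
  shows "cone J \<theta> x \<in> splx J"
proof (cases "card J * low J x = 1")
  case True
  then show ?thesis using cone_centre[OF x] x by simp
next
  case False
  with card_low_le[OF x] have t: "card J * low J x < 1" by simp
  then obtain i where i: "i \<in> J" "radial J x \<in> splx (J - {i})" by (rule radial_in[OF x])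
  then have y: "\<theta> (radial J x) \<in> splx J" using \<theta> splx_mono[of "J - {i}" J] J by blast
  have "sum (cone J \<theta> x) J = 1"
    using splxD(3)[OF y] by (simp add: cone_def sum.distrib flip: sum_distrib_left)
  then show ?thesis
    using t low_nonneg[OF x] splxD(1,2)[OF y] by (auto simp: splx_def cone_def)
qed

lemma cone_inverse:
  assumes x: "x \<in> splx J"
    and \<theta>: "\<And>i y. i \<in> J \<Longrightarrow> y \<in> splx (J - {i}) \<Longrightarrow> \<theta> y \<in> splx (J - {i}) \<and> \<theta>' (\<theta> y) = y"
  shows "cone J \<theta>' (cone J \<theta> x) = x"
proof (cases "card J * low J x = 1")
  case True
  then show ?thesis using cone_centre[OF x] x by simp
next
  case False
  with card_low_le[OF x] have t: "card J * low J x < 1" by simp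
  then obtain i where i: "i \<in> J" "radial J x \<in> splx (J - {i})" by (rule radial_in[OF x])
  then have y: "\<theta> (radial J x) \<in> splx (J - {i})" and inv: "\<theta>' (\<theta> (radial J x)) = radial J x"
    using \<theta> by blast+
  have l: "low J (cone J \<theta> x) = low J x" by (rule low_cone[where \<theta>=\<theta>, OF x y i(1)])
  have "radial J (cone J \<theta> x) l = \<theta> (radial J x) l" for l
    using t splxD(2)[OF y, of l] unfolding radial_def[of J "cone J \<theta> x"] l by (auto simp: cone_def)
  then have "radial J (cone J \<theta> x) = \<theta> (radial J x)" by blast
  then have "cone J \<theta>' (cone J \<theta> x) l = x l" for l
    using radial_eq[OF x t, of l] by (simp add: cone_def[of J \<theta>'] l inv)
  then show ?thesis by blast
qed

text \<open>The cone leaves the barycentric part of \<open>x\<close> alone, and \<open>lin\<close>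
  is linear in the two parts.\<close>

lemma lin_cone:
  assumes x: "x \<in> splx J" and \<theta>: "\<And>i y. i \<in> J \<Longrightarrow> y \<in> splx (J - {i}) \<Longrightarrow> lin J w (\<theta> y) = lin J w y"
  shows "lin J w (cone J \<theta> x) = lin J w x"
proof (cases "card J * low J x = 1")
  case True
  then show ?thesis using cone_centre[OF x] x by simp
next
  case False
  with card_low_le[OF x] have t: "card J * low J x < 1" by simp
  then obtain i where i: "i \<in> J" "radial J x \<in> splx (J - {i})" by (rule radial_in[OF x])
  have *: "lin J w (\<lambda>i. (if i \<in> J then m else 0) + s * z i) = lin J w (\<lambda>i. m) + s * lin J w z" for m s z
    by (simp add: lin_def distrib_left sum.distrib sum_distrib_left mult.left_commute)
  have "lin J w (cone J \<theta> x) = lin J w (\<lambda>l. (if l \<in> J then low J x else 0) + (1 - card J * low J x) * radial J x l)"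
    unfolding cone_def * using \<theta>[OF i] by simp
  then show ?thesis by (simp flip: radial_eq[OF x t])
qed

lemma continuous_on_low: "continuous_on S (low J)"
  using J(1,2)
proof (induction J rule: finite_ne_induct)
  case (singleton i)
  then show ?case by (simp add: low_def[abs_def] continuous_on_coord)
next
  case (insert i F)
  have "low (insert i F) = (\<lambda>x. min (x i) (low F x))"
    using insert by (auto simp: low_def[abs_def])
  then show ?case using insert by (auto intro: continuous_intros)
qed

lemma continuous_on_cone:
  assumes \<theta>: "\<And>i y. i \<in> J \<Longrightarrow> y \<in> splx (J - {i}) \<Longrightarrow> \<theta> y \<in> splx (J - {i})"
    and cont: "\<And>i. i \<in> J \<Longrightarrow> continuous_on (splx (J - {i})) \<theta>"
  shows "continuous_on (splx J) (cone J \<theta>)"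
proof -
  let ?t = "\<lambda>x. 1 - card J * low J x"
  have tc: "continuous_on S ?t" for S by (intro continuous_intros continuous_on_low)
  have bc: "continuous_on (\<Union>i\<in>J. splx (J - {i})) \<theta>"
    by (rule continuous_on_closed_Union) (use J cont closed_splx in auto)
  have main: "continuous_on (splx J) (\<lambda>x. ?t x * \<theta> (radial J x) l)" for l
    unfolding continuous_on_def
  proof
    fix x assume x: "x \<in> splx J"
    let ?F = "at x within splx J"
    have tt: "(?t \<longlongrightarrow> ?t x) ?F" using tc[of "splx J"] x unfolding continuous_on_def by blast
    show "((\<lambda>x. ?t x * \<theta> (radial J x) l) \<longlongrightarrow> ?t x * \<theta> (radial J x) l) ?F"
    proof (cases "?t x = 0")
      \<comment> \<open>At the barycentre the coordinates of \<open>\<theta>\<close> stay between 0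
        and 1 while the factor in front tends to 0.\<close>
      case True
      have inS: "\<forall>\<^sub>F z in ?F. z \<in> splx J" by (simp add: eventually_at_filter)
      have bound: "0 \<le> ?t z * \<theta> (radial J z) l \<and> ?t z * \<theta> (radial J z) l \<le> ?t z" if z: "z \<in> splx J" for z
      proof (cases "?t z = 0")
        case False
        with card_low_le[OF z] have t: "card J * low J z < 1" by simp
        then obtain i where i: "i \<in> J" "radial J z \<in> splx (J - {i})" by (rule radial_in[OF z])
        then have "0 \<le> \<theta> (radial J z) l" "\<theta> (radial J z) l \<le> 1"
          using \<theta> splxD(1) splx_le_1 J by (meson finite_Diff)+
        with t show ?thesis by (simp add: mult_left_le)
      qed simp
      have "((\<lambda>x. ?t x * \<theta> (radial J x) l) \<longlongrightarrow> 0) ?F"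
      proof (rule tendsto_sandwich[OF _ _ tendsto_const])
        show "\<forall>\<^sub>F z in ?F. 0 \<le> ?t z * \<theta> (radial J z) l" "\<forall>\<^sub>F z in ?F. ?t z * \<theta> (radial J z) l \<le> ?t z"
          using inS by (eventually_elim, use bound in blast)+
        show "(?t \<longlongrightarrow> 0) ?F" using tt True by simp
      qed
      with True show ?thesis by simp
    next
      case False
      with card_low_le[OF x] have t: "0 < ?t x" by simp
      let ?U = "{z. 0 < ?t z}"
      have U: "open ?U" by (intro open_Collect_less continuous_intros continuous_on_low)
      have "continuous_on (splx J \<inter> ?U) (radial J)"
      proof (rule continuous_on_coordinatewise_then_product)
        fix l
        show "continuous_on (splx J \<inter> ?U) (\<lambda>x. radial J x l)"
          unfolding radial_def by (cases "l \<in> J") (auto intro!: continuous_intros continuous_on_low)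
      qed
      moreover have "radial J ` (splx J \<inter> ?U) \<subseteq> (\<Union>i\<in>J. splx (J - {i}))"
      proof (intro image_subsetI)
        fix z assume "z \<in> splx J \<inter> ?U"
        then show "radial J z \<in> (\<Union>i\<in>J. splx (J - {i}))" using radial_in[of z] by auto
      qed
      ultimately have "continuous_on (splx J \<inter> ?U) (\<lambda>x. \<theta> (radial J x))"
        by (intro continuous_on_compose2[OF bc])
      then have "continuous_on (splx J \<inter> ?U) (\<lambda>x. ?t x * \<theta> (radial J x) l)"
        by (intro continuous_on_mult tc) (rule continuous_on_product_then_coordinatewise)
      then have "((\<lambda>x. ?t x * \<theta> (radial J x) l) \<longlongrightarrow> ?t x * \<theta> (radial J x) l) (at x within (splx J \<inter> ?U))"
        using x t unfolding continuous_on_def by blast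
      moreover have "at x within (splx J \<inter> ?U) = ?F"
        by (rule at_within_nhd[OF _ U]) (use t in auto)
      ultimately show ?thesis by simp
    qed
  qed
  show ?thesis
  proof (rule continuous_on_coordinatewise_then_product)
    fix l
    show "continuous_on (splx J) (\<lambda>x. cone J \<theta> x l)"
      unfolding cone_def by (cases "l \<in> J") (auto intro!: continuous_intros main continuous_on_low)
  qed
qed

end

text \<open>The conjugations of different facets need not agree on common faces, so a compatible one
  on the whole boundary is built by induction on the dimension of faces. If \<open>h\<close> is
  known on the boundary of \<open>J\<close>, and \<open>G J\<close> is the conjugation that belongs
  to \<open>J\<close>, then \<open>G' J \<circ> h\<close> preserves \<open>lin\<close> on that
  boundary. Its cone preserves \<open>lin\<close> on \<open>J\<close>, and following it by
  \<open>G J\<close> extends \<open>h\<close>. A last cone, over the boundary of \<open>N\<close>,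
  defines \<open>f\<close>.\<close>

lemma extend_good:
  assumes N: "finite N" "N \<noteq> {}" and \<phi>: "\<And>i. i \<in> N \<Longrightarrow> conj_affine (N - {i}) \<phi>"
  obtains f where "conj_affine N f" "\<And>i x. i \<in> N \<Longrightarrow> x \<in> splx (N - {i}) \<Longrightarrow> f x = \<phi> x"
proof -
  define w where "w i = \<phi> (vtx i)" for i
  let ?P = "\<lambda>J h h'. face_homeo J h h' \<and> (\<forall>x\<in>splx J. \<phi> (h x) = lin N w x)"
  define P where "P J h h' \<longleftrightarrow> ?P J h h'" for J h h'
  have exP: "\<exists>h h'. P J h h'" if J: "J \<subset> N" for J
  proof -
    obtain i where i: "i \<in> N" "J \<subseteq> N - {i}" using J by blast
    have "conj_affine J \<phi>" using conj_affine_subset[OF \<phi>[OF i(1)] i(2)] N by simp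
    then obtain h h' where h: "face_homeo J h h'" "\<And>x. x \<in> splx J \<Longrightarrow> \<phi> (h x) = lin J w x"
      using conj_affineE1[of J \<phi>] unfolding w_def by blast
    then have "P J h h'" unfolding P_def using lin_mono_face[of J N] J N by auto
    then show ?thesis by blast
  qed
  then obtain G G' where G: "\<And>J. J \<subset> N \<Longrightarrow> P J (G J) (G' J)" by metis
  have "\<exists>h h'. \<forall>J. J \<subset> N \<and> card J \<le> m \<longrightarrow> P J h h'" for m
  proof (induction m)
    case 0
    have empty: "J = {}" if "J \<subset> N" "card J \<le> 0" for J
    proof -
      have "finite J" using that(1) N(1) finite_subset[of J N] by blast
      then show ?thesis using that(2) by simp
    qed
    show ?case
    proof (intro exI allI impI)
      fix J assume "J \<subset> N \<and> card J \<le> 0"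
      then have "J = {}" using empty by blast
      then show "P J (\<lambda>x. x) (\<lambda>x. x)" by (simp add: P_def face_homeo_id)
    qed
  next
    case (Suc m)
    then obtain h h' where h: "\<And>J. J \<subset> N \<Longrightarrow> card J \<le> m \<Longrightarrow> P J h h'" by blast
    \<comment> \<open>The support of a point is its smallest face; its size decides whether the old
      map or the new extension applies.\<close>
    define supp where "supp x = {i \<in> N. x i \<noteq> 0}" for x :: "nat \<Rightarrow> real"
    define K where "K J = (\<lambda>x. G J (cone J (G' J \<circ> h) x))" for J
    define K' where "K' J = (\<lambda>x. cone J (h' \<circ> G J) (G' J x))" for J
    define k where "k x = (if card (supp x) \<le> m then h x else K (supp x) x)" for x
    define k' where "k' x = (if card (supp x) \<le> m then h' x else K' (supp x) x)" for x
    have supp_sub: "supp x \<subseteq> J" if "J \<subseteq> N" "x \<in> splx J" for x J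
      using that splxD(2) unfolding supp_def by blast
    have old: "k x = h x \<and> k' x = h' x" if "J \<subset> N" "card J \<le> m" "x \<in> splx J" for x J
    proof -
      have "card (supp x) \<le> m"
      proof -
        have "finite J" "supp x \<subseteq> J" using supp_sub[of J x] that N finite_subset by auto
        then show ?thesis using that(2) card_mono[of J "supp x"] by simp
      qed
      then show ?thesis by (simp add: k_def k'_def)
    qed
    have "P J k k'" if J: "J \<subset> N" "card J \<le> Suc m" for J
    proof (cases "card J \<le> m")
      case True
      have PJ: "?P J h h'" using h[OF J(1) True] unfolding P_def .
      have "finite J" using J N finite_subset by blast
      then have sub: "L \<subset> N" "card L \<le> m" if "L \<subseteq> J" for L
        using that J True card_mono[of J L] by auto
      have eq: "k x = h x" "k' x = h' x" if "x \<in> splx J" for x using old J True that by blast+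
      have "face_homeo J k k'"
        unfolding face_homeo_def
      proof (intro conjI allI impI ballI)
        fix L assume L: "L \<subseteq> J"
        then have "k x = h x \<and> k' x = h' x" if "x \<in> splx L" for x using old sub that by blast
        then show "k ` splx L \<subseteq> splx L" "k' ` splx L \<subseteq> splx L" using PJ L by (auto dest: face_homeoD)
      next
        fix x assume x: "x \<in> splx J"
        then have "h x \<in> splx J" "h' x \<in> splx J" using PJ by (auto dest: face_homeoD)
        with x show "k' (k x) = x" "k (k' x) = x" using PJ eq by (auto simp: face_homeoD)
      next
        show "continuous_on (splx J) k" "continuous_on (splx J) k'"
          using PJ eq by (auto dest: face_homeoD cong: continuous_on_cong)
      qed
      then show ?thesis unfolding P_def using PJ eq by simp
    next
      case False
      with J have cJ: "card J = Suc m" by simp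
      have fJ: "finite J" "J \<noteq> {}" using J(1) N(1) cJ finite_subset[of J N] by (blast, force)
      have JN: "J \<subseteq> N" using J by blast
      have GJ: "face_homeo J (G J) (G' J)" "\<And>x. x \<in> splx J \<Longrightarrow> \<phi> (G J x) = lin N w x" using G[OF J(1)] unfolding P_def by auto
      have sub: "J - {i} \<subset> N" "card (J - {i}) \<le> m" if "i \<in> J" for i
        using J cJ that fJ by auto
      have hi: "?P (J - {i}) h h'" if "i \<in> J" for i using h[OF sub[OF that]] unfolding P_def .
      have mem: "G' J (h y) \<in> splx (J - {i})" "h' (G J y) \<in> splx (J - {i})" "h y \<in> splx (J - {i})" "h' y \<in> splx (J - {i})"
        "G J y \<in> splx (J - {i})" "G' J y \<in> splx (J - {i})" "y \<in> splx J" "h y \<in> splx J" "h' (G J y) \<in> splx J"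
        if "i \<in> J" "y \<in> splx (J - {i})" for i y
      proof -
        note h1 = face_homeoD(1,2)[OF conjunct1[OF hi[OF that(1)]] order.refl]
        note g1 = face_homeoD(1,2)[OF GJ(1), of "J - {i}"]
        show "G' J (h y) \<in> splx (J - {i})" "h' (G J y) \<in> splx (J - {i})" "h y \<in> splx (J - {i})" "h' y \<in> splx (J - {i})"
        "G J y \<in> splx (J - {i})" "G' J y \<in> splx (J - {i})"
          using h1 g1 that by auto
        then show "y \<in> splx J" "h y \<in> splx J" "h' (G J y) \<in> splx J"
          using splx_mono[of "J - {i}" J] fJ that h1 g1 by blast+
      qed
      have inv1: "(h' \<circ> G J) ((G' J \<circ> h) y) = y" and inv2: "(G' J \<circ> h) ((h' \<circ> G J) y) = y"
        if "i \<in> J" "y \<in> splx (J - {i})" for i y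
      proof -
        note hh = face_homeoD(3,4)[OF conjunct1[OF hi[OF that(1)]]]
        show "(h' \<circ> G J) ((G' J \<circ> h) y) = y"
          using mem[OF that] face_homeoD(4)[OF GJ(1)] hh(1)[OF that(2)] by simp
        show "(G' J \<circ> h) ((h' \<circ> G J) y) = y"
          using mem[OF that] face_homeoD(3)[OF GJ(1)] hh(2) by simp
      qed
      have ext: "K J x = h x \<and> K' J x = h' x" if "i \<in> J" "x \<in> splx (J - {i})" for i x
        using cone_boundary[OF fJ that, of "G' J \<circ> h"] cone_boundary[OF fJ that(1) mem(6)[OF that], of "h' \<circ> G J"]
          face_homeoD(4)[OF GJ(1)] mem[OF that] by (simp add: K_def K'_def)
      have eq: "k x = K J x" "k' x = K' J x" if x: "x \<in> splx J" for x
      proof -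
        have "k x = K J x \<and> k' x = K' J x"
        proof (cases "supp x = J")
          case True
          then show ?thesis using cJ by (simp add: k_def k'_def)
        next
          case False
          then obtain i where i: "i \<in> J" "x i = 0" using supp_sub[OF JN x] JN unfolding supp_def by blast
          then have "x \<in> splx (J \<inter> (J - {i}))" using x fJ by (intro splx_subset_support) auto
          then have xi: "x \<in> splx (J - {i})" by (simp add: Int_absorb1)
          then show ?thesis using ext[OF i(1) xi] old[OF sub[OF i(1)] xi] by simp
        qed
        then show "k x = K J x" "k' x = K' J x" by blast+
      qed
      have c1: "cone J (G' J \<circ> h) x \<in> splx J" "cone J (h' \<circ> G J) x \<in> splx J" if "x \<in> splx J" for x
        using cone_in_splx[OF fJ that] mem by auto
      have Kin: "K J x \<in> splx J" "K' J x \<in> splx J" if "x \<in> splx J" for x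
        using c1 that face_homeoD(1,2)[OF GJ(1) order.refl] unfolding K_def K'_def by auto
      have "face_homeo J k k'"
        unfolding face_homeo_def
      proof (intro conjI allI impI ballI)
        fix L assume L: "L \<subseteq> J"
        have "k ` splx L \<subseteq> splx L \<and> k' ` splx L \<subseteq> splx L"
        proof (cases "L = J")
          case True
          then show ?thesis using eq Kin by auto
        next
          case False
          then obtain i where i: "i \<in> J" "L \<subseteq> J - {i}" using L by blast
          have "splx L \<subseteq> splx (J - {i})" using splx_mono[OF i(2)] fJ by simp
          then have "k x = h x \<and> k' x = h' x" if "x \<in> splx L" for x using old[OF sub[OF i(1)]] that by blast
          moreover have "h x \<in> splx L \<and> h' x \<in> splx L" if "x \<in> splx L" for x
            using face_homeoD(1,2)[OF conjunct1[OF hi[OF i(1)]] i(2) that] by blast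
          ultimately show ?thesis by auto
        qed
        then show "k ` splx L \<subseteq> splx L" "k' ` splx L \<subseteq> splx L" by blast+
      next
        fix x assume x: "x \<in> splx J"
        have "K' J (K J x) = cone J (h' \<circ> G J) (cone J (G' J \<circ> h) x)"
          unfolding K_def K'_def using face_homeoD(3)[OF GJ(1)] c1 x by simp
        also have "\<dots> = x" by (rule cone_inverse[OF fJ x]) (use mem inv1 in auto)
        finally show "k' (k x) = x" using eq Kin x by simp
        have "cone J (G' J \<circ> h) (cone J (h' \<circ> G J) (G' J x)) = G' J x"
          by (rule cone_inverse[OF fJ face_homeoD(2)[OF GJ(1) order.refl x]]) (use mem inv2 in auto)
        then have "K J (K' J x) = x"
          unfolding K_def K'_def using face_homeoD(4)[OF GJ(1) x] by simp
        then show "k (k' x) = x" using eq Kin x by simp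
      next
        have cG: "continuous_on (splx (J - {i})) (G J)" "continuous_on (splx (J - {i})) (G' J)"
          "continuous_on (splx (J - {i})) h" "continuous_on (splx (J - {i})) h'" if "i \<in> J" for i
          using face_homeoD(5,6)[OF GJ(1)] splx_mono[of "J - {i}" J] fJ face_homeoD(5,6)[OF conjunct1[OF hi[OF that]]]
            continuous_on_subset
          by blast+
        have "continuous_on (splx J) (cone J (G' J \<circ> h))"
        proof (rule continuous_on_cone[OF fJ])
          fix i assume i: "i \<in> J"
          show "continuous_on (splx (J - {i})) (G' J \<circ> h)"
            by (rule continuous_on_compose) (use cG[OF i] mem i in \<open>auto elim!: continuous_on_subset\<close>)
        qed (use mem in auto)
        then have "continuous_on (splx J) (K J)"
          unfolding K_def by (rule continuous_on_compose2[OF face_homeoD(5)[OF GJ(1)]]) (use c1 in auto)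
        then show "continuous_on (splx J) k" using eq by (simp cong: continuous_on_cong)
        have "continuous_on (splx J) (cone J (h' \<circ> G J))"
        proof (rule continuous_on_cone[OF fJ])
          fix i assume i: "i \<in> J"
          show "continuous_on (splx (J - {i})) (h' \<circ> G J)"
            by (rule continuous_on_compose) (use cG[OF i] mem i in \<open>auto elim!: continuous_on_subset\<close>)
        qed (use mem in auto)
        then have "continuous_on (splx J) (K' J)"
          unfolding K'_def by (rule continuous_on_compose2[OF _ face_homeoD(6)[OF GJ(1)]])
            (use face_homeoD(2)[OF GJ(1) order.refl] in auto)
        then show "continuous_on (splx J) k'" using eq by (simp cong: continuous_on_cong)
      qed
      moreover have "\<phi> (k x) = lin N w x" if x: "x \<in> splx J" for x
      proof -
        have "\<phi> (k x) = lin J w (cone J (G' J \<circ> h) x)"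
          using eq(1)[OF x] GJ(2)[OF c1(1)[OF x]] lin_mono_face[OF JN N(1) c1(1)[OF x]] by (simp add: K_def)
        \<comment> \<open>On the boundary both \<open>h\<close> and \<open>G J\<close> conjugate
          \<open>\<phi>\<close> to \<open>lin N w\<close>, so that \<open>G' J \<circ> h\<close>
          preserves it.\<close>
        also have "\<dots> = lin J w x"
        proof (rule lin_cone[OF fJ x])
          fix i y assume i: "i \<in> J" and y: "y \<in> splx (J - {i})"
          have "lin N w (G' J (h y)) = \<phi> (G J (G' J (h y)))"
            using GJ(2)[OF face_homeoD(2)[OF GJ(1) order.refl mem(8)[OF i y]]] by simp
          also have "\<dots> = lin N w y" using face_homeoD(4)[OF GJ(1)] mem[OF i y] hi[OF i] y by simp
          finally show "lin J w ((G' J \<circ> h) y) = lin J w y"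
            using lin_mono_face[OF JN N(1)] mem[OF i y] face_homeoD(2)[OF GJ(1) order.refl] by simp
        qed
        also have "\<dots> = lin N w x" using lin_mono_face[OF JN N(1) x] by simp
        finally show ?thesis .
      qed
      ultimately show ?thesis unfolding P_def by blast
    qed
    then show ?case by blast
  qed
  from this[of "card N"] obtain h h' where h0: "\<And>J. J \<subset> N \<Longrightarrow> card J \<le> card N \<Longrightarrow> P J h h'"
    by blast
  have h: "P J h h'" if "J \<subset> N" for J
    using h0[OF that] card_mono[OF N(1), of J] that by blast
  have hi: "face_homeo (N - {i}) h h'" "\<And>x. x \<in> splx (N - {i}) \<Longrightarrow> \<phi> (h x) = lin N w x" if "i \<in> N" for i
    using h[of "N - {i}"] that unfolding P_def by auto
  have mem: "h y \<in> splx (N - {i})" "h' y \<in> splx (N - {i})" "h' (h y) = y" "h (h' y) = y"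
    if "i \<in> N" "y \<in> splx (N - {i})" for i y
    using face_homeoD(1-4)[OF hi(1)[OF that(1)]] that by auto
  have fh: "face_homeo N (cone N h) (cone N h')"
    unfolding face_homeo_def
  proof (intro conjI allI impI ballI)
    fix L assume L: "L \<subseteq> N"
    have "cone N h ` splx L \<subseteq> splx L \<and> cone N h' ` splx L \<subseteq> splx L"
    proof (cases "L = N")
      case True
      then show ?thesis using cone_in_splx[OF N] mem by auto
    next
      case False
      then obtain i where i: "i \<in> N" "L \<subseteq> N - {i}" using L by blast
      have "splx L \<subseteq> splx (N - {i})" using splx_mono[OF i(2)] N by simp
      then have "cone N h x = h x \<and> cone N h' x = h' x" if "x \<in> splx L" for x
        using cone_boundary[OF N i(1)] that by blast
      then show ?thesis using face_homeoD(1,2)[OF hi(1)[OF i(1)] i(2)] by auto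
    qed
    then show "cone N h ` splx L \<subseteq> splx L" "cone N h' ` splx L \<subseteq> splx L" by blast+
  next
    fix x assume "x \<in> splx N"
    then show "cone N h' (cone N h x) = x" "cone N h (cone N h' x) = x"
      using mem by (auto intro!: cone_inverse[OF N])
  next
    show "continuous_on (splx N) (cone N h)" "continuous_on (splx N) (cone N h')"
      using mem face_homeoD(5,6)[OF hi(1)] by (auto intro!: continuous_on_cone[OF N])
  qed
  define f where "f x = lin N w (cone N h' x)" for x
  have conj_affine: "conj_affine N f"
    by (rule conj_affineI[OF fh N(1), of _ w]) (simp add: f_def face_homeoD(3)[OF fh])
  have ext: "f x = \<phi> x" if "i \<in> N" "x \<in> splx (N - {i})" for i x
    using cone_boundary[OF N that] hi(2)[OF that(1) mem(2)[OF that]] mem[OF that] by (simp add: f_def)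
  with conj_affine ext that show ?thesis by blast
qed


section \<open>Gluing level functions along a horn\<close>

text \<open>A continuous map from a compact space to a Hausdorff space is closed, hence a quotient
  map onto its image.\<close>

lemma continuous_on_factor:
  fixes g :: "'a::topological_space \<Rightarrow> 'b::t2_space" and \<rho> :: "'b \<Rightarrow> 'c::topological_space"
  assumes K: "compact K" and g: "continuous_on K g" and \<rho>g: "continuous_on K (\<lambda>x. \<rho> (g x))"
  shows "continuous_on (g ` K) \<rho>"
proof -
  have "\<exists>A. closed A \<and> A \<inter> g ` K = \<rho> -` C \<inter> g ` K" if C: "closed C" for C
  proof -
    have "closedin (top_of_set K) (K \<inter> (\<lambda>x. \<rho> (g x)) -` C)"
      using \<rho>g C by (rule continuous_closedin_preimage)
    then have "compact (K \<inter> (\<lambda>x. \<rho> (g x)) -` C)"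
      by (rule closedin_compact[OF K])
    then have "compact (g ` (K \<inter> (\<lambda>x. \<rho> (g x)) -` C))"
      using continuous_on_subset[OF g] by (intro compact_continuous_image) auto
    then have "closed (g ` (K \<inter> (\<lambda>x. \<rho> (g x)) -` C))" by (rule compact_imp_closed)
    moreover have "g ` (K \<inter> (\<lambda>x. \<rho> (g x)) -` C) \<inter> g ` K = \<rho> -` C \<inter> g ` K" by auto
    ultimately show ?thesis by blast
  qed
  then show ?thesis by (simp add: continuous_on_closed_invariant)
qed

section \<open>Edges that start at the apex of the horn\<close>

definition edge :: "nat \<Rightarrow> nat \<Rightarrow> real \<Rightarrow> nat \<Rightarrow> real" where
  "edge k i t = (\<lambda>l. (1 - t) * vtx k l + t * vtx i l)"

lemma edge_in_splx:
  assumes "k \<in> I" "i \<in> I" "finite I" "t \<in> {0..1}"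
  shows "edge k i t \<in> splx I"
  unfolding edge_def using assms by (intro splx_convex) (auto simp: vtx_in_splx)

lemma edge_0 [simp]: "edge k i 0 = vtx k" and edge_1 [simp]: "edge k i 1 = vtx i"
  by (auto simp: edge_def)

lemma continuous_on_edge: "continuous_on S (edge k i)"
  unfolding edge_def[abs_def] by (intro continuous_intros)

text \<open>An edge is a face, so the conjugating homeomorphism restricts to it, and
  \<open>u\<close> is this restriction in the coordinate of the edge. In particular \<open>f\<close>
  is constant or strictly monotone along an edge.\<close>

lemma conj_affine_on_edge:
  assumes f: "conj_affine I f" and I: "finite I" "k \<in> I" "i \<in> I" "k \<noteq> i"
  obtains u where "continuous_on {0..1} u" "inj_on u {0..1}" "u ` {0..1} \<subseteq> {0..1}" "u 0 = 0" "u 1 = 1"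
    "\<And>t. t \<in> {0..1} \<Longrightarrow> f (edge k i t) = f (vtx k) + (f (vtx i) - f (vtx k)) * u t"
proof -
  have "conj_affine {k, i} f" by (rule conj_affine_subset[OF f]) (use I in auto)
  then obtain h h' where h: "face_homeo {k, i} h h'" "\<And>x. x \<in> splx {k, i} \<Longrightarrow> f x = lin {k, i} (\<lambda>i. f (vtx i)) (h' x)"
    using conj_affineE2 by blast
  define u where "u t = h' (edge k i t) i" for t
  have e: "edge k i t \<in> splx {k, i}" if "t \<in> {0..1}" for t by (rule edge_in_splx) (use that in auto)
  have he: "h' (edge k i t) \<in> splx {k, i}" if "t \<in> {0..1}" for t
    using face_homeoD(2)[OF h(1) order.refl e[OF that]] .
  have hk: "h' (edge k i t) k = 1 - u t" if "t \<in> {0..1}" for t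
    using splxD(3)[OF he[OF that]] I(4) by (simp add: u_def)
  have "continuous_on {0..1} (\<lambda>t. h' (edge k i t))"
    by (rule continuous_on_compose2[OF face_homeoD(6)[OF h(1)] continuous_on_edge]) (use e in auto)
  then have "continuous_on {0..1} u"
    unfolding u_def by (rule continuous_on_product_then_coordinatewise)
  moreover have "inj_on u {0..1}"
  proof (rule inj_onI)
    fix s t :: real assume st: "s \<in> {0..1}" "t \<in> {0..1}" "u s = u t"
    have "h' (edge k i s) l = h' (edge k i t) l" for l
    proof -
      consider "l = k" | "l = i" | "l \<notin> {k, i}" by blast
      then show ?thesis
      proof cases
        case 1
        then show ?thesis using hk[OF st(1)] hk[OF st(2)] st(3) by simp
      next
        case 2
        then show ?thesis using st(3) by (simp add: u_def)
      next
        case 3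
        then show ?thesis using splxD(2)[OF he[OF st(1)] 3] splxD(2)[OF he[OF st(2)] 3] by simp
      qed
    qed
    then have "h' (edge k i s) = h' (edge k i t)" by blast
    then have "h (h' (edge k i s)) = h (h' (edge k i t))" by (rule arg_cong)
    then have "edge k i s = edge k i t"
      unfolding face_homeoD(4)[OF h(1) e[OF st(1)]] face_homeoD(4)[OF h(1) e[OF st(2)]] .
    then have "edge k i s i = edge k i t i" by (rule fun_cong)
    then show "s = t" using I(4) by (simp add: edge_def vtx_def)
  qed
  moreover have "u ` {0..1} \<subseteq> {0..1}"
    using splxD(1)[OF he] splx_le_1[OF he] by (auto simp: u_def)
  moreover have "u 0 = 0" "u 1 = 1"
    using face_homeo_vtx(2)[OF h(1)] I(4) by (simp_all add: u_def vtx_def)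
  moreover have "f (edge k i t) = f (vtx k) + (f (vtx i) - f (vtx k)) * u t" if "t \<in> {0..1}" for t
    using h(2)[OF e[OF that]] hk[OF that] I(4) by (simp add: lin_def algebra_simps u_def)
  ultimately show ?thesis using that by blast
qed

lemma conj_affine_edge_continuous:
  assumes "conj_affine I f" "finite I" "k \<in> I" "i \<in> I"
  shows "continuous_on {0..1} (\<lambda>t. f (edge k i t))"
  by (rule continuous_on_compose2[OF conj_affine_continuous[OF assms(1)] continuous_on_edge])
    (use assms edge_in_splx in auto)

lemma conj_affine_edge_ivt:
  assumes f: "conj_affine I f" "finite I" "k \<in> I" "i \<in> I" and c: "f (vtx k) \<le> c \<and> c \<le> f (vtx i) \<or> f (vtx i) \<le> c \<and> c \<le> f (vtx k)"
  obtains t where "t \<in> {0..1}" "f (edge k i t) = c"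
proof -
  have "connected ((\<lambda>t. f (edge k i t)) ` {0..1})"
    using conj_affine_edge_continuous[OF f] by (intro connected_continuous_image) auto
  moreover have "f (vtx k) \<in> (\<lambda>t. f (edge k i t)) ` {0..1}" "f (vtx i) \<in> (\<lambda>t. f (edge k i t)) ` {0..1}"
    by (force intro: image_eqI[of _ _ 0] image_eqI[of _ _ 1])+
  ultimately have "c \<in> (\<lambda>t. f (edge k i t)) ` {0..1}"
    using c by (meson connectedD_interval)
  with that show ?thesis by blast
qed

lemma conj_affine_bounds:
  assumes f: "conj_affine I f" "finite I" and x: "x \<in> splx I"
  obtains i j where "i \<in> I" "j \<in> I" "f (vtx i) \<le> f x" "f x \<le> f (vtx j)"
proof -
  obtain h h' where h: "face_homeo I h h'" "\<And>x. x \<in> splx I \<Longrightarrow> f x = lin I (\<lambda>i. f (vtx i)) (h' x)"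
    using conj_affineE2[OF f(1)] by blast
  have y: "h' x \<in> splx I" using face_homeoD(2)[OF h(1) order.refl x] .
  obtain l where l: "l \<in> I" "0 < h' x l" by (rule splx_support_ex[OF y])
  have "\<exists>i\<in>I. f (vtx i) \<le> f x"
  proof (rule ccontr)
    assume "\<not> ?thesis"
    then have "f x < lin I (\<lambda>i. f (vtx i)) (h' x)"
      using l by (intro lin_greater[OF y f(2), of _ _ l]) (auto simp: not_le less_imp_le)
    then show False using h(2)[OF x] by simp
  qed
  moreover have "\<exists>i\<in>I. f x \<le> f (vtx i)"
  proof (rule ccontr)
    assume "\<not> ?thesis"
    then have "lin I (\<lambda>i. f (vtx i)) (h' x) < f x"
      using l by (intro lin_less[OF y f(2), of _ _ l]) (auto simp: not_le less_imp_le)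
    then show False using h(2)[OF x] by simp
  qed
  ultimately show ?thesis using that by blast
qed

text \<open>Each value of \<open>f\<close> lies between the values at two vertices, hence between
  the value at \<open>k\<close> and that at some other vertex, and the edge joining these takes it.
  Thus a level function of a facet can be studied on its edges at \<open>k\<close>.\<close>

lemma conj_affine_reach_edge:
  assumes f: "conj_affine I f" "finite I" and k: "k \<in> I" "i0 \<in> I" "i0 \<noteq> k" and x: "x \<in> splx I"
  obtains i t where "i \<in> I" "i \<noteq> k" "t \<in> {0..1}" "f x = f (edge k i t)"
proof (cases "f x = f (vtx k)")
  case True
  then show ?thesis using that[of i0 0] k by simp
next
  case False
  obtain i j where ij: "i \<in> I" "j \<in> I" "f (vtx i) \<le> f x" "f x \<le> f (vtx j)" by (rule conj_affine_bounds[OF f x])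
  define l where "l = (if f x < f (vtx k) then i else j)"
  have "l \<in> I" "l \<noteq> k" "f (vtx k) \<le> f x \<and> f x \<le> f (vtx l) \<or> f (vtx l) \<le> f x \<and> f x \<le> f (vtx k)"
    using ij False by (auto simp: l_def)
  then show ?thesis using conj_affine_edge_ivt[OF f k(1), of l "f x"] that by metis
qed

text \<open>The facet opposite the vertex \<open>j\<close> of the simplex on \<open>insert k N\<close> carries the function \<open>f j\<close>;
  the facet opposite \<open>k\<close> is the missing one.\<close>

locale facets =
  fixes N :: "nat set" and k :: nat and f :: "nat \<Rightarrow> (nat \<Rightarrow> real) \<Rightarrow> real"
  assumes N: "finite N" "3 \<le> card N" and k: "k \<notin> N"
    and conj_affine_f: "j \<in> N \<Longrightarrow> conj_affine (insert k (N - {j})) (f j)"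
    and levels: "j \<in> N \<Longrightarrow> l \<in> N \<Longrightarrow> x \<in> splx (insert k (N - {j})) \<Longrightarrow> x \<in> splx (insert k (N - {l})) \<Longrightarrow>
      y \<in> splx (insert k (N - {j})) \<Longrightarrow> y \<in> splx (insert k (N - {l})) \<Longrightarrow> f j x = f j y \<longleftrightarrow> f l x = f l y"
begin

abbreviation I :: "nat \<Rightarrow> nat set" where "I j \<equiv> insert k (N - {j})"

text \<open>Any facet that contains both edges may decide, by \<open>edge_rel_iff\<close>, because
  two facets have the same levels on their common face.\<close>

definition edge_rel :: "nat \<Rightarrow> real \<Rightarrow> nat \<Rightarrow> real \<Rightarrow> bool" where
  "edge_rel a s b t \<longleftrightarrow> (\<exists>j\<in>N - {a, b}. f j (edge k a s) = f j (edge k b t))"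

lemma I_finite: "finite (I j)" using N by simp

lemma ex_other: obtains j where "j \<in> N" "j \<noteq> a" "j \<noteq> b"
proof -
  have "\<not> N \<subseteq> {a, b}"
  proof
    assume "N \<subseteq> {a, b}"
    then have "card N \<le> card {a, b}" by (intro card_mono) auto
    also have "\<dots> \<le> 2" by (simp add: card_insert_if)
    finally show False using N by simp
  qed
  with that show ?thesis by blast
qed

lemma edge_in: "i \<in> N \<Longrightarrow> i \<noteq> j \<Longrightarrow> t \<in> {0..1} \<Longrightarrow> edge k i t \<in> splx (I j)"
  by (rule edge_in_splx) (use N in auto)

lemma edge_rel_iff:
  assumes "a \<in> N" "b \<in> N" "j \<in> N" "j \<noteq> a" "j \<noteq> b" "s \<in> {0..1}" "t \<in> {0..1}"
  shows "edge_rel a s b t \<longleftrightarrow> f j (edge k a s) = f j (edge k b t)"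
proof
  assume "edge_rel a s b t"
  then obtain l where l: "l \<in> N" "l \<noteq> a" "l \<noteq> b" "f l (edge k a s) = f l (edge k b t)" by (auto simp: edge_rel_def)
  have "f j (edge k a s) = f j (edge k b t) \<longleftrightarrow> f l (edge k a s) = f l (edge k b t)"
    by (rule levels) (use assms l in \<open>auto intro!: edge_in\<close>)
  then show "f j (edge k a s) = f j (edge k b t)" using l by simp
qed (use assms in \<open>auto simp: edge_rel_def\<close>)

lemma edge_rel_sym: "edge_rel a s b t \<Longrightarrow> edge_rel b t a s"
  unfolding edge_rel_def by (metis insert_commute)

lemma edge_rel_refl: "edge_rel a s a s"
  using ex_other[of a a] unfolding edge_rel_def by (metis Diff_iff insert_iff singletonD)

text \<open>Three distinct edges are the only case of interest: if two of them coincide, one facet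
  contains them all, see \<open>edge_rel_trans\<close>.\<close>

definition edge_trans :: bool where
  "edge_trans \<longleftrightarrow> (\<forall>a\<in>N. \<forall>b\<in>N. \<forall>c\<in>N. \<forall>s\<in>{0..1}. \<forall>t\<in>{0..1}. \<forall>r\<in>{0..1}.
     a \<noteq> b \<and> b \<noteq> c \<and> a \<noteq> c \<and> edge_rel a s b t \<and> edge_rel b t c r \<longrightarrow> edge_rel a s c r)"

text \<open>Every level meets the facet opposite the \<open>j0\<close> below, so that \<open>f j0\<close> provides a common scale.\<close>

definition edge_dom :: bool where
  "edge_dom \<longleftrightarrow> (\<exists>j0\<in>N. \<exists>p\<in>N. j0 \<noteq> p \<and> (\<forall>t\<in>{0..1}. \<exists>s\<in>{0..1}. edge_rel j0 t p s))"

text \<open>Along a link the lifted horn stays in one leaf of the covering. This is why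
  \<open>glue\<close> also returns a chain of links between any two points with the same
  value.\<close>

definition link :: "((nat \<Rightarrow> real) \<times> (nat \<Rightarrow> real)) set" where
  "link = (\<Union>j\<in>N. {(x, y). x \<in> splx (I j) \<and> y \<in> splx (I j) \<and> f j x = f j y})"

lemma edge_rel_trans:
  assumes T: edge_trans and N': "a \<in> N" "b \<in> N" "c \<in> N" and t: "s \<in> {0..1}" "t \<in> {0..1}" "r \<in> {0..1}"
    and ab: "edge_rel a s b t" and bc: "edge_rel b t c r"
  shows "edge_rel a s c r"
proof (cases "a \<noteq> b \<and> b \<noteq> c \<and> a \<noteq> c")
  case True
  then show ?thesis using T assms unfolding edge_trans_def by blast
next
  case False
  obtain j where "j \<in> N" "j \<noteq> a" "j \<noteq> b" "j \<noteq> c"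
  proof (cases "a = b")
    case True
    then show ?thesis using ex_other[of b c] that by metis
  next
    case ab: False
    with False have "c = a \<or> c = b" by blast
    then show ?thesis using ex_other[of a b] that by metis
  qed
  then show ?thesis using edge_rel_iff[of a b j s t] edge_rel_iff[of b c j t r] edge_rel_iff[of a c j s r] N' t ab bc by simp
qed

text \<open>The common scale is that of \<open>f j0\<close>. It applies to all edges except the one
  to \<open>j0\<close>, which is not in that facet; the levels of this edge are borrowed from the
  edge to \<open>p\<close>. The result is the function \<open>\<alpha>\<close> on the edges. Any
  other point receives the value of an edge point on its level. Two facets containing the point give
  the same value, since it shares its level with an edge point inside their common face.\<close>

lemma glue:
  assumes T: edge_trans and D: edge_dom
  obtains \<phi> where "\<And>j. j \<in> N \<Longrightarrow> conj_affine (I j) \<phi>"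
    "\<And>j x y. j \<in> N \<Longrightarrow> x \<in> splx (I j) \<Longrightarrow> y \<in> splx (I j) \<Longrightarrow> \<phi> x = \<phi> y \<longleftrightarrow> f j x = f j y"
    "\<And>j l x y. j \<in> N \<Longrightarrow> l \<in> N \<Longrightarrow> x \<in> splx (I j) \<Longrightarrow> y \<in> splx (I l) \<Longrightarrow> \<phi> x = \<phi> y \<Longrightarrow> (x, y) \<in> link\<^sup>*"
proof -
  obtain j0 p where j0: "j0 \<in> N" "p \<in> N" "j0 \<noteq> p" and dom: "\<And>t. t \<in> {0..1} \<Longrightarrow> \<exists>s\<in>{0..1}. edge_rel j0 t p s"
    using D unfolding edge_dom_def by blast
  obtain S where S: "\<And>t. t \<in> {0..1} \<Longrightarrow> S t \<in> {0..1} \<and> edge_rel j0 t p (S t)" using dom by metis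
  define \<alpha> where "\<alpha> i t = (if i = j0 then f j0 (edge k p (S t)) else f j0 (edge k i t))" for i t
  have \<alpha>_rep: "\<exists>i'\<in>N. \<exists>t'\<in>{0..1}. i' \<noteq> j0 \<and> edge_rel i t i' t' \<and> \<alpha> i t = f j0 (edge k i' t')"
    if "i \<in> N" "t \<in> {0..1}" for i t
  proof (cases "i = j0")
    case True
    then show ?thesis
      using that S[OF that(2)] j0 by (intro bexI[of _ p] bexI[of _ "S t"]) (auto simp: \<alpha>_def)
  next
    case False
    then show ?thesis
      using that edge_rel_refl by (intro bexI[of _ i] bexI[of _ t]) (auto simp: \<alpha>_def)
  qed
  have \<alpha>_iff: "\<alpha> i s = \<alpha> l t \<longleftrightarrow> edge_rel i s l t" if il: "i \<in> N" "l \<in> N" and st: "s \<in> {0..1}" "t \<in> {0..1}" for i l s t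
  proof -
    obtain i' s' where i': "i' \<in> N" "s' \<in> {0..1}" "i' \<noteq> j0" "edge_rel i s i' s'" "\<alpha> i s = f j0 (edge k i' s')"
      using \<alpha>_rep[OF il(1) st(1)] by blast
    obtain l' t' where l': "l' \<in> N" "t' \<in> {0..1}" "l' \<noteq> j0" "edge_rel l t l' t'" "\<alpha> l t = f j0 (edge k l' t')"
      using \<alpha>_rep[OF il(2) st(2)] by blast
    have "\<alpha> i s = \<alpha> l t \<longleftrightarrow> edge_rel i' s' l' t'"
      using edge_rel_iff[of i' l' j0 s' t'] i' l' j0 by auto
    also have "\<dots> \<longleftrightarrow> edge_rel i s l t"
    proof
      assume "edge_rel i' s' l' t'"
      then have "edge_rel i s l' t'" using edge_rel_trans[OF T il(1) i'(1) l'(1) st(1) i'(2) l'(2) i'(4)] by blast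
      then show "edge_rel i s l t" using edge_rel_trans[OF T il(1) l'(1) il(2) st(1) l'(2) st(2)] edge_rel_sym[OF l'(4)] by blast
    next
      assume "edge_rel i s l t"
      then have "edge_rel i' s' l t" using edge_rel_trans[OF T i'(1) il(1) il(2) i'(2) st] edge_rel_sym[OF i'(4)] by blast
      then show "edge_rel i' s' l' t'" using edge_rel_trans[OF T i'(1) il(2) l'(1) i'(2) st(2) l'(2)] l'(4) by blast
    qed
    finally show ?thesis .
  qed
  have \<alpha>_cont: "continuous_on {0..1} (\<alpha> i)" if i: "i \<in> N" for i
  proof (cases "i = j0")
    case False
    then have "continuous_on {0..1} (\<lambda>t. f j0 (edge k i t))"
      using i by (intro conj_affine_edge_continuous[OF conj_affine_f[OF j0(1)] I_finite]) auto
    then show ?thesis using False by (simp add: \<alpha>_def[abs_def])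
  next
    case True
    \<comment> \<open>The map \<open>S\<close> was chosen pointwise and need not be continuous. A
      third facet, opposite \<open>j\<close>, contains the edges to \<open>j0\<close> and to
      \<open>p\<close>; there \<open>\<rho>\<close> converts the scale of \<open>f j\<close> along
      the edge to \<open>p\<close> into that of \<open>f j0\<close>, and this conversion is
      continuous.\<close>
    obtain j where j: "j \<in> N" "j \<noteq> j0" "j \<noteq> p" by (rule ex_other)
    let ?g = "\<lambda>t. f j (edge k p t)"
    define \<rho> where "\<rho> c = f j0 (edge k p (SOME s. s \<in> {0..1} \<and> ?g s = c))" for c
    have \<rho>g: "\<rho> (?g s) = f j0 (edge k p s)" if s: "s \<in> {0..1}" for s
    proof -
      define s' where "s' = (SOME r. r \<in> {0..1} \<and> ?g r = ?g s)"
      have s': "s' \<in> {0..1}" "?g s' = ?g s" using someI[of "\<lambda>r. r \<in> {0..1} \<and> ?g r = ?g s" s] s by (auto simp: s'_def)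
      then have "edge_rel p s' p s" using edge_rel_iff[of p p j s' s] j j0 s by simp
      then have "f j0 (edge k p s') = f j0 (edge k p s)" using edge_rel_iff[of p p j0 s' s] j0 s s'(1) by simp
      then show ?thesis by (simp add: \<rho>_def s'_def)
    qed
    have gc: "continuous_on {0..1} ?g"
      using j0 j by (intro conj_affine_edge_continuous[OF conj_affine_f[OF j(1)] I_finite]) auto
    have "continuous_on {0..1} (\<lambda>t. f j0 (edge k p t))"
      using j0 by (intro conj_affine_edge_continuous[OF conj_affine_f[OF j0(1)] I_finite]) auto
    then have "continuous_on {0..1} (\<lambda>t. \<rho> (?g t))" by (rule continuous_on_eq) (simp add: \<rho>g)
    then have \<rho>c: "continuous_on (?g ` {0..1}) \<rho>" by (intro continuous_on_factor gc) auto
    have gS: "f j (edge k j0 t) = ?g (S t)" if "t \<in> {0..1}" for t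
      using edge_rel_iff[of j0 p j t "S t"] S[OF that] j j0 that by simp
    have "continuous_on {0..1} (\<lambda>t. f j (edge k j0 t))"
      using j0 j by (intro conj_affine_edge_continuous[OF conj_affine_f[OF j(1)] I_finite]) auto
    then have "continuous_on {0..1} (\<lambda>t. \<rho> (f j (edge k j0 t)))"
      by (rule continuous_on_compose2[OF \<rho>c]) (use gS S in auto)
    moreover have "\<rho> (f j (edge k j0 t)) = \<alpha> i t" if "t \<in> {0..1}" for t
      using gS[OF that] \<rho>g[of "S t"] S[OF that] True by (simp add: \<alpha>_def)
    ultimately show ?thesis by (rule continuous_on_eq)
  qed
  define P where "P x v \<longleftrightarrow> (\<exists>j\<in>N. \<exists>i\<in>N. \<exists>t\<in>{0..1}. i \<noteq> j \<and> x \<in> splx (I j) \<and> f j x = f j (edge k i t) \<and> v = \<alpha> i t)" for x v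
  have reach: "\<exists>i\<in>N. \<exists>t\<in>{0..1}. i \<noteq> j \<and> i \<noteq> l \<and> f j x = f j (edge k i t)"
    if "j \<in> N" "l \<in> N" "x \<in> splx (I j)" "x \<in> splx (I l)" for j l x
  proof -
    have eq: "I j \<inter> I l = insert k (N - {j, l})" by auto
    have x: "x \<in> splx (insert k (N - {j, l}))"
      using splx_Int[OF I_finite[of j] I_finite[of l]] that eq by auto
    have g: "conj_affine (insert k (N - {j, l})) (f j)"
      by (rule conj_affine_subset[OF conj_affine_f[OF that(1)]]) (use N in auto)
    obtain i0 where "i0 \<in> N" "i0 \<noteq> j" "i0 \<noteq> l" by (rule ex_other)
    then have i0: "i0 \<in> insert k (N - {j, l})" "i0 \<noteq> k" using k by auto
    have "finite (insert k (N - {j, l}))" using N by simp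
    from conj_affine_reach_edge[OF g this insertI1 i0 x] show ?thesis by blast
  qed
  have link_rel: "edge_rel i t i' t'"
    if jl: "j \<in> N" "l \<in> N" "x \<in> splx (I j)" "x \<in> splx (I l)" and i: "i \<in> N" "t \<in> {0..1}" "i \<noteq> j" "f j x = f j (edge k i t)"
      and i': "i' \<in> N" "t' \<in> {0..1}" "i' \<noteq> l" "f l x = f l (edge k i' t')" for j l x i t i' t'
  proof -
    obtain m s where m: "m \<in> N" "s \<in> {0..1}" "m \<noteq> j" "m \<noteq> l" "f j x = f j (edge k m s)" using reach[OF jl] by blast
    have "f l x = f l (edge k m s)"
      using levels[OF jl, of "edge k m s"] m edge_in by blast
    then have "edge_rel i t m s" "edge_rel m s i' t'"
      using edge_rel_iff[of i m j t s] edge_rel_iff[of m i' l s t'] m i i' jl(1,2) by auto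
    then show ?thesis using edge_rel_trans[OF T i(1) m(1) i'(1) i(2) m(2) i'(2)] by blast
  qed
  have P_unique: "v = w" if "P x v" "P x w" for x v w
  proof -
    obtain j i t where 1: "j \<in> N" "i \<in> N" "t \<in> {0..1}" "i \<noteq> j" "x \<in> splx (I j)" "f j x = f j (edge k i t)" "v = \<alpha> i t"
      using \<open>P x v\<close> unfolding P_def by blast
    obtain l i' t' where 2: "l \<in> N" "i' \<in> N" "t' \<in> {0..1}" "i' \<noteq> l" "x \<in> splx (I l)" "f l x = f l (edge k i' t')" "w = \<alpha> i' t'"
      using \<open>P x w\<close> unfolding P_def by blast
    have "edge_rel i t i' t'" by (rule link_rel[of j l x]) (use 1 2 in auto)
    then show ?thesis using \<alpha>_iff 1 2 by simp
  qed
  define \<phi> where "\<phi> x = (THE v. P x v)" for x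
  have \<phi>_eq: "\<phi> x = \<alpha> i t" if "j \<in> N" "i \<in> N" "t \<in> {0..1}" "i \<noteq> j" "x \<in> splx (I j)" "f j x = f j (edge k i t)" for j i t x
  proof -
    have "P x (\<alpha> i t)" unfolding P_def using that by blast
    then show ?thesis unfolding \<phi>_def using P_unique by blast
  qed
  have rep: "\<exists>i\<in>N. \<exists>t\<in>{0..1}. i \<noteq> j \<and> f j x = f j (edge k i t) \<and> \<phi> x = \<alpha> i t" if "j \<in> N" "x \<in> splx (I j)" for j x
    using reach[OF that(1,1) that(2,2)] \<phi>_eq[OF that(1) _ _ _ that(2)] by blast
  have lev: "\<phi> x = \<phi> y \<longleftrightarrow> f j x = f j y" if j: "j \<in> N" and x: "x \<in> splx (I j)" and y: "y \<in> splx (I j)" for j x y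
  proof -
    obtain i s where i: "i \<in> N" "s \<in> {0..1}" "i \<noteq> j" "f j x = f j (edge k i s)" "\<phi> x = \<alpha> i s" using rep[OF j x] by blast
    obtain l t where l: "l \<in> N" "t \<in> {0..1}" "l \<noteq> j" "f j y = f j (edge k l t)" "\<phi> y = \<alpha> l t" using rep[OF j y] by blast
    show ?thesis using \<alpha>_iff[OF i(1) l(1) i(2) l(2)] edge_rel_iff[of i l j s t] i l j by auto
  qed
  have conj_affine_\<phi>: "conj_affine (I j) \<phi>" if j: "j \<in> N" for j
  proof -
    define \<rho> where "\<rho> c = \<phi> (SOME x. x \<in> splx (I j) \<and> f j x = c)" for c
    have \<rho>: "\<rho> (f j x) = \<phi> x" if x: "x \<in> splx (I j)" for x
      using someI[of "\<lambda>z. z \<in> splx (I j) \<and> f j z = f j x" x] x lev[OF j _ x] unfolding \<rho>_def by auto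
    \<comment> \<open>The range of \<open>f j\<close> is a finite union of compact images of edges,
      and on each of them the conversion \<open>\<rho>\<close> is known through
      \<open>\<alpha>\<close>.\<close>
    have fim: "f j ` splx (I j) = (\<Union>i\<in>N - {j}. (\<lambda>t. f j (edge k i t)) ` {0..1})"
    proof
      show "f j ` splx (I j) \<subseteq> (\<Union>i\<in>N - {j}. (\<lambda>t. f j (edge k i t)) ` {0..1})"
        using rep[OF j] by (auto simp: image_iff) blast
      show "(\<Union>i\<in>N - {j}. (\<lambda>t. f j (edge k i t)) ` {0..1}) \<subseteq> f j ` splx (I j)"
        using edge_in[of _ j] by auto
    qed
    have "continuous_on (f j ` splx (I j)) \<rho>"
      unfolding fim
    proof (rule continuous_on_closed_Union)
      fix i assume i: "i \<in> N - {j}"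
      have gc: "continuous_on {0..1} (\<lambda>t. f j (edge k i t))"
        using i by (intro conj_affine_edge_continuous[OF conj_affine_f[OF j] I_finite]) auto
      then show "closed ((\<lambda>t. f j (edge k i t)) ` {0..1})"
        by (intro compact_imp_closed compact_continuous_image) auto
      have \<rho>\<alpha>: "\<rho> (f j (edge k i t)) = \<alpha> i t" if t: "t \<in> {0..1}" for t
        using \<rho>[of "edge k i t"] \<phi>_eq[OF j _ t, of i "edge k i t"] edge_in[of i j t] i t by simp
      have "continuous_on {0..1} (\<alpha> i)" using \<alpha>_cont[of i] i by blast
      then have "continuous_on {0..1} (\<lambda>t. \<rho> (f j (edge k i t)))"
        by (rule continuous_on_eq) (simp add: \<rho>\<alpha>)
      then show "continuous_on ((\<lambda>t. f j (edge k i t)) ` {0..1}) \<rho>" by (intro continuous_on_factor gc) auto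
    qed (use N in auto)
    moreover have "inj_on \<rho> (f j ` splx (I j))" by (rule inj_onI) (auto simp: \<rho> lev[OF j])
    ultimately have "conj_affine (I j) (\<lambda>x. \<rho> (f j x))" by (intro conj_affine_comp[OF conj_affine_f[OF j] I_finite])
    then show ?thesis by (rule conj_affine_cong[OF _ I_finite]) (simp add: \<rho>)
  qed
  have "(x, y) \<in> link\<^sup>*"
    if j: "j \<in> N" and l: "l \<in> N" and x: "x \<in> splx (I j)" and y: "y \<in> splx (I l)" and eq: "\<phi> x = \<phi> y" for j l x y
  proof -
    obtain i s where i: "i \<in> N" "s \<in> {0..1}" "i \<noteq> j" "f j x = f j (edge k i s)" "\<phi> x = \<alpha> i s" using rep[OF j x] by blast
    obtain m t where m: "m \<in> N" "t \<in> {0..1}" "m \<noteq> l" "f l y = f l (edge k m t)" "\<phi> y = \<alpha> m t" using rep[OF l y] by blast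
    \<comment> \<open>Three links form the chain: to an edge inside facet \<open>j\<close>, across
      inside facet \<open>q\<close>, and away from an edge inside facet \<open>l\<close>.\<close>
    obtain q where q: "q \<in> N" "q \<noteq> i" "q \<noteq> m" by (rule ex_other)
    have "edge_rel i s m t" using \<alpha>_iff[OF i(1) m(1) i(2) m(2)] i(5) m(5) eq by simp
    then have "f q (edge k i s) = f q (edge k m t)" using edge_rel_iff[of i m q s t] q i m by simp
    moreover have "edge k i s \<in> splx (I q)" "edge k m t \<in> splx (I q)" "edge k i s \<in> splx (I j)" "edge k m t \<in> splx (I l)"
      using q(2,3) by (auto intro!: edge_in q(1) i(1,2,3) m(1,2,3))
    ultimately have "(edge k i s, edge k m t) \<in> link"
      unfolding link_def using q(1) by blast
    moreover have "(x, edge k i s) \<in> link"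
      unfolding link_def using j x i(4) \<open>edge k i s \<in> splx (I j)\<close> by blast
    moreover have "(edge k m t, y) \<in> link"
      unfolding link_def using l y m(4)[symmetric] \<open>edge k m t \<in> splx (I l)\<close> by blast
    ultimately show ?thesis by (meson converse_rtrancl_into_rtrancl r_into_rtrancl)
  qed
  then show ?thesis using that[OF conj_affine_\<phi> lev] by blast
qed

lemma edge_between:
  assumes j: "j \<in> N" "i \<in> N" "i \<noteq> j" and t: "t \<in> {0..1}"
  obtains u where "u \<in> {0..1}" "f j (edge k i t) = f j (vtx k) + (f j (vtx i) - f j (vtx k)) * u"
proof -
  have "k \<noteq> i" using j k by blast
  from conj_affine_on_edge[OF conj_affine_f[OF j(1)] I_finite _ _ this] j
  obtain v where v: "v ` {0..1} \<subseteq> {0..1}" "\<And>t. t \<in> {0..1} \<Longrightarrow> f j (edge k i t) = f j (vtx k) + (f j (vtx i) - f j (vtx k)) * v t"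
    by (metis Diff_iff insertCI singletonD)
  then show ?thesis using that[of "v t"] t by blast
qed

text \<open>If \<open>N\<close> has four elements, some facet contains any three given edges, and
  its level function gives transitivity.\<close>

lemma edge_trans_large:
  assumes "4 \<le> card N"
  shows edge_trans
  unfolding edge_trans_def
proof (intro ballI impI, elim conjE)
  fix a b c and s t r :: real
  assume N': "a \<in> N" "b \<in> N" "c \<in> N" and st: "s \<in> {0..1}" "t \<in> {0..1}" "r \<in> {0..1}"
    and ab: "edge_rel a s b t" and bc: "edge_rel b t c r"
  have "\<not> N \<subseteq> {a, b, c}"
  proof
    assume "N \<subseteq> {a, b, c}"
    then have "card N \<le> card {a, b, c}" by (intro card_mono) auto
    also have "\<dots> \<le> 3" by (simp add: card_insert_if)
    finally show False using assms by simp
  qed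
  then obtain j where "j \<in> N" "j \<noteq> a" "j \<noteq> b" "j \<noteq> c" by blast
  then show "edge_rel a s c r"
    using edge_rel_iff[of a b j s t] edge_rel_iff[of b c j t r] edge_rel_iff[of a c j s r] N' st ab bc by simp
qed

text \<open>Such an edge carries no level but that of the apex, and every other edge begins with
  it.\<close>

lemma edge_dom_const:
  assumes i: "i \<in> N" "j \<in> N" "j \<noteq> i" "f j (vtx i) = f j (vtx k)"
  shows edge_dom
proof -
  obtain p where p: "p \<in> N" "p \<noteq> i" by (rule ex_other)
  have "edge_rel i t p 0" if t: "t \<in> {0..1}" for t
  proof -
    obtain l where l: "l \<in> N" "l \<noteq> i" "l \<noteq> p" by (rule ex_other)
    obtain u where "f j (edge k i t) = f j (vtx k) + (f j (vtx i) - f j (vtx k)) * u"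
      using edge_between[OF i(2,1) i(3)[symmetric] t] by blast
    then have "f j (edge k i t) = f j (vtx k)" using i(4) by simp
    moreover have vI: "vtx k \<in> splx (I m)" for m using vtx_in_splx[OF I_finite] by simp
    moreover have "edge k i t \<in> splx (I j)" "edge k i t \<in> splx (I l)"
      using edge_in i l t by auto
    ultimately have "f l (edge k i t) = f l (vtx k)"
      using levels[OF i(2) l(1), of "edge k i t" "vtx k"] by simp
    then show ?thesis using edge_rel_iff[of i p l t 0] i p l t by simp
  qed
  then show ?thesis unfolding edge_dom_def using i(1) p by (metis atLeastAtMost_iff order.refl zero_le_one)
qed

text \<open>Of the two edges, the one whose end is closer to the level of the apex takes only values
  that the other one takes as well.\<close>

lemma edge_dom_same_side:
  assumes j: "j \<in> N" "a \<in> N" "b \<in> N" "j \<noteq> a" "j \<noteq> b" "a \<noteq> b"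
    and side: "f j (vtx a) < f j (vtx k) \<longleftrightarrow> f j (vtx b) < f j (vtx k)"
      "f j (vtx k) < f j (vtx a) \<longleftrightarrow> f j (vtx k) < f j (vtx b)"
  shows edge_dom
proof -
  have dom: edge_dom if ab: "a \<in> N" "b \<in> N" "j \<noteq> a" "j \<noteq> b" "a \<noteq> b"
    and btw: "f j (vtx k) \<le> f j (vtx a) \<and> f j (vtx a) \<le> f j (vtx b) \<or> f j (vtx b) \<le> f j (vtx a) \<and> f j (vtx a) \<le> f j (vtx k)" for a b
  proof -
    have "\<exists>s\<in>{0..1}. edge_rel a t b s" if t: "t \<in> {0..1}" for t
    proof -
      obtain u where u: "u \<in> {0..1}" "f j (edge k a t) = f j (vtx k) + (f j (vtx a) - f j (vtx k)) * u"
        using edge_between[OF j(1) ab(1) ab(3)[symmetric] t] by blast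
      have "f j (vtx k) \<le> f j (edge k a t) \<and> f j (edge k a t) \<le> f j (vtx b) \<or>
        f j (vtx b) \<le> f j (edge k a t) \<and> f j (edge k a t) \<le> f j (vtx k)"
      proof (cases "f j (vtx k) \<le> f j (vtx a) \<and> f j (vtx a) \<le> f j (vtx b)")
        case True
        then have "0 \<le> (f j (vtx a) - f j (vtx k)) * u" "(f j (vtx a) - f j (vtx k)) * u \<le> (f j (vtx a) - f j (vtx k)) * 1"
          using u(1) mult_left_mono[of u 1 "f j (vtx a) - f j (vtx k)"] by auto
        then show ?thesis using True u(2) by auto
      next
        case False
        then have *: "f j (vtx b) \<le> f j (vtx a)" "f j (vtx a) \<le> f j (vtx k)" using btw by auto
        then have "(f j (vtx a) - f j (vtx k)) * u \<le> 0" "(f j (vtx a) - f j (vtx k)) * 1 \<le> (f j (vtx a) - f j (vtx k)) * u"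
          using u(1) mult_left_mono_neg[of u 1 "f j (vtx a) - f j (vtx k)"] by (auto intro!: mult_nonpos_nonneg)
        then show ?thesis using * u(2) by auto
      qed
      then obtain s where s: "s \<in> {0..1}" "f j (edge k b s) = f j (edge k a t)"
        using conj_affine_edge_ivt[OF conj_affine_f[OF j(1)] I_finite, of k b "f j (edge k a t)"] ab by auto
      then show ?thesis using edge_rel_iff[of a b j t s] ab j(1) t by auto
    qed
    then show ?thesis unfolding edge_dom_def using ab by blast
  qed
  show ?thesis
  proof (cases "f j (vtx k) < f j (vtx a)")
    case True
    then show ?thesis using dom[of a b] dom[of b a] j side by linarith
  next
    case False
    then show ?thesis using dom[of a b] dom[of b a] j side by linarith
  qed
qed

text \<open>The facet opposite \<open>j\<close> contains three edges, and the level of the apex has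
  only two sides; an edge that leads to neither side is constant.\<close>

lemma edge_dom_large:
  assumes "4 \<le> card N"
  shows edge_dom
proof -
  obtain A where A: "A \<subseteq> N" "card A = 4" using obtain_subset_with_card_n[OF assms] by metis
  then have "card A = Suc (Suc (Suc (Suc 0)))" by simp
  then obtain a b c j where abc: "a \<in> N" "b \<in> N" "c \<in> N" "j \<in> N" "a \<noteq> b" "b \<noteq> c" "a \<noteq> c" "j \<noteq> a" "j \<noteq> b" "j \<noteq> c"
    using A(1) unfolding card_Suc_eq by blast
  show ?thesis
    using edge_dom_const[OF abc(1,4,8)] edge_dom_const[OF abc(2,4,9)] edge_dom_const[OF abc(3,4,10)]
      edge_dom_same_side[OF abc(4,1,2,8,9,5)] edge_dom_same_side[OF abc(4,2,3,9,10,6)] edge_dom_same_side[OF abc(4,1,3,8,10,7)]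
    by linarith
qed

end


section \<open>Coverings and fibrations\<close>

lemma covering_mapD:
  assumes "covering_map E B p"
  shows "continuous_map E B p" "p ` topspace E = topspace B"
  using assms by (auto simp: covering_map_def)

definition evenly :: "'c topology \<Rightarrow> 'a topology \<Rightarrow> ('c \<Rightarrow> 'a) \<Rightarrow> 'a set \<Rightarrow> 'c set set \<Rightarrow> bool" where
  "evenly E B p T \<V> \<longleftrightarrow> openin B T \<and> \<Union>\<V> = {e \<in> topspace E. p e \<in> T} \<and> (\<forall>V\<in>\<V>. openin E V) \<and>
     pairwise disjnt \<V> \<and> (\<forall>V\<in>\<V>. homeomorphic_map (subtopology E V) (subtopology B T) p)"

lemma covering_even:
  assumes "covering_map E B p" "b \<in> topspace B"
  obtains T \<V> where "b \<in> T" "evenly E B p T \<V>"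
  using assms unfolding covering_map_def evenly_def by blast

lemma evenlyD:
  assumes "evenly E B p T \<V>"
  shows "openin B T" "\<Union>\<V> = {e \<in> topspace E. p e \<in> T}" "V \<in> \<V> \<Longrightarrow> openin E V" "pairwise disjnt \<V>"
    "V \<in> \<V> \<Longrightarrow> homeomorphic_map (subtopology E V) (subtopology B T) p"
  using assms by (auto simp: evenly_def)

lemma covering_sheet:
  assumes cov: "covering_map E B p" and e: "e \<in> topspace E"
  obtains T V r where "openin B T" "openin E V" "e \<in> V"
    "continuous_map (subtopology B T) E r" "\<And>y. y \<in> T \<Longrightarrow> r y \<in> V \<and> p (r y) = y"
    "\<And>v. v \<in> V \<Longrightarrow> p v \<in> T \<and> r (p v) = v"
proof -
  have "p e \<in> topspace B" using covering_mapD[OF cov] e by blast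
  then obtain T \<V> where pT: "p e \<in> T" and ev: "evenly E B p T \<V>"
    by (rule covering_even[OF cov])
  note T = pT evenlyD(1,2)[OF ev] and \<V> = evenlyD(3-5)[OF ev]
  then obtain V where V: "V \<in> \<V>" "e \<in> V" using e by blast
  obtain r where r: "homeomorphic_maps (subtopology E V) (subtopology B T) p r"
    using \<V>(3)[OF V(1)] homeomorphic_map_maps by blast
  have tV: "topspace (subtopology E V) = V" and tT: "topspace (subtopology B T) = T"
    using openin_subset[OF \<V>(1)[OF V(1)]] openin_subset[OF T(2)] by auto
  have "continuous_map (subtopology B T) E r"
    using r by (simp add: homeomorphic_maps_def continuous_map_in_subtopology)
  moreover have "r y \<in> V \<and> p (r y) = y" if "y \<in> T" for y
    using r that tV tT unfolding homeomorphic_maps_def continuous_map_def by auto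
  moreover have "p v \<in> T \<and> r (p v) = v" if "v \<in> V" for v
    using r that tV tT unfolding homeomorphic_maps_def continuous_map_def by auto
  ultimately show ?thesis using that T(2) \<V>(1)[OF V(1)] V(2) by blast
qed

lemma covering_lift_unique:
  assumes cov: "covering_map E B p" and Y: "connected_space Y"
    and f: "continuous_map Y E f" and g: "continuous_map Y E g"
    and pfg: "\<And>y. y \<in> topspace Y \<Longrightarrow> p (f y) = p (g y)"
    and y0: "y0 \<in> topspace Y" "f y0 = g y0" and y: "y \<in> topspace Y"
  shows "f y = g y"
proof -
  let ?A = "{y \<in> topspace Y. f y = g y}"
  have nbhd: "\<exists>W. openin Y W \<and> y \<in> W \<and> (if f y = g y then W \<subseteq> ?A else W \<inter> ?A = {})"
    if y: "y \<in> topspace Y" for y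
  proof -
    have fy: "f y \<in> topspace E" "g y \<in> topspace E"
      using continuous_map_image_subset_topspace[OF f] continuous_map_image_subset_topspace[OF g] y by blast+
    then have "p (f y) \<in> topspace B" using covering_mapD[OF cov] by blast
    then obtain T \<V> where pT: "p (f y) \<in> T" and ev: "evenly E B p T \<V>"
      by (rule covering_even[OF cov])
    note T = pT evenlyD(1,2)[OF ev] and \<V> = evenlyD(3-5)[OF ev]
    obtain V where V: "V \<in> \<V>" "f y \<in> V" using T fy by blast
    obtain W where W: "W \<in> \<V>" "g y \<in> W" using T fy pfg[OF y] by (metis (mono_tags, lifting) UnionE mem_Collect_eq)
    have inj: "inj_on p V"
      using homeomorphic_imp_injective_map[OF \<V>(3)[OF V(1)]] openin_subset[OF \<V>(1)[OF V(1)]] by (simp add: inf.absorb2)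
    define O' where "O' = {z \<in> topspace Y. f z \<in> V} \<inter> {z \<in> topspace Y. g z \<in> W}"
    have "openin Y O'"
      unfolding O'_def by (intro openin_Int openin_continuous_map_preimage[OF f] openin_continuous_map_preimage[OF g] \<V>(1) V W)
    moreover have "y \<in> O'" using y V W by (simp add: O'_def)
    moreover have "if f y = g y then O' \<subseteq> ?A else O' \<inter> ?A = {}"
    proof (cases "V = W")
      case True
      then have "O' \<subseteq> ?A" using inj pfg unfolding O'_def inj_on_def by blast
      then show ?thesis using \<open>y \<in> O'\<close> by auto
    next
      case False
      then have "V \<inter> W = {}" using \<V>(2) V W by (auto simp: pairwise_def disjnt_def)
      then show ?thesis using V W unfolding O'_def by auto
    qed
    ultimately show ?thesis by blast
  qed
  have "openin Y ?A"
  proof (subst openin_subopen, intro ballI)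
    fix y assume "y \<in> ?A"
    then show "\<exists>W. openin Y W \<and> y \<in> W \<and> W \<subseteq> ?A" using nbhd[of y] by auto
  qed
  moreover have "openin Y (topspace Y - ?A)"
  proof (subst openin_subopen, intro ballI)
    fix y assume y: "y \<in> topspace Y - ?A"
    then obtain W where W: "openin Y W" "y \<in> W" "W \<inter> ?A = {}" using nbhd[of y] by auto
    moreover have "W \<subseteq> topspace Y" using openin_subset[OF W(1)] .
    ultimately show "\<exists>W. openin Y W \<and> y \<in> W \<and> W \<subseteq> topspace Y - ?A" by blast
  qed
  ultimately have "?A = {} \<or> ?A = topspace Y"
    using Y unfolding connected_space_clopen_in closedin_def by blast
  with y0 y show ?thesis by blast
qed

lemma continuous_map_split_real:
  assumes r: "continuous_map Y euclideanreal r"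
    and G: "continuous_map (subtopology Y {y. r y \<le> b}) E G"
    and H: "continuous_map (subtopology Y {y. b \<le> r y}) E H"
    and eq: "\<And>y. y \<in> topspace Y \<Longrightarrow> r y = b \<Longrightarrow> G y = H y"
  shows "continuous_map Y E (\<lambda>y. if r y \<le> b then G y else H y)"
proof -
  let ?T = "\<lambda>k. if k then {y \<in> topspace Y. r y \<in> {..b}} else {y \<in> topspace Y. r y \<in> {b..}}"
  show ?thesis
  proof (rule pasting_lemma_closed[of "{True, False}" _ ?T _ "\<lambda>k. if k then G else H"])
    show "closedin Y (?T k)" for k
      using closedin_continuous_map_preimage[OF r, of "{..b}"] closedin_continuous_map_preimage[OF r, of "{b..}"] by simp
    show "continuous_map (subtopology Y (?T k)) E (if k then G else H)" for k
      using continuous_map_from_subtopology_mono[OF G, of "?T k"] continuous_map_from_subtopology_mono[OF H, of "?T k"]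
      by (cases k) auto
    show "(if k then G else H) z = (if l then G else H) z"
      if "z \<in> topspace Y \<inter> ?T k \<inter> ?T l" for k l z
      using that eq[of z] by (auto split: if_splits)
    show "\<exists>k. k \<in> {True, False} \<and> z \<in> ?T k \<and> (if r z \<le> b then G z else H z) = (if k then G else H) z"
      if "z \<in> topspace Y" for z
      using that by (intro exI[of _ "r z \<le> b"]) auto
  qed simp
qed

lemma continuous_map_glue_real:
  fixes N :: "'x set"
  assumes G: "continuous_map (subtopology (prod_topology X euclideanreal) (N \<times> {a..b})) E G"
    and H: "continuous_map (subtopology (prod_topology X euclideanreal) (N \<times> {b..c})) E H"
    and eq: "\<And>x. x \<in> N \<Longrightarrow> x \<in> topspace X \<Longrightarrow> G (x, b) = H (x, b)"
  shows "continuous_map (subtopology (prod_topology X euclideanreal) (N \<times> {a..c})) E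
    (\<lambda>z. if snd z \<le> b then G z else H z)"
proof (rule continuous_map_split_real)
  show "continuous_map (subtopology (prod_topology X euclideanreal) (N \<times> {a..c})) euclideanreal snd"
    by (intro continuous_map_from_subtopology continuous_map_snd)
  show "continuous_map (subtopology (subtopology (prod_topology X euclideanreal) (N \<times> {a..c})) {y. snd y \<le> b}) E G"
    unfolding subtopology_subtopology by (rule continuous_map_from_subtopology_mono[OF G]) auto
  show "continuous_map (subtopology (subtopology (prod_topology X euclideanreal) (N \<times> {a..c})) {y. b \<le> snd y}) E H"
    unfolding subtopology_subtopology by (rule continuous_map_from_subtopology_mono[OF H]) auto
qed (use eq in auto)

text \<open>The interval is bisected until one evenly covered set suffices. \<open>Q\<close>
  quantifies over the initial data, so that the end of one lift can start the next while the
  neighbourhood of \<open>x0\<close> shrinks.\<close>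

lemma covering_lift_homotopy_local:
  assumes cov: "covering_map E B p" and F: "continuous_map (prod_topology X euclideanreal) B F"
    and x0: "x0 \<in> topspace X" and "a \<le> b"
    and N: "openin X N" "x0 \<in> N" and g: "continuous_map (subtopology X N) E g"
    and pg: "\<And>x. x \<in> N \<Longrightarrow> p (g x) = F (x, a)"
  shows "\<exists>N' G. openin X N' \<and> x0 \<in> N' \<and> N' \<subseteq> N \<and>
    continuous_map (subtopology (prod_topology X euclideanreal) (N' \<times> {a..b})) E G \<and>
    (\<forall>x\<in>N'. \<forall>t\<in>{a..b}. p (G (x, t)) = F (x, t)) \<and> (\<forall>x\<in>N'. G (x, a) = g x)"
proof -
  define Q where "Q a b \<longleftrightarrow> (\<forall>N g. openin X N \<and> x0 \<in> N \<and> continuous_map (subtopology X N) E g \<and>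
      (\<forall>x\<in>N. p (g x) = F (x, a)) \<longrightarrow>
    (\<exists>N' G. openin X N' \<and> x0 \<in> N' \<and> N' \<subseteq> N \<and>
      continuous_map (subtopology (prod_topology X euclideanreal) (N' \<times> {a..b})) E G \<and>
      (\<forall>x\<in>N'. \<forall>t\<in>{a..b}. p (G (x, t)) = F (x, t)) \<and> (\<forall>x\<in>N'. G (x, a) = g x)))" for a b
  have "Q a b"
    using \<open>a \<le> b\<close>
  proof (induction rule: Bolzano)
    case (trans a b c)
    show ?case
      unfolding Q_def
    proof (intro allI impI, elim conjE)
      fix N g assume "openin X N" "x0 \<in> N" "continuous_map (subtopology X N) E g" "\<forall>x\<in>N. p (g x) = F (x, a)"
      then have *: "openin X N \<and> x0 \<in> N \<and> continuous_map (subtopology X N) E g \<and> (\<forall>x\<in>N. p (g x) = F (x, a))"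
        by blast
      from trans(1)[unfolded Q_def, THEN spec, THEN spec, THEN mp, OF *] obtain N1 G1 where 1: "openin X N1" "x0 \<in> N1" "N1 \<subseteq> N"
        "continuous_map (subtopology (prod_topology X euclideanreal) (N1 \<times> {a..b})) E G1"
        "\<forall>x\<in>N1. \<forall>t\<in>{a..b}. p (G1 (x, t)) = F (x, t)" "\<forall>x\<in>N1. G1 (x, a) = g x"
        by blast
      have "continuous_map (subtopology X N1) E (\<lambda>x. G1 (x, b))"
      proof -
        have "continuous_map (subtopology X N1) (prod_topology X euclideanreal) (\<lambda>x. (x, b))"
          by (intro continuous_map_pairedI continuous_map_from_subtopology) auto
        then have "continuous_map (subtopology X N1) (subtopology (prod_topology X euclideanreal) (N1 \<times> {a..b})) (\<lambda>x. (x, b))"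
          using trans(3) by (auto simp: continuous_map_in_subtopology)
        from continuous_map_compose[OF this 1(4)] show ?thesis by (simp add: o_def)
      qed
      moreover have "\<forall>x\<in>N1. p (G1 (x, b)) = F (x, b)" using 1(5) trans(3) by simp
      ultimately have *: "openin X N1 \<and> x0 \<in> N1 \<and> continuous_map (subtopology X N1) E (\<lambda>x. G1 (x, b)) \<and>
        (\<forall>x\<in>N1. p (G1 (x, b)) = F (x, b))" using 1 by blast
      from trans(2)[unfolded Q_def, THEN spec, THEN spec, THEN mp, OF *] obtain N2 G2 where 2: "openin X N2" "x0 \<in> N2" "N2 \<subseteq> N1"
        "continuous_map (subtopology (prod_topology X euclideanreal) (N2 \<times> {b..c})) E G2"
        "\<forall>x\<in>N2. \<forall>t\<in>{b..c}. p (G2 (x, t)) = F (x, t)" "\<forall>x\<in>N2. G2 (x, b) = G1 (x, b)"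
        by blast
      have G1: "continuous_map (subtopology (prod_topology X euclideanreal) (N2 \<times> {a..b})) E G1"
        by (rule continuous_map_from_subtopology_mono[OF 1(4)]) (use 2 in auto)
      have "continuous_map (subtopology (prod_topology X euclideanreal) (N2 \<times> {a..c})) E (\<lambda>z. if snd z \<le> b then G1 z else G2 z)"
        by (rule continuous_map_glue_real[OF G1 2(4)]) (use 2 trans in auto)
      then show "\<exists>N' G. openin X N' \<and> x0 \<in> N' \<and> N' \<subseteq> N \<and>
        continuous_map (subtopology (prod_topology X euclideanreal) (N' \<times> {a..c})) E G \<and>
        (\<forall>x\<in>N'. \<forall>t\<in>{a..c}. p (G (x, t)) = F (x, t)) \<and> (\<forall>x\<in>N'. G (x, a) = g x)"
        using 1 2 trans by (intro exI[of _ N2] exI[of _ "\<lambda>z. if snd z \<le> b then G1 z else G2 z"]) (auto simp: subset_iff)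
    qed
  next
    case (local s)
    have "F (x0, s) \<in> topspace B"
      using continuous_map_image_subset_topspace[OF F] x0 by force
    then obtain T \<V> where pT: "F (x0, s) \<in> T" and ev: "evenly E B p T \<V>"
      by (rule covering_even[OF cov])
    note T = pT evenlyD(1,2)[OF ev] and \<V> = evenlyD(3-5)[OF ev]
    have "openin (prod_topology X euclideanreal) {z \<in> topspace (prod_topology X euclideanreal). F z \<in> T}"
      by (rule openin_continuous_map_preimage[OF F T(2)])
    moreover have "(x0, s) \<in> {z \<in> topspace (prod_topology X euclideanreal). F z \<in> T}"
      using x0 T by simp
    ultimately have "\<exists>N0 U. openin X N0 \<and> openin euclideanreal U \<and> x0 \<in> N0 \<and> s \<in> U \<and>
      N0 \<times> U \<subseteq> {z \<in> topspace (prod_topology X euclideanreal). F z \<in> T}"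
      unfolding openin_prod_topology_alt by blast
    then obtain N0 U where NU: "openin X N0" "open U" "x0 \<in> N0" "s \<in> U"
      "N0 \<times> U \<subseteq> {z \<in> topspace (prod_topology X euclideanreal). F z \<in> T}"
      by auto
    then obtain d where d: "0 < d" "\<And>t. \<bar>t - s\<bar> < d \<Longrightarrow> t \<in> U"
      unfolding open_dist by (metis dist_real_def)
    have "Q a b" if ab: "a \<le> s" "s \<le> b" "b - a < d" for a b
      unfolding Q_def
    proof (intro allI impI, elim conjE)
      fix N g assume N: "openin X N" "x0 \<in> N" and g: "continuous_map (subtopology X N) E g" and pg: "\<forall>x\<in>N. p (g x) = F (x, a)"
      have FT: "F (x, t) \<in> T" if "x \<in> N0" "t \<in> {a..b}" for x t
      proof -
        have "\<bar>t - s\<bar> < d" using that(2) ab by auto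
        then show ?thesis using that(1) d(2)[of t] NU(5) by blast
      qed
      have NX: "N \<subseteq> topspace X" using openin_subset[OF N(1)] .
      have "g x0 \<in> topspace E"
        using continuous_map_image_subset_topspace[OF g] N(2) NX by auto
      moreover have "p (g x0) \<in> T" using pg N FT[OF NU(3), of a] ab by auto
      ultimately obtain V where V: "V \<in> \<V>" "g x0 \<in> V" using T(3) by blast
      obtain r where r: "homeomorphic_maps (subtopology E V) (subtopology B T) p r"
        using \<V>(3)[OF V(1)] homeomorphic_map_maps by blast
      have tV: "topspace (subtopology E V) = V" and tT: "topspace (subtopology B T) = T"
        using openin_subset[OF \<V>(1)[OF V(1)]] openin_subset[OF T(2)] by auto
      have rc: "continuous_map (subtopology B T) E r"
        using r by (simp add: homeomorphic_maps_def continuous_map_in_subtopology)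
      have pr: "p (r y) = y" if "y \<in> T" for y
        using r that tT unfolding homeomorphic_maps_def by auto
      have rp: "r (p v) = v" if "v \<in> V" for v
        using r that tV unfolding homeomorphic_maps_def by auto
      define N' where "N' = {x \<in> N. g x \<in> V} \<inter> N0"
      have "openin (subtopology X N) {x \<in> topspace (subtopology X N). g x \<in> V}"
        by (rule openin_continuous_map_preimage[OF g \<V>(1)[OF V(1)]])
      moreover have tN: "topspace (subtopology X N) = N" using NX by auto
      ultimately have "openin X {x \<in> N. g x \<in> V}"
        using N(1) unfolding tN by (simp add: openin_open_subtopology)
      then have "openin X N'" unfolding N'_def using NU(1) by blast
      moreover have "x0 \<in> N'" "N' \<subseteq> N" using N V NU by (auto simp: N'_def)
      moreover have "continuous_map (subtopology (prod_topology X euclideanreal) (N' \<times> {a..b})) E (r \<circ> F)"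
      proof (rule continuous_map_compose[OF _ rc])
        show "continuous_map (subtopology (prod_topology X euclideanreal) (N' \<times> {a..b})) (subtopology B T) F"
          unfolding continuous_map_in_subtopology
          using continuous_map_from_subtopology[OF F] FT by (auto simp: N'_def)
      qed
      moreover have "\<forall>x\<in>N'. \<forall>t\<in>{a..b}. p ((r \<circ> F) (x, t)) = F (x, t)"
        using FT pr by (simp add: N'_def)
      moreover have "\<forall>x\<in>N'. (r \<circ> F) (x, a) = g x"
        using pg rp by (auto simp: N'_def) (metis pg)
      ultimately show "\<exists>N' G. openin X N' \<and> x0 \<in> N' \<and> N' \<subseteq> N \<and>
        continuous_map (subtopology (prod_topology X euclideanreal) (N' \<times> {a..b})) E G \<and>
        (\<forall>x\<in>N'. \<forall>t\<in>{a..b}. p (G (x, t)) = F (x, t)) \<and> (\<forall>x\<in>N'. G (x, a) = g x)"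
        by blast
    qed
    with d(1) show ?case by blast
  qed
  then show ?thesis unfolding Q_def using N g pg by blast
qed

text \<open>Two local lifts agree over a common point of \<open>X\<close>: the vertical segment is
  connected and both start with \<open>g\<close>. Hence they can be pasted.\<close>

lemma covering_lift_homotopy:
  assumes cov: "covering_map E B p" and F: "continuous_map (prod_topology X euclideanreal) B F"
    and g: "continuous_map X E g" and pg: "\<And>x. x \<in> topspace X \<Longrightarrow> p (g x) = F (x, 0)"
  obtains G where "continuous_map (subtopology (prod_topology X euclideanreal) (topspace X \<times> {0..1})) E G"
    "\<And>x t. x \<in> topspace X \<Longrightarrow> t \<in> {0..1} \<Longrightarrow> p (G (x, t)) = F (x, t)"
    "\<And>x. x \<in> topspace X \<Longrightarrow> G (x, 0) = g x"
proof -
  define P where "P x0 N G \<longleftrightarrow> openin X N \<and> x0 \<in> N \<and>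
    continuous_map (subtopology (prod_topology X euclideanreal) (N \<times> {0..1})) E G \<and>
    (\<forall>x\<in>N. \<forall>t\<in>{0..1}. p (G (x, t)) = F (x, t)) \<and> (\<forall>x\<in>N. G (x, 0) = g x)" for x0 N G
  have "\<exists>N G. P x0 N G" if x0: "x0 \<in> topspace X" for x0
  proof -
    have "continuous_map (subtopology X (topspace X)) E g" using g by simp
    from covering_lift_homotopy_local[OF cov F x0 zero_le_one openin_topspace x0 this pg]
    show ?thesis unfolding P_def by blast
  qed
  then obtain N G where P: "\<And>x. x \<in> topspace X \<Longrightarrow> P x (N x) (G x)"
    by metis
  then have N: "\<And>x. x \<in> topspace X \<Longrightarrow> openin X (N x)" "\<And>x. x \<in> topspace X \<Longrightarrow> x \<in> N x"
    and G: "\<And>x. x \<in> topspace X \<Longrightarrow> continuous_map (subtopology (prod_topology X euclideanreal) (N x \<times> {0..1})) E (G x)"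
    and pG: "\<And>x y t. x \<in> topspace X \<Longrightarrow> y \<in> N x \<Longrightarrow> t \<in> {0..1} \<Longrightarrow> p (G x (y, t)) = F (y, t)"
    and G0: "\<And>x y. x \<in> topspace X \<Longrightarrow> y \<in> N x \<Longrightarrow> G x (y, 0) = g y"
    using P by (simp_all add: P_def)
  have agree: "G x (z, t) = G y (z, t)"
    if "x \<in> topspace X" "y \<in> topspace X" "z \<in> N x" "z \<in> N y" "t \<in> {0..1}" for x y z t
  proof -
    have zX: "z \<in> topspace X" using openin_subset[OF N(1)[OF that(1)]] that by blast
    have c: "continuous_map (top_of_set {0..1}) E (\<lambda>t. G x (z, t))" if "x \<in> topspace X" "z \<in> N x" for x
    proof -
      have "continuous_map (top_of_set {0..1}) (prod_topology X euclideanreal) (\<lambda>t. (z, t))"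
        using zX by (intro continuous_map_pairedI) auto
      then have "continuous_map (top_of_set {0..1}) (subtopology (prod_topology X euclideanreal) (N x \<times> {0..1})) (\<lambda>t. (z, t))"
        using that by (auto simp: continuous_map_in_subtopology)
      from continuous_map_compose[OF this G[OF that(1)]] show ?thesis by (simp add: o_def)
    qed
    show ?thesis
      by (rule covering_lift_unique[OF cov _ c c, of x y 0])
        (use that pG G0 in \<open>auto simp: connected_space_subtopology\<close>)
  qed
  define H where "H z = G (fst z) z" for z
  have "continuous_map (subtopology (prod_topology X euclideanreal) (topspace X \<times> {0..1})) E H"
  proof (rule pasting_lemma[of "topspace X" _ "\<lambda>x. (topspace X \<times> {0..1}) \<inter> (N x \<times> UNIV)" _ G])
    fix x assume x: "x \<in> topspace X"
    have "openin (prod_topology X euclideanreal) (N x \<times> UNIV)"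
      using N(1)[OF x] by (simp add: openin_prod_Times_iff)
    then show "openin (subtopology (prod_topology X euclideanreal) (topspace X \<times> {0..1})) ((topspace X \<times> {0..1}) \<inter> (N x \<times> UNIV))"
      by (metis inf_commute openin_subtopology)
    show "continuous_map (subtopology (subtopology (prod_topology X euclideanreal) (topspace X \<times> {0..1})) ((topspace X \<times> {0..1}) \<inter> (N x \<times> UNIV))) E (G x)"
      unfolding subtopology_subtopology
      by (rule continuous_map_from_subtopology_mono[OF G[OF x]]) auto
  next
    fix x y z assume "x \<in> topspace X" "y \<in> topspace X"
      "z \<in> topspace (subtopology (prod_topology X euclideanreal) (topspace X \<times> {0..1})) \<inter>
        (topspace X \<times> {0..1} \<inter> N x \<times> UNIV) \<inter> (topspace X \<times> {0..1} \<inter> N y \<times> UNIV)"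
    then show "G x z = G y z" using agree[of x y "fst z" "snd z"] by auto
  next
    fix z assume "z \<in> topspace (subtopology (prod_topology X euclideanreal) (topspace X \<times> {0..1}))"
    then show "\<exists>j. j \<in> topspace X \<and> z \<in> topspace X \<times> {0..1} \<inter> N j \<times> UNIV \<and> H z = G j z"
      using N(2) by (intro exI[of _ "fst z"]) (auto simp: H_def)
  qed
  then show ?thesis
    using that[of H] pG G0 N(2) by (simp add: H_def)
qed

text \<open>The contraction is lifted, starting from the constant map \<open>e\<close>, and
  evaluated at time 1. The centre \<open>d\<close> does not move, so its lifted path is constant and
  ends at \<open>e\<close>.\<close>

lemma covering_lift_contractible:
  assumes cov: "covering_map E B p" and f: "continuous_map X B f"
    and c: "continuous_map (prod_topology X euclideanreal) X c"
    and c1: "\<And>x. x \<in> topspace X \<Longrightarrow> c (x, 1) = x" and c0: "\<And>x. x \<in> topspace X \<Longrightarrow> c (x, 0) = d"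
    and cd: "\<And>t. t \<in> {0..1} \<Longrightarrow> c (d, t) = d"
    and d: "d \<in> topspace X" and e: "e \<in> topspace E" "p e = f d"
  obtains g where "continuous_map X E g" "\<And>x. x \<in> topspace X \<Longrightarrow> p (g x) = f x" "g d = e"
proof -
  have F: "continuous_map (prod_topology X euclideanreal) B (f \<circ> c)"
    by (rule continuous_map_compose[OF c f])
  have ce: "continuous_map X E (\<lambda>x. e)" using e by simp
  obtain G where G: "continuous_map (subtopology (prod_topology X euclideanreal) (topspace X \<times> {0..1})) E G"
    and pG: "\<And>x t. x \<in> topspace X \<Longrightarrow> t \<in> {0..1} \<Longrightarrow> p (G (x, t)) = (f \<circ> c) (x, t)"
    and G0: "\<And>x. x \<in> topspace X \<Longrightarrow> G (x, 0) = e"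
    using covering_lift_homotopy[OF cov F ce] c0 e by auto
  have pt: "continuous_map X (subtopology (prod_topology X euclideanreal) (topspace X \<times> {0..1})) (\<lambda>x. (x, 1))"
    by (auto simp: continuous_map_in_subtopology intro!: continuous_map_pairedI)
  have "continuous_map X E (\<lambda>x. G (x, 1))"
    using continuous_map_compose[OF pt G] by (simp add: o_def)
  moreover have "p (G (x, 1)) = f x" if "x \<in> topspace X" for x
    using pG[OF that, of 1] c1[OF that] by simp
  moreover have "G (d, 1) = e"
  proof -
    have "continuous_map (top_of_set {0..1}) (subtopology (prod_topology X euclideanreal) (topspace X \<times> {0..1})) (\<lambda>t. (d, t))"
      using d by (auto simp: continuous_map_in_subtopology intro!: continuous_map_pairedI)
    then have Gd: "continuous_map (top_of_set {0..1}) E (\<lambda>t. G (d, t))"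
      using continuous_map_compose[OF _ G] by (auto simp: o_def)
    show ?thesis
      by (rule covering_lift_unique[OF cov _ Gd, of "\<lambda>t. e" 0])
        (use e d pG G0 cd in \<open>auto simp: connected_space_subtopology\<close>)
  qed
  ultimately show ?thesis using that by blast
qed

section \<open>Sheets over chart domains\<close>

lemma covering_section_sheet:
  assumes cov: "covering_map E M p" and U: "openin M U" and s: "continuous_map (subtopology M U) E s"
    and ps: "\<And>x. x \<in> U \<Longrightarrow> p (s x) = x"
  shows "openin E (s ` U)" "p ` s ` U = U" "homeomorphic_map (subtopology E (s ` U)) (subtopology M U) p"
proof -
  have UM: "U \<subseteq> topspace M" using openin_subset[OF U] .
  have tU: "topspace (subtopology M U) = U" using UM by auto
  have sE: "s x \<in> topspace E" if "x \<in> U" for x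
    using continuous_map_image_subset_topspace[OF s] that tU by blast
  show "openin E (s ` U)"
  proof (subst openin_subopen, intro ballI)
    fix e assume "e \<in> s ` U"
    then obtain y where y: "y \<in> U" "e = s y" by blast
    obtain T V r where T: "openin M T" "openin E V" "e \<in> V"
      "continuous_map (subtopology M T) E r" "\<And>y. y \<in> T \<Longrightarrow> r y \<in> V \<and> p (r y) = y"
      "\<And>v. v \<in> V \<Longrightarrow> p v \<in> T \<and> r (p v) = v"
      using covering_sheet[OF cov sE[OF y(1)]] y(2) by blast
    have "openin (subtopology M U) {x \<in> U. s x \<in> V}"
      using openin_continuous_map_preimage[OF s T(2)] unfolding tU .
    then have U': "openin M {x \<in> U. s x \<in> V}" using U by (simp add: openin_open_subtopology)
    have VE: "V \<subseteq> topspace E" using openin_subset[OF T(2)] .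
    have "openin E ({e \<in> topspace E. p e \<in> {x \<in> U. s x \<in> V}} \<inter> V)"
      by (intro openin_Int openin_continuous_map_preimage[OF covering_mapD(1)[OF cov] U'] T)
    moreover have "e \<in> {e \<in> topspace E. p e \<in> {x \<in> U. s x \<in> V}} \<inter> V"
      using y T(3) VE ps by auto
    moreover have "{e \<in> topspace E. p e \<in> {x \<in> U. s x \<in> V}} \<inter> V \<subseteq> s ` U"
    proof
      fix v assume v: "v \<in> {e \<in> topspace E. p e \<in> {x \<in> U. s x \<in> V}} \<inter> V"
      then have "s (p v) \<in> V" "p (s (p v)) = p v" using ps by auto
      then have "s (p v) = v" using T(6) v by (metis IntD2)
      with v show "v \<in> s ` U" by (metis (mono_tags, lifting) IntD1 imageI mem_Collect_eq)
    qed
    ultimately show "\<exists>T. openin E T \<and> e \<in> T \<and> T \<subseteq> s ` U" by blast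
  qed
  show pU: "p ` s ` U = U" using ps by force
  have "homeomorphic_maps (subtopology E (s ` U)) (subtopology M U) p s"
    unfolding homeomorphic_maps_def continuous_map_in_subtopology
    using continuous_map_from_subtopology[OF covering_mapD(1)[OF cov]] s ps by auto
  then show "homeomorphic_map (subtopology E (s ` U)) (subtopology M U) p"
    using homeomorphic_map_maps by blast
qed

text \<open>A chart domain is contractible, hence evenly covered.\<close>

lemma covering_sheet_over_chart:
  fixes \<phi> :: "'a \<Rightarrow> real ^ 'm::finite"
  assumes cov: "covering_map E M p" and ch: "is_chart M (U, \<phi>)" "\<phi> ` U = UNIV"
    and e: "e \<in> topspace E" "p e \<in> U"
  obtains V where "openin E V" "e \<in> V" "p ` V = U" "homeomorphic_map (subtopology E V) (subtopology M U) p"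
proof -
  have U: "openin M U" and hom: "homeomorphic_map (subtopology M U) euclidean \<phi>"
    using ch by (auto simp: is_chart_def)
  have tU: "topspace (subtopology M U) = U" using openin_subset[OF U] by auto
  obtain \<psi> where \<psi>: "homeomorphic_maps (subtopology M U) euclidean \<phi> \<psi>"
    using hom homeomorphic_map_maps by blast
  have \<psi>c: "continuous_map euclidean M \<psi>" and \<phi>c: "continuous_map (subtopology M U) euclidean \<phi>"
    and \<psi>\<phi>: "\<And>x. x \<in> U \<Longrightarrow> \<psi> (\<phi> x) = x"
    using \<psi> tU by (auto simp: homeomorphic_maps_def continuous_map_in_subtopology)
  define d where "d = \<phi> (p e)"
  have "continuous_on UNIV (\<lambda>z :: (real ^ 'm) \<times> real. d + snd z *\<^sub>R (fst z - d))"
    by (intro continuous_intros)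
  then have c: "continuous_map (prod_topology (euclidean :: (real ^ 'm) topology) euclideanreal) euclidean (\<lambda>z. d + snd z *\<^sub>R (fst z - d))"
    by simp
  have "p e = \<psi> d" using \<psi>\<phi>[OF e(2)] by (simp add: d_def)
  have "\<exists>g. continuous_map euclidean E g \<and> (\<forall>x. p (g x) = \<psi> x) \<and> g d = e"
    by (rule covering_lift_contractible[OF cov \<psi>c c, of d e]) (use e \<open>p e = \<psi> d\<close> in auto)
  then obtain g where g: "continuous_map euclidean E g" "\<And>x. p (g x) = \<psi> x" "g d = e"
    by blast
  have s: "continuous_map (subtopology M U) E (g \<circ> \<phi>)"
    by (rule continuous_map_compose[OF \<phi>c g(1)])
  have ps: "p ((g \<circ> \<phi>) x) = x" if "x \<in> U" for x using g(2) \<psi>\<phi>[OF that] by simp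
  have "(g \<circ> \<phi>) (p e) = e" using g(3) by (simp add: d_def)
  then have "e \<in> (g \<circ> \<phi>) ` U" using e(2) by (metis imageI)
  then show ?thesis
    using that covering_section_sheet[OF cov U s ps] by blast
qed

text \<open>Over the compact interval the pull-back bundle is trivial; \<open>S\<close> transports a point to the fibre
  over \<open>a\<close> and \<open>T\<close> transports it back.\<close>

definition trivialises where
  "trivialises E q U a b S T \<longleftrightarrow>
     continuous_map (subtopology (prod_topology euclideanreal E) {(s, e). s \<in> {a..b} \<and> q e = U s}) E S \<and>
     continuous_map (subtopology (prod_topology euclideanreal E) {(t, z). t \<in> {a..b} \<and> q z = U a}) E T \<and>
     (\<forall>s\<in>{a..b}. \<forall>e\<in>topspace E. q e = U s \<longrightarrow> q (S (s, e)) = U a \<and> T (s, S (s, e)) = e) \<and>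
     (\<forall>t\<in>{a..b}. \<forall>z\<in>topspace E. q z = U a \<longrightarrow> q (T (t, z)) = U t) \<and>
     (\<forall>z\<in>topspace E. q z = U a \<longrightarrow> S (a, z) = z \<and> T (a, z) = z)"

lemma trivialises_in:
  assumes "trivialises E q U a b S T" "s \<in> {a..b}" "e \<in> topspace E"
  shows "q e = U s \<Longrightarrow> S (s, e) \<in> topspace E" "q e = U a \<Longrightarrow> T (s, e) \<in> topspace E"
proof -
  have S: "continuous_map (subtopology (prod_topology euclideanreal E) {(s, e). s \<in> {a..b} \<and> q e = U s}) E S"
    and T: "continuous_map (subtopology (prod_topology euclideanreal E) {(t, z). t \<in> {a..b} \<and> q z = U a}) E T"
    using assms by (auto simp: trivialises_def)
  show "q e = U s \<Longrightarrow> S (s, e) \<in> topspace E"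
    using continuous_map_image_subset_topspace[OF S] assms by auto
  show "q e = U a \<Longrightarrow> T (s, e) \<in> topspace E"
    using continuous_map_image_subset_topspace[OF T] assms by auto
qed

text \<open>Beyond \<open>b\<close>, transport passes through the fibre over \<open>b\<close>. The
  two formulas agree at time \<open>b\<close> because the second trivialisation is the identity over
  its own base point.\<close>

lemma trivialises_glue:
  assumes 1: "trivialises E q U a b S1 T1" and 2: "trivialises E q U b c S2 T2" and "a \<le> b" "b \<le> c"
  shows "trivialises E q U a c (\<lambda>z. if fst z \<le> b then S1 z else S1 (b, S2 z))
    (\<lambda>z. if fst z \<le> b then T1 z else T2 (fst z, T1 (b, snd z)))"
  unfolding trivialises_def
proof (intro conjI)
  let ?P = "prod_topology euclideanreal E"
  have S1: "continuous_map (subtopology ?P {(s, e). s \<in> {a..b} \<and> q e = U s}) E S1"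
    and T1: "continuous_map (subtopology ?P {(t, z). t \<in> {a..b} \<and> q z = U a}) E T1"
    and S2: "continuous_map (subtopology ?P {(s, e). s \<in> {b..c} \<and> q e = U s}) E S2"
    and T2: "continuous_map (subtopology ?P {(t, z). t \<in> {b..c} \<and> q z = U b}) E T2"
    using 1 2 by (auto simp: trivialises_def)
  have q1: "q (S1 (s, e)) = U a" "T1 (s, S1 (s, e)) = e" if "s \<in> {a..b}" "e \<in> topspace E" "q e = U s" for s e
    using 1 that unfolding trivialises_def by blast+
  have q2: "q (S2 (s, e)) = U b" "T2 (s, S2 (s, e)) = e" if "s \<in> {b..c}" "e \<in> topspace E" "q e = U s" for s e
    using 2 that unfolding trivialises_def by blast+
  have r1: "q (T1 (t, z)) = U t" if "t \<in> {a..b}" "z \<in> topspace E" "q z = U a" for t z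
    using 1 that unfolding trivialises_def by blast
  have r2: "q (T2 (t, z)) = U t" if "t \<in> {b..c}" "z \<in> topspace E" "q z = U b" for t z
    using 2 that unfolding trivialises_def by blast
  have id1: "S1 (a, z) = z" "T1 (a, z) = z" if "z \<in> topspace E" "q z = U a" for z
    using 1 that unfolding trivialises_def by blast+
  have id2: "S2 (b, z) = z" "T2 (b, z) = z" if "z \<in> topspace E" "q z = U b" for z
    using 2 that unfolding trivialises_def by blast+
  note in1 = trivialises_in[OF 1] and in2 = trivialises_in[OF 2]
  have b: "b \<in> {a..b}" "b \<in> {b..c}" using assms by auto
  let ?D = "{(s, e). s \<in> {a..c} \<and> q e = U s}"
  show "continuous_map (subtopology ?P ?D) E (\<lambda>z. if fst z \<le> b then S1 z else S1 (b, S2 z))"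
  proof (rule continuous_map_split_real)
    show "continuous_map (subtopology ?P ?D) euclideanreal fst"
      by (intro continuous_map_from_subtopology continuous_map_fst)
    show "continuous_map (subtopology (subtopology ?P ?D) {y. fst y \<le> b}) E S1"
      unfolding subtopology_subtopology by (rule continuous_map_from_subtopology_mono[OF S1]) auto
    have *: "continuous_map (subtopology (subtopology ?P ?D) {y. b \<le> fst y}) E S2"
      unfolding subtopology_subtopology by (rule continuous_map_from_subtopology_mono[OF S2]) auto
    have "continuous_map (subtopology (subtopology ?P ?D) {y. b \<le> fst y})
        (subtopology ?P {(s, e). s \<in> {a..b} \<and> q e = U s}) (\<lambda>z. (b, S2 z))"
      unfolding continuous_map_in_subtopology
      using * q2(1) b by (auto intro!: continuous_map_pairedI)
    from continuous_map_compose[OF this S1]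
    show "continuous_map (subtopology (subtopology ?P ?D) {y. b \<le> fst y}) E (\<lambda>z. S1 (b, S2 z))"
      by (simp add: o_def)
    show "S1 z = S1 (b, S2 z)" if "z \<in> topspace (subtopology ?P ?D)" "fst z = b" for z
      using that id2 by (cases z) auto
  qed
  let ?D' = "{(t, z). t \<in> {a..c} \<and> q z = U a}"
  show "continuous_map (subtopology ?P ?D') E (\<lambda>z. if fst z \<le> b then T1 z else T2 (fst z, T1 (b, snd z)))"
  proof (rule continuous_map_split_real)
    show "continuous_map (subtopology ?P ?D') euclideanreal fst"
      by (intro continuous_map_from_subtopology continuous_map_fst)
    show "continuous_map (subtopology (subtopology ?P ?D') {y. fst y \<le> b}) E T1"
      unfolding subtopology_subtopology by (rule continuous_map_from_subtopology_mono[OF T1]) auto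
    let ?Q = "subtopology (subtopology ?P ?D') {y. b \<le> fst y}"
    have c1: "continuous_map ?Q euclideanreal fst" and c2: "continuous_map ?Q E snd"
      by (intro continuous_map_from_subtopology continuous_map_fst continuous_map_snd)+
    have "continuous_map ?Q (subtopology ?P {(t, z). t \<in> {a..b} \<and> q z = U a}) (\<lambda>z. (b, snd z))"
      unfolding continuous_map_in_subtopology
      using c2 b by (auto intro!: continuous_map_pairedI)
    from continuous_map_compose[OF this T1] have "continuous_map ?Q E (\<lambda>z. T1 (b, snd z))"
      by (simp add: o_def)
    then have "continuous_map ?Q (subtopology ?P {(t, z). t \<in> {b..c} \<and> q z = U b}) (\<lambda>z. (fst z, T1 (b, snd z)))"
      unfolding continuous_map_in_subtopology
      using c1 r1[OF b(1)] by (auto intro!: continuous_map_pairedI)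
    from continuous_map_compose[OF this T2]
    show "continuous_map ?Q E (\<lambda>z. T2 (fst z, T1 (b, snd z)))"
      by (simp add: o_def)
    show "T1 z = T2 (fst z, T1 (b, snd z))" if "z \<in> topspace (subtopology ?P ?D')" "fst z = b" for z
      using that id2(2)[OF in1(2)[OF b(1)] r1[OF b(1)], of "snd z"] by (cases z) auto
  qed
  show "\<forall>s\<in>{a..c}. \<forall>e\<in>topspace E. q e = U s \<longrightarrow>
      q (if fst (s, e) \<le> b then S1 (s, e) else S1 (b, S2 (s, e))) = U a \<and>
      (if fst (s, if fst (s, e) \<le> b then S1 (s, e) else S1 (b, S2 (s, e))) \<le> b
       then T1 (s, if fst (s, e) \<le> b then S1 (s, e) else S1 (b, S2 (s, e)))
       else T2 (fst (s, if fst (s, e) \<le> b then S1 (s, e) else S1 (b, S2 (s, e))),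
          T1 (b, snd (s, if fst (s, e) \<le> b then S1 (s, e) else S1 (b, S2 (s, e)))))) = e"
  proof (intro ballI impI)
    fix s e assume s: "s \<in> {a..c}" and e: "e \<in> topspace E" "q e = U s"
    show "q (if fst (s, e) \<le> b then S1 (s, e) else S1 (b, S2 (s, e))) = U a \<and>
      (if fst (s, if fst (s, e) \<le> b then S1 (s, e) else S1 (b, S2 (s, e))) \<le> b
       then T1 (s, if fst (s, e) \<le> b then S1 (s, e) else S1 (b, S2 (s, e)))
       else T2 (fst (s, if fst (s, e) \<le> b then S1 (s, e) else S1 (b, S2 (s, e))),
          T1 (b, snd (s, if fst (s, e) \<le> b then S1 (s, e) else S1 (b, S2 (s, e)))))) = e"
    proof (cases "s \<le> b")
      case True
      then show ?thesis using q1[of s e] s e by simp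
    next
      case False
      then have s': "s \<in> {b..c}" using s by simp
      then show ?thesis
        using False q1[OF b(1) in2(1)[OF s' e] q2(1)[OF s' e]] q2(2)[OF s' e] by simp
    qed
  qed
  show "\<forall>t\<in>{a..c}. \<forall>z\<in>topspace E. q z = U a \<longrightarrow>
      q (if fst (t, z) \<le> b then T1 (t, z) else T2 (fst (t, z), T1 (b, snd (t, z)))) = U t"
  proof (intro ballI impI)
    fix t z assume t: "t \<in> {a..c}" and z: "z \<in> topspace E" "q z = U a"
    show "q (if fst (t, z) \<le> b then T1 (t, z) else T2 (fst (t, z), T1 (b, snd (t, z)))) = U t"
      using t r1[of t z] z r2[OF _ in1(2)[OF b(1) z(1,2)] r1[OF b(1) z], of t] by auto
  qed
  show "\<forall>z\<in>topspace E. q z = U a \<longrightarrow>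
      (if fst (a, z) \<le> b then S1 (a, z) else S1 (b, S2 (a, z))) = z \<and>
      (if fst (a, z) \<le> b then T1 (a, z) else T2 (fst (a, z), T1 (b, snd (a, z)))) = z"
    using id1 \<open>a \<le> b\<close> by simp
qed

text \<open>By bisection. A short piece of the path lies in one trivialising open set, where
  transport keeps the fibre coordinate \<open>snd (h e)\<close> and replaces the base coordinate.
  Only a path in the base is involved, so that a leaf space that is not Hausdorff causes no
  trouble.\<close>

lemma trivialises_ex:
  assumes fib: "locally_trivial_fibration E B q" and U: "continuous_map euclideanreal B U" and "a \<le> b"
  shows "\<exists>S T. trivialises E q U a b S T"
  using \<open>a \<le> b\<close>
proof (induction rule: Bolzano)
  case (trans a b c)
  then show ?case using trivialises_glue by blast
next
  case (local x)
  have "U x \<in> topspace B" using continuous_map_image_subset_topspace[OF U] by auto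
  then obtain V Z h where V: "openin B V" "U x \<in> V"
    and h: "homeomorphic_map (subtopology E {e \<in> topspace E. q e \<in> V}) (prod_topology (subtopology B V) (Z :: 'a topology)) h"
    and fst: "\<forall>e\<in>topspace E. q e \<in> V \<longrightarrow> fst (h e) = q e"
    using fib unfolding locally_trivial_fibration_def by blast
  obtain k where k: "homeomorphic_maps (subtopology E {e \<in> topspace E. q e \<in> V}) (prod_topology (subtopology B V) Z) h k"
    using h homeomorphic_map_maps by blast
  have hc: "continuous_map (subtopology E {e \<in> topspace E. q e \<in> V}) (prod_topology (subtopology B V) Z) h"
    and kc: "continuous_map (prod_topology (subtopology B V) Z) E k"
    and kh: "\<And>e. e \<in> topspace E \<Longrightarrow> q e \<in> V \<Longrightarrow> k (h e) = e"
    and hk: "\<And>y. y \<in> topspace (prod_topology (subtopology B V) Z) \<Longrightarrow> h (k y) = y"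
    using k unfolding homeomorphic_maps_def by (auto simp: continuous_map_in_subtopology)
  have "k ` topspace (prod_topology (subtopology B V) Z) \<subseteq> topspace (subtopology E {e \<in> topspace E. q e \<in> V})"
    using k unfolding homeomorphic_maps_def by (intro continuous_map_image_subset_topspace) auto
  then have kin: "k y \<in> topspace E \<and> q (k y) \<in> V \<and> h (k y) = y"
    if "y \<in> topspace (prod_topology (subtopology B V) Z)" for y
    using hk that by (metis (no_types, lifting) IntE image_subset_iff mem_Collect_eq topspace_subtopology)
  have "open {t. U t \<in> V}"
    using openin_continuous_map_preimage[OF U V(1)] by simp
  then obtain d where d: "0 < d" "\<And>t. \<bar>t - x\<bar> < d \<Longrightarrow> U t \<in> V"
    using V(2) unfolding open_dist by (auto simp: dist_real_def)
  have "\<exists>S T. trivialises E q U a b S T" if ab: "a \<le> x" "x \<le> b" "b - a < d" for a b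
  proof -
    have UV: "U t \<in> V" if "t \<in> {a..b}" for t using d(2)[of t] ab that by auto
    have VB: "V \<subseteq> topspace B" using openin_subset[OF V(1)] .
    have hZ: "h e \<in> topspace (prod_topology (subtopology B V) Z)" if "e \<in> topspace E" "q e \<in> V" for e
      using continuous_map_image_subset_topspace[OF hc] that by auto
    define S where "S = (\<lambda>z :: real \<times> 'a. k (U a, snd (h (snd z))))"
    define T where "T = (\<lambda>z. k (U (fst z), snd (h (snd z))))"
    have a: "a \<in> {a..b}" using ab by simp
    have mem: "(U t, snd (h e)) \<in> topspace (prod_topology (subtopology B V) Z)"
      if "t \<in> {a..b}" "e \<in> topspace E" "q e \<in> V" for t e
      using hZ[OF that(2,3)] UV[OF that(1)] VB by (cases "h e") auto
    have qk: "q (k (U t, snd (h e))) = U t \<and> snd (h (k (U t, snd (h e)))) = snd (h e)"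
      if "t \<in> {a..b}" "e \<in> topspace E" "q e \<in> V" for t e
      using kin[OF mem[OF that]] fst by (metis fst_conv snd_conv)
    have kk: "k (U t, snd (h e)) = e" if "e \<in> topspace E" "q e = U t" "t \<in> {a..b}" for e t
      using fst kh[of e] UV[OF that(3)] that by (metis prod.collapse)
    let ?P = "prod_topology euclideanreal E"
    have cont: "continuous_map (subtopology ?P D) E (\<lambda>z. k (U (f z), snd (h (snd z))))"
      if D: "\<And>z. z \<in> D \<Longrightarrow> f z \<in> {a..b} \<and> q (snd z) \<in> V" and f: "continuous_map ?P euclideanreal f" for D f
    proof -
      have "continuous_map (subtopology ?P D) (subtopology E {e \<in> topspace E. q e \<in> V}) snd"
        using D by (auto simp: continuous_map_in_subtopology intro!: continuous_map_from_subtopology continuous_map_snd)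
      from continuous_map_compose[OF continuous_map_compose[OF this hc] continuous_map_snd]
      have "continuous_map (subtopology ?P D) Z (\<lambda>z. snd (h (snd z)))" by (simp add: o_def)
      moreover have "continuous_map (subtopology ?P D) (subtopology B V) (\<lambda>z. U (f z))"
        using continuous_map_from_subtopology[OF continuous_map_compose[OF f U], of D] D UV
        by (auto simp: continuous_map_in_subtopology o_def)
      ultimately have "continuous_map (subtopology ?P D) (prod_topology (subtopology B V) Z) (\<lambda>z. (U (f z), snd (h (snd z))))"
        by (intro continuous_map_pairedI)
      from continuous_map_compose[OF this kc] show ?thesis by (simp add: o_def)
    qed
    have "trivialises E q U a b S T"
      unfolding trivialises_def
    proof (intro conjI ballI impI)
      show "continuous_map (subtopology ?P {(s, e). s \<in> {a..b} \<and> q e = U s}) E S"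
        unfolding S_def using a UV by (intro cont) auto
      show "continuous_map (subtopology ?P {(t, z). t \<in> {a..b} \<and> q z = U a}) E T"
        unfolding T_def using a UV by (intro cont continuous_map_fst) auto
    qed (use a UV qk kk kin mem in \<open>auto simp: S_def T_def\<close>)
    then show ?thesis by blast
  qed
  with d(1) show ?case by blast
qed

text \<open>Each \<open>e x\<close> is transported to the fibre over \<open>U a\<close> and from
  there to the fibre over \<open>U (g x)\<close>. Transport there and back is the identity, so
  nothing moves where \<open>f\<close> and \<open>g\<close> agree. The homotopy is thus lifted
  relative to that set, which keeps the horn fixed in \<open>fill\<close>.\<close>

lemma fibration_lift_interval:
  assumes fib: "locally_trivial_fibration E B q" and U: "continuous_map euclideanreal B U"
    and f: "continuous_map X euclideanreal f" "f ` topspace X \<subseteq> {a..b}"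
    and g: "continuous_map X euclideanreal g" "g ` topspace X \<subseteq> {a..b}"
    and e: "continuous_map X E e" and qe: "\<And>x. x \<in> topspace X \<Longrightarrow> q (e x) = U (f x)"
  obtains s where "continuous_map X E s" "\<And>x. x \<in> topspace X \<Longrightarrow> q (s x) = U (g x)"
    "\<And>x. x \<in> topspace X \<Longrightarrow> f x = g x \<Longrightarrow> s x = e x"
proof (cases "topspace X = {}")
  case True
  then show ?thesis using that[of e] e by auto
next
  case False
  then have "a \<le> b" using f(2) by (metis atLeastAtMost_iff ex_in_conv image_subset_iff order.trans)
  then obtain S T where tr: "trivialises E q U a b S T" using trivialises_ex[OF fib U] by blast
  let ?P = "prod_topology euclideanreal E"
  have eE: "e x \<in> topspace E" if "x \<in> topspace X" for x
    using continuous_map_image_subset_topspace[OF e] that by blast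
  have S: "continuous_map (subtopology ?P {(s, e). s \<in> {a..b} \<and> q e = U s}) E S"
    and T: "continuous_map (subtopology ?P {(t, z). t \<in> {a..b} \<and> q z = U a}) E T"
    using tr by (auto simp: trivialises_def)
  have "continuous_map X (subtopology ?P {(s, e). s \<in> {a..b} \<and> q e = U s}) (\<lambda>x. (f x, e x))"
    unfolding continuous_map_in_subtopology using f e qe by (auto intro!: continuous_map_pairedI)
  from continuous_map_compose[OF this S] have Sc: "continuous_map X E (\<lambda>x. S (f x, e x))" by (simp add: o_def)
  have qS: "q (S (f x, e x)) = U a \<and> T (f x, S (f x, e x)) = e x" if "x \<in> topspace X" for x
    using tr f(2) eE[OF that] qe[OF that] that unfolding trivialises_def by blast
  have "continuous_map X (subtopology ?P {(t, z). t \<in> {a..b} \<and> q z = U a}) (\<lambda>x. (g x, S (f x, e x)))"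
    unfolding continuous_map_in_subtopology using g Sc qS by (auto intro!: continuous_map_pairedI)
  from continuous_map_compose[OF this T] have "continuous_map X E (\<lambda>x. T (g x, S (f x, e x)))" by (simp add: o_def)
  moreover have "q (T (g x, S (f x, e x))) = U (g x)" if x: "x \<in> topspace X" for x
  proof -
    have "g x \<in> {a..b}" "S (f x, e x) \<in> topspace E"
      using g(2) x continuous_map_image_subset_topspace[OF Sc] by blast+
    then show ?thesis using tr qS[OF x] unfolding trivialises_def by blast
  qed
  moreover have "T (g x, S (f x, e x)) = e x" if "x \<in> topspace X" "f x = g x" for x
    using qS[OF that(1)] that(2) by simp
  ultimately show ?thesis using that by blast
qed


section \<open>Leaves and leaf spaces\<close>

lemma sym_same_plaque: "sym (same_plaque G)"
proof (rule symI)
  fix x y assume "(x, y) \<in> same_plaque G"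
  then obtain U \<phi> where "(U, \<phi>) \<in> G" "x \<in> U" "y \<in> U" "last_coord (\<phi> y) = last_coord (\<phi> x)"
    by (auto simp: same_plaque_def)
  then show "(y, x) \<in> same_plaque G" by (auto simp: same_plaque_def)
qed

lemma leaf_eq_iff: "leaf G x = leaf G y \<longleftrightarrow> (x, y) \<in> (same_plaque G)\<^sup>*"
proof
  assume eq: "leaf G x = leaf G y"
  have "y \<in> leaf G y" by (simp add: leaf_def)
  then have "y \<in> leaf G x" unfolding eq .
  then show "(x, y) \<in> (same_plaque G)\<^sup>*" by (simp add: leaf_def)
next
  assume "(x, y) \<in> (same_plaque G)\<^sup>*"
  moreover from this have "(y, x) \<in> (same_plaque G)\<^sup>*"
    by (rule symD[OF sym_rtrancl[OF sym_same_plaque]])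
  ultimately show "leaf G x = leaf G y"
    unfolding leaf_def by (auto intro: rtrancl_trans)
qed

lemma mem_leaf_iff: "y \<in> leaf G x \<longleftrightarrow> leaf G x = leaf G y"
  by (simp add: leaf_eq_iff) (simp add: leaf_def)

lemma leaf_eq_plaque:
  assumes "(V, \<xi>) \<in> G" "x \<in> V" "y \<in> V" "last_coord (\<xi> x) = last_coord (\<xi> y)"
  shows "leaf G x = leaf G y"
  unfolding leaf_eq_iff using assms by (intro r_into_rtrancl) (auto simp: same_plaque_def)

lemma leaves_leaf:
  assumes "L \<in> leaves M F" "x \<in> L"
  shows "L = leaf F x"
  using assms by (auto simp: leaves_def mem_leaf_iff)

lemma foliation_chart:
  assumes "codim_one_foliation M A F" "(U, \<phi>) \<in> F"
  shows "is_chart M (U, \<phi>)" "openin M U" "\<phi> ` U = UNIV" "homeomorphic_map (subtopology M U) euclidean \<phi>"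
    "topspace (subtopology M U) = U"
proof -
  have "\<forall>c\<in>F. smooth_chart M A c \<and> snd c ` fst c = UNIV"
    using assms(1) unfolding codim_one_foliation_def by (rule conjunct1)
  from bspec[OF this assms(2)] show ch: "is_chart M (U, \<phi>)" and im: "\<phi> ` U = UNIV"
    by (simp_all add: smooth_chart_def)
  then show U: "openin M U" and "homeomorphic_map (subtopology M U) euclidean \<phi>"
    by (auto simp: is_chart_def)
  show "topspace (subtopology M U) = U" using openin_subset[OF U] by auto
qed

lemma chart_inverse:
  assumes "homeomorphic_map (subtopology M U) euclidean \<phi>" "topspace (subtopology M U) = U"
  obtains \<psi> where "continuous_map euclidean (subtopology M U) \<psi>" "\<And>z. \<psi> z \<in> U" "\<And>z. \<phi> (\<psi> z) = z"
    "\<And>x. x \<in> U \<Longrightarrow> \<psi> (\<phi> x) = x"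
proof -
  obtain \<psi> where \<psi>: "homeomorphic_maps (subtopology M U) euclidean \<phi> \<psi>"
    using assms homeomorphic_map_maps by blast
  then have c: "continuous_map euclidean (subtopology M U) \<psi>" by (simp add: homeomorphic_maps_def)
  then have "\<psi> z \<in> U" for z using continuous_map_image_subset_topspace[OF c] assms(2) by auto
  then show ?thesis using that[OF c] \<psi> assms(2) unfolding homeomorphic_maps_def by auto
qed

lemma foliation_cover:
  assumes "codim_one_foliation M A F" "x \<in> topspace M"
  obtains U \<phi> where "(U, \<phi>) \<in> F" "x \<in> U"
proof -
  have "x \<in> \<Union> (fst ` F)" using assms by (simp add: codim_one_foliation_def)
  then show ?thesis using that by force
qed

lemma plaque_local:
  assumes fol: "codim_one_foliation M A F" and c: "(U, \<phi>) \<in> F" and d: "(U', \<phi>') \<in> F" and y: "y \<in> U" "y \<in> U'"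
  obtains N where "openin M N" "y \<in> N" "N \<subseteq> U \<inter> U'"
    "\<And>u v. u \<in> N \<Longrightarrow> v \<in> N \<Longrightarrow> last_coord (\<phi> u) = last_coord (\<phi> v) \<Longrightarrow> last_coord (\<phi>' u) = last_coord (\<phi>' v)"
proof -
  note C = foliation_chart[OF fol c]
  have "foliated_compatible (U, \<phi>) (U', \<phi>')"
    using fol c d unfolding codim_one_foliation_def by blast
  moreover have "\<phi> y \<in> overlap (U, \<phi>) (U', \<phi>')" using y by (auto simp: overlap_def)
  ultimately obtain W where W: "open W" "\<phi> y \<in> W" "W \<subseteq> overlap (U, \<phi>) (U', \<phi>')"
    "\<forall>u\<in>W. \<forall>v\<in>W. last_coord u = last_coord v \<longrightarrow>
       last_coord (transition (U, \<phi>) (U', \<phi>') u) = last_coord (transition (U, \<phi>) (U', \<phi>') v)"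
    unfolding foliated_compatible_def by blast
  have inj: "inj_on \<phi> U" using homeomorphic_imp_injective_map[OF C(4)] C(5) by simp
  have tr: "transition (U, \<phi>) (U', \<phi>') (\<phi> u) = \<phi>' u" if "u \<in> U" for u
    using the_inv_into_f_f[OF inj that] by (simp add: transition_def)
  define N where "N = {x \<in> topspace (subtopology M U). \<phi> x \<in> W}"
  have NU: "N \<subseteq> U" using C(5) by (auto simp: N_def)
  have "openin (subtopology M U) N"
    unfolding N_def using W(1) by (intro openin_continuous_map_preimage[OF homeomorphic_imp_continuous_map[OF C(4)]]) simp
  then have "openin M N" using C(2) by (simp add: openin_open_subtopology)
  moreover have "y \<in> N" using y C(5) W(2) by (simp add: N_def)
  moreover have "u \<in> U'" if "u \<in> N" for u
  proof -
    have "\<phi> u \<in> \<phi> ` (U \<inter> U')" using that W(3) by (auto simp: N_def overlap_def)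
    then show ?thesis using inj NU that by (auto dest: inj_onD)
  qed
  moreover have "last_coord (\<phi>' u) = last_coord (\<phi>' v)"
    if "u \<in> N" "v \<in> N" "last_coord (\<phi> u) = last_coord (\<phi> v)" for u v
  proof -
    have "\<phi> u \<in> W" "\<phi> v \<in> W" using that by (auto simp: N_def)
    then have "last_coord (transition (U, \<phi>) (U', \<phi>') (\<phi> u)) = last_coord (transition (U, \<phi>) (U', \<phi>') (\<phi> v))"
      using W(4) that(3) by blast
    then show ?thesis using tr that(1,2) NU by (simp add: subset_iff)
  qed
  ultimately show ?thesis using that NU by blast
qed

section \<open>A leaf meets a chart in countably many plaques\<close>

lemma locally_constant_countable:
  assumes "second_countable X" "\<And>x. x \<in> topspace X \<Longrightarrow> \<exists>N. openin X N \<and> x \<in> N \<and> (\<forall>y\<in>N. f y = f x)"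
  shows "countable (f ` topspace X)"
proof -
  obtain N where N: "\<And>x. x \<in> topspace X \<Longrightarrow> openin X (N x) \<and> x \<in> N x \<and> (\<forall>y\<in>N x. f y = f x)"
    using assms(2) by metis
  have "Lindelof_space X" by (rule second_countable_imp_Lindelof_space[OF assms(1)])
  moreover have "topspace X \<subseteq> \<Union> (N ` topspace X)" using N by blast
  moreover have "\<forall>U\<in>N ` topspace X. openin X U" using N by blast
  ultimately obtain \<V> where \<V>: "countable \<V>" "\<V> \<subseteq> N ` topspace X" "topspace X \<subseteq> \<Union>\<V>"
    unfolding Lindelof_space_alt by meson
  obtain C where C: "countable C" "C \<subseteq> topspace X" "\<V> = N ` C"
    using countable_subset_image[of \<V> N "topspace X"] \<V>(1,2) by blast
  have "f ` topspace X \<subseteq> f ` C"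
  proof
    fix z assume "z \<in> f ` topspace X"
    then obtain x where x: "x \<in> topspace X" "z = f x" by blast
    then obtain c where "c \<in> C" "x \<in> N c" using \<V>(3) C(3) by blast
    then show "z \<in> f ` C" using N C(2) x by blast
  qed
  then show ?thesis by (rule countable_subset) (rule countable_image[OF C(1)])
qed

lemma continuous_last_coord: "continuous_on S (last_coord :: real ^ 'm::{finite,linorder} \<Rightarrow> real)"
  unfolding last_coord_def[abs_def] by (intro continuous_intros)

text \<open>Along a plaque of the first chart the transverse coordinate of the second is locally
  constant, and a second countable space leaves room for only countably many values.\<close>

lemma countable_plaque_overlap:
  assumes fol: "codim_one_foliation M A F" and sc: "second_countable M"
    and c: "(U, \<phi>) \<in> F" and d: "(U', \<phi>') \<in> F"
  shows "countable {last_coord (\<phi>' y) |y. y \<in> U \<and> y \<in> U' \<and> last_coord (\<phi> y) = s}"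
proof -
  let ?P = "{y \<in> U \<inter> U'. last_coord (\<phi> y) = s}"
  let ?X = "subtopology M ?P"
  have PX: "topspace ?X = ?P"
    using openin_subset[OF foliation_chart(2)[OF fol c]] by auto
  have "countable ((\<lambda>y. last_coord (\<phi>' y)) ` topspace ?X)"
  proof (rule locally_constant_countable)
    show "second_countable ?X" by (rule second_countable_subtopology[OF sc])
    fix x assume "x \<in> topspace ?X"
    then have x: "x \<in> ?P" using PX by simp
    then obtain N where N: "openin M N" "x \<in> N" "N \<subseteq> U \<inter> U'"
      "\<And>u v. u \<in> N \<Longrightarrow> v \<in> N \<Longrightarrow> last_coord (\<phi> u) = last_coord (\<phi> v) \<Longrightarrow> last_coord (\<phi>' u) = last_coord (\<phi>' v)"
      using plaque_local[OF fol c d, of x] by blast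
    have "openin ?X (?P \<inter> N)" using N(1) by (auto simp: openin_subtopology)
    moreover have "\<forall>y\<in>?P \<inter> N. last_coord (\<phi>' y) = last_coord (\<phi>' x)"
    proof
      fix y assume "y \<in> ?P \<inter> N"
      then show "last_coord (\<phi>' y) = last_coord (\<phi>' x)" using x by (intro N(4) N(2)) auto
    qed
    ultimately show "\<exists>N. openin ?X N \<and> x \<in> N \<and> (\<forall>y\<in>N. last_coord (\<phi>' y) = last_coord (\<phi>' x))"
      using x N(2) by blast
  qed
  moreover have "(\<lambda>y. last_coord (\<phi>' y)) ` topspace ?X = {last_coord (\<phi>' y) |y. y \<in> U \<and> y \<in> U' \<and> last_coord (\<phi> y) = s}"
    unfolding PX by blast
  ultimately show ?thesis by simp
qed

lemma convex_last_coord: "convex {z :: real ^ 'm::{finite,linorder}. last_coord z = s}"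
proof -
  have "s * u + s * v = s" if "u + v = 1" for u v :: real
    using that by (metis distrib_left mult.right_neutral)
  then show ?thesis by (auto simp: convex_def last_coord_def mult.commute)
qed

text \<open>A plaque is the image of a hyperplane, hence connected. The points of it that plaques of
  the smaller atlas can reach from \<open>x\<close> form a clopen subset.\<close>

lemma same_plaque_subatlas:
  assumes fol: "codim_one_foliation M A F" and F0: "F0 \<subseteq> F" "\<Union> (fst ` F0) = topspace M"
    and xy: "(x, y) \<in> same_plaque F"
  shows "(x, y) \<in> (same_plaque F0)\<^sup>*"
proof -
  obtain U \<phi> where c: "(U, \<phi>) \<in> F" and x: "x \<in> U" and y: "y \<in> U" and eq: "last_coord (\<phi> x) = last_coord (\<phi> y)"
    using xy by (auto simp: same_plaque_def)
  note C = foliation_chart[OF fol c]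
  obtain \<psi> where \<psi>: "continuous_map euclidean (subtopology M U) \<psi>" "\<And>z. \<psi> z \<in> U" "\<And>z. \<phi> (\<psi> z) = z"
    "\<And>x. x \<in> U \<Longrightarrow> \<psi> (\<phi> x) = x"
    by (rule chart_inverse[OF C(4,5)]) blast
  let ?Z = "{z. last_coord z = last_coord (\<phi> x)}"
  have "connectedin euclidean ?Z" using convex_connected[OF convex_last_coord] by simp
  then have con: "connectedin M (\<psi> ` ?Z)"
    using connectedin_continuous_map_image \<psi>(1) by (metis connectedin_subtopology)
  let ?X = "subtopology M (\<psi> ` ?Z)"
  have tX: "topspace ?X = \<psi> ` ?Z" using con by (simp add: connectedin_def inf.absorb2)
  have nbhd: "\<exists>N. openin ?X N \<and> u \<in> N \<and> (\<forall>v\<in>N. (u, v) \<in> same_plaque F0)" if u: "u \<in> \<psi> ` ?Z" for u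
  proof -
    have uU: "u \<in> U" "last_coord (\<phi> u) = last_coord (\<phi> x)" using u \<psi> by auto
    have "u \<in> topspace M" using u con by (auto simp: connectedin_def)
    then have "u \<in> \<Union> (fst ` F0)" by (simp only: F0(2))
    then obtain U' \<phi>' where d: "(U', \<phi>') \<in> F0" "u \<in> U'" by auto
    then obtain N where N: "openin M N" "u \<in> N" "N \<subseteq> U \<inter> U'"
      "\<And>u v. u \<in> N \<Longrightarrow> v \<in> N \<Longrightarrow> last_coord (\<phi> u) = last_coord (\<phi> v) \<Longrightarrow> last_coord (\<phi>' u) = last_coord (\<phi>' v)"
      using plaque_local[OF fol c, of U' \<phi>' u] F0(1) uU by blast
    have "(u, v) \<in> same_plaque F0" if v: "v \<in> \<psi> ` ?Z \<inter> N" for v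
    proof -
      have "last_coord (\<phi> v) = last_coord (\<phi> x)" using v \<psi> by auto
      then have "last_coord (\<phi>' u) = last_coord (\<phi>' v)" by (intro N(4) N(2)) (use v uU in auto)
      then show ?thesis using d N(3) v by (auto simp: same_plaque_def)
    qed
    moreover have "openin ?X (\<psi> ` ?Z \<inter> N)" using N(1) by (metis inf_commute openin_subtopology)
    ultimately show ?thesis using u N(2) by blast
  qed
  let ?A = "{v \<in> topspace ?X. (x, v) \<in> (same_plaque F0)\<^sup>*}"
  have "openin ?X ?A"
  proof (subst openin_subopen, intro ballI)
    fix u assume u: "u \<in> ?A"
    then have "u \<in> topspace ?X" by blast
    then have "u \<in> \<psi> ` ?Z" unfolding tX .
    from nbhd[OF this] obtain N where N: "openin ?X N" "u \<in> N" "\<forall>v\<in>N. (u, v) \<in> same_plaque F0" by blast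
    have "N \<subseteq> ?A"
    proof
      fix v assume v: "v \<in> N"
      then have "(x, v) \<in> (same_plaque F0)\<^sup>*" using N(3) u by (blast intro: rtrancl_into_rtrancl)
      then show "v \<in> ?A" using v openin_subset[OF N(1)] by blast
    qed
    with N show "\<exists>T. openin ?X T \<and> u \<in> T \<and> T \<subseteq> ?A" by blast
  qed
  moreover have "openin ?X (topspace ?X - ?A)"
  proof (subst openin_subopen, intro ballI)
    fix u assume u: "u \<in> topspace ?X - ?A"
    then have "u \<in> topspace ?X" by blast
    then have "u \<in> \<psi> ` ?Z" unfolding tX .
    from nbhd[OF this] obtain N where N: "openin ?X N" "u \<in> N" "\<forall>v\<in>N. (u, v) \<in> same_plaque F0" by blast
    have "N \<subseteq> topspace ?X - ?A"
    proof
      fix v assume v: "v \<in> N"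
      then have "(v, u) \<in> same_plaque F0" using N(3) by (blast intro: symD[OF sym_same_plaque])
      then have "(x, v) \<notin> (same_plaque F0)\<^sup>*" using u by (blast intro: rtrancl_into_rtrancl)
      then show "v \<in> topspace ?X - ?A" using v openin_subset[OF N(1)] by blast
    qed
    with N show "\<exists>T. openin ?X T \<and> u \<in> T \<and> T \<subseteq> topspace ?X - ?A" by blast
  qed
  ultimately have "?A = {} \<or> ?A = topspace ?X"
    using con unfolding connectedin_def connected_space_clopen_in closedin_def by blast
  moreover have "x \<in> \<psi> ` ?Z" "y \<in> \<psi> ` ?Z" using \<psi>(4)[OF x] \<psi>(4)[OF y] eq by (metis (mono_tags) image_eqI mem_Collect_eq)+
  ultimately show ?thesis using tX by blast
qed

text \<open>The maximal atlas is too large for counting, so chains of plaques are first refined to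
  chains in a countable subatlas, which the Lindelof property provides. Then the values are counted
  by induction on the length of the chain.\<close>

lemma countable_leaf_chart:
  assumes fol: "codim_one_foliation M A F" and sc: "second_countable M" and L: "L \<in> leaves M F" and d: "(U, \<phi>) \<in> F"
  shows "countable {last_coord (\<phi> y) |y. y \<in> L \<and> y \<in> U}"
proof -
  have "Lindelof_space M" by (rule second_countable_imp_Lindelof_space[OF sc])
  moreover have "topspace M \<subseteq> \<Union> (fst ` F)" using fol by (simp add: codim_one_foliation_def)
  moreover have "\<forall>U\<in>fst ` F. openin M U" using foliation_chart(2)[OF fol] by force
  ultimately obtain \<V> where \<V>: "countable \<V>" "\<V> \<subseteq> fst ` F" "topspace M \<subseteq> \<Union>\<V>"
    unfolding Lindelof_space_alt by meson
  obtain F0 where F0: "countable F0" "F0 \<subseteq> F" "\<V> = fst ` F0"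
    using countable_subset_image[of \<V> fst F] \<V>(1,2) by blast
  have "\<Union> (fst ` F0) \<subseteq> topspace M"
  proof clarify
    fix U \<phi> x assume "(U, \<phi>) \<in> F0" "x \<in> fst (U, \<phi>)"
    then show "x \<in> topspace M"
      using F0(2) openin_subset[OF foliation_chart(2)[OF fol, of U \<phi>]] by auto
  qed
  with \<V>(3) F0(3) have cov: "\<Union> (fst ` F0) = topspace M" by blast
  obtain x where x: "L = leaf F x" using L by (auto simp: leaves_def)
  let ?R = "same_plaque F0"
  have L_eq: "y \<in> L \<Longrightarrow> \<exists>k. (x, y) \<in> ?R ^^ k" for y
  proof -
    assume "y \<in> L"
    then have "(x, y) \<in> (same_plaque F)\<^sup>*" by (simp add: x leaf_def)
    then have "(x, y) \<in> ?R\<^sup>*"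
      by (induction rule: rtrancl_induct) (use same_plaque_subatlas[OF fol F0(2) cov] in \<open>auto intro: rtrancl_trans\<close>)
    then show ?thesis by (simp add: rtrancl_power)
  qed
  have cnt: "countable {last_coord (\<phi> y) |y. (x, y) \<in> ?R ^^ k \<and> y \<in> U}" if "(U, \<phi>) \<in> F" for k U \<phi>
    using that
  proof (induction k arbitrary: U \<phi>)
    case 0
    have "{last_coord (\<phi> y) |y. (x, y) \<in> ?R ^^ 0 \<and> y \<in> U} \<subseteq> {last_coord (\<phi> x)}" by auto
    then show ?case by (rule countable_subset) simp
  next
    case (Suc k)
    let ?V = "\<lambda>c. {last_coord (snd c y) |y. (x, y) \<in> ?R ^^ k \<and> y \<in> fst c}"
    let ?B = "\<Union>c\<in>F0. \<Union>s\<in>?V c. {last_coord (\<phi> y) |y. y \<in> fst c \<and> y \<in> U \<and> last_coord (snd c y) = s}"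
    have "{last_coord (\<phi> y) |y. (x, y) \<in> ?R ^^ Suc k \<and> y \<in> U} \<subseteq> ?B"
    proof clarify
      fix y assume "(x, y) \<in> ?R ^^ Suc k" and yU: "y \<in> U"
      then obtain w where w: "(x, w) \<in> ?R ^^ k" "(w, y) \<in> ?R" by auto
      then obtain W \<xi> where c: "(W, \<xi>) \<in> F0" "w \<in> W" "y \<in> W" "last_coord (\<xi> w) = last_coord (\<xi> y)"
        by (auto simp: same_plaque_def)
      show "last_coord (\<phi> y) \<in> ?B"
      proof (rule UN_I[OF c(1)], rule UN_I)
        show "last_coord (\<xi> w) \<in> ?V (W, \<xi>)" using w(1) c(2) by auto
        show "last_coord (\<phi> y) \<in> {last_coord (\<phi> y) |y. y \<in> fst (W, \<xi>) \<and> y \<in> U \<and> last_coord (snd (W, \<xi>) y) = last_coord (\<xi> w)}"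
          using c yU by auto
      qed
    qed
    moreover have "countable ?B"
    proof (intro countable_UN F0(1))
      fix c assume c: "c \<in> F0"
      then have cF: "(fst c, snd c) \<in> F" using F0(2) by auto
      then show "countable (?V c)" by (rule Suc.IH)
      fix s
      show "countable {last_coord (\<phi> y) |y. y \<in> fst c \<and> y \<in> U \<and> last_coord (snd c y) = s}"
        by (rule countable_plaque_overlap[OF fol sc cF Suc.prems])
    qed
    ultimately show ?case by (rule countable_subset)
  qed
  have "{last_coord (\<phi> y) |y. y \<in> L \<and> y \<in> U} \<subseteq> (\<Union>k. {last_coord (\<phi> y) |y. (x, y) \<in> ?R ^^ k \<and> y \<in> U})"
    using L_eq by blast
  moreover have "countable (\<Union>k. {last_coord (\<phi> y) |y. (x, y) \<in> ?R ^^ k \<and> y \<in> U})"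
    using cnt[OF d] by (intro countable_UN) auto
  ultimately show ?thesis by (rule countable_subset)
qed

section \<open>The pull-back foliation of a covering\<close>

lemma pullback_atlas_chart:
  assumes fol: "codim_one_foliation M A F" and V: "(V, \<xi>) \<in> pullback_atlas E M p F"
  obtains \<phi> where "\<xi> = \<phi> \<circ> p" "openin E V" "(p ` V, \<phi>) \<in> F" "homeomorphic_map (subtopology E V) euclidean \<xi>"
    "topspace (subtopology E V) = V"
proof -
  obtain \<phi> where \<phi>: "\<xi> = \<phi> \<circ> p" "openin E V" "(p ` V, \<phi>) \<in> F"
    "homeomorphic_map (subtopology E V) (subtopology M (p ` V)) p"
    using V by (auto simp: pullback_atlas_def)
  have "homeomorphic_map (subtopology E V) euclidean \<xi>"
    unfolding \<phi>(1) by (rule homeomorphic_map_compose[OF \<phi>(4) foliation_chart(4)[OF fol \<phi>(3)]])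
  then show ?thesis using that \<phi> openin_subset[OF \<phi>(2)] by auto
qed

lemma pullback_sheet:
  assumes fol: "codim_one_foliation M A F" and cov: "covering_map E M p"
    and e: "e \<in> topspace E" "(U, \<phi>) \<in> F" "p e \<in> U"
  obtains V where "openin E V" "e \<in> V" "p ` V = U" "(V, \<phi> \<circ> p) \<in> pullback_atlas E M p F"
proof -
  obtain V where V: "openin E V" "e \<in> V" "p ` V = U" "homeomorphic_map (subtopology E V) (subtopology M U) p"
    using covering_sheet_over_chart[OF cov foliation_chart(1,3)[OF fol e(2)] e(1,3)] by blast
  have "(V, \<phi> \<circ> p) \<in> pullback_atlas E M p F"
    unfolding pullback_atlas_def using V e(2) by blast
  with V that show ?thesis by blast
qed

lemma leaf_pullback_project:
  assumes "leaf (pullback_atlas E M p F) x = leaf (pullback_atlas E M p F) y"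
  shows "leaf F (p x) = leaf F (p y)"
proof -
  have "(x, y) \<in> (same_plaque (pullback_atlas E M p F))\<^sup>*" using assms unfolding leaf_eq_iff .
  then show ?thesis
  proof (induction rule: rtrancl_induct)
    case (step y z)
    then obtain V \<phi> where "(p ` V, \<phi>) \<in> F" "y \<in> V" "z \<in> V" "last_coord (\<phi> (p y)) = last_coord (\<phi> (p z))"
      by (auto simp: same_plaque_def pullback_atlas_def)
    then show ?case using step.IH leaf_eq_plaque by fastforce
  qed simp
qed

text \<open>The preimage of a leaf may split into many leaves of the covering, but a path cannot
  pass from one to another. In a chart its transverse coordinate runs through a connected set that
  is countable by \<open>countable_leaf_chart\<close>, so it is locally constant.\<close>

lemma leaf_pullback_path:
  assumes fol: "codim_one_foliation M A F" and sc: "second_countable M" and cov: "covering_map E M p"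
    and L: "L \<in> leaves M F" and \<gamma>: "continuous_map (top_of_set {0..1::real}) E \<gamma>"
    and pL: "\<And>t. t \<in> {0..1} \<Longrightarrow> p (\<gamma> t) \<in> L"
  shows "leaf (pullback_atlas E M p F) (\<gamma> 0) = leaf (pullback_atlas E M p F) (\<gamma> 1)"
proof -
  let ?G = "pullback_atlas E M p F"
  have "\<forall>t\<in>{0..1}. \<forall>\<^sub>F s in at t within {0..1}. leaf ?G (\<gamma> t) = leaf ?G (\<gamma> s)"
  proof
    fix t :: real assume t: "t \<in> {0..1}"
    have \<gamma>E: "\<gamma> t \<in> topspace E" using continuous_map_image_subset_topspace[OF \<gamma>] t by auto
    then have "p (\<gamma> t) \<in> topspace M" using covering_mapD[OF cov] by blast
    then obtain U \<phi> where U: "(U, \<phi>) \<in> F" "p (\<gamma> t) \<in> U" by (rule foliation_cover[OF fol])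
    obtain V where V: "openin E V" "\<gamma> t \<in> V" "p ` V = U" "(V, \<phi> \<circ> p) \<in> ?G"
      using pullback_sheet[OF fol cov \<gamma>E U] by blast
    obtain \<phi>' where V': "\<phi> \<circ> p = \<phi>' \<circ> p" "homeomorphic_map (subtopology E V) euclidean (\<phi> \<circ> p)"
      using pullback_atlas_chart[OF fol V(4)] by metis
    have "openin (top_of_set {0..1}) {s \<in> {0..1}. \<gamma> s \<in> V}"
      using openin_continuous_map_preimage[OF \<gamma> V(1)] by simp
    then obtain d where d: "0 < d" "\<And>s. s \<in> {0..1} \<Longrightarrow> dist s t < d \<Longrightarrow> \<gamma> s \<in> V"
      using t V(2) unfolding openin_euclidean_subtopology_iff by (smt (verit, ccfv_SIG) mem_Collect_eq)
    let ?J = "{0..1} \<inter> ball t d"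
    have JV: "\<gamma> s \<in> V" if "s \<in> ?J" for s using d(2)[of s] that by (simp add: dist_commute)
    have "continuous_map (top_of_set ?J) (subtopology E V) \<gamma>"
      using \<gamma> JV by (auto simp: continuous_map_in_subtopology elim!: continuous_map_from_subtopology_mono)
    from continuous_map_compose[OF this homeomorphic_imp_continuous_map[OF V'(2)]]
    have "continuous_on ?J (\<lambda>s. \<phi> (p (\<gamma> s)))" by (simp add: o_def)
    then have "continuous_on ?J (\<lambda>s. last_coord (\<phi> (p (\<gamma> s))))"
      by (rule continuous_on_compose2[OF continuous_last_coord[of UNIV]]) simp
    moreover have "connected ?J" by (intro convex_connected convex_Int) auto
    ultimately have con: "connected ((\<lambda>s. last_coord (\<phi> (p (\<gamma> s)))) ` ?J)"
      by (rule connected_continuous_image)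
    have "(\<lambda>s. last_coord (\<phi> (p (\<gamma> s)))) ` ?J \<subseteq> {last_coord (\<phi> y) |y. y \<in> L \<and> y \<in> U}"
      using pL JV V(3) by blast
    then have cnt: "countable ((\<lambda>s. last_coord (\<phi> (p (\<gamma> s)))) ` ?J)"
      by (rule countable_subset[OF _ countable_leaf_chart[OF fol sc L U(1)]])
    have "leaf ?G (\<gamma> t) = leaf ?G (\<gamma> s)" if s: "s \<in> ?J" for s
    proof -
      have tJ: "t \<in> ?J" using t d(1) by simp
      have "last_coord (\<phi> (p (\<gamma> t))) = last_coord (\<phi> (p (\<gamma> s)))"
        using connected_uncountable[OF con imageI[OF tJ] imageI[OF s]] cnt by blast
      then show ?thesis using leaf_eq_plaque[OF V(4) JV[OF tJ] JV[OF s]] by simp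
    qed
    then show "\<forall>\<^sub>F s in at t within {0..1}. leaf ?G (\<gamma> t) = leaf ?G (\<gamma> s)"
      unfolding eventually_at using d(1) by (intro exI[of _ d]) (auto simp: dist_commute)
  qed
  then show ?thesis
    by (rule connected_local_const[rotated -1]) (auto simp: connected_Icc)
qed

section \<open>The leaf space of the pull-back foliation\<close>

lemma topspace_leaf_space: "topspace (leaf_space E G) = leaves E G"
proof -
  have "{x \<in> topspace E. leaf G x \<in> leaves E G} = topspace E" by (auto simp: leaves_def)
  then have "openin (leaf_space E G) (leaves E G)" by (simp add: openin_leaf_space)
  moreover have "topspace (leaf_space E G) \<subseteq> leaves E G"
    using openin_topspace[of "leaf_space E G"] unfolding openin_leaf_space by blast
  ultimately show ?thesis using openin_subset by blast
qed

lemma continuous_map_leaf: "continuous_map E (leaf_space E G) (leaf G)"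
  by (auto simp: continuous_map_def openin_leaf_space topspace_leaf_space leaves_def)

text \<open>The saturation of an open set is open. Along a chain of plaques, a neighbourhood of one
  point that consists of saturated points yields one of the next point, since the transverse
  coordinate of a chart is an open map.\<close>

lemma open_map_leaf:
  assumes fol: "codim_one_foliation M A F" and W: "openin E W"
  shows "openin (leaf_space E (pullback_atlas E M p F)) (leaf (pullback_atlas E M p F) ` W)"
proof -
  let ?G = "pullback_atlas E M p F"
  let ?S = "{y \<in> topspace E. leaf ?G y \<in> leaf ?G ` W}"
  have step: "\<exists>N. openin E N \<and> y \<in> N \<and> (\<forall>y'\<in>N. leaf ?G y' \<in> leaf ?G ` W)"
    if "(x, y) \<in> (same_plaque ?G)\<^sup>*" "x \<in> W" for x y
    using that
  proof (induction rule: rtrancl_induct)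
    case base
    then show ?case using W by blast
  next
    case (step y z)
    then obtain N where N: "openin E N" "y \<in> N" "\<forall>y'\<in>N. leaf ?G y' \<in> leaf ?G ` W" by blast
    obtain V \<xi> where V: "(V, \<xi>) \<in> ?G" "y \<in> V" "z \<in> V" "last_coord (\<xi> y) = last_coord (\<xi> z)"
      using step(2) by (auto simp: same_plaque_def)
    have oV: "openin E V" and hom: "homeomorphic_map (subtopology E V) euclidean \<xi>" and tV: "topspace (subtopology E V) = V"
      using pullback_atlas_chart[OF fol V(1)] by metis+
    have "openin (subtopology E V) (V \<inter> N)" using N(1) oV by (simp add: openin_open_subtopology openin_Int)
    then have "open (\<xi> ` (V \<inter> N))"
      using homeomorphic_imp_open_map[OF hom] unfolding open_map_def by auto
    then have T: "open (last_coord ` \<xi> ` (V \<inter> N))"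
      unfolding last_coord_def[abs_def] by (intro open_image_vec_nth)
    let ?U = "{u \<in> V. \<xi> u \<in> last_coord -` last_coord ` \<xi> ` (V \<inter> N)}"
    have "openin (subtopology E V) {u \<in> topspace (subtopology E V). \<xi> u \<in> last_coord -` last_coord ` \<xi> ` (V \<inter> N)}"
      by (rule openin_continuous_map_preimage[OF homeomorphic_imp_continuous_map[OF hom]])
        (use T open_vimage continuous_last_coord in auto)
    then have openO: "openin E ?U"
      unfolding tV using oV by (simp add: openin_open_subtopology)
    have "leaf ?G u \<in> leaf ?G ` W" if u: "u \<in> V" "\<xi> u \<in> last_coord -` last_coord ` \<xi> ` (V \<inter> N)" for u
    proof -
      obtain y' where y': "y' \<in> V" "y' \<in> N" "last_coord (\<xi> y') = last_coord (\<xi> u)" using u(2) by auto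
      have "leaf ?G y' = leaf ?G u" by (rule leaf_eq_plaque[OF V(1) y'(1) u(1) y'(3)])
      moreover have "leaf ?G y' \<in> leaf ?G ` W" using N(3) y'(2) by blast
      ultimately show ?thesis by simp
    qed
    moreover have "z \<in> ?U"
      using V N(2) by (auto simp: image_iff intro!: bexI[of _ y])
    ultimately have "openin E ?U \<and> z \<in> ?U \<and> (\<forall>y'\<in>?U. leaf ?G y' \<in> leaf ?G ` W)"
      using openO by simp
    then show ?case ..
  qed
  have "openin E ?S"
  proof (subst openin_subopen, intro ballI)
    fix y assume "y \<in> ?S"
    then obtain x where x: "x \<in> W" "leaf ?G x = leaf ?G y" by auto
    have "(x, y) \<in> (same_plaque ?G)\<^sup>*" using x(2) unfolding leaf_eq_iff .
    from step[OF this x(1)] obtain N where N: "openin E N" "y \<in> N" "\<forall>y'\<in>N. leaf ?G y' \<in> leaf ?G ` W"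
      by blast
    then show "\<exists>T. openin E T \<and> y \<in> T \<and> T \<subseteq> ?S" using openin_subset[OF N(1)] by blast
  qed
  then show ?thesis using openin_subset[OF W] by (auto simp: openin_leaf_space leaves_def)
qed

text \<open>Here the leaf space has to be a one-manifold: a transversal is mapped continuously and
  openly into a chart of the leaf space, that is, from an interval to the line, and such a map is
  injective. So different plaques near \<open>e\<close> belong to different leaves.\<close>

lemma leaf_space_chart_injective:
  fixes F :: "('a, 'm::{finite,linorder}) chart set"
  assumes fol: "codim_one_foliation M A F" and cov: "covering_map E M p"
    and one: "one_manifold (leaf_space E (pullback_atlas E M p F))"
    and e: "e \<in> topspace E" "(U, \<phi>) \<in> F" "p e \<in> U"
  obtains V where "openin E V" "e \<in> V" "p ` V \<subseteq> U"
    "\<And>x y. x \<in> V \<Longrightarrow> y \<in> V \<Longrightarrow> leaf (pullback_atlas E M p F) x = leaf (pullback_atlas E M p F) y \<longleftrightarrow>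
      last_coord (\<phi> (p x)) = last_coord (\<phi> (p y))"
proof -
  let ?G = "pullback_atlas E M p F"
  let ?B = "leaf_space E ?G"
  obtain V where V: "openin E V" "e \<in> V" "p ` V = U" "(V, \<phi> \<circ> p) \<in> ?G"
    using pullback_sheet[OF fol cov e] by blast
  define \<xi> where "\<xi> = \<phi> \<circ> p"
  have hom: "homeomorphic_map (subtopology E V) euclidean \<xi>" and tV: "topspace (subtopology E V) = V"
    using pullback_atlas_chart[OF fol V(4)] unfolding \<xi>_def by metis+
  obtain k where k: "continuous_map euclidean (subtopology E V) k" "\<And>z. k z \<in> V" "\<And>z. \<xi> (k z) = z"
    "\<And>x. x \<in> V \<Longrightarrow> k (\<xi> x) = x"
    by (rule chart_inverse[OF hom tV]) blast
  define s0 where "s0 = last_coord (\<xi> e)"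
  \<comment> \<open>The vertical line through \<open>e\<close> in the chart, parametrised by its
    height.\<close>
  define l where "l s = k (\<xi> e + (s - s0) *\<^sub>R axis (Max UNIV) 1)" for s
  have lV: "l s \<in> V" for s using k(2) by (simp add: l_def)
  have ll: "last_coord (\<xi> (l s)) = s" for s
    by (simp add: l_def k(3)) (simp add: last_coord_def s0_def axis_def)
  have "continuous_map euclidean euclidean (\<lambda>s. \<xi> e + (s - s0) *\<^sub>R axis (Max UNIV) 1 :: (real, 'm) vec)"
    by (simp add: continuous_intros)
  from continuous_map_compose[OF this k(1)] have lc: "continuous_map euclidean E l"
    by (simp add: o_def l_def[abs_def] continuous_map_in_subtopology)
  define f where "f s = leaf ?G (l s)" for s
  have fc: "continuous_map euclidean ?B f"
    using continuous_map_compose[OF lc continuous_map_leaf] by (simp add: o_def f_def[abs_def])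
  have leaf_f: "leaf ?G x = f (last_coord (\<xi> x))" if "x \<in> V" for x
    unfolding f_def by (rule leaf_eq_plaque[OF V(4) that lV]) (simp flip: \<xi>_def add: ll)
  have leB: "leaf ?G e \<in> topspace ?B" using e(1) by (simp add: topspace_leaf_space leaves_def)
  then obtain N where N: "openin ?B N" "leaf ?G e \<in> N" "subtopology ?B N homeomorphic_space euclideanreal"
    using one unfolding one_manifold_def by blast
  then obtain \<nu> where \<nu>: "homeomorphic_map (subtopology ?B N) euclideanreal \<nu>"
    using homeomorphic_space by blast
  have "open {s. f s \<in> N}" using openin_continuous_map_preimage[OF fc N(1)] by simp
  moreover have "f s0 \<in> N" using N(2) leaf_f[OF V(2)] by (simp add: s0_def)
  ultimately obtain d where d: "0 < d" "ball s0 d \<subseteq> {s. f s \<in> N}"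
    unfolding open_contains_ball by blast
  let ?J = "ball s0 d"
  have "continuous_map (top_of_set ?J) (subtopology ?B N) f"
    using d(2) continuous_map_from_subtopology[OF fc] by (auto simp: continuous_map_in_subtopology)
  from continuous_map_compose[OF this homeomorphic_imp_continuous_map[OF \<nu>]]
  have gc: "continuous_on ?J (\<nu> \<circ> f)" by simp
  have "open ((\<nu> \<circ> f) ` T)" if T: "open T" "T \<subseteq> ?J" for T
  proof -
    let ?W = "{v \<in> V. \<xi> v \<in> last_coord -` T}"
    have "openin (subtopology E V) {v \<in> topspace (subtopology E V). \<xi> v \<in> last_coord -` T}"
      by (rule openin_continuous_map_preimage[OF homeomorphic_imp_continuous_map[OF hom]])
        (use T open_vimage continuous_last_coord in auto)
    then have "openin E ?W"
      unfolding tV using V(1) by (simp add: openin_open_subtopology)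
    then have "openin ?B (leaf ?G ` ?W)" by (rule open_map_leaf[OF fol])
    moreover have "leaf ?G ` ?W = f ` T"
    proof
      show "leaf ?G ` ?W \<subseteq> f ` T" using leaf_f by auto
      show "f ` T \<subseteq> leaf ?G ` ?W" using lV ll by (auto simp: f_def)
    qed
    ultimately have "openin (subtopology ?B N) (f ` T)"
      using N(1) d(2) T(2) by (auto simp: openin_open_subtopology)
    then show ?thesis
      using homeomorphic_imp_open_map[OF \<nu>] unfolding open_map_def by (auto simp: image_comp)
  qed
  then have inj: "inj_on (\<nu> \<circ> f) ?J"
    using injective_eq_1d_open_map_UNIV[of ?J "\<nu> \<circ> f"] gc by (auto simp: is_interval_convex_1)
  let ?V = "{v \<in> V. \<xi> v \<in> last_coord -` ?J}"
  have "openin (subtopology E V) {v \<in> topspace (subtopology E V). \<xi> v \<in> last_coord -` ?J}"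
    by (rule openin_continuous_map_preimage[OF homeomorphic_imp_continuous_map[OF hom]])
      (use open_vimage continuous_last_coord in auto)
  then have "openin E ?V"
    unfolding tV using V(1) by (simp add: openin_open_subtopology)
  moreover have "e \<in> ?V" using V(2) d(1) by (simp add: s0_def)
  moreover have "p ` ?V \<subseteq> U" using V(3) by blast
  moreover have "leaf ?G x = leaf ?G y \<longleftrightarrow> last_coord (\<phi> (p x)) = last_coord (\<phi> (p y))"
    if xy: "x \<in> ?V" "y \<in> ?V" for x y
  proof
    assume "leaf ?G x = leaf ?G y"
    then have "(\<nu> \<circ> f) (last_coord (\<xi> x)) = (\<nu> \<circ> f) (last_coord (\<xi> y))" using leaf_f xy by simp
    then have "last_coord (\<xi> x) = last_coord (\<xi> y)" using inj_onD[OF inj] xy by simp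
    then show "last_coord (\<phi> (p x)) = last_coord (\<phi> (p y))" by (simp add: \<xi>_def)
  next
    assume "last_coord (\<phi> (p x)) = last_coord (\<phi> (p y))"
    then show "leaf ?G x = leaf ?G y" using leaf_eq_plaque[OF V(4)] xy by simp
  qed
  ultimately show ?thesis using that by blast
qed


section \<open>Level functions of simplices in a foliated manifold\<close>

text \<open>The levels of an affine function on a simplex are convex, and \<open>h\<close> carries
  segments in them to paths in the levels of \<open>f\<close>.\<close>

lemma conj_affine_level_path:
  assumes f: "conj_affine J f" and x: "x \<in> splx J" and y: "y \<in> splx J" and eq: "f x = f y"
  obtains g where "continuous_on {0..1::real} g" "g ` {0..1} \<subseteq> splx J" "g 0 = x" "g 1 = y"
    "\<And>t. t \<in> {0..1} \<Longrightarrow> f (g t) = f x"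
proof -
  obtain h h' where h: "face_homeo J h h'" "\<And>x. x \<in> splx J \<Longrightarrow> f (h x) = lin J (\<lambda>i. f (vtx i)) x"
    using conj_affineE1[OF f] by blast
  have h': "h' x \<in> splx J" "h' y \<in> splx J" using face_homeoD(2)[OF h(1) order.refl] x y by auto
  have hh: "h (h' x) = x" "h (h' y) = y" using face_homeoD(4)[OF h(1)] x y by auto
  let ?s = "\<lambda>t i. (1 - t) * h' x i + t * h' y i"
  have s: "?s t \<in> splx J" if "t \<in> {0..1}" for t using splx_convex[OF h'] that by simp
  have fx: "f x = lin J (\<lambda>i. f (vtx i)) (h' x)" "f y = lin J (\<lambda>i. f (vtx i)) (h' y)"
    using h(2)[OF h'(1)] h(2)[OF h'(2)] hh by simp_all
  have "f (h (?s t)) = f x" if "t \<in> {0..1}" for t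
  proof -
    have "f (h (?s t)) = (1 - t) * f x + t * f y"
      using h(2)[OF s[OF that]] by (simp only: lin_convex fx)
    then show ?thesis using eq by (simp add: algebra_simps)
  qed
  moreover have "continuous_on {0..1} (\<lambda>t. h (?s t))"
    by (rule continuous_on_compose2[OF face_homeoD(5)[OF h(1)]]) (use s in \<open>auto intro!: continuous_intros\<close>)
  moreover have "(\<lambda>t. h (?s t)) ` {0..1} \<subseteq> splx J" using face_homeoD(1)[OF h(1) order.refl s] by auto
  ultimately show ?thesis using that[of "\<lambda>t. h (?s t)"] hh by simp
qed

lemma conj_affine_slab_connected:
  assumes "conj_affine J f"
  shows "connected {x \<in> splx J. f x \<in> {c..d}}"
proof -
  obtain h h' where h: "face_homeo J h h'" "\<And>x. x \<in> splx J \<Longrightarrow> f (h x) = lin J (\<lambda>i. f (vtx i)) x"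
    using conj_affineE1[OF assms] by blast
  let ?S = "{x \<in> splx J. lin J (\<lambda>i. f (vtx i)) x \<in> {c..d}}"
  have "{x \<in> splx J. f x \<in> {c..d}} = h ` ?S"
  proof
    show "h ` ?S \<subseteq> {x \<in> splx J. f x \<in> {c..d}}" using h(2) face_homeoD(1)[OF h(1) order.refl] by auto
    show "{x \<in> splx J. f x \<in> {c..d}} \<subseteq> h ` ?S"
    proof
      fix x assume x: "x \<in> {x \<in> splx J. f x \<in> {c..d}}"
      then have "h' x \<in> splx J" "h (h' x) = x" using face_homeoD(2)[OF h(1) order.refl] face_homeoD(4)[OF h(1)] by auto
      then show "x \<in> h ` ?S" using h(2)[of "h' x"] x by (intro image_eqI[of _ _ "h' x"]) auto
    qed
  qed
  then show ?thesis
    using connected_continuous_image[OF continuous_on_subset[OF face_homeoD(5)[OF h(1)]] connected_lin_slab] by auto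
qed

text \<open>The curve crosses each level once and runs through the interior of the simplex except at
  the extreme levels. Interior points are those where local surjectivity says something.\<close>

lemma conj_affine_section:
  assumes f: "conj_affine J f" "finite J" and pq: "p \<in> J" "q \<in> J" and lt: "f (vtx p) < f (vtx q)"
    and min: "\<And>i. i \<in> J \<Longrightarrow> f (vtx p) \<le> f (vtx i) \<and> f (vtx i) \<le> f (vtx q)"
  obtains \<gamma> where "continuous_on {f (vtx p)..f (vtx q)} \<gamma>"
    "\<And>c. c \<in> {f (vtx p)..f (vtx q)} \<Longrightarrow> \<gamma> c \<in> splx J \<and> f (\<gamma> c) = c"
    "\<And>c i. c \<in> {f (vtx p)<..<f (vtx q)} \<Longrightarrow> i \<in> J \<Longrightarrow> 0 < \<gamma> c i"
proof -
  obtain h h' where h: "face_homeo J h h'" "\<And>x. x \<in> splx J \<Longrightarrow> f (h x) = lin J (\<lambda>i. f (vtx i)) x"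
    using conj_affineE1[OF f(1)] by blast
  let ?a = "f (vtx p)" and ?b = "f (vtx q)"
  let ?n = "real (card J)"
  have npos: "0 < ?n" using f(2) pq(1) by (simp add: card_gt_0_iff) blast
  have pq': "p \<noteq> q" using lt by auto
  define bc where "bc i = (if i \<in> J then 1 / ?n else 0)" for i
  have bc: "bc \<in> splx J" using npos by (auto simp: splx_def bc_def)
  let ?L = "lin J (\<lambda>i. f (vtx i))"
  define c0 where "c0 = ?L bc"
  define \<tau> where "\<tau> c = (c - ?a) / (?b - ?a)" for c
  have \<tau>01: "\<tau> c \<in> {0..1}" if "c \<in> {?a..?b}" for c using that lt by (auto simp: \<tau>_def divide_simps)
  have \<tau>int: "0 < \<tau> c" "\<tau> c < 1" if "c \<in> {?a<..<?b}" for c using that lt by (auto simp: \<tau>_def divide_simps)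
  have c0: "c0 \<in> {?a..?b}" unfolding c0_def using lin_le[OF bc, of "\<lambda>i. f (vtx i)" ?b] lin_ge[OF bc, of ?a "\<lambda>i. f (vtx i)"] min by auto
  define E where "E c = edge p q (\<tau> c)" for c
  have ES: "E c \<in> splx J" if "c \<in> {?a..?b}" for c unfolding E_def by (rule edge_in_splx[OF pq f(2) \<tau>01[OF that]])
  have LE: "?L (E c) = c" for c
  proof -
    have "?L (E c) = (1 - \<tau> c) * ?a + \<tau> c * ?b"
      unfolding E_def edge_def lin_convex using lin_vtx[OF f(2) pq(1)] lin_vtx[OF f(2) pq(2)] by simp
    also have "\<dots> = ?a + (?b - ?a) * \<tau> c" by (simp add: algebra_simps)
    also have "\<dots> = c" using lt by (simp add: \<tau>_def)
    finally show ?thesis .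
  qed
  \<comment> \<open>The edge from \<open>p\<close> to \<open>q\<close> meets each level once, but in
    the boundary. Adding a multiple of \<open>bc\<close>, the barycentre, minus \<open>E c0\<close>,
    the edge point on the same level, does not change the level and makes all coordinates positive.
    The factor \<open>m c\<close> is at most half of the smaller edge coordinate, so that no
    coordinate becomes negative.\<close>
  define m where "m c = min (\<tau> c) (1 - \<tau> c) / 2" for c
  define G where "G c i = E c i + m c * (bc i - E c0 i)" for c i
  have E0: "E c i = (if i = p then 1 - \<tau> c else if i = q then \<tau> c else 0)" for c i
    using pq' by (simp add: E_def edge_def vtx_def)
  have low: "E c i / 2 \<le> E c i + m c * (0 - E c0 i)" if c: "c \<in> {?a..?b}" for c i
  proof -
    have m0: "0 \<le> m c" using \<tau>01[OF c] by (simp add: m_def)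
    have "m c * E c0 i \<le> E c i / 2"
    proof (cases "i = p \<or> i = q")
      case True
      have "E c0 i \<le> 1" using splx_le_1[OF ES[OF c0] f(2)] .
      then have "m c * E c0 i \<le> m c" using m0 by (simp add: mult_left_le)
      also have "m c \<le> E c i / 2" using True pq' by (auto simp: m_def E0)
      finally show ?thesis .
    qed (simp add: E0)
    then show ?thesis by simp
  qed
  have G_low: "E c i / 2 + m c * bc i \<le> G c i" if "c \<in> {?a..?b}" for c i
    using low[OF that, of i] by (simp add: G_def algebra_simps)
  have nn: "0 \<le> E c i / 2" "0 \<le> m c * bc i" if "c \<in> {?a..?b}" for c i
    using splxD(1)[OF ES[OF that]] splxD(1)[OF bc] \<tau>01[OF that] by (auto simp: m_def)
  have GS: "G c \<in> splx J" if c: "c \<in> {?a..?b}" for c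
  proof -
    have "sum (G c) J = sum (E c) J + m c * (sum bc J - sum (E c0) J)"
      by (simp add: G_def[abs_def] sum.distrib sum_subtractf flip: sum_distrib_left)
    also have "\<dots> = 1" using splxD(3)[OF ES[OF c]] splxD(3)[OF ES[OF c0]] splxD(3)[OF bc] by simp
    finally have "sum (G c) J = 1" .
    moreover have "0 \<le> G c i" for i using G_low[OF c, of i] nn[OF c, of i] by linarith
    moreover have "G c i = 0" if "i \<notin> J" for i
      using splxD(2)[OF ES[OF c] that] splxD(2)[OF ES[OF c0] that] splxD(2)[OF bc that] by (simp add: G_def)
    ultimately show ?thesis by (simp add: splx_def)
  qed
  have LG: "?L (G c) = c" for c
  proof -
    have "?L (G c) = ?L (E c) + m c * (?L bc - ?L (E c0))"
      by (simp add: lin_def G_def[abs_def] algebra_simps sum.distrib sum_subtractf sum_distrib_left)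
    then show ?thesis by (simp add: LE c0_def)
  qed
  have Gpos: "0 < G c i" if c: "c \<in> {?a<..<?b}" "i \<in> J" for c i
  proof -
    have c': "c \<in> {?a..?b}" using c by simp
    have "0 < m c * bc i" using \<tau>int[OF c(1)] c(2) npos by (simp add: m_def bc_def)
    then show ?thesis using G_low[OF c', of i] nn[OF c', of i] by linarith
  qed
  have Gc: "continuous_on S G" for S
    unfolding G_def[abs_def] E0 m_def \<tau>_def
    by (intro continuous_on_coordinatewise_then_product) (use lt in \<open>auto intro!: continuous_intros\<close>)
  have pos: "0 < h x i" if x: "x \<in> splx J" "\<And>i. i \<in> J \<Longrightarrow> 0 < x i" and i: "i \<in> J" for x i
  proof (rule ccontr)
    assume "\<not> 0 < h x i"
    then have "h x i = 0" using splxD(1)[OF face_homeoD(1)[OF h(1) order.refl x(1)], of i] by simp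
    then have "h x \<in> splx (J \<inter> (J - {i}))"
      using face_homeoD(1)[OF h(1) order.refl x(1)] f(2) by (intro splx_subset_support) auto
    then have "h' (h x) \<in> splx (J - {i})" using face_homeoD(2)[OF h(1), of "J - {i}"] by (simp add: Int_absorb1 Diff_subset)
    then have "x i = 0" using face_homeoD(3)[OF h(1) x(1)] splxD(2)[of x "J - {i}" i] by simp
    then show False using x(2)[OF i] by simp
  qed
  show ?thesis
  proof
    show "continuous_on {?a..?b} (\<lambda>c. h (G c))"
      by (rule continuous_on_compose2[OF face_homeoD(5)[OF h(1)] Gc]) (use GS in auto)
    show "h (G c) \<in> splx J \<and> f (h (G c)) = c" if "c \<in> {?a..?b}" for c
      using face_homeoD(1)[OF h(1) order.refl GS[OF that]] h(2)[OF GS[OF that]] LG by simp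
    show "0 < h (G c) i" if "c \<in> {?a<..<?b}" "i \<in> J" for c i
      using that by (intro pos GS Gpos) auto
  qed
qed

lemma conj_affine_extremes:
  assumes f: "conj_affine J f" "finite J" "J \<noteq> {}"
  obtains p q where "p \<in> J" "q \<in> J" "f ` splx J = {f (vtx p)..f (vtx q)}"
    "\<And>i. i \<in> J \<Longrightarrow> f (vtx p) \<le> f (vtx i) \<and> f (vtx i) \<le> f (vtx q)"
proof -
  let ?V = "(\<lambda>i. f (vtx i)) ` J"
  have V: "finite ?V" "?V \<noteq> {}" using f by auto
  obtain p where p: "p \<in> J" "f (vtx p) = Min ?V" using Min_in[OF V] by auto
  obtain q where q: "q \<in> J" "f (vtx q) = Max ?V" using Max_in[OF V] by auto
  have mm: "f (vtx p) \<le> f (vtx i) \<and> f (vtx i) \<le> f (vtx q)" if "i \<in> J" for i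
    using that p q V by auto
  have "f ` splx J = {f (vtx p)..f (vtx q)}"
  proof
    show "f ` splx J \<subseteq> {f (vtx p)..f (vtx q)}"
    proof
      fix c assume "c \<in> f ` splx J"
      then obtain x where x: "x \<in> splx J" "c = f x" by blast
      obtain i j where "i \<in> J" "j \<in> J" "f (vtx i) \<le> f x" "f x \<le> f (vtx j)" by (rule conj_affine_bounds[OF f(1,2) x(1)])
      then show "c \<in> {f (vtx p)..f (vtx q)}" using mm x(2) by force
    qed
    have "connected (f ` splx J)"
      by (rule connected_continuous_image[OF conj_affine_continuous[OF f(1)] connected_splx])
    moreover have "f (vtx p) \<in> f ` splx J" "f (vtx q) \<in> f ` splx J" using p(1) q(1) vtx_in_splx[OF f(2)] by blast+
    ultimately show "{f (vtx p)..f (vtx q)} \<subseteq> f ` splx J" by (simp add: connected_contains_Icc)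
  qed
  then show ?thesis using that p q mm by blast
qed

text \<open>This is \<open>induced_rel\<close> for an arbitrary face and with an explicit connected
  set; see \<open>induced_rel_iff\<close>.\<close>

definition conn_rel :: "'a topology \<Rightarrow> ('a, 'm::{finite,linorder}) chart set \<Rightarrow> ((nat \<Rightarrow> real) \<Rightarrow> 'a) \<Rightarrow> nat set \<Rightarrow>
    (nat \<Rightarrow> real) \<Rightarrow> (nat \<Rightarrow> real) \<Rightarrow> bool" where
  "conn_rel M F \<Sigma> J x y \<longleftrightarrow>
     (\<exists>C. connected C \<and> C \<subseteq> splx J \<and> x \<in> C \<and> y \<in> C \<and> (\<exists>L\<in>leaves M F. \<Sigma> ` C \<subseteq> L))"

definition level_fn where
  "level_fn M F \<Sigma> J f \<longleftrightarrow> conj_affine J f \<and> (\<forall>x\<in>splx J. \<forall>y\<in>splx J. conn_rel M F \<Sigma> J x y \<longleftrightarrow> f x = f y)"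

definition loc_surj where
  "loc_surj F J \<Sigma> \<longleftrightarrow>
     (\<forall>(U, \<phi>)\<in>F. \<forall>p\<in>splx J. (\<forall>i\<in>J. 0 < p i) \<longrightarrow> \<Sigma> p \<in> U \<longrightarrow>
        (\<forall>W. openin (top_of_set (splx J)) W \<and> p \<in> W \<and> \<Sigma> ` W \<subseteq> U \<longrightarrow>
           (\<exists>T. open T \<and> last_coord (\<phi> (\<Sigma> p)) \<in> T \<and> T \<subseteq> (\<lambda>x. last_coord (\<phi> (\<Sigma> x))) ` W)))"

text \<open>A constant level function expresses \<open>contained_in_leaf\<close>, by
  \<open>contained_in_leaf_iff_const\<close>.\<close>

definition strong_fn where
  "strong_fn F J \<Sigma> f \<longleftrightarrow> (\<forall>x\<in>splx J. \<forall>y\<in>splx J. f x = f y) \<or> loc_surj F J \<Sigma>"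

lemma conn_rel_leaf:
  assumes "conn_rel M F \<Sigma> J x y"
  shows "leaf F (\<Sigma> x) = leaf F (\<Sigma> y)"
proof -
  obtain C L where "x \<in> C" "y \<in> C" "L \<in> leaves M F" "\<Sigma> ` C \<subseteq> L"
    using assms unfolding conn_rel_def by blast
  then show ?thesis using leaves_leaf by (metis image_subset_iff)
qed

lemma conn_rel_pathI:
  fixes g :: "real \<Rightarrow> nat \<Rightarrow> real"
  assumes "continuous_on {0..1} g" "g ` {0..1} \<subseteq> splx J" "g 0 = x" "g 1 = y"
    and "\<And>t. t \<in> {0..1} \<Longrightarrow> leaf F (\<Sigma> (g t)) = leaf F (\<Sigma> x)" and "\<Sigma> x \<in> topspace M"
  shows "conn_rel M F \<Sigma> J x y"
  unfolding conn_rel_def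
proof (intro exI conjI bexI)
  show "connected (g ` {0..1})" by (rule connected_continuous_image[OF assms(1)]) simp
  show "\<Sigma> ` g ` {0..1} \<subseteq> leaf F (\<Sigma> x)" using assms(5) by (auto simp: mem_leaf_iff)
  show "leaf F (\<Sigma> x) \<in> leaves M F" using assms(6) by (simp add: leaves_def)
qed (use assms in \<open>auto intro: image_eqI[of _ _ 0] image_eqI[of _ _ 1]\<close>)

lemma level_fnD:
  assumes "level_fn M F \<Sigma> J f"
  shows "conj_affine J f" "x \<in> splx J \<Longrightarrow> y \<in> splx J \<Longrightarrow> conn_rel M F \<Sigma> J x y \<longleftrightarrow> f x = f y"
    "x \<in> splx J \<Longrightarrow> y \<in> splx J \<Longrightarrow> f x = f y \<Longrightarrow> leaf F (\<Sigma> x) = leaf F (\<Sigma> y)"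
  using assms conn_rel_leaf unfolding level_fn_def by blast+

text \<open>Points with equal values of \<open>f\<close> are joined by a path on one level inside
  the common face. It lies in a leaf and also in the other facet, where it connects the two
  points.\<close>

lemma level_fn_agree:
  assumes 1: "level_fn M F \<Sigma> J f" and 2: "level_fn M F \<Sigma> J' f'" and J: "finite J" "finite J'"
    and \<Sigma>: "\<Sigma> ` splx J \<subseteq> topspace M"
    and x: "x \<in> splx J" "x \<in> splx J'" and y: "y \<in> splx J" "y \<in> splx J'" and eq: "f x = f y"
  shows "f' x = f' y"
proof -
  have g: "conj_affine (J \<inter> J') f" by (rule conj_affine_subset[OF level_fnD(1)[OF 1]]) (use J in auto)
  have xy: "x \<in> splx (J \<inter> J')" "y \<in> splx (J \<inter> J')" using x y splx_Int[OF J] by auto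
  obtain \<gamma> where \<gamma>: "continuous_on {0..1::real} \<gamma>" "\<gamma> ` {0..1} \<subseteq> splx (J \<inter> J')" "\<gamma> 0 = x" "\<gamma> 1 = y"
    "\<And>t. t \<in> {0..1} \<Longrightarrow> f (\<gamma> t) = f x"
    using conj_affine_level_path[OF g xy eq] by blast
  have sub: "splx (J \<inter> J') \<subseteq> splx J" "splx (J \<inter> J') \<subseteq> splx J'" using splx_Int[OF J] by auto
  have "conn_rel M F \<Sigma> J' x y"
  proof (rule conn_rel_pathI[OF \<gamma>(1) _ \<gamma>(3,4)])
    show "\<gamma> ` {0..1} \<subseteq> splx J'" using \<gamma>(2) sub by blast
    show "leaf F (\<Sigma> (\<gamma> t)) = leaf F (\<Sigma> x)" if "t \<in> {0..1}" for t
      using level_fnD(3)[OF 1 _ x(1) \<gamma>(5)[OF that]] \<gamma>(2) sub that by blast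
    show "\<Sigma> x \<in> topspace M" using \<Sigma> x by blast
  qed
  then show ?thesis using level_fnD(2)[OF 2 x(2) y(2)] by simp
qed

lemma splx_lift:
  assumes cov: "covering_map E M p" and T: "finite T" "T \<noteq> {}"
    and \<Sigma>: "continuous_map (top_of_set (splx T)) M \<Sigma>"
  obtains S where "continuous_map (top_of_set (splx T)) E S" "\<And>x. x \<in> splx T \<Longrightarrow> p (S x) = \<Sigma> x"
proof -
  obtain i where i: "i \<in> T" using T by blast
  let ?d = "vtx i"
  have d: "?d \<in> splx T" using i T by (simp add: vtx_in_splx)
  then have "\<Sigma> ?d \<in> topspace M" using continuous_map_image_subset_topspace[OF \<Sigma>] by auto
  then obtain e where e: "e \<in> topspace E" "p e = \<Sigma> ?d" using covering_mapD(2)[OF cov] by force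
  \<comment> \<open>The contraction to the vertex \<open>?d\<close> is clamped to times between 0
    and 1, because the lifting lemma expects it at all real times.\<close>
  define c where "c z = (\<lambda>l. (1 - max 0 (min 1 (snd z))) * ?d l + max 0 (min 1 (snd z)) * fst z l)"
    for z :: "(nat \<Rightarrow> real) \<times> real"
  have cc: "continuous_on (splx T \<times> UNIV) c"
    unfolding c_def[abs_def]
  proof (intro continuous_on_coordinatewise_then_product)
    fix l
    have "continuous_on (splx T \<times> UNIV) (\<lambda>z. fst z l)" for l :: nat
      by (rule continuous_on_product_then_coordinatewise) (intro continuous_intros)
    then show "continuous_on (splx T \<times> UNIV) (\<lambda>z. (1 - max 0 (min 1 (snd z))) * ?d l + max 0 (min 1 (snd z)) * fst z l)"
      by (intro continuous_intros)
  qed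
  have "c ` (splx T \<times> UNIV) \<subseteq> splx T"
    using splx_convex[OF d] by (auto simp: c_def)
  moreover have "prod_topology (top_of_set (splx T)) euclideanreal = top_of_set (splx T \<times> UNIV)"
    using prod_topology_subtopology_eu[of "splx T" "UNIV :: real set"] by (simp add: subtopology_UNIV)
  ultimately have c: "continuous_map (prod_topology (top_of_set (splx T)) euclideanreal) (top_of_set (splx T)) c"
    using cc by (auto simp: continuous_map_in_subtopology)
  have "\<exists>g. continuous_map (top_of_set (splx T)) E g \<and> (\<forall>x\<in>splx T. p (g x) = \<Sigma> x) \<and> g ?d = e"
    by (rule covering_lift_contractible[OF cov \<Sigma> c, of ?d e]) (use d e in \<open>auto simp: c_def algebra_simps\<close>)
  then show ?thesis using that by blast
qed

lemma loc_surjD: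
  assumes ls: "loc_surj F J \<Sigma>" and U: "(U, \<phi>) \<in> F"
    and z: "z \<in> splx J" "\<And>i. i \<in> J \<Longrightarrow> 0 < z i" "\<Sigma> z \<in> U"
    and W: "openin (top_of_set (splx J)) W" "z \<in> W" "\<Sigma> ` W \<subseteq> U"
  shows "\<exists>T. open T \<and> last_coord (\<phi> (\<Sigma> z)) \<in> T \<and> T \<subseteq> (\<lambda>x. last_coord (\<phi> (\<Sigma> x))) ` W"
proof -
  have "\<forall>z\<in>splx J. (\<forall>i\<in>J. 0 < z i) \<longrightarrow> \<Sigma> z \<in> U \<longrightarrow>
        (\<forall>W. openin (top_of_set (splx J)) W \<and> z \<in> W \<and> \<Sigma> ` W \<subseteq> U \<longrightarrow>
           (\<exists>T. open T \<and> last_coord (\<phi> (\<Sigma> z)) \<in> T \<and> T \<subseteq> (\<lambda>x. last_coord (\<phi> (\<Sigma> x))) ` W))"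
    using bspec[OF ls[unfolded loc_surj_def] U] by simp
  from bspec[OF this z(1)] show ?thesis using z(2,3) W by simp
qed

section \<open>Levels of a simplex lifted to a covering\<close>

locale fol_cover =
  fixes M :: "'a topology" and A F :: "('a, 'm::{finite,linorder}) chart set" and E :: "'b topology" and p :: "'b \<Rightarrow> 'a"
  assumes fol: "codim_one_foliation M A F" and sc: "second_countable M" and cov: "covering_map E M p"
begin

abbreviation q :: "'b \<Rightarrow> 'b set" where "q \<equiv> leaf (pullback_atlas E M p F)"

text \<open>Two points on a level are joined by a path on this level, hence in a leaf below, and
  \<open>leaf_pullback_path\<close> applies to its lift.\<close>

lemma lift_level:
  assumes lev: "level_fn M F \<Sigma> J f" and T: "J \<subseteq> T" "finite T"
    and S: "continuous_map (top_of_set (splx T)) E S" and pS: "\<And>x. x \<in> splx T \<Longrightarrow> p (S x) = \<Sigma> x"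
    and xy: "x \<in> splx J" "y \<in> splx J" "f x = f y"
  shows "q (S x) = q (S y)"
proof -
  obtain \<gamma> where \<gamma>: "continuous_on {0..1::real} \<gamma>" "\<gamma> ` {0..1} \<subseteq> splx J" "\<gamma> 0 = x" "\<gamma> 1 = y"
    "\<And>t. t \<in> {0..1} \<Longrightarrow> f (\<gamma> t) = f x"
    using conj_affine_level_path[OF level_fnD(1)[OF lev] xy] by blast
  have JT: "splx J \<subseteq> splx T" by (rule splx_mono[OF T])
  have "continuous_map (top_of_set {0..1}) (top_of_set (splx T)) \<gamma>"
    using \<gamma>(1,2) JT by (auto simp: continuous_map_in_subtopology)
  from continuous_map_compose[OF this S] have c: "continuous_map (top_of_set {0..1}) E (S \<circ> \<gamma>)" .
  have SE: "S x \<in> topspace E" using continuous_map_image_subset_topspace[OF S] xy(1) JT by auto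
  have "\<Sigma> x \<in> topspace M" using covering_mapD(2)[OF cov] SE pS[of x] xy(1) JT by force
  then have L: "leaf F (\<Sigma> x) \<in> leaves M F" by (simp add: leaves_def)
  have "q ((S \<circ> \<gamma>) 0) = q ((S \<circ> \<gamma>) 1)"
  proof (rule leaf_pullback_path[OF fol sc cov L c])
    fix t :: real assume t: "t \<in> {0..1}"
    then have g: "\<gamma> t \<in> splx J" using \<gamma>(2) by blast
    have "leaf F (\<Sigma> x) = leaf F (\<Sigma> (\<gamma> t))"
      by (rule level_fnD(3)[OF lev xy(1) g]) (simp add: \<gamma>(5)[OF t])
    then show "p ((S \<circ> \<gamma>) t) \<in> leaf F (\<Sigma> x)" using pS g JT by (auto simp: mem_leaf_iff)
  qed
  then show ?thesis using \<gamma>(3,4) by simp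
qed

end

text \<open>Were the end values equal, the value \<open>z\<close> halfway between them and another
  value \<open>w s\<close> would be taken on both sides of \<open>s\<close>. The lemma reaches the
  extreme levels of a simplex, about which local surjectivity is silent.\<close>

lemma inj_on_closed_interval:
  fixes w :: "real \<Rightarrow> real"
  assumes w: "continuous_on {u..v} w" and inj: "inj_on w {u<..<v}" and "u < v"
  shows "w u \<noteq> w v"
proof
  assume eq: "w u = w v"
  define s1 s2 where "s1 = u + (v - u) / 3" and "s2 = u + 2 * (v - u) / 3"
  have s12: "s1 \<in> {u<..<v}" "s2 \<in> {u<..<v}" "s1 < s2" using \<open>u < v\<close> by (auto simp: s1_def s2_def field_simps)
  have "w s1 \<noteq> w s2" using inj_onD[OF inj _ s12(1,2)] s12(3) by auto
  then have "w s1 \<noteq> w u \<or> w s2 \<noteq> w u" by auto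
  then obtain s where s: "s \<in> {u<..<v}" "w s \<noteq> w u" using s12(1,2) by blast
  define z where "z = (w s + w u) / 2"
  have zne: "z \<noteq> w u" "z \<noteq> w s" using s by (auto simp: z_def)
  have c: "connected (w ` {u..s})" "connected (w ` {s..v})"
    using s by (auto intro!: connected_continuous_image continuous_on_subset[OF w])
  have "z \<in> w ` {u..s}"
  proof -
    have "w u \<in> w ` {u..s}" "w s \<in> w ` {u..s}" using s by auto
    moreover have "w u \<le> z \<and> z \<le> w s \<or> w s \<le> z \<and> z \<le> w u" by (auto simp: z_def)
    ultimately show ?thesis using c(1) by (meson connectedD_interval)
  qed
  then obtain t1 where t1: "t1 \<in> {u..s}" "w t1 = z" by blast
  have "z \<in> w ` {s..v}"
  proof -
    have "w v \<in> w ` {s..v}" "w s \<in> w ` {s..v}" using s by auto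
    moreover have "w v \<le> z \<and> z \<le> w s \<or> w s \<le> z \<and> z \<le> w v" by (auto simp: z_def eq)
    ultimately show ?thesis using c(2) by (meson connectedD_interval)
  qed
  then obtain t2 where t2: "t2 \<in> {s..v}" "w t2 = z" by blast
  have "t1 \<noteq> u" "t1 \<noteq> s" "t2 \<noteq> v" "t2 \<noteq> s" using t1 t2 zne eq by auto
  then have t12: "t1 \<in> {u<..<v}" "t2 \<in> {u<..<v}" "t1 < t2" using t1 t2 s(1) by auto
  then have "t1 = t2" using inj_onD[OF inj _ t12(1,2)] t1(2) t2(2) by simp
  with t12(3) show False by simp
qed

context fol_cover
begin

text \<open>Along a transversal the leaf map is an open map between intervals.\<close>

lemma level_local_injective:
  assumes one: "one_manifold (leaf_space E (pullback_atlas E M p F))"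
    and lev: "level_fn M F \<Sigma> J f" and st: "strong_fn F J \<Sigma> f" and T: "J \<subseteq> T" "finite T"
    and S: "continuous_map (top_of_set (splx T)) E S" and pS: "\<And>x. x \<in> splx T \<Longrightarrow> p (S x) = \<Sigma> x"
    and z: "z \<in> splx J"
  obtains \<epsilon> where "0 < \<epsilon>" "\<And>x y. x \<in> splx J \<Longrightarrow> y \<in> splx J \<Longrightarrow> \<bar>f x - f z\<bar> < \<epsilon> \<Longrightarrow> \<bar>f y - f z\<bar> < \<epsilon> \<Longrightarrow>
    q (S x) = q (S y) \<Longrightarrow> f x = f y"
proof (cases "\<forall>x\<in>splx J. \<forall>y\<in>splx J. f x = f y")
  case True
  show ?thesis
  proof (rule that[of 1])
    fix x y assume "x \<in> splx J" "y \<in> splx J"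
    then show "f x = f y" using True by blast
  qed simp
next
  case False
  then have ls: "loc_surj F J \<Sigma>" using st unfolding strong_fn_def by blast
  have fJ: "finite J" using T finite_subset by blast
  have JT: "splx J \<subseteq> splx T" by (rule splx_mono[OF T])
  have gf: "conj_affine J f" using level_fnD(1)[OF lev] .
  have "J \<noteq> {}" using z by auto
  then obtain i0 i1 where ext: "i0 \<in> J" "i1 \<in> J" "f ` splx J = {f (vtx i0)..f (vtx i1)}"
    "\<And>i. i \<in> J \<Longrightarrow> f (vtx i0) \<le> f (vtx i) \<and> f (vtx i) \<le> f (vtx i1)"
    using conj_affine_extremes[OF gf fJ] by metis
  define a b where "a = f (vtx i0)" and "b = f (vtx i1)"
  have rng: "f x \<in> {a..b}" if "x \<in> splx J" for x using that ext(3) by (auto simp: a_def b_def)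
  have lt: "a < b"
  proof (rule ccontr)
    assume "\<not> a < b"
    then have "f x = a" if "x \<in> splx J" for x using rng[OF that] by simp
    with False show False by simp
  qed
  obtain \<gamma> where \<gamma>c: "continuous_on {a..b} \<gamma>" and \<gamma>: "\<And>c. c \<in> {a..b} \<Longrightarrow> \<gamma> c \<in> splx J \<and> f (\<gamma> c) = c"
    and \<gamma>int: "\<And>c i. c \<in> {a<..<b} \<Longrightarrow> i \<in> J \<Longrightarrow> 0 < \<gamma> c i"
    using conj_affine_section[OF gf fJ ext(1,2) lt[unfolded a_def b_def] ext(4)] unfolding a_def b_def by metis
  define c where "c = f z"
  have c: "c \<in> {a..b}" using rng[OF z] by (simp add: c_def)
  have SE: "S x \<in> topspace E" if "x \<in> splx J" for x
    using continuous_map_image_subset_topspace[OF S] that JT by auto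
  have "\<Sigma> (\<gamma> c) \<in> topspace M" using covering_mapD(2)[OF cov] SE[of "\<gamma> c"] pS[of "\<gamma> c"] \<gamma>[OF c] JT by force
  then obtain U \<phi> where U: "(U, \<phi>) \<in> F" "\<Sigma> (\<gamma> c) \<in> U" by (rule foliation_cover[OF fol])
  have pU: "p (S (\<gamma> c)) \<in> U" using U(2) pS \<gamma>[OF c] JT by auto
  obtain V where V: "openin E V" "S (\<gamma> c) \<in> V" "p ` V \<subseteq> U"
    "\<And>x y. x \<in> V \<Longrightarrow> y \<in> V \<Longrightarrow> q x = q y \<longleftrightarrow> last_coord (\<phi> (p x)) = last_coord (\<phi> (p y))"
    using leaf_space_chart_injective[OF fol cov one SE U(1) pU] \<gamma>[OF c] by blast
  have "continuous_map (top_of_set {a..b}) (top_of_set (splx T)) \<gamma>"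
    using \<gamma>c \<gamma> JT by (auto simp: continuous_map_in_subtopology)
  from continuous_map_compose[OF this S] have S\<gamma>: "continuous_map (top_of_set {a..b}) E (S \<circ> \<gamma>)" .
  have "openin (top_of_set {a..b}) {t \<in> {a..b}. S (\<gamma> t) \<in> V}"
    using openin_continuous_map_preimage[OF S\<gamma> V(1)] by simp
  then have "\<exists>e>0. \<forall>t\<in>{a..b}. dist t c < e \<longrightarrow> t \<in> {t \<in> {a..b}. S (\<gamma> t) \<in> V}"
    using c V(2) unfolding openin_euclidean_subtopology_iff by simp
  then obtain e where e: "0 < e" "\<And>t. t \<in> {a..b} \<Longrightarrow> \<bar>t - c\<bar> < e \<Longrightarrow> S (\<gamma> t) \<in> V"
    by (auto simp: dist_real_def)
  let ?J = "{a..b} \<inter> ball c e"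
  let ?J1 = "{a<..<b} \<inter> ball c e"
  have JV: "S (\<gamma> t) \<in> V" if "t \<in> ?J" for t using e(2)[of t] that by (simp add: dist_real_def abs_minus_commute)
  \<comment> \<open>The transverse coordinate depends only on the level, by \<open>w_level\<close>,
    so it can be studied along the curve \<open>\<gamma>\<close>.\<close>
  define w where "w t = last_coord (\<phi> (p (S (\<gamma> t))))" for t
  have wc: "continuous_on ?J w"
  proof -
    have "continuous_map (top_of_set ?J) (subtopology M U) (p \<circ> (S \<circ> \<gamma>))"
      unfolding continuous_map_in_subtopology
    proof (intro conjI)
      show "continuous_map (top_of_set ?J) M (p \<circ> (S \<circ> \<gamma>))"
        by (rule continuous_map_compose[OF continuous_map_from_subtopology_mono[OF S\<gamma>] covering_mapD(1)[OF cov]]) auto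
      show "(p \<circ> (S \<circ> \<gamma>)) \<in> topspace (top_of_set ?J) \<rightarrow> U" using JV V(3) by auto
    qed
    from continuous_map_compose[OF this homeomorphic_imp_continuous_map[OF foliation_chart(4)[OF fol U(1)]]]
    have "continuous_on ?J (\<lambda>t. \<phi> (p (S (\<gamma> t))))" by (simp add: o_def)
    then show ?thesis unfolding w_def
      by (rule continuous_on_compose2[OF continuous_last_coord[of UNIV]]) simp
  qed
  have w_level: "last_coord (\<phi> (\<Sigma> x)) = w (f x)" if x: "x \<in> splx J" "S x \<in> V" "f x \<in> ?J" for x
  proof -
    have "q (S x) = q (S (\<gamma> (f x)))"
      by (rule lift_level[OF lev T S pS x(1)]) (use \<gamma>[of "f x"] x in auto)
    then have "last_coord (\<phi> (p (S x))) = w (f x)" using V(4)[OF x(2) JV[OF x(3)]] by (simp add: w_def)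
    then show ?thesis using pS[of x] x(1) JT by auto
  qed
  \<comment> \<open>Near \<open>\<gamma> t\<close> all points on the level \<open>r\<close> have
    transverse coordinate \<open>w r\<close>. So local surjectivity of the simplex at the interior
    point \<open>\<gamma> t\<close> says that \<open>w\<close> is open at \<open>t\<close>.\<close>
  have opn: "open (w ` O1)" if O1: "open O1" "O1 \<subseteq> ?J1" for O1
  proof (subst open_subopen, intro ballI)
    fix y assume "y \<in> w ` O1"
    then obtain t where t: "t \<in> O1" "y = w t" by blast
    then have tJ: "t \<in> ?J1" "t \<in> ?J" "t \<in> {a..b}" "t \<in> {a<..<b}" using O1 by auto
    let ?W = "{x \<in> splx J. S x \<in> V} \<inter> (splx J \<inter> f -` O1)"
    have "continuous_map (top_of_set (splx J)) E S"
      by (rule continuous_map_from_subtopology_mono[OF S JT])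
    from openin_continuous_map_preimage[OF this V(1)] have "openin (top_of_set (splx J)) {x \<in> splx J. S x \<in> V}" by simp
    moreover have "openin (top_of_set (splx J)) (splx J \<inter> f -` O1)"
      by (rule continuous_openin_preimage_gen[OF conj_affine_continuous[OF gf] O1(1)])
    ultimately have W: "openin (top_of_set (splx J)) ?W" by (rule openin_Int)
    have gW: "\<gamma> t \<in> ?W" using \<gamma>[OF tJ(3)] JV[OF tJ(2)] t(1) by simp
    have W\<Sigma>: "\<Sigma> ` ?W \<subseteq> U"
    proof (intro image_subsetI)
      fix x assume "x \<in> ?W"
      then have "x \<in> splx T" "S x \<in> V" using JT by auto
      then show "\<Sigma> x \<in> U" using V(3) pS by (metis image_subset_iff)
    qed
    have gU: "\<Sigma> (\<gamma> t) \<in> U" using W\<Sigma> gW by blast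
    have gS: "\<gamma> t \<in> splx J" using \<gamma>[OF tJ(3)] by simp
    have "\<exists>T. open T \<and> last_coord (\<phi> (\<Sigma> (\<gamma> t))) \<in> T \<and> T \<subseteq> (\<lambda>x. last_coord (\<phi> (\<Sigma> x))) ` ?W"
      by (rule loc_surjD[OF ls U(1) gS \<gamma>int[OF tJ(4)] gU W gW W\<Sigma>])
    then obtain O2 where O2: "open O2" "last_coord (\<phi> (\<Sigma> (\<gamma> t))) \<in> O2" "O2 \<subseteq> (\<lambda>x. last_coord (\<phi> (\<Sigma> x))) ` ?W"
      by blast
    have "y \<in> O2" using O2(2) w_level[of "\<gamma> t"] gW \<gamma>[OF tJ(3)] tJ(2) t(2) by simp
    moreover have "O2 \<subseteq> w ` O1"
    proof
      fix v assume "v \<in> O2"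
      then obtain x where x: "x \<in> ?W" "v = last_coord (\<phi> (\<Sigma> x))" using O2(3) by blast
      then have "f x \<in> O1" "f x \<in> ?J" using O1(2) by auto
      then show "v \<in> w ` O1" using w_level[of x] x by auto
    qed
    ultimately show "\<exists>T. open T \<and> y \<in> T \<and> T \<subseteq> w ` O1" using O2(1) by blast
  qed
  have int1: "is_interval ?J1"
    by (simp add: is_interval_convex_1 convex_Int)
  have "continuous_on ?J1 w" by (rule continuous_on_subset[OF wc]) auto
  from injective_eq_1d_open_map_UNIV[OF this int1] have inj1: "inj_on w ?J1"
    using opn by blast
  have inj: "w s \<noteq> w t" if st: "s < t" "s \<in> ?J" "t \<in> ?J" for s t
  proof (rule inj_on_closed_interval[OF _ _ st(1)])
    have "is_interval ?J" by (simp add: is_interval_convex_1 convex_Int)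
    then have sub: "{s..t} \<subseteq> ?J" using st by (meson atLeastAtMost_iff mem_is_interval_1_I subsetI)
    then show "continuous_on {s..t} w" by (rule continuous_on_subset[OF wc])
    have "{s<..<t} \<subseteq> ?J1"
    proof
      fix r assume r: "r \<in> {s<..<t}"
      then have "r \<in> {s..t}" by simp
      then have "r \<in> ?J" using sub by blast
      then show "r \<in> ?J1" using r st by auto
    qed
    then show "inj_on w {s<..<t}" by (rule inj_on_subset[OF inj1])
  qed
  show ?thesis
  proof
    show "0 < e" by (rule e(1))
    fix x y assume x: "x \<in> splx J" and y: "y \<in> splx J" and xe: "\<bar>f x - f z\<bar> < e" and ye: "\<bar>f y - f z\<bar> < e" and eq: "q (S x) = q (S y)"
    have fJ': "f x \<in> ?J" "f y \<in> ?J" using rng[OF x] rng[OF y] xe ye by (auto simp: c_def dist_real_def abs_minus_commute)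
    have "q (S x) = q (S (\<gamma> (f x)))"
      by (rule lift_level[OF lev T S pS x]) (use \<gamma>[of "f x"] fJ' in auto)
    moreover have "q (S y) = q (S (\<gamma> (f y)))"
      by (rule lift_level[OF lev T S pS y]) (use \<gamma>[of "f y"] fJ' in auto)
    ultimately have "w (f x) = w (f y)"
      using V(4)[OF JV[OF fJ'(1)] JV[OF fJ'(2)]] eq by (simp add: w_def)
    then show "f x = f y" using inj[of "f x" "f y"] inj[of "f y" "f x"] fJ' by (metis linorder_neqE)
  qed
qed

end

section \<open>Horns of strongly transverse simplices\<close>

locale strong_facets = facets N k f + fol_cover M A F E p
  for N k f and M :: "'a topology" and A F :: "('a, 'm::{finite,linorder}) chart set"
    and E :: "'b topology" and p :: "'b \<Rightarrow> 'a" +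
  fixes \<Sigma> :: "(nat \<Rightarrow> real) \<Rightarrow> 'a" and S :: "(nat \<Rightarrow> real) \<Rightarrow> 'b"
  assumes one: "one_manifold (leaf_space E (pullback_atlas E M p F))"
    and lev: "j \<in> N \<Longrightarrow> level_fn M F \<Sigma> (I j) (f j)"
    and strong: "j \<in> N \<Longrightarrow> strong_fn F (I j) \<Sigma> (f j)"
    and Sc: "continuous_map (top_of_set (splx (insert k N))) E S"
    and pS: "x \<in> splx (insert k N) \<Longrightarrow> p (S x) = \<Sigma> x"
begin

lemma finT: "finite (insert k N)" and IT: "I j \<subseteq> insert k N"
  using N by auto

lemma level_leaf:
  assumes "j \<in> N" "x \<in> splx (I j)" "y \<in> splx (I j)" "f j x = f j y"
  shows "q (S x) = q (S y)"
  by (rule lift_level[OF lev IT finT Sc pS]) (use assms in auto)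

lemma local_inj:
  assumes "j \<in> N" "z \<in> splx (I j)"
  obtains \<epsilon> where "0 < \<epsilon>" "\<And>x y. x \<in> splx (I j) \<Longrightarrow> y \<in> splx (I j) \<Longrightarrow> \<bar>f j x - f j z\<bar> < \<epsilon> \<Longrightarrow>
    \<bar>f j y - f j z\<bar> < \<epsilon> \<Longrightarrow> q (S x) = q (S y) \<Longrightarrow> f j x = f j y"
  by (rule level_local_injective[OF one lev strong IT finT Sc pS]) (use assms in auto)

text \<open>The times at which the curves are on the same level form a closed set, which is open by
  \<open>local_inj\<close>.\<close>

lemma curves_agree:
  assumes j: "j \<in> N" and a: "continuous_on {0..s} a" "a ` {0..s} \<subseteq> splx (I j)"
    and b: "continuous_on {0..s} b" "b ` {0..s} \<subseteq> splx (I j)" and "0 \<le> s"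
    and leaf: "\<And>t. t \<in> {0..s::real} \<Longrightarrow> q (S (a t)) = q (S (b t))" and start: "f j (a 0) = f j (b 0)"
  shows "f j (a s) = f j (b s)"
proof -
  have fc: "continuous_on (splx (I j)) (f j)" by (rule conj_affine_continuous[OF conj_affine_f[OF j]])
  have fa: "continuous_on {0..s} (\<lambda>t. f j (a t))" by (rule continuous_on_compose2[OF fc a])
  have fb: "continuous_on {0..s} (\<lambda>t. f j (b t))" by (rule continuous_on_compose2[OF fc b])
  let ?Z = "{t \<in> {0..s}. f j (a t) - f j (b t) = 0}"
  have Zeq: "?Z = {0..s} \<inter> (\<lambda>t. f j (a t) - f j (b t)) -` {0}" by auto
  have cl: "closedin (top_of_set {0..s}) ?Z"
    unfolding Zeq by (intro continuous_closedin_preimage continuous_on_diff fa fb) auto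
  have op: "openin (top_of_set {0..s}) ?Z"
  proof (subst openin_subopen, intro ballI)
    fix t assume t: "t \<in> ?Z"
    then have at: "a t \<in> splx (I j)" using a(2) by auto
    obtain \<epsilon> where \<epsilon>: "0 < \<epsilon>" "\<And>x y. x \<in> splx (I j) \<Longrightarrow> y \<in> splx (I j) \<Longrightarrow> \<bar>f j x - f j (a t)\<bar> < \<epsilon> \<Longrightarrow>
      \<bar>f j y - f j (a t)\<bar> < \<epsilon> \<Longrightarrow> q (S x) = q (S y) \<Longrightarrow> f j x = f j y"
      using local_inj[OF j at] by metis
    let ?B = "ball (f j (a t)) \<epsilon>"
    let ?O = "({0..s} \<inter> (\<lambda>t. f j (a t)) -` ?B) \<inter> ({0..s} \<inter> (\<lambda>t. f j (b t)) -` ?B)"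
    have "openin (top_of_set {0..s}) ?O"
      by (intro openin_Int continuous_openin_preimage_gen fa fb) auto
    moreover have "t \<in> ?O" using t \<epsilon>(1) by auto
    moreover have "?O \<subseteq> ?Z"
    proof
      fix r assume r: "r \<in> ?O"
      then have "a r \<in> splx (I j)" "b r \<in> splx (I j)" using a(2) b(2) by blast+
      then have "f j (a r) = f j (b r)"
        using \<epsilon>(2)[of "a r" "b r"] leaf[of r] r by (auto simp: dist_real_def abs_minus_commute)
      with r show "r \<in> ?Z" by simp
    qed
    ultimately show "\<exists>T. openin (top_of_set {0..s}) T \<and> t \<in> T \<and> T \<subseteq> ?Z" by blast
  qed
  have "0 \<in> ?Z" using start \<open>0 \<le> s\<close> by simp
  moreover have "connected {0..s}" by simp
  ultimately have "?Z = {0..s}"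
    using cl op unfolding connected_clopen by blast
  moreover have "s \<in> {0..s}" using \<open>0 \<le> s\<close> by simp
  ultimately show ?thesis by (smt (verit) mem_Collect_eq)
qed

end

context facets
begin

lemma vtx_in_I: "vtx k \<in> splx (I j)"
  using vtx_in_splx[OF I_finite] by simp

lemma level_k:
  assumes "i \<in> N" "j \<in> N" "l \<in> N" "i \<noteq> j" "i \<noteq> l" "t \<in> {0..1}"
  shows "f j (edge k i t) = f j (vtx k) \<longleftrightarrow> f l (edge k i t) = f l (vtx k)"
  by (rule levels) (use assms vtx_in_I edge_in in auto)

text \<open>Along the first edge the values run monotonically from that of the apex to the common
  value, so each occurs on the second edge before \<open>t\<close>. Since the common value differs
  from that of the apex, \<open>f j\<close> is injective on the second edge, which makes the
  matching \<open>\<kappa>\<close> unique and continuous.\<close>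

lemma edge_match:
  assumes j: "j \<in> N" and ab: "a \<in> N" "b \<in> N" "a \<noteq> j" "b \<noteq> j" and st: "s \<in> {0..1}" "t \<in> {0..1}"
    and eq: "f j (edge k a s) = f j (edge k b t)" and ne: "f j (edge k a s) \<noteq> f j (vtx k)"
  obtains \<kappa> where "continuous_on {0..s} \<kappa>" "\<kappa> ` {0..s} \<subseteq> {0..t}" "\<kappa> 0 = 0" "\<kappa> s = t"
    "\<And>x. x \<in> {0..s} \<Longrightarrow> f j (edge k a x) = f j (edge k b (\<kappa> x))"
proof -
  let ?A = "\<lambda>x. f j (edge k a x)" and ?B = "\<lambda>x. f j (edge k b x)"
  have ka: "k \<noteq> a" "k \<noteq> b" using k ab by auto
  obtain u where u: "continuous_on {0..1} u" "inj_on u {0..1}" "u ` {0..1} \<subseteq> {0..1}" "u 0 = 0" "u 1 = 1"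
    "\<And>t. t \<in> {0..1} \<Longrightarrow> ?A t = f j (vtx k) + (f j (vtx a) - f j (vtx k)) * u t"
    by (rule conj_affine_on_edge[OF conj_affine_f[OF j] I_finite _ _ ka(1)]) (use ab in auto)
  obtain v where v: "continuous_on {0..1} v" "inj_on v {0..1}" "v ` {0..1} \<subseteq> {0..1}" "v 0 = 0" "v 1 = 1"
    "\<And>t. t \<in> {0..1} \<Longrightarrow> ?B t = f j (vtx k) + (f j (vtx b) - f j (vtx k)) * v t"
    by (rule conj_affine_on_edge[OF conj_affine_f[OF j] I_finite _ _ ka(2)]) (use ab in auto)
  have mono: "w x \<le> w y" if w: "continuous_on {0..1} w" "inj_on w {0..1}" "w 0 = 0" "w 1 = (1::real)"
    and xy: "0 \<le> x" "x \<le> y" "y \<le> 1" for w :: "real \<Rightarrow> real" and x y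
  proof -
    have "is_interval {0..1::real}" by (simp add: is_interval_convex_1)
    then consider "strict_mono_on {0..1} w" | "strict_antimono_on {0..1} w"
      using injective_eq_monotone_map[of "{0..1}" w] w by blast
    then show ?thesis
    proof cases
      case 1
      then have "w x < w y" if "x < y" using that xy by (simp add: monotone_on_def)
      then show ?thesis using xy by (cases "x = y") auto
    next
      case 2
      then have "w 1 < w 0" by (auto simp: monotone_on_def)
      then show ?thesis using w by simp
    qed
  qed
  have Bne: "?B t \<noteq> f j (vtx k)" using eq ne by simp
  then have bne: "f j (vtx b) \<noteq> f j (vtx k)" using v(6)[OF st(2)] by auto
  have Binj: "inj_on ?B {0..1}"
    using v(2,6) bne by (auto simp: inj_on_def)
  have Bc: "continuous_on {0..1} ?B" and Ac: "continuous_on {0..1} ?A"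
    using ab by (auto intro!: conj_affine_edge_continuous[OF conj_affine_f[OF j] I_finite])
  have ex: "\<exists>y\<in>{0..t}. ?B y = ?A x" if x: "x \<in> {0..s}" for x
  proof -
    have x1: "x \<in> {0..1}" using x st by auto
    have "u x \<in> {0..1}" using u(3) x1 by blast
    then have "0 \<le> u x" "u x \<le> u s" using mono[OF u(1,2,4,5), of x s] x st by auto
    then have "f j (vtx k) \<le> ?A x \<and> ?A x \<le> ?A s \<or> ?A s \<le> ?A x \<and> ?A x \<le> f j (vtx k)"
      unfolding u(6)[OF x1] u(6)[OF st(1)]
      by (cases "0 \<le> f j (vtx a) - f j (vtx k)") (auto intro: mult_left_mono mult_left_mono_neg simp: mult_nonpos_nonneg)
    moreover have "connected (?B ` {0..t})"
      by (rule connected_continuous_image[OF continuous_on_subset[OF Bc]]) (use st in auto)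
    moreover have "f j (vtx k) \<in> ?B ` {0..t}" "?A s \<in> ?B ` {0..t}"
      using st eq by (auto intro: image_eqI[of _ _ 0] image_eqI[of _ _ t])
    ultimately have "?A x \<in> ?B ` {0..t}" by (meson connectedD_interval)
    then show ?thesis by (metis imageE)
  qed
  define \<kappa> where "\<kappa> x = the_inv_into {0..1} ?B (?A x)" for x
  have \<kappa>: "\<kappa> x \<in> {0..t} \<and> ?B (\<kappa> x) = ?A x" if x: "x \<in> {0..s}" for x
  proof -
    obtain y where y: "y \<in> {0..t}" "?B y = ?A x" using ex[OF x] by blast
    then have "y \<in> {0..1}" using st by auto
    then have "the_inv_into {0..1} ?B (?B y) = y" by (rule the_inv_into_f_f[OF Binj])
    then show ?thesis using y by (simp add: \<kappa>_def)
  qed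
  have uniq: "y = y'" if "y \<in> {0..1}" "y' \<in> {0..1}" "?B y = ?B y'" for y y'
    using inj_onD[OF Binj] that by blast
  have \<kappa>01: "\<kappa> x \<in> {0..1}" if "x \<in> {0..s}" for x using \<kappa>[OF that] st by auto
  have s0: "0 \<in> {0..s}" "s \<in> {0..s}" using st by auto
  show ?thesis
  proof
    have inv: "continuous_on (?B ` {0..1}) (the_inv_into {0..1} ?B)"
      by (rule continuous_on_inv[OF Bc]) (auto simp: the_inv_into_f_f[OF Binj])
    show "continuous_on {0..s} \<kappa>"
      unfolding \<kappa>_def
    proof (rule continuous_on_compose2[OF inv continuous_on_subset[OF Ac]])
      show "?A ` {0..s} \<subseteq> ?B ` {0..1}" using \<kappa> \<kappa>01 by (metis image_eqI image_subsetI)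
    qed (use st in auto)
    show "\<kappa> ` {0..s} \<subseteq> {0..t}" using \<kappa> by blast
    show "\<kappa> 0 = 0" by (rule uniq) (use \<kappa>01[OF s0(1)] \<kappa>[OF s0(1)] in auto)
    show "\<kappa> s = t" by (rule uniq) (use \<kappa>01[OF s0(2)] \<kappa>[OF s0(2)] st eq in auto)
    show "?A x = ?B (\<kappa> x)" if "x \<in> {0..s}" for x using \<kappa>[OF that] by simp
  qed
qed

end

context strong_facets
begin

text \<open>If \<open>N\<close> has only three elements, no facet contains three edges. The levels
  are then followed from the apex: matching the edge to \<open>a\<close> with the edge to
  \<open>b\<close> in facet \<open>j1\<close>, and this with the edge to \<open>c\<close> in facet
  \<open>j2\<close>, yields two curves in facet \<open>j3\<close> that pass through the same leaves
  of the covering. They start together at the apex, so \<open>curves_agree\<close> compares their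
  ends.\<close>

lemma edge_trans_strong: edge_trans
  unfolding edge_trans_def
proof (intro ballI impI, elim conjE)
  fix a b c and s t r :: real
  assume N': "a \<in> N" "b \<in> N" "c \<in> N" and st: "s \<in> {0..1}" "t \<in> {0..1}" "r \<in> {0..1}"
    and ab: "edge_rel a s b t" and bc: "edge_rel b t c r"
  obtain j1 where j1: "j1 \<in> N" "j1 \<noteq> a" "j1 \<noteq> b" by (rule ex_other)
  obtain j2 where j2: "j2 \<in> N" "j2 \<noteq> b" "j2 \<noteq> c" by (rule ex_other)
  obtain j3 where j3: "j3 \<in> N" "j3 \<noteq> a" "j3 \<noteq> c" by (rule ex_other)
  have e1: "f j1 (edge k a s) = f j1 (edge k b t)" using edge_rel_iff[of a b j1 s t] N' j1 st ab by simp
  have e2: "f j2 (edge k b t) = f j2 (edge k c r)" using edge_rel_iff[of b c j2 t r] N' j2 st bc by simp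
  have "f j3 (edge k a s) = f j3 (edge k c r)"
  proof (cases "f j1 (edge k a s) = f j1 (vtx k)")
    case True
    have "f j2 (edge k b t) = f j2 (vtx k)"
      using True e1 level_k[of b j1 j2 t] N' j1 j2 st by simp
    then have "f j3 (edge k c r) = f j3 (vtx k)"
      using e2 level_k[of c j2 j3 r] N' j2 j3 st by simp
    moreover have "f j3 (edge k a s) = f j3 (vtx k)"
      using True level_k[of a j1 j3 s] N' j1 j3 st by simp
    ultimately show ?thesis by simp
  next
    case False
    obtain \<kappa>1 where 1: "continuous_on {0..s} \<kappa>1" "\<kappa>1 ` {0..s} \<subseteq> {0..t}" "\<kappa>1 0 = 0" "\<kappa>1 s = t"
      "\<And>x. x \<in> {0..s} \<Longrightarrow> f j1 (edge k a x) = f j1 (edge k b (\<kappa>1 x))"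
      using edge_match[OF j1(1) N'(1,2) j1(2,3)[symmetric] st(1,2) e1 False] by blast
    have "f j2 (edge k b t) \<noteq> f j2 (vtx k)"
      using False e1 level_k[of b j1 j2 t] N' j1 j2 st by simp
    then obtain \<kappa>2 where 2: "continuous_on {0..t} \<kappa>2" "\<kappa>2 ` {0..t} \<subseteq> {0..r}" "\<kappa>2 0 = 0" "\<kappa>2 t = r"
      "\<And>x. x \<in> {0..t} \<Longrightarrow> f j2 (edge k b x) = f j2 (edge k c (\<kappa>2 x))"
      using edge_match[OF j2(1) N'(2,3) j2(2,3)[symmetric] st(2,3) e2] by blast
    have dom: "\<kappa>1 x \<in> {0..t}" "\<kappa>2 (\<kappa>1 x) \<in> {0..r}" if "x \<in> {0..s}" for x using 1(2) 2(2) that by blast+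
    have 01: "x \<in> {0..1}" "\<kappa>1 x \<in> {0..1}" "\<kappa>2 (\<kappa>1 x) \<in> {0..1}" if "x \<in> {0..s}" for x
      using dom[OF that] that st by auto
    have "f j3 (edge k a s) = f j3 (edge k c (\<kappa>2 (\<kappa>1 s)))"
    proof (rule curves_agree[OF j3(1), where a="edge k a" and b="\<lambda>x. edge k c (\<kappa>2 (\<kappa>1 x))" and s=s])
      show "continuous_on {0..s} (edge k a)" by (rule continuous_on_edge)
      show "continuous_on {0..s} (\<lambda>x. edge k c (\<kappa>2 (\<kappa>1 x)))"
        by (rule continuous_on_compose2[OF continuous_on_edge[of UNIV] continuous_on_compose2[OF 2(1) 1(1,2)]]) simp
      show "edge k a ` {0..s} \<subseteq> splx (I j3)" using edge_in[OF N'(1) j3(2)[symmetric]] 01 by blast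
      show "(\<lambda>x. edge k c (\<kappa>2 (\<kappa>1 x))) ` {0..s} \<subseteq> splx (I j3)" using edge_in[OF N'(3) j3(3)[symmetric]] 01 by blast
      show "0 \<le> s" using st by simp
      show "f j3 (edge k a 0) = f j3 (edge k c (\<kappa>2 (\<kappa>1 0)))" using 1(3) 2(3) by simp
      fix x assume x: "x \<in> {0..s}"
      have "q (S (edge k a x)) = q (S (edge k b (\<kappa>1 x)))"
        using edge_in N' j1 01[OF x] 1(5)[OF x] by (intro level_leaf[OF j1(1)]) auto
      also have "\<dots> = q (S (edge k c (\<kappa>2 (\<kappa>1 x))))"
        using edge_in N' j2 01[OF x] 2(5)[OF dom(1)[OF x]] by (intro level_leaf[OF j2(1)]) auto
      finally show "q (S (edge k a x)) = q (S (edge k c (\<kappa>2 (\<kappa>1 x))))" .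
    qed
    then show ?thesis using 1(4) 2(4) by simp
  qed
  then show "edge_rel a s c r" using edge_rel_iff[of a c j3 s r] N' j3 st by simp
qed

text \<open>If each facet contains only two edges, no single level function compares the directions
  of three. The transverse coordinate \<open>g\<close> of a chart around the lifted apex sees all
  edges at once. Two of three leave the leaf of the apex to the same side of it, and local
  injectivity turns this into the same side for a level function.\<close>

lemma edge_dom_strong: edge_dom
proof -
  obtain B where B: "B \<subseteq> N" "card B = 3" using obtain_subset_with_card_n[OF N(2)] by metis
  then have "card B = Suc (Suc (Suc 0))" by simp
  then obtain a b c where abc: "a \<in> N" "b \<in> N" "c \<in> N" "a \<noteq> b" "b \<noteq> c" "a \<noteq> c"
    using B(1) unfolding card_Suc_eq by blast
  show ?thesis
  proof (cases "\<exists>i\<in>N. \<exists>j\<in>N. j \<noteq> i \<and> f j (vtx i) = f j (vtx k)")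
    case True
    then show ?thesis using edge_dom_const by blast
  next
    case nonconst: False
    have vT: "vtx k \<in> splx (insert k N)" using vtx_in_splx[OF finT] by simp
    have SE: "S (vtx k) \<in> topspace E"
      using continuous_map_image_subset_topspace[OF Sc] vT by auto
    then have "p (S (vtx k)) \<in> topspace M" using covering_mapD(2)[OF cov] by blast
    then obtain U \<phi> where U: "(U, \<phi>) \<in> F" "p (S (vtx k)) \<in> U" by (rule foliation_cover[OF fol])
    obtain V where V: "openin E V" "S (vtx k) \<in> V" "p ` V = U" "(V, \<phi> \<circ> p) \<in> pullback_atlas E M p F"
      using pullback_sheet[OF fol cov SE U] by blast
    define W where "W = {x \<in> splx (insert k N). S x \<in> V}"
    have oW: "openin (top_of_set (splx (insert k N))) W"
      using openin_continuous_map_preimage[OF Sc V(1)] by (simp add: W_def)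
    define g where "g x = last_coord (\<phi> (p (S x)))" for x
    have gc: "continuous_on W g"
    proof -
      have "continuous_map (top_of_set W) (subtopology M U) (p \<circ> S)"
        unfolding continuous_map_in_subtopology
      proof (intro conjI)
        show "continuous_map (top_of_set W) M (p \<circ> S)"
          by (rule continuous_map_compose[OF continuous_map_from_subtopology_mono[OF Sc] covering_mapD(1)[OF cov]])
            (auto simp: W_def)
        show "(p \<circ> S) \<in> topspace (top_of_set W) \<rightarrow> U" using V(3) by (auto simp: W_def)
      qed
      from continuous_map_compose[OF this homeomorphic_imp_continuous_map[OF foliation_chart(4)[OF fol U(1)]]]
      have "continuous_on W (\<lambda>x. \<phi> (p (S x)))" by (simp add: o_def)
      then show ?thesis unfolding g_def
        by (rule continuous_on_compose2[OF continuous_last_coord[of UNIV]]) simp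
    qed
    have g_leaf: "q (S x) = q (S y)" if "x \<in> W" "y \<in> W" "g x = g y" for x y
      using that leaf_eq_plaque[OF V(4), of "S x" "S y"] by (simp add: W_def g_def)
    have "\<forall>j\<in>N. \<exists>\<epsilon>>0. \<forall>x\<in>splx (I j). \<forall>y\<in>splx (I j). \<bar>f j x - f j (vtx k)\<bar> < \<epsilon> \<longrightarrow>
        \<bar>f j y - f j (vtx k)\<bar> < \<epsilon> \<longrightarrow> q (S x) = q (S y) \<longrightarrow> f j x = f j y"
    proof
      fix j assume "j \<in> N"
      then show "\<exists>\<epsilon>>0. \<forall>x\<in>splx (I j). \<forall>y\<in>splx (I j). \<bar>f j x - f j (vtx k)\<bar> < \<epsilon> \<longrightarrow>
        \<bar>f j y - f j (vtx k)\<bar> < \<epsilon> \<longrightarrow> q (S x) = q (S y) \<longrightarrow> f j x = f j y"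
        using local_inj[OF _ vtx_in_I] by metis
    qed
    then obtain \<epsilon> where \<epsilon>: "\<And>j. j \<in> N \<Longrightarrow> 0 < \<epsilon> j"
      "\<And>j x y. j \<in> N \<Longrightarrow> x \<in> splx (I j) \<Longrightarrow> y \<in> splx (I j) \<Longrightarrow> \<bar>f j x - f j (vtx k)\<bar> < \<epsilon> j \<Longrightarrow>
        \<bar>f j y - f j (vtx k)\<bar> < \<epsilon> j \<Longrightarrow> q (S x) = q (S y) \<Longrightarrow> f j x = f j y"
      by metis
    have tend: "(edge k i \<longlongrightarrow> vtx k) (at_right 0)" for i
    proof -
      have "(edge k i \<longlongrightarrow> edge k i 0) (at 0 within {0<..})"
        using continuous_on_edge[of UNIV k i] unfolding continuous_on_def
        by (metis UNIV_I subset_UNIV tendsto_within_subset)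
      then show ?thesis by simp
    qed
    have in01: "\<forall>\<^sub>F t in at_right 0. (t::real) \<in> {0..1}"
      using eventually_at_right_real[OF zero_less_one] by eventually_elim auto
    have inW: "\<forall>\<^sub>F t in at_right 0. edge k i t \<in> W" if i: "i \<in> N" for i
    proof -
      obtain O' where O': "open O'" "W = splx (insert k N) \<inter> O'" using oW by (auto simp: openin_open)
      have "vtx k \<in> O'" using O' vT V(2) by (auto simp: W_def)
      with tend[of i] O'(1) have "\<forall>\<^sub>F t in at_right 0. edge k i t \<in> O'" by (rule topological_tendstoD)
      with in01 show ?thesis
        by eventually_elim (use edge_in_splx[of k "insert k N" i] finT i O'(2) in auto)
    qed
    have close: "\<forall>\<^sub>F t in at_right 0. \<bar>f j (edge k i t) - f j (vtx k)\<bar> < \<epsilon> j" if ij: "i \<in> N" "j \<in> N" "i \<noteq> j" for i j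
    proof -
      have "continuous_on {0..1} (\<lambda>t. f j (edge k i t))"
        using ij by (intro conj_affine_edge_continuous[OF conj_affine_f[OF ij(2)] I_finite]) auto
      then have "((\<lambda>t. f j (edge k i t)) \<longlongrightarrow> f j (edge k i 0)) (at 0 within {0..1})"
        unfolding continuous_on_def by (rule bspec) simp
      then have "((\<lambda>t. f j (edge k i t)) \<longlongrightarrow> f j (vtx k)) (at_right 0)"
        by (simp add: at_within_Icc_at_right)
      then have "\<forall>\<^sub>F t in at_right 0. dist (f j (edge k i t)) (f j (vtx k)) < \<epsilon> j"
        using \<epsilon>(1)[OF ij(2)] by (rule tendstoD)
      then show ?thesis by (simp add: dist_real_def)
    qed
    have "\<forall>\<^sub>F t in at_right 0. t \<in> {0..1} \<and> (\<forall>i\<in>N. edge k i t \<in> W) \<and>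
        (\<forall>i\<in>N. \<forall>j\<in>N. i \<noteq> j \<longrightarrow> \<bar>f j (edge k i t) - f j (vtx k)\<bar> < \<epsilon> j)"
      using in01 inW close N(1)
      by (intro eventually_conj eventually_ball_finite ballI) (auto intro: eventually_mono)
    then obtain d where d: "0 < d" "\<And>t. 0 < t \<Longrightarrow> t < d \<Longrightarrow> t \<in> {0..1} \<and> (\<forall>i\<in>N. edge k i t \<in> W) \<and>
        (\<forall>i\<in>N. \<forall>j\<in>N. i \<noteq> j \<longrightarrow> \<bar>f j (edge k i t) - f j (vtx k)\<bar> < \<epsilon> j)"
      unfolding eventually_at_right_field by blast
    \<comment> \<open>Half of \<open>d\<close>, so that the closed interval up to
      \<open>\<delta>\<close> is admissible: all edges are in the chart and, in each facet, at
      levels where equal leaves force equal levels.\<close>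
    define \<delta> where "\<delta> = d / 2"
    have \<delta>0: "0 < \<delta>" using d(1) by (simp add: \<delta>_def)
    have pos: "t \<in> {0..1} \<and> (\<forall>i\<in>N. edge k i t \<in> W) \<and>
        (\<forall>i\<in>N. \<forall>j\<in>N. i \<noteq> j \<longrightarrow> \<bar>f j (edge k i t) - f j (vtx k)\<bar> < \<epsilon> j)" if t: "t \<in> {0..\<delta>}" for t
    proof (cases "t = 0")
      case True
      then show ?thesis using vT V(2) \<epsilon>(1) by (simp add: W_def)
    next
      case False
      then show ?thesis using d(2)[of t] t d(1) by (simp add: \<delta>_def)
    qed
    have wc: "continuous_on {0..\<delta>} (\<lambda>t. g (edge k i t))" if "i \<in> N" for i
      by (rule continuous_on_compose2[OF gc continuous_on_edge]) (use pos that in auto)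
    define w0 where "w0 = g (vtx k)"
    \<comment> \<open>Otherwise the edge would be back in the leaf of the apex, hence on its level,
      which a nonconstant level function takes on the edge only at time 0.\<close>
    have wne: "g (edge k i \<delta>) \<noteq> w0" if i: "i \<in> N" for i
    proof
      assume eq: "g (edge k i \<delta>) = w0"
      obtain j where j: "j \<in> N" "j \<noteq> i" by (rule ex_other)
      have \<delta>: "\<delta> \<in> {0..\<delta>}" "0 \<in> {0..\<delta>}" using \<delta>0 by auto
      have "q (S (edge k i \<delta>)) = q (S (vtx k))"
        by (rule g_leaf) (use pos[OF \<delta>(1)] pos[OF \<delta>(2)] i eq in \<open>auto simp: w0_def\<close>)
      then have eqf: "f j (edge k i \<delta>) = f j (vtx k)"
        using pos[OF \<delta>(1)] i j edge_in[of i j \<delta>] vtx_in_I \<epsilon>(1)[OF j(1)] by (intro \<epsilon>(2)[OF j(1)]) auto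
      have ki: "k \<noteq> i" using i k by auto
      obtain v where v: "inj_on v {0..1}" "v 0 = 0"
        "\<And>t. t \<in> {0..1} \<Longrightarrow> f j (edge k i t) = f j (vtx k) + (f j (vtx i) - f j (vtx k)) * v t"
        by (rule conj_affine_on_edge[OF conj_affine_f[OF j(1)] I_finite _ _ ki]) (use i j in auto)
      have "v \<delta> = 0" using eqf v(3)[of \<delta>] pos[OF \<delta>(1)] nonconst i j by auto
      then have "\<delta> = 0" using v(1,2) pos[OF \<delta>(1)] by (auto dest: inj_onD[of v _ \<delta> 0])
      with \<delta>0 show False by simp
    qed
    have pair: edge_dom if xy: "x \<in> N" "y \<in> N" "x \<noteq> y" and sgn: "w0 < g (edge k x \<delta>) \<longleftrightarrow> w0 < g (edge k y \<delta>)" for x y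
    proof -
      obtain j where j: "j \<in> N" "j \<noteq> x" "j \<noteq> y" by (rule ex_other)
      \<comment> \<open>Of the two values of \<open>g\<close> the one closer to that of the apex, so
        that both edges reach it.\<close>
      define z where "z = (if w0 < g (edge k x \<delta>) then min (g (edge k x \<delta>)) (g (edge k y \<delta>)) else max (g (edge k x \<delta>)) (g (edge k y \<delta>)))"
      have zne: "z \<noteq> w0" using wne[OF xy(1)] wne[OF xy(2)] sgn by (auto simp: z_def min_def max_def)
      have btw: "w0 \<le> z \<and> z \<le> g (edge k i \<delta>) \<or> g (edge k i \<delta>) \<le> z \<and> z \<le> w0" if "i = x \<or> i = y" for i
        using that sgn by (auto simp: z_def)
      have hit: "\<exists>t\<in>{0..\<delta>}. g (edge k i t) = z" if i: "i = x \<or> i = y" for i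
      proof -
        have iN: "i \<in> N" using i xy by blast
        have "connected ((\<lambda>t. g (edge k i t)) ` {0..\<delta>})"
          by (rule connected_continuous_image[OF wc[OF iN]]) simp
        moreover have "w0 \<in> (\<lambda>t. g (edge k i t)) ` {0..\<delta>}" "g (edge k i \<delta>) \<in> (\<lambda>t. g (edge k i t)) ` {0..\<delta>}"
          using \<delta>0 by (auto simp: w0_def intro: image_eqI[of _ _ 0])
        ultimately have "z \<in> (\<lambda>t. g (edge k i t)) ` {0..\<delta>}" using btw[OF i] by (meson connectedD_interval)
        then show ?thesis by (metis imageE)
      qed
      obtain s where s: "s \<in> {0..\<delta>}" "g (edge k x s) = z" using hit by blast
      obtain t where t: "t \<in> {0..\<delta>}" "g (edge k y t) = z" using hit by blast
      have "q (S (edge k x s)) = q (S (edge k y t))"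
        by (rule g_leaf) (use pos[OF s(1)] pos[OF t(1)] xy s t in auto)
      then have eqf: "f j (edge k x s) = f j (edge k y t)"
        using pos[OF s(1)] pos[OF t(1)] xy j by (intro \<epsilon>(2)[OF j(1)] edge_in) auto
      have kxy: "k \<noteq> x" "k \<noteq> y" using xy k by auto
      obtain u where u: "inj_on u {0..1}" "u ` {0..1} \<subseteq> {0..1}" "u 0 = 0"
        "\<And>t. t \<in> {0..1} \<Longrightarrow> f j (edge k x t) = f j (vtx k) + (f j (vtx x) - f j (vtx k)) * u t"
        by (rule conj_affine_on_edge[OF conj_affine_f[OF j(1)] I_finite _ _ kxy(1)]) (use xy j in auto)
      obtain v where v: "inj_on v {0..1}" "v ` {0..1} \<subseteq> {0..1}" "v 0 = 0"
        "\<And>t. t \<in> {0..1} \<Longrightarrow> f j (edge k y t) = f j (vtx k) + (f j (vtx y) - f j (vtx k)) * v t"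
        by (rule conj_affine_on_edge[OF conj_affine_f[OF j(1)] I_finite _ _ kxy(2)]) (use xy j in auto)
      have s1: "s \<in> {0..1}" "t \<in> {0..1}" using pos[OF s(1)] pos[OF t(1)] by auto
      have "s \<noteq> 0" "t \<noteq> 0" using s(2) t(2) zne by (auto simp: w0_def)
      then have "u s \<noteq> 0" "v t \<noteq> 0" using u(1,3) v(1,3) s1 by (auto dest: inj_onD[of u _ s 0] inj_onD[of v _ t 0])
      moreover have "u s \<in> {0..1}" "v t \<in> {0..1}" using u(2) v(2) s1 by blast+
      ultimately have uv: "0 < u s" "0 < v t" by auto
      have eq2: "(f j (vtx x) - f j (vtx k)) * u s = (f j (vtx y) - f j (vtx k)) * v t"
        using eqf u(4)[OF s1(1)] v(4)[OF s1(2)] by simp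
      have "f j (vtx x) - f j (vtx k) < 0 \<longleftrightarrow> f j (vtx y) - f j (vtx k) < 0"
        using eq2 uv by (metis mult_less_0_iff order_less_imp_not_less)
      moreover have "0 < f j (vtx x) - f j (vtx k) \<longleftrightarrow> 0 < f j (vtx y) - f j (vtx k)"
        using eq2 uv by (metis zero_less_mult_iff order_less_imp_not_less)
      ultimately show edge_dom
        by (intro edge_dom_same_side[OF j(1) xy(1,2) j(2,3) xy(3)]) auto
    qed
    show ?thesis
      using pair[OF abc(1,2,4)] pair[OF abc(2,3,5)] pair[OF abc(1,3,6)] by blast
  qed
qed

end


section \<open>Filling a horn\<close>

text \<open>The projection of the simplex onto the horn, parallel to the line from the barycentre of
  the missing face to the apex.\<close>

definition retract :: "nat set \<Rightarrow> nat \<Rightarrow> (nat \<Rightarrow> real) \<Rightarrow> nat \<Rightarrow> real" where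
  "retract N k x = (\<lambda>i. if i \<in> N then x i - low N x else if i = k then x k + card N * low N x else 0)"

lemma retract_horn:
  assumes N: "finite N" "N \<noteq> {}" "k \<notin> N" and x: "x \<in> splx (insert k N)"
  obtains j where "j \<in> N" "retract N k x \<in> splx (insert k (N - {j}))"
proof -
  obtain j where j: "j \<in> N" "low N x = x j" by (rule low_ex[OF N(1,2)])
  have m0: "0 \<le> low N x" using j splxD(1)[OF x] by simp
  have "sum (retract N k x) (insert k N) = (x k + card N * low N x) + (\<Sum>i\<in>N. x i - low N x)"
    using N by (simp add: retract_def)
  also have "\<dots> = 1" using splxD(3)[OF x] N by (simp add: sum_subtractf)
  finally have "retract N k x \<in> splx (insert k N)"
    using low_le[OF N(1,2)] m0 splxD(1)[OF x] by (auto simp: splx_def retract_def)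
  then have "retract N k x \<in> splx (insert k N \<inter> insert k (N - {j}))"
    using N j by (intro splx_subset_support) (auto simp: retract_def)
  moreover have "insert k N \<inter> insert k (N - {j}) = insert k (N - {j})" by auto
  ultimately show ?thesis using that j(1) by metis
qed

lemma retract_id:
  assumes N: "finite N" "N \<noteq> {}" "k \<notin> N" and j: "j \<in> N" and x: "x \<in> splx (insert k (N - {j}))"
  shows "retract N k x = x"
proof -
  have "low N x = 0"
  proof (rule low_eqI[OF N(1,2) j])
    show "x j = 0" using splxD(2)[OF x, of j] j N(3) by auto
  qed (rule splxD(1)[OF x])
  then show ?thesis using splxD(2)[OF x] by (auto simp: retract_def)
qed

lemma continuous_on_retract:
  assumes "finite N" "N \<noteq> {}"
  shows "continuous_on S (retract N k)"
proof (rule continuous_on_coordinatewise_then_product)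
  fix i
  show "continuous_on S (\<lambda>x. retract N k x i)"
    unfolding retract_def by (cases "i \<in> N"; cases "i = k") (auto intro!: continuous_intros continuous_on_low[OF assms])
qed

context facets
begin

definition horn :: "(nat \<Rightarrow> real) set" where "horn = (\<Union>j\<in>N. splx (I j))"

lemma N_ne: "N \<noteq> {}" using N by auto

lemma horn_sub: "horn \<subseteq> splx (insert k N)"
  using splx_mono[of _ "insert k N"] N by (auto simp: horn_def) (metis Diff_subset finite_insert insert_mono subsetD)

lemma compact_horn: "compact horn"
  unfolding horn_def by (intro compact_UN N compact_splx I_finite)

lemma retract_in_horn: "x \<in> splx (insert k N) \<Longrightarrow> retract N k x \<in> horn"
  using retract_horn[OF N(1) N_ne k] unfolding horn_def by (metis UN_I)

lemma retract_horn_id: "x \<in> horn \<Longrightarrow> retract N k x = x"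
  unfolding horn_def using retract_id[OF N(1) N_ne k] by blast

lemma ex_facet_containing:
  assumes "a \<in> insert k N" "b \<in> insert k N"
  obtains j where "j \<in> N" "a \<in> I j" "b \<in> I j"
proof -
  obtain j where "j \<in> N" "j \<noteq> a" "j \<noteq> b" by (rule ex_other)
  then show ?thesis using that assms by blast
qed

end

section \<open>Construction of the filling\<close>

locale facet_levels = facets N k f + fol_cover M A F E p
  for N k f and M :: "'a topology" and A F :: "('a, 'm::{finite,linorder}) chart set"
    and E :: "'b topology" and p :: "'b \<Rightarrow> 'a" +
  fixes \<Sigma> :: "(nat \<Rightarrow> real) \<Rightarrow> 'a"
  assumes lev: "j \<in> N \<Longrightarrow> level_fn M F \<Sigma> (I j) (f j)"
    and \<Sigma>c: "continuous_map (top_of_set (splx (insert k N))) M \<Sigma>"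
    and fib: "locally_trivial_fibration E (leaf_space E (pullback_atlas E M p F)) (leaf (pullback_atlas E M p F))"
begin

lemma fill:
  assumes tr: edge_trans and dom: edge_dom
  obtains \<Sigma>' \<phi> where "continuous_map (top_of_set (splx (insert k N))) M \<Sigma>'"
    "\<And>x. x \<in> horn \<Longrightarrow> \<Sigma>' x = \<Sigma> x"
    "\<And>j. j \<in> N \<Longrightarrow> level_fn M F \<Sigma>' (I j) \<phi>" "level_fn M F \<Sigma>' N \<phi>"
proof -
  let ?T = "insert k N"
  have "\<exists>\<psi>. (\<forall>j\<in>N. conj_affine (I j) \<psi>) \<and> (\<forall>j\<in>N. \<forall>x\<in>splx (I j). \<forall>y\<in>splx (I j). \<psi> x = \<psi> y \<longleftrightarrow> f j x = f j y) \<and>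
    (\<forall>j\<in>N. \<forall>l\<in>N. \<forall>x\<in>splx (I j). \<forall>y\<in>splx (I l). \<psi> x = \<psi> y \<longrightarrow> (x, y) \<in> link\<^sup>*)"
    by (rule glue[OF tr dom]) blast
  then obtain \<psi> where \<psi>good: "\<And>j. j \<in> N \<Longrightarrow> conj_affine (I j) \<psi>"
    and \<psi>lev: "\<And>j x y. j \<in> N \<Longrightarrow> x \<in> splx (I j) \<Longrightarrow> y \<in> splx (I j) \<Longrightarrow> \<psi> x = \<psi> y \<longleftrightarrow> f j x = f j y"
    and \<psi>link: "\<And>j l x y. j \<in> N \<Longrightarrow> l \<in> N \<Longrightarrow> x \<in> splx (I j) \<Longrightarrow> y \<in> splx (I l) \<Longrightarrow> \<psi> x = \<psi> y \<Longrightarrow> (x, y) \<in> link\<^sup>*"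
    by blast
  have finT: "finite ?T" and IT: "I j \<subseteq> ?T" for j using N by auto
  have "conj_affine (N - {i}) \<psi>" if "i \<in> N" for i
    by (rule conj_affine_subset[OF \<psi>good[OF that]]) (use N in auto)
  then obtain \<psi>N where \<psi>N: "conj_affine N \<psi>N" "\<And>i x. i \<in> N \<Longrightarrow> x \<in> splx (N - {i}) \<Longrightarrow> \<psi>N x = \<psi> x"
    using extend_good[OF N(1) N_ne] by metis
  define \<phi> where "\<phi> x = (if x \<in> horn then \<psi> x else \<psi>N x)" for x
  have \<phi>_I: "\<phi> x = \<psi> x" if "j \<in> N" "x \<in> splx (I j)" for j x
    using that by (auto simp: \<phi>_def horn_def)
  have \<phi>_N: "\<phi> x = \<psi>N x" if x: "x \<in> splx N" for x
  proof (cases "x \<in> horn")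
    case True
    then obtain j where j: "j \<in> N" "x \<in> splx (I j)" by (auto simp: horn_def)
    then have "x \<in> splx (N \<inter> I j)" using x splx_Int[OF N(1) I_finite] by blast
    moreover have "N \<inter> I j = N - {j}" using k by auto
    ultimately show ?thesis using \<psi>N(2)[OF j(1)] \<phi>_I[OF j] by simp
  qed (simp add: \<phi>_def)
  have conj_affine_I: "conj_affine (I j) \<phi>" if "j \<in> N" for j
    by (rule conj_affine_cong[OF \<psi>good[OF that] I_finite]) (use \<phi>_I that in auto)
  have conj_affine_N: "conj_affine N \<phi>"
    by (rule conj_affine_cong[OF \<psi>N(1) N(1)]) (use \<phi>_N in auto)
  have \<phi>lev: "\<phi> x = \<phi> y \<longleftrightarrow> f j x = f j y" if "j \<in> N" "x \<in> splx (I j)" "y \<in> splx (I j)" for j x y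
    using \<psi>lev[OF that] \<phi>_I that by simp
  let ?V = "(\<lambda>i. \<phi> (vtx i)) ` ?T"
  have V: "finite ?V" "?V \<noteq> {}" using finT by auto
  obtain a where a: "a \<in> ?T" "\<phi> (vtx a) = Min ?V" using Min_in[OF V] by (metis imageE)
  obtain b where b: "b \<in> ?T" "\<phi> (vtx b) = Max ?V" using Max_in[OF V] by (metis imageE)
  define lo hi where "lo = \<phi> (vtx a)" and "hi = \<phi> (vtx b)"
  have vtx_range: "lo \<le> \<phi> (vtx i) \<and> \<phi> (vtx i) \<le> hi" if "i \<in> ?T" for i
  proof -
    have "\<phi> (vtx i) \<in> ?V" using that by (rule imageI)
    then show ?thesis unfolding lo_def hi_def a(2) b(2) using Min_le[OF V(1)] Max_ge[OF V(1)] by blast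
  qed
  have range: "\<phi> x \<in> {lo..hi}" if x: "x \<in> horn \<union> splx N" for x
  proof -
    have *: ?thesis if J: "conj_affine J \<phi>" "finite J" "J \<subseteq> ?T" "x \<in> splx J" for J
    proof -
      obtain i j where "i \<in> J" "j \<in> J" "\<phi> (vtx i) \<le> \<phi> x" "\<phi> x \<le> \<phi> (vtx j)" by (rule conj_affine_bounds[OF J(1,2,4)])
      then show ?thesis using vtx_range[of i] vtx_range[of j] J(3) by auto
    qed
    show ?thesis
    proof (cases "x \<in> splx N")
      case True
      then show ?thesis using *[OF conj_affine_N N(1)] by blast
    next
      case False
      then obtain j where "j \<in> N" "x \<in> splx (I j)" using x by (auto simp: horn_def)
      then show ?thesis using *[OF conj_affine_I I_finite IT] by blast
    qed
  qed
  have "horn \<noteq> {}" using vtx_in_I N_ne by (auto simp: horn_def)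
  then have lohi: "lo \<le> hi" using range by fastforce
  \<comment> \<open>One facet contains the vertices of least and of greatest value, so all values in
    between are taken on the horn.\<close>
  obtain j1 where j1: "j1 \<in> N" "a \<in> I j1" "b \<in> I j1" by (rule ex_facet_containing[OF a(1) b(1)])
  have surj: "\<phi> ` horn = {lo..hi}"
  proof
    show "\<phi> ` horn \<subseteq> {lo..hi}" using range by auto
    have "connected (\<phi> ` splx (I j1))"
      by (rule connected_continuous_image[OF conj_affine_continuous[OF conj_affine_I[OF j1(1)]] connected_splx])
    moreover have "lo \<in> \<phi> ` splx (I j1)" "hi \<in> \<phi> ` splx (I j1)"
      using j1(2,3) vtx_in_splx[OF I_finite] by (auto simp: lo_def hi_def)
    ultimately have "{lo..hi} \<subseteq> \<phi> ` splx (I j1)" by (simp add: connected_contains_Icc)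
    also have "\<dots> \<subseteq> \<phi> ` horn" using j1(1) by (auto simp: horn_def)
    finally show "{lo..hi} \<subseteq> \<phi> ` horn" .
  qed
  have \<phi>hc: "continuous_on horn \<phi>"
    unfolding horn_def by (rule continuous_on_closed_Union) (use N closed_splx conj_affine_continuous[OF conj_affine_I] in auto)
  have \<phi>c: "continuous_on (horn \<union> splx N) \<phi>"
    using compact_imp_closed[OF compact_horn] closed_splx \<phi>hc conj_affine_continuous[OF conj_affine_N] by (intro continuous_on_closed_Un)
  obtain S where S: "continuous_map (top_of_set (splx ?T)) E S" "\<And>x. x \<in> splx ?T \<Longrightarrow> p (S x) = \<Sigma> x"
    using splx_lift[OF cov finT _ \<Sigma>c] by blast
  have link_leaf: "q (S x) = q (S y)" if "(x, y) \<in> link\<^sup>*" for x y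
    using that
  proof (induction rule: rtrancl_induct)
    case (step y z)
    then obtain j where "j \<in> N" "y \<in> splx (I j)" "z \<in> splx (I j)" "f j y = f j z" by (auto simp: link_def)
    then have "q (S y) = q (S z)" using lift_level[OF lev IT finT S] by blast
    then show ?case using step.IH by simp
  qed simp
  have qS: "q (S x) = q (S y)" if xy: "x \<in> horn" "y \<in> horn" "\<phi> x = \<phi> y" for x y
  proof -
    obtain j l where jl: "j \<in> N" "l \<in> N" "x \<in> splx (I j)" "y \<in> splx (I l)" using xy(1,2) unfolding horn_def by blast
    have "\<psi> x = \<psi> y" using \<phi>_I[OF jl(1,3)] \<phi>_I[OF jl(2,4)] xy(3) by simp
    then show ?thesis by (rule link_leaf[OF \<psi>link[OF jl]])
  qed
  let ?B = "leaf_space E (pullback_atlas E M p F)"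
  have Bc: "continuous_map (top_of_set horn) ?B (q \<circ> S)"
    by (rule continuous_map_compose[OF continuous_map_from_subtopology_mono[OF S(1) horn_sub] continuous_map_leaf])
  have "\<exists>x. x \<in> horn \<and> \<phi> x = c" if "c \<in> {lo..hi}" for c using surj that by (metis imageE)
  then obtain \<rho> where \<rho>: "\<And>c. c \<in> {lo..hi} \<Longrightarrow> \<rho> c \<in> horn \<and> \<phi> (\<rho> c) = c" by metis
  \<comment> \<open>Beyond the extreme levels the path of leaves is continued by constants, because
    the lifting lemma takes a path on the whole line.\<close>
  define cl where "cl c = max lo (min hi c)" for c
  have cl: "cl c \<in> {lo..hi}" for c using lohi by (auto simp: cl_def)
  have cl_id: "cl c = c" if "c \<in> {lo..hi}" for c using that by (auto simp: cl_def)
  define U where "U c = q (S (\<rho> (cl c)))" for c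
  have U\<phi>: "q (S x) = U (\<phi> x)" if "x \<in> horn" for x
    using qS[OF that, of "\<rho> (\<phi> x)"] \<rho> range[of x] that by (simp add: U_def cl_id)
  \<comment> \<open>The compact horn maps onto the interval by a quotient map, so that
    \<open>U\<close> inherits continuity from \<open>q \<circ> S\<close>, although the
    representatives \<open>\<rho>\<close> were chosen pointwise.\<close>
  have quot: "quotient_map (top_of_set horn) (top_of_set {lo..hi}) \<phi>"
  proof (rule continuous_closed_imp_quotient_map)
    show cont: "continuous_map (top_of_set horn) (top_of_set {lo..hi}) \<phi>"
      using \<phi>hc surj by (auto simp: continuous_map_in_subtopology)
    show "closed_map (top_of_set horn) (top_of_set {lo..hi}) \<phi>"
      by (rule continuous_imp_closed_map[OF cont])
        (use compact_horn in \<open>auto simp: compact_space_subtopology Hausdorff_space_subtopology\<close>)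
  qed (use surj in auto)
  have "continuous_map (top_of_set horn) ?B (U \<circ> \<phi>)"
    by (rule continuous_map_eq[OF Bc]) (use U\<phi> in auto)
  then have Uc0: "continuous_map (top_of_set {lo..hi}) ?B U"
    using continuous_compose_quotient_map_eq[OF quot] by blast
  have "continuous_map euclideanreal (top_of_set {lo..hi}) cl"
    using cl by (auto simp: continuous_map_in_subtopology cl_def intro!: continuous_intros)
  from continuous_map_compose[OF this Uc0] have "continuous_map euclideanreal ?B (U \<circ> cl)" .
  then have Uc: "continuous_map euclideanreal ?B U"
    by (rule continuous_map_eq) (simp only: U_def o_def cl_id[OF cl])
  let ?X = "top_of_set (splx ?T)"
  have HN: "horn \<union> splx N \<subseteq> splx ?T" using horn_sub splx_mono[of N ?T] finT by blast
  have "normal_space ?X"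
    by (simp add: compact_Hausdorff_or_regular_imp_normal_space compact_space_subtopology compact_splx[OF finT] Hausdorff_space_subtopology)
  moreover have "closedin ?X (horn \<union> splx N)"
    using HN compact_imp_closed[OF compact_horn] closed_splx by (intro closed_subset closed_Un)
  moreover have "continuous_map (subtopology ?X (horn \<union> splx N)) euclideanreal \<phi>"
    using \<phi>c HN by (simp add: subtopology_subtopology inf_absorb2)
  moreover have "\<phi> ` (horn \<union> splx N) \<subseteq> {lo..hi}" using range by blast
  ultimately obtain \<Phi> where \<Phi>: "continuous_map ?X euclideanreal \<Phi>" "\<And>x. x \<in> horn \<union> splx N \<Longrightarrow> \<Phi> x = \<phi> x"
    "\<Phi> ` topspace ?X \<subseteq> {lo..hi}"
    using Tietze_extension_closed_real_interval lohi by metis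
  let ?r = "retract N k"
  have rc: "continuous_map ?X (top_of_set horn) ?r"
    using continuous_on_retract[OF N(1) N_ne] retract_in_horn by (auto simp: continuous_map_in_subtopology)
  have fr: "continuous_map ?X euclideanreal (\<phi> \<circ> ?r)"
    by (rule continuous_map_compose[OF rc]) (use \<phi>hc in simp)
  have Sr: "continuous_map ?X E (S \<circ> ?r)"
    by (rule continuous_map_compose[OF rc continuous_map_from_subtopology_mono[OF S(1) horn_sub]])
  have frange: "(\<phi> \<circ> ?r) ` topspace ?X \<subseteq> {lo..hi}" using range retract_in_horn by auto
  have qSr: "q ((S \<circ> ?r) x) = U ((\<phi> \<circ> ?r) x)" if "x \<in> topspace ?X" for x
    using U\<phi> retract_in_horn that by simp
  \<comment> \<open>On the horn \<open>\<phi> \<circ> ?r\<close> and \<open>\<Phi>\<close> agree,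
    hence the new map is the old lift there.\<close>
  obtain s where s: "continuous_map ?X E s" "\<And>x. x \<in> topspace ?X \<Longrightarrow> q (s x) = U (\<Phi> x)"
    "\<And>x. x \<in> topspace ?X \<Longrightarrow> (\<phi> \<circ> ?r) x = \<Phi> x \<Longrightarrow> s x = (S \<circ> ?r) x"
    using fibration_lift_interval[OF fib Uc fr frange \<Phi>(1,3) Sr qSr] by metis
  define \<Sigma>' where "\<Sigma>' = p \<circ> s"
  have \<Sigma>'c: "continuous_map ?X M \<Sigma>'"
    unfolding \<Sigma>'_def by (rule continuous_map_compose[OF s(1) covering_mapD(1)[OF cov]])
  have \<Sigma>'horn: "\<Sigma>' x = \<Sigma> x" if x: "x \<in> horn" for x
  proof -
    have xT: "x \<in> splx ?T" using x horn_sub by blast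
    have "s x = S x" using s(3)[of x] xT \<Phi>(2)[of x] x retract_horn_id[OF x] by simp
    then show ?thesis using S(2)[OF xT] by (simp add: \<Sigma>'_def)
  qed
  have \<Sigma>'M: "\<Sigma>' x \<in> topspace M" if "x \<in> splx ?T" for x
    using continuous_map_image_subset_topspace[OF \<Sigma>'c] that by auto
  have leaf_eq: "leaf F (\<Sigma>' x) = leaf F (\<Sigma>' y)" if "x \<in> splx N \<union> horn" "y \<in> splx N \<union> horn" "\<phi> x = \<phi> y" for x y
  proof -
    have "x \<in> splx ?T" "y \<in> splx ?T" "\<Phi> x = \<phi> x" "\<Phi> y = \<phi> y" using that(1,2) HN \<Phi>(2) by blast+
    then have "q (s x) = q (s y)" using s(2)[of x] s(2)[of y] that(3) by simp
    from leaf_pullback_project[OF this] show ?thesis by (simp add: \<Sigma>'_def)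
  qed
  have conn_eq: "conn_rel M F \<Sigma>' (I j) x y \<longleftrightarrow> conn_rel M F \<Sigma> (I j) x y" if "j \<in> N" for j x y
  proof -
    have "\<Sigma>' ` C = \<Sigma> ` C" if "C \<subseteq> splx (I j)" for C
      using \<Sigma>'horn that \<open>j \<in> N\<close> by (intro image_cong) (auto simp: horn_def)
    then show ?thesis unfolding conn_rel_def by metis
  qed
  have level_I: "level_fn M F \<Sigma>' (I j) \<phi>" if j: "j \<in> N" for j
    unfolding level_fn_def conn_eq[OF j] using conj_affine_I[OF j] level_fnD(2)[OF lev[OF j]] \<phi>lev[OF j] by blast
  have "conn_rel M F \<Sigma>' N x y \<longleftrightarrow> \<phi> x = \<phi> y" if x: "x \<in> splx N" and y: "y \<in> splx N" for x y
  proof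
    assume eq: "\<phi> x = \<phi> y"
    obtain \<gamma> where \<gamma>: "continuous_on {0..1::real} \<gamma>" "\<gamma> ` {0..1} \<subseteq> splx N" "\<gamma> 0 = x" "\<gamma> 1 = y"
      "\<And>t. t \<in> {0..1} \<Longrightarrow> \<phi> (\<gamma> t) = \<phi> x"
      using conj_affine_level_path[OF conj_affine_N x y eq] by blast
    show "conn_rel M F \<Sigma>' N x y"
    proof (rule conn_rel_pathI[OF \<gamma>(1-4)])
      show "leaf F (\<Sigma>' (\<gamma> t)) = leaf F (\<Sigma>' x)" if t: "t \<in> {0..1}" for t
        by (rule leaf_eq) (use \<gamma>(2) \<gamma>(5)[OF t] t x in auto)
      show "\<Sigma>' x \<in> topspace M" using \<Sigma>'M x HN by blast
    qed
  next
    \<comment> \<open>A connected set in one leaf might cross a whole interval of levels of the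
      missing face. The facet opposite a \<open>j\<close> different from both extreme vertices has
      all these levels as well. Its slab between them is connected and lies in the same leaf, which
      contradicts the level function of that facet.\<close>
    have main: False
      if x: "x \<in> splx N" and y: "y \<in> splx N" and conn: "conn_rel M F \<Sigma>' N x y" and lt: "\<phi> x < \<phi> y" for x y
    proof -
      obtain C L where C: "connected C" "C \<subseteq> splx N" "x \<in> C" "y \<in> C" and L: "L \<in> leaves M F" "\<Sigma>' ` C \<subseteq> L"
        using conn unfolding conn_rel_def by blast
      obtain i1 i2 where i12: "i1 \<in> N" "i2 \<in> N" "\<phi> ` splx N = {\<phi> (vtx i1)..\<phi> (vtx i2)}"
        by (rule conj_affine_extremes[OF conj_affine_N N(1) N_ne])
      obtain j where j: "j \<in> N" "j \<noteq> i1" "j \<noteq> i2" by (rule ex_other)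
      let ?J = "N - {j}"
      have gJ: "conj_affine ?J \<phi>" using conj_affine_subset[OF conj_affine_N] N by blast
      have hit: "\<exists>z\<in>splx ?J. \<phi> z = c" if c: "c \<in> {\<phi> x..\<phi> y}" for c
      proof -
        have "\<phi> x \<in> \<phi> ` splx N" "\<phi> y \<in> \<phi> ` splx N" using x y by auto
        then have "c \<in> {\<phi> (vtx i1)..\<phi> (vtx i2)}" using c unfolding i12(3) by auto
        moreover have "connected (\<phi> ` splx ?J)"
          by (rule connected_continuous_image[OF conj_affine_continuous[OF gJ] connected_splx])
        moreover have "\<phi> (vtx i1) \<in> \<phi> ` splx ?J" "\<phi> (vtx i2) \<in> \<phi> ` splx ?J"
          using vtx_in_splx[of ?J] N i12 j by auto
        ultimately have "c \<in> \<phi> ` splx ?J" by (meson atLeastAtMost_iff connectedD_interval)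
        then show ?thesis by (metis imageE)
      qed
      have JI: "splx ?J \<subseteq> splx (I j)" "splx ?J \<subseteq> splx N"
        by (rule splx_mono; use N in auto)+
      have inL: "\<Sigma>' z \<in> L" if z: "z \<in> splx (I j)" "\<phi> z \<in> {\<phi> x..\<phi> y}" for z
      proof -
        have "connected (\<phi> ` C)"
          by (rule connected_continuous_image[OF continuous_on_subset[OF conj_affine_continuous[OF conj_affine_N] C(2)] C(1)])
        then have "\<phi> z \<in> \<phi> ` C" using C(3,4) z(2) by (meson atLeastAtMost_iff connectedD_interval imageI)
        then obtain u where u: "u \<in> C" "\<phi> u = \<phi> z" by auto
        have "leaf F (\<Sigma>' u) = leaf F (\<Sigma>' z)"
          by (rule leaf_eq) (use u C(2) z j(1) in \<open>auto simp: horn_def\<close>)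
        moreover have "L = leaf F (\<Sigma>' u)" using leaves_leaf[OF L(1)] L(2) u(1) by blast
        ultimately show ?thesis by (simp add: mem_leaf_iff)
      qed
      let ?Q = "{z \<in> splx (I j). \<phi> z \<in> {\<phi> x..\<phi> y}}"
      obtain z1 where z1: "z1 \<in> splx ?J" "\<phi> z1 = \<phi> x" using hit[of "\<phi> x"] lt by auto
      obtain z2 where z2: "z2 \<in> splx ?J" "\<phi> z2 = \<phi> y" using hit[of "\<phi> y"] lt by auto
      have "conn_rel M F \<Sigma>' (I j) z1 z2"
        unfolding conn_rel_def
      proof (intro exI conjI bexI)
        show "connected ?Q" by (rule conj_affine_slab_connected[OF conj_affine_I[OF j(1)]])
        show "z1 \<in> ?Q" "z2 \<in> ?Q" using z1 z2 JI lt by auto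
        show "\<Sigma>' ` ?Q \<subseteq> L" using inL by blast
        show "L \<in> leaves M F" by (rule L(1))
      qed auto
      then have "\<phi> z1 = \<phi> z2" using level_fnD(2)[OF level_I[OF j(1)]] z1 z2 JI by blast
      then show False using z1 z2 lt by simp
    qed
    assume conn: "conn_rel M F \<Sigma>' N x y"
    then have "conn_rel M F \<Sigma>' N y x" unfolding conn_rel_def by blast
    with conn show "\<phi> x = \<phi> y" using main[OF x y] main[OF y x] by (metis linorder_neqE)
  qed
  then have level_N: "level_fn M F \<Sigma>' N \<phi>" unfolding level_fn_def using conj_affine_N by blast
  show ?thesis by (rule that[OF \<Sigma>'c \<Sigma>'horn level_I level_N])
qed

end

section \<open>Local surjectivity of the missing face\<close>

lemma face_homeo_pos:
  assumes h: "face_homeo J h h'" "finite J" and x: "x \<in> splx J" "\<And>i. i \<in> J \<Longrightarrow> 0 < x i" and i: "i \<in> J"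
  shows "0 < h x i"
proof (rule ccontr)
  have hx: "h x \<in> splx J" using face_homeoD(1)[OF h(1) order.refl x(1)] .
  assume "\<not> 0 < h x i"
  then have "h x i = 0" using splxD(1)[OF hx, of i] by simp
  then have "h x \<in> splx (J \<inter> (J - {i}))"
    using hx h(2) by (intro splx_subset_support) auto
  then have "h' (h x) \<in> splx (J - {i})" using face_homeoD(2)[OF h(1), of "J - {i}"] by (simp add: Int_absorb1 Diff_subset)
  then have "x i = 0" using face_homeoD(3)[OF h(1) x(1)] splxD(2)[of x "J - {i}" i] by simp
  then show False using x(2)[OF i] by simp
qed

context fol_cover
begin

text \<open>On a short arc across the levels of the missing face the transverse coordinate is
  injective: the leaf on each level also passes through a facet of the horn, where
  \<open>level_local_injective\<close> holds. A continuous injection on an open interval is open,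
  and this is local surjectivity. The facet is chosen to contain both vertices of extreme value, so
  that it meets all levels.\<close>

lemma strong_face:
  assumes one: "one_manifold (leaf_space E (pullback_atlas E M p F))"
    and N: "finite N" "3 \<le> card N" and \<Sigma>: "continuous_map (top_of_set (splx (insert k N))) M \<Sigma>"
    and lev_I: "\<And>j. j \<in> N \<Longrightarrow> level_fn M F \<Sigma> (insert k (N - {j})) \<phi>"
    and lev_N: "level_fn M F \<Sigma> N \<phi>"
    and st: "\<And>j. j \<in> N \<Longrightarrow> strong_fn F (insert k (N - {j})) \<Sigma> \<phi>"
  shows "strong_fn F N \<Sigma> \<phi>"
proof (cases "\<forall>x\<in>splx N. \<forall>y\<in>splx N. \<phi> x = \<phi> y")
  case True
  then show ?thesis unfolding strong_fn_def by (rule disjI1)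
next
  case False
  let ?T = "insert k N"
  have finT: "finite ?T" "?T \<noteq> {}" and NT: "N \<subseteq> ?T" and IT: "insert k (N - {j}) \<subseteq> ?T" for j using N by auto
  have Nne: "N \<noteq> {}" using N by auto
  have gN: "conj_affine N \<phi>" by (rule level_fnD(1)[OF lev_N])
  obtain S where S: "continuous_map (top_of_set (splx ?T)) E S" "\<And>x. x \<in> splx ?T \<Longrightarrow> p (S x) = \<Sigma> x"
    using splx_lift[OF cov finT \<Sigma>] by blast
  have splxN: "splx N \<subseteq> splx ?T" by (rule splx_mono[OF NT finT(1)])
  obtain h h' where h: "face_homeo N h h'" "\<And>x. x \<in> splx N \<Longrightarrow> \<phi> (h x) = lin N (\<lambda>i. \<phi> (vtx i)) x"
    using conj_affineE1[OF gN] by blast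
  obtain i1 i2 where i12: "i1 \<in> N" "i2 \<in> N" "\<phi> ` splx N = {\<phi> (vtx i1)..\<phi> (vtx i2)}"
    and mm: "\<And>i. i \<in> N \<Longrightarrow> \<phi> (vtx i1) \<le> \<phi> (vtx i) \<and> \<phi> (vtx i) \<le> \<phi> (vtx i2)"
    using conj_affine_extremes[OF gN N(1) Nne] by metis
  define a b where "a = \<phi> (vtx i1)" and "b = \<phi> (vtx i2)"
  have ab: "a < b"
  proof (rule ccontr)
    assume "\<not> a < b"
    then have "\<phi> x = a" if "x \<in> splx N" for x
      using i12(3) that unfolding a_def b_def by (metis antisym_conv atLeastAtMost_iff imageI linorder_not_less order.trans)
    then show False using False by metis
  qed
  have neq: "i1 \<noteq> i2" using ab by (auto simp: a_def b_def)
  have "\<not> N \<subseteq> {i1, i2}"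
  proof
    assume "N \<subseteq> {i1, i2}"
    then have "card N \<le> card {i1, i2}" by (intro card_mono) auto
    also have "\<dots> \<le> 2" by (simp add: card_insert_if)
    finally show False using N by simp
  qed
  then obtain j where j: "j \<in> N" "j \<noteq> i1" "j \<noteq> i2" by blast
  let ?J = "N - {j}" and ?I = "insert k (N - {j})"
  have gJ: "conj_affine ?J \<phi>" by (rule conj_affine_subset[OF gN]) (use N in auto)
  have JI: "splx ?J \<subseteq> splx ?I" "splx ?J \<subseteq> splx N"
    by (rule splx_mono; use N in auto)+
  have hit: "\<exists>y\<in>splx ?J. \<phi> y = c" if c: "c \<in> {a..b}" for c
  proof -
    have "connected (\<phi> ` splx ?J)"
      by (rule connected_continuous_image[OF conj_affine_continuous[OF gJ] connected_splx])
    moreover have "a \<in> \<phi> ` splx ?J" "b \<in> \<phi> ` splx ?J"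
      using vtx_in_splx[of ?J] N i12 j by (auto simp: a_def b_def)
    ultimately have "c \<in> \<phi> ` splx ?J" using c by (meson atLeastAtMost_iff connectedD_interval)
    then show ?thesis by (metis imageE)
  qed
  have "loc_surj F N \<Sigma>"
    unfolding loc_surj_def
  proof (intro ballI, clarify)
    fix U \<xi> z W
    assume U: "(U, \<xi>) \<in> F" and z: "z \<in> splx N" "\<forall>i\<in>N. 0 < z i" "\<Sigma> z \<in> U"
      and W: "openin (top_of_set (splx N)) W" "z \<in> W" "\<Sigma> ` W \<subseteq> U"
    define z0 where "z0 = h' z"
    have z0: "z0 \<in> splx N" using face_homeoD(2)[OF h(1) order.refl z(1)] by (simp add: z0_def)
    have hz0: "h z0 = z" using face_homeoD(4)[OF h(1) z(1)] by (simp add: z0_def)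
    have z0pos: "0 < z0 i" if "i \<in> N" for i
      unfolding z0_def by (rule face_homeo_pos[OF face_homeo_sym[OF h(1)] N(1) z(1)]) (use z(2) that in auto)
    let ?L = "lin N (\<lambda>i. \<phi> (vtx i))"
    define c where "c = \<phi> z"
    have cL: "c = ?L z0" using h(2)[OF z0] hz0 by (simp add: c_def)
    have "c < b" unfolding cL b_def
      by (rule lin_less[OF z0 N(1) _ i12(1) z0pos[OF i12(1)]]) (use mm ab in \<open>auto simp: a_def b_def\<close>)
    have "a < c" unfolding cL a_def
      by (rule lin_greater[OF z0 N(1) _ i12(2) z0pos[OF i12(2)]]) (use mm ab in \<open>auto simp: a_def b_def\<close>)
    \<comment> \<open>Shifting weight from the vertex of least value to that of greatest value moves
      the point through the levels; the factor is such that \<open>v r\<close> is on level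
      \<open>r\<close>.\<close>
    define v where "v r = (\<lambda>i. z0 i + (r - c) / (b - a) * (vtx i2 i - vtx i1 i))" for r
    define \<delta> where "\<delta> = (b - a) * min (z0 i1) (z0 i2)"
    have \<delta>: "0 < \<delta>" using ab z0pos i12 by (simp add: \<delta>_def)
    have vS: "v r \<in> splx N" if "\<bar>r - c\<bar> < \<delta>" for r
    proof -
      have t: "\<bar>(r - c) / (b - a)\<bar> < min (z0 i1) (z0 i2)"
        using that ab by (simp add: \<delta>_def abs_divide pos_divide_less_eq mult.commute del: min_less_iff_conj)
      have "sum (v r) N = sum z0 N + (r - c) / (b - a) * (sum (vtx i2) N - sum (vtx i1) N)"
        unfolding v_def sum.distrib sum_subtractf[symmetric] sum_distrib_left ..
      also have "\<dots> = 1"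
        using splxD(3)[OF z0] splxD(3)[of "vtx i1" N] splxD(3)[of "vtx i2" N] vtx_in_splx[OF N(1)] i12 by simp
      finally have "sum (v r) N = 1" .
      moreover have "0 \<le> v r i" for i
      proof -
        define e where "e = (r - c) / (b - a)"
        have "- e < z0 i1" "e < z0 i1" "- e < z0 i2" "e < z0 i2" using t unfolding e_def[symmetric] by auto
        moreover have "v r i = z0 i + e * (vtx i2 i - vtx i1 i)" by (simp add: v_def e_def)
        ultimately show ?thesis using splxD(1)[OF z0, of i] neq by (auto simp: vtx_def)
      qed
      moreover have "v r i = 0" if "i \<notin> N" for i
        using splxD(2)[OF z0 that] that i12 by (auto simp: v_def vtx_def)
      ultimately show ?thesis by (simp add: splx_def)
    qed
    have vL: "?L (v r) = r" for r
    proof -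
      have "?L (v r) = ?L z0 + (r - c) / (b - a) * (?L (vtx i2) - ?L (vtx i1))"
      proof -
        define e where "e = (r - c) / (b - a)"
        have "v r = (\<lambda>i. z0 i + e * (vtx i2 i - vtx i1 i))" by (simp add: v_def e_def)
        then show ?thesis
          unfolding e_def[symmetric] by (simp add: lin_def algebra_simps sum.distrib sum_subtractf sum_distrib_left)
      qed
      also have "\<dots> = c + (r - c) / (b - a) * (b - a)"
        using lin_vtx[OF N(1)] i12 by (simp add: cL a_def b_def)
      finally show ?thesis using ab by simp
    qed
    define s where "s r = h (v r)" for r
    let ?B = "ball c \<delta>"
    have sS: "s r \<in> splx N" "\<phi> (s r) = r" if "r \<in> ?B" for r
      using vS[of r] that h(2)[of "v r"] vL face_homeoD(1)[OF h(1) order.refl]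
      by (auto simp: s_def dist_real_def abs_minus_commute)
    have sc: "continuous_on ?B s"
      unfolding s_def
      by (rule continuous_on_compose2[OF face_homeoD(5)[OF h(1)]])
        (use vS ab in \<open>auto simp: v_def[abs_def] dist_real_def abs_minus_commute intro!: continuous_intros\<close>)
    have v0: "v c = z0" by (simp add: v_def)
    have s0: "s c = z" by (simp add: s_def v0 hz0)
    have zT: "z \<in> splx ?T" using z(1) splxN by blast
    have SE: "S z \<in> topspace E" using continuous_map_image_subset_topspace[OF S(1)] zT by auto
    have pz: "p (S z) \<in> U" using S(2)[OF zT] z(3) by simp
    obtain V where V: "openin E V" "S z \<in> V" "p ` V = U" "(V, \<xi> \<circ> p) \<in> pullback_atlas E M p F"
      using pullback_sheet[OF fol cov SE U pz] by blast
    have "c \<in> {a..b}" using \<open>a < c\<close> \<open>c < b\<close> by simp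
    then obtain y0 where y0: "y0 \<in> splx ?J" "\<phi> y0 = c" using hit by blast
    have y0I: "y0 \<in> splx ?I" using y0 JI by blast
    obtain \<epsilon> where \<epsilon>: "0 < \<epsilon>" "\<And>x y. x \<in> splx ?I \<Longrightarrow> y \<in> splx ?I \<Longrightarrow> \<bar>\<phi> x - \<phi> y0\<bar> < \<epsilon> \<Longrightarrow> \<bar>\<phi> y - \<phi> y0\<bar> < \<epsilon> \<Longrightarrow>
      q (S x) = q (S y) \<Longrightarrow> \<phi> x = \<phi> y"
      using level_local_injective[OF one lev_I[OF j(1)] st[OF j(1)] IT finT(1) S y0I] by metis
    have sT: "continuous_map (top_of_set ?B) (top_of_set (splx ?T)) s"
      using sc sS splxN by (auto simp: continuous_map_in_subtopology)
    from continuous_map_compose[OF this S(1)] have Ss: "continuous_map (top_of_set ?B) E (S \<circ> s)" .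
    obtain W' where W': "open W'" "W = splx N \<inter> W'" using W(1) by (auto simp: openin_open)
    have "openin (top_of_set ?B) (?B \<inter> s -` W')"
      by (rule continuous_openin_preimage_gen[OF sc W'(1)])
    then have o1: "open (?B \<inter> s -` W')" by (simp add: openin_open_eq)
    have "openin (top_of_set ?B) {r \<in> ?B. S (s r) \<in> V}"
      using openin_continuous_map_preimage[OF Ss V(1)] by simp
    then have o2: "open {r \<in> ?B. S (s r) \<in> V}" by (simp add: openin_open_eq)
    have "open ((?B \<inter> s -` W') \<inter> {r \<in> ?B. S (s r) \<in> V} \<inter> ball c \<epsilon> \<inter> {a<..<b})"
      by (intro open_Int o1 o2) auto
    moreover have "c \<in> (?B \<inter> s -` W') \<inter> {r \<in> ?B. S (s r) \<in> V} \<inter> ball c \<epsilon> \<inter> {a<..<b}"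
      using \<delta> \<epsilon>(1) W(2) W'(2) V(2) s0 \<open>a < c\<close> \<open>c < b\<close> by auto
    ultimately obtain d where d: "0 < d" "ball c d \<subseteq> (?B \<inter> s -` W') \<inter> {r \<in> ?B. S (s r) \<in> V} \<inter> ball c \<epsilon> \<inter> {a<..<b}"
      unfolding open_contains_ball by blast
    let ?D = "ball c d"
    have D: "r \<in> ?B" "s r \<in> W" "S (s r) \<in> V" "\<bar>r - c\<bar> < \<epsilon>" "r \<in> {a..b}" if "r \<in> ?D" for r
      using d(2) that sS(1)[of r] W'(2) by (auto simp: dist_real_def abs_minus_commute subset_iff)
    define w where "w r = last_coord (\<xi> (\<Sigma> (s r)))" for r
    have wp: "w r = last_coord (\<xi> (p (S (s r))))" if "r \<in> ?D" for r
      using S(2)[of "s r"] sS(1)[OF D(1)[OF that]] splxN by (auto simp: w_def)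
    have wc: "continuous_on ?D w"
    proof -
      have "continuous_map (top_of_set ?D) (subtopology M U) (p \<circ> (S \<circ> s))"
        unfolding continuous_map_in_subtopology
      proof (intro conjI)
        show "continuous_map (top_of_set ?D) M (p \<circ> (S \<circ> s))"
          by (rule continuous_map_compose[OF continuous_map_from_subtopology_mono[OF Ss] covering_mapD(1)[OF cov]]) (use D in blast)
        show "(p \<circ> (S \<circ> s)) \<in> topspace (top_of_set ?D) \<rightarrow> U" using D(3) V(3) by auto
      qed
      from continuous_map_compose[OF this homeomorphic_imp_continuous_map[OF foliation_chart(4)[OF fol U]]]
      have "continuous_on ?D (\<lambda>r. \<xi> (p (S (s r))))" by (simp add: o_def)
      then have "continuous_on ?D (\<lambda>r. last_coord (\<xi> (p (S (s r)))))"
        by (rule continuous_on_compose2[OF continuous_last_coord[of UNIV]]) simp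
      then show ?thesis by (rule continuous_on_eq) (simp add: wp)
    qed
    \<comment> \<open>The points of the arc are replaced by points \<open>y\<close> and
      \<open>y'\<close> on the same levels in the face that the missing face shares with the
      facet.\<close>
    have winj: "inj_on w ?D"
    proof (rule inj_onI)
      fix r r' assume r: "r \<in> ?D" "r' \<in> ?D" "w r = w r'"
      have "q (S (s r)) = q (S (s r'))"
        by (rule leaf_eq_plaque[OF V(4) D(3)[OF r(1)] D(3)[OF r(2)]]) (use r wp in simp)
      moreover obtain y where y: "y \<in> splx ?J" "\<phi> y = r" using hit[OF D(5)[OF r(1)]] by blast
      moreover obtain y' where y': "y' \<in> splx ?J" "\<phi> y' = r'" using hit[OF D(5)[OF r(2)]] by blast
      moreover have "q (S y) = q (S (s r))"
        by (rule lift_level[OF lev_N NT finT(1) S]) (use y JI sS D(1)[OF r(1)] in auto)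
      moreover have "q (S y') = q (S (s r'))"
        by (rule lift_level[OF lev_N NT finT(1) S]) (use y' JI sS D(1)[OF r(2)] in auto)
      ultimately have "q (S y) = q (S y')" by simp
      then have "\<phi> y = \<phi> y'"
        by (rule \<epsilon>(2)[rotated -1]) (use y y' y0 JI D(4)[OF r(1)] D(4)[OF r(2)] in auto)
      then show "r = r'" using y y' by simp
    qed
    have "is_interval ?D" by (simp add: is_interval_convex_1)
    then have "open (w ` ?D)" using injective_eq_1d_open_map_UNIV[OF wc] winj by blast
    moreover have "last_coord (\<xi> (\<Sigma> z)) \<in> w ` ?D" using d(1) s0 by (auto simp: w_def intro: image_eqI[of _ _ c])
    moreover have "w ` ?D \<subseteq> (\<lambda>x. last_coord (\<xi> (\<Sigma> x))) ` W" using D(2) by (auto simp: w_def)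
    ultimately show "\<exists>T. open T \<and> last_coord (\<xi> (\<Sigma> z)) \<in> T \<and> T \<subseteq> (\<lambda>x. last_coord (\<xi> (\<Sigma> x))) ` W" by blast
  qed
  then show ?thesis by (simp add: strong_fn_def)
qed

end


section \<open>Transverse singular simplices\<close>

definition reindexing :: "nat set \<Rightarrow> nat set \<Rightarrow> (nat \<Rightarrow> nat) \<Rightarrow> (nat \<Rightarrow> nat) \<Rightarrow> bool" where
  "reindexing A B i i' \<longleftrightarrow> finite A \<and> finite B \<and> (\<forall>a\<in>A. i a \<in> B \<and> i' (i a) = a) \<and> (\<forall>b\<in>B. i' b \<in> A \<and> i (i' b) = b)"

text \<open>Coordinates are read off through \<open>i\<close>, so the map is contravariant: for
  \<open>reindexing A B i i'\<close> it sends \<open>splx B\<close> to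
  \<open>splx A\<close>.\<close>

definition pull :: "(nat \<Rightarrow> nat) \<Rightarrow> nat set \<Rightarrow> (nat \<Rightarrow> real) \<Rightarrow> nat \<Rightarrow> real" where
  "pull i A x = (\<lambda>a. if a \<in> A then x (i a) else 0)"

lemma reindexing_sym: "reindexing A B i i' \<Longrightarrow> reindexing B A i' i"
  by (auto simp: reindexing_def)

lemma continuous_on_pull: "continuous_on S (pull i A)"
proof (rule continuous_on_coordinatewise_then_product)
  fix a show "continuous_on S (\<lambda>x. pull i A x a)"
    by (cases "a \<in> A") (simp_all add: pull_def continuous_on_coord)
qed

lemma pull_splx_image:
  assumes r: "reindexing A B i i'" and J: "J \<subseteq> A" and x: "x \<in> splx (i ` J)"
  shows "pull i A x \<in> splx J"
proof -
  have fin: "finite A" and inj: "inj_on i A" using r by (auto simp: reindexing_def intro: inj_on_inverseI)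
  have "sum (pull i A x) J = (\<Sum>a\<in>J. x (i a))" using J by (intro sum.cong) (auto simp: pull_def)
  also have "\<dots> = sum x (i ` J)" by (simp add: sum.reindex inj_on_subset[OF inj J])
  also have "\<dots> = 1" by (rule splxD(3)[OF x])
  finally have "sum (pull i A x) J = 1" .
  moreover have "pull i A x a = 0" if a: "a \<notin> J" for a
  proof (cases "a \<in> A")
    case True
    then have "i a \<notin> i ` J" using inj_on_image_mem_iff[OF inj True J] a by simp
    then show ?thesis using splxD(2)[OF x] by (simp add: pull_def)
  qed (simp add: pull_def)
  ultimately show ?thesis using splxD(1)[OF x] by (auto simp: splx_def pull_def)
qed

lemma reindexing_image:
  assumes r: "reindexing A B i i'" and K: "K \<subseteq> B"
  shows "i' ` K \<subseteq> A" "i ` i' ` K = K"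
proof -
  have *: "i' b \<in> A \<and> i (i' b) = b" if "b \<in> K" for b using r K that by (auto simp: reindexing_def)
  then show "i' ` K \<subseteq> A" by blast
  have "(\<lambda>b. i (i' b)) ` K = (\<lambda>b. b) ` K" by (rule image_cong) (use * in auto)
  then show "i ` i' ` K = K" by (simp add: image_image)
qed

lemma pull_splx_preimage:
  assumes r: "reindexing A B i i'" and K: "K \<subseteq> B" and x: "x \<in> splx K"
  shows "pull i A x \<in> splx (i' ` K)"
  by (rule pull_splx_image[OF r reindexing_image(1)[OF r K]]) (use x reindexing_image(2)[OF r K] in simp)

lemma pull_splx:
  assumes r: "reindexing A B i i'" and x: "x \<in> splx B"
  shows "pull i A x \<in> splx A"
proof -
  have "i ` A = B"
    using reindexing_image(2)[OF r order.refl] r unfolding reindexing_def by (metis image_subset_iff subset_antisym image_mono)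
  then show ?thesis using pull_splx_image[OF r order.refl] x by simp
qed

lemma pull_inverse:
  assumes r: "reindexing A B i i'" and x: "x \<in> splx B"
  shows "pull i' B (pull i A x) = x"
proof
  fix b show "pull i' B (pull i A x) b = x b"
    using r splxD(2)[OF x, of b] by (cases "b \<in> B") (auto simp: pull_def reindexing_def)
qed

lemma lin_pull:
  assumes r: "reindexing A B i i'"
  shows "lin A c (pull i A x) = lin B (\<lambda>b. c (i' b)) x"
proof -
  have "lin A c (pull i A x) = (\<Sum>a\<in>A. c a * x (i a))" unfolding lin_def by (intro sum.cong) (auto simp: pull_def)
  also have "\<dots> = (\<Sum>b\<in>B. c (i' b) * x b)"
    by (rule sum.reindex_bij_witness[of _ i' i]) (use r in \<open>auto simp: reindexing_def\<close>)
  finally show ?thesis by (simp add: lin_def)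
qed

lemma face_homeo_pull:
  assumes r: "reindexing A B i i'" and h: "face_homeo A h h'"
  shows "face_homeo B (\<lambda>x. pull i' B (h (pull i A x))) (\<lambda>x. pull i' B (h' (pull i A x)))"
proof -
  have faces: "pull i' B (g (pull i A x)) \<in> splx K"
    if g: "\<And>J x. J \<subseteq> A \<Longrightarrow> x \<in> splx J \<Longrightarrow> g x \<in> splx J" and K: "K \<subseteq> B" "x \<in> splx K" for K g x
  proof (rule pull_splx_image[OF reindexing_sym[OF r] K(1)])
    show "g (pull i A x) \<in> splx (i' ` K)" by (rule g[OF reindexing_image(1)[OF r K(1)] pull_splx_preimage[OF r K]])
  qed
  have inv: "pull i' B (g' (pull i A (pull i' B (g (pull i A x))))) = x"
    if g: "\<And>x. x \<in> splx A \<Longrightarrow> g x \<in> splx A" "\<And>x. x \<in> splx A \<Longrightarrow> g' (g x) = x" and x: "x \<in> splx B" for x g g'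
    using pull_inverse[OF reindexing_sym[OF r] g(1)[OF pull_splx[OF r x]]] g(2)[OF pull_splx[OF r x]] pull_inverse[OF r x] by simp
  have cont: "continuous_on (splx B) (\<lambda>x. pull i' B (g (pull i A x)))" if g: "continuous_on (splx A) g" for g
    by (rule continuous_on_compose2[OF continuous_on_pull continuous_on_compose2[OF g continuous_on_pull]])
      (use pull_splx[OF r] in auto)
  note hD = face_homeoD[OF h]
  show ?thesis
    unfolding face_homeo_def
    using faces[of h, OF hD(1)] faces[of h', OF hD(2)] cont[OF hD(5)] cont[OF hD(6)]
      inv[of h h', OF hD(1)[OF order.refl] hD(3)] inv[of h' h, OF hD(2)[OF order.refl] hD(4)] by blast
qed

lemma conj_affine_pull:
  assumes r: "reindexing A B i i'" and f: "conj_affine A f"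
  shows "conj_affine B (\<lambda>x. f (pull i A x))"
proof -
  obtain h h' where h: "face_homeo A h h'" "\<And>x. x \<in> splx A \<Longrightarrow> f (h x) = lin A (\<lambda>i. f (vtx i)) x"
    using conj_affineE1[OF f] by blast
  have finB: "finite B" using r by (simp add: reindexing_def)
  show ?thesis
  proof (rule conj_affineI[OF face_homeo_pull[OF r h(1)] finB])
    fix x assume x: "x \<in> splx B"
    have "h (pull i A x) \<in> splx A" by (rule face_homeoD(1)[OF h(1) order.refl pull_splx[OF r x]])
    then show "f (pull i A (pull i' B (h (pull i A x)))) = lin B (\<lambda>b. f (vtx (i' b))) x"
      using pull_inverse[OF reindexing_sym[OF r]] h(2)[OF pull_splx[OF r x]] lin_pull[OF r] by simp
  qed
qed

lemma conn_rel_cong: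
  assumes "\<And>x. x \<in> splx J \<Longrightarrow> \<Sigma> x = \<Sigma>' x"
  shows "conn_rel M F \<Sigma> J x y \<longleftrightarrow> conn_rel M F \<Sigma>' J x y"
proof -
  have "\<Sigma> ` C = \<Sigma>' ` C" if "C \<subseteq> splx J" for C using that assms by (intro image_cong) auto
  then show ?thesis unfolding conn_rel_def by metis
qed

lemma level_fn_cong:
  assumes "level_fn M F \<Sigma> J f" "finite J" "\<And>x. x \<in> splx J \<Longrightarrow> \<Sigma>' x = \<Sigma> x" "\<And>x. x \<in> splx J \<Longrightarrow> f' x = f x"
  shows "level_fn M F \<Sigma>' J f'"
  using conj_affine_cong[OF level_fnD(1)[OF assms(1)] assms(2,4)] level_fnD(2)[OF assms(1)] assms(4)
    conn_rel_cong[of J \<Sigma>' \<Sigma> M F, OF assms(3)] unfolding level_fn_def by simp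

lemma loc_surj_cong:
  assumes ls: "loc_surj F J \<Sigma>" and eq: "\<And>x. x \<in> splx J \<Longrightarrow> \<Sigma>' x = \<Sigma> x"
  shows "loc_surj F J \<Sigma>'"
  unfolding loc_surj_def
proof (intro ballI, clarify)
  fix U \<phi> z W
  assume U: "(U, \<phi>) \<in> F" and z: "z \<in> splx J" "\<forall>i\<in>J. 0 < z i" "\<Sigma>' z \<in> U"
    and W: "openin (top_of_set (splx J)) W" "z \<in> W" "\<Sigma>' ` W \<subseteq> U"
  have WJ: "W \<subseteq> splx J" using openin_subset[OF W(1)] by simp
  have im: "\<Sigma> ` W = \<Sigma>' ` W" "(\<lambda>x. last_coord (\<phi> (\<Sigma> x))) ` W = (\<lambda>x. last_coord (\<phi> (\<Sigma>' x))) ` W"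
    using WJ eq by (auto intro!: image_cong)
  show "\<exists>T. open T \<and> last_coord (\<phi> (\<Sigma>' z)) \<in> T \<and> T \<subseteq> (\<lambda>x. last_coord (\<phi> (\<Sigma>' x))) ` W"
    using loc_surjD[OF ls U z(1) _ _ W(1,2)] z(2,3) W(3) eq[OF z(1)] im by simp
qed

lemma conn_rel_pull_imp:
  assumes r: "reindexing A B i i'" and c: "conn_rel M F (\<lambda>x. \<Sigma> (pull i A x)) B x y"
  shows "conn_rel M F \<Sigma> A (pull i A x) (pull i A y)"
proof -
  obtain C L where C: "connected C" "C \<subseteq> splx B" "x \<in> C" "y \<in> C" "L \<in> leaves M F" "(\<lambda>x. \<Sigma> (pull i A x)) ` C \<subseteq> L"
    using c unfolding conn_rel_def by blast
  have "connected (pull i A ` C)" by (rule connected_continuous_image[OF continuous_on_pull C(1)])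
  moreover have "pull i A ` C \<subseteq> splx A" using C(2) pull_splx[OF r] by blast
  ultimately show ?thesis using C(3-6) unfolding conn_rel_def by blast
qed

lemma conn_rel_pull:
  assumes r: "reindexing A B i i'" and x: "x \<in> splx B" and y: "y \<in> splx B"
  shows "conn_rel M F (\<lambda>x. \<Sigma> (pull i A x)) B x y \<longleftrightarrow> conn_rel M F \<Sigma> A (pull i A x) (pull i A y)"
proof
  assume "conn_rel M F \<Sigma> A (pull i A x) (pull i A y)"
  moreover have "\<Sigma> (pull i A (pull i' B z)) = \<Sigma> z" if "z \<in> splx A" for z
    using pull_inverse[OF reindexing_sym[OF r] that] by simp
  ultimately have "conn_rel M F (\<lambda>z. \<Sigma> (pull i A (pull i' B z))) A (pull i A x) (pull i A y)"
    using conn_rel_cong[of A "\<lambda>z. \<Sigma> (pull i A (pull i' B z))" \<Sigma> M F] by simp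
  from conn_rel_pull_imp[OF reindexing_sym[OF r], of M F "\<lambda>x. \<Sigma> (pull i A x)", OF this]
  show "conn_rel M F (\<lambda>x. \<Sigma> (pull i A x)) B x y" using pull_inverse[OF r] x y by simp
qed (rule conn_rel_pull_imp[OF r])

lemma level_fn_pull:
  assumes r: "reindexing A B i i'" and lev: "level_fn M F \<Sigma> A f"
  shows "level_fn M F (\<lambda>x. \<Sigma> (pull i A x)) B (\<lambda>x. f (pull i A x))"
  using conj_affine_pull[OF r level_fnD(1)[OF lev]] level_fnD(2)[OF lev] conn_rel_pull[OF r, where M = M and F = F and \<Sigma> = \<Sigma>] pull_splx[OF r]
  unfolding level_fn_def by simp

lemma loc_surj_pull:
  assumes r: "reindexing A B i i'" and ls: "loc_surj F A \<Sigma>"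
  shows "loc_surj F B (\<lambda>x. \<Sigma> (pull i A x))"
  unfolding loc_surj_def
proof (intro ballI, clarify)
  fix U \<phi> z W
  assume U: "(U, \<phi>) \<in> F" and z: "z \<in> splx B" "\<forall>i\<in>B. 0 < z i" "\<Sigma> (pull i A z) \<in> U"
    and W: "openin (top_of_set (splx B)) W" "z \<in> W" "(\<lambda>x. \<Sigma> (pull i A x)) ` W \<subseteq> U"
  let ?W = "{x \<in> splx A. pull i' B x \<in> W}"
  have "continuous_map (top_of_set (splx A)) (top_of_set (splx B)) (pull i' B)"
    using continuous_on_pull pull_splx[OF reindexing_sym[OF r]] by (auto simp: continuous_map_in_subtopology)
  from openin_continuous_map_preimage[OF this W(1)] have W': "openin (top_of_set (splx A)) ?W" by simp
  have WB: "W \<subseteq> splx B" using openin_subset[OF W(1)] by simp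
  have z': "pull i A z \<in> splx A" "\<And>a. a \<in> A \<Longrightarrow> 0 < pull i A z a" "pull i A z \<in> ?W"
    using pull_splx[OF r z(1)] z(2) r W(2) pull_inverse[OF r z(1)] by (auto simp: pull_def reindexing_def)
  have fac: "\<Sigma> x = \<Sigma> (pull i A (pull i' B x))" if "x \<in> ?W" for x
    using pull_inverse[OF reindexing_sym[OF r]] that by simp
  have WU: "\<Sigma> ` ?W \<subseteq> U"
  proof clarify
    fix x assume x: "x \<in> splx A" "pull i' B x \<in> W"
    then have "\<Sigma> (pull i A (pull i' B x)) \<in> U" using W(3) by blast
    then show "\<Sigma> x \<in> U" using fac x by simp
  qed
  obtain T where T: "open T" "last_coord (\<phi> (\<Sigma> (pull i A z))) \<in> T" "T \<subseteq> (\<lambda>x. last_coord (\<phi> (\<Sigma> x))) ` ?W"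
    using loc_surjD[OF ls U z'(1,2) z(3) W' z'(3) WU] by blast
  moreover have "(\<lambda>x. last_coord (\<phi> (\<Sigma> x))) ` ?W \<subseteq> (\<lambda>x. last_coord (\<phi> (\<Sigma> (pull i A x)))) ` W"
    using fac by auto
  ultimately show "\<exists>T. open T \<and> last_coord (\<phi> (\<Sigma> (pull i A z))) \<in> T \<and> T \<subseteq> (\<lambda>x. last_coord (\<phi> (\<Sigma> (pull i A x)))) ` W"
    by blast
qed

lemma strong_fn_pull:
  assumes r: "reindexing A B i i'" and "strong_fn F A \<Sigma> f"
  shows "strong_fn F B (\<lambda>x. \<Sigma> (pull i A x)) (\<lambda>x. f (pull i A x))"
  using assms(2) loc_surj_pull[OF r] pull_splx[OF r] unfolding strong_fn_def by blast

lemma strong_fn_cong: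
  assumes "strong_fn F J \<Sigma> f" "\<And>x. x \<in> splx J \<Longrightarrow> \<Sigma>' x = \<Sigma> x" "\<And>x. x \<in> splx J \<Longrightarrow> f' x = f x"
  shows "strong_fn F J \<Sigma>' f'"
  using assms(1,3) loc_surj_cong[of F J \<Sigma> \<Sigma>', OF _ assms(2)] unfolding strong_fn_def by auto

section \<open>Transversality in terms of level functions\<close>

lemma induced_rel_iff: "(x, y) \<in> induced_rel M F n \<sigma> \<longleftrightarrow> conn_rel M F \<sigma> {..n} x y"
proof -
  have "connectedin (subtopology (simplex_top n) {z \<in> standard_simplex n. \<sigma> z \<in> L}) C \<longleftrightarrow>
      connected C \<and> C \<subseteq> splx {..n} \<and> \<sigma> ` C \<subseteq> L" for C L
    unfolding simplex_top_eq by (auto simp: connectedin_subtopology standard_simplex_eq_splx)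
  then have "(x, y) \<in> induced_rel M F n \<sigma> \<longleftrightarrow>
      (\<exists>L\<in>leaves M F. \<exists>C. (connected C \<and> C \<subseteq> splx {..n} \<and> \<sigma> ` C \<subseteq> L) \<and> x \<in> C \<and> y \<in> C)"
    by (simp add: induced_rel_def connected_component_of_def)
  also have "\<dots> \<longleftrightarrow> conn_rel M F \<sigma> {..n} x y" unfolding conn_rel_def by blast
  finally show ?thesis .
qed

lemma local_surjectivity_iff: "local_surjectivity F n \<sigma> \<longleftrightarrow> loc_surj F {..n} \<sigma>"
  unfolding local_surjectivity_def loc_surj_def simplex_top_eq simplex_interior_def
  by (simp add: case_prod_unfold Ball_def standard_simplex_eq_splx imp_conjL)

text \<open>The definition of \<open>affine_on_simplex\<close> combines only two points at a time,
  so vertices are added one by one.\<close>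

lemma affine_on_simplex_lin:
  assumes f: "affine_on_simplex n f" and x: "x \<in> splx {..n}"
  shows "f x = lin {..n} (\<lambda>i. f (vtx i)) x"
proof -
  let ?L = "lin {..n} (\<lambda>i. f (vtx i))"
  have "\<forall>x\<in>splx J. f x = ?L x" if "finite J" "J \<subseteq> {..n}" for J
    using that
  proof (induction J)
    case (insert j J)
    have j: "vtx j \<in> splx {..n}" "f (vtx j) = ?L (vtx j)" using insert by (auto simp: vtx_in_splx lin_vtx)
    show ?case
    proof
      fix x assume x: "x \<in> splx (insert j J)"
      show "f x = ?L x"
      proof (cases "x j = 1")
        case True
        then have "sum x J = 0" using splxD(3)[OF x] insert.hyps by simp
        then have "\<forall>i\<in>J. x i = 0" using sum_nonneg_eq_0_iff[OF insert.hyps(1)] splxD(1)[OF x] by blast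
        have "x = vtx j"
        proof
          fix i show "x i = vtx j i"
            using True \<open>\<forall>i\<in>J. x i = 0\<close> splxD(2)[OF x, of i] by (cases "i \<in> J") (auto simp: vtx_def)
        qed
        then show ?thesis using j by simp
      next
        case False
        then have lt: "0 < 1 - x j" using splx_le_1[OF x, of j] insert.hyps(1) by simp
        \<comment> \<open>The projection of \<open>x\<close> from the vertex \<open>j\<close> to the
          opposite face; \<open>x\<close> lies on the segment between \<open>y\<close> and this
          vertex.\<close>
        define y where "y = (\<lambda>i. if i = j then 0 else x i / (1 - x j))"
        have "sum y J = sum x J / (1 - x j)"
          unfolding sum_divide_distrib using insert.hyps(2) by (intro sum.cong) (auto simp: y_def)
        also have "\<dots> = 1" using splxD(3)[OF x] insert.hyps lt by (simp add: field_simps)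
        finally have y: "y \<in> splx J"
          using splxD(1,2)[OF x] insert.hyps(2) lt by (auto simp: splx_def y_def)
        then have y': "y \<in> splx {..n}" using splx_mono[of J "{..n}"] insert.prems by auto
        have xe: "x = (\<lambda>i. (1 - x j) * y i + x j * vtx j i)"
          using lt by (auto simp: y_def vtx_def)
        have "x j \<in> {0..1}" using splxD(1)[OF x, of j] lt by simp
        then have "f x = (1 - x j) * f y + x j * f (vtx j)"
          using f y' j(1) unfolding affine_on_simplex_def standard_simplex_eq_splx by (subst xe) blast
        also have "\<dots> = (1 - x j) * ?L y + x j * ?L (vtx j)" using insert y j(2) by auto
        also have "\<dots> = ?L x" by (subst (3) xe) (simp add: lin_convex)
        finally show ?thesis .
      qed
    qed
  qed simp
  from this[of "{..n}"] show ?thesis using x by simp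
qed

lemma simplex_face_eq_splx: "I \<subseteq> {..n} \<Longrightarrow> simplex_face n I = splx I"
  using splx_subset_support[of _ "{..n}" I] splx_mono[of I "{..n}"]
  by (auto simp: simplex_face_def standard_simplex_eq_splx Int_absorb1 splxD)

text \<open>The image of a vertex is a face with a single point, hence a vertex. The image of a face
  is the face spanned by the images of its vertices, because by injectivity it contains no
  others.\<close>

lemma simplicial_homeomorphism_vertices:
  assumes H: "simplicial_homeomorphism n H"
  obtains \<pi> where "bij_betw \<pi> {..n} {..n}" "\<And>I. I \<subseteq> {..n} \<Longrightarrow> H ` splx I = splx (\<pi> ` I)"
proof -
  have hm: "homeomorphic_map (top_of_set (splx {..n})) (top_of_set (splx {..n})) H"
    using H by (simp add: simplicial_homeomorphism_def simplex_top_eq)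
  have inj: "inj_on H (splx {..n})" using homeomorphic_imp_injective_map[OF hm] by simp
  have face: "\<exists>J\<subseteq>{..n}. H ` splx I = splx J" if I: "I \<subseteq> {..n}" for I
  proof -
    obtain J where "J \<subseteq> {..n}" "H ` simplex_face n I = simplex_face n J"
      using H I unfolding simplicial_homeomorphism_def by blast
    then show ?thesis using simplex_face_eq_splx I by metis
  qed
  have "\<exists>j\<le>n. H (vtx i) = vtx j" if i: "i \<le> n" for i
  proof -
    obtain J where J: "J \<subseteq> {..n}" "H ` splx {i} = splx J" using face[of "{i}"] i by auto
    then have eq: "splx J = {H (vtx i)}" by (simp add: splx_singleton)
    then obtain j where "j \<in> J" by (metis all_not_in_conv insert_not_empty splx_empty)
    moreover have "finite J" using J(1) finite_subset by blast
    ultimately show ?thesis using eq J(1) vtx_in_splx[of J j] by auto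
  qed
  then obtain \<pi> where \<pi>: "\<And>i. i \<le> n \<Longrightarrow> \<pi> i \<le> n \<and> H (vtx i) = vtx (\<pi> i)" by metis
  have v: "vtx i \<in> splx {..n}" if "i \<le> n" for i using that by (simp add: vtx_in_splx)
  have vinj: "i = j" if "vtx i = vtx j" for i j using fun_cong[OF that, of i] by (simp add: vtx_def split: if_splits)
  have "inj_on \<pi> {..n}"
  proof (rule inj_onI)
    fix i j assume ij: "i \<in> {..n}" "j \<in> {..n}" "\<pi> i = \<pi> j"
    then have "H (vtx i) = H (vtx j)" using \<pi> by simp
    then show "i = j" using inj_onD[OF inj] v ij vinj by simp
  qed
  moreover have "\<pi> ` {..n} \<subseteq> {..n}" using \<pi> by auto
  ultimately have bij: "bij_betw \<pi> {..n} {..n}" by (simp add: endo_inj_surj bij_betw_def)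
  moreover have "H ` splx I = splx (\<pi> ` I)" if I: "I \<subseteq> {..n}" for I
  proof -
    obtain J where J: "J \<subseteq> {..n}" "H ` splx I = splx J" using face[OF I] by blast
    have fin: "finite I" "finite J" using I J(1) finite_subset by blast+
    have "\<pi> i \<in> J \<longleftrightarrow> i \<in> I" if i: "i \<le> n" for i
    proof -
      have "\<pi> i \<in> J \<longleftrightarrow> H (vtx i) \<in> H ` splx I" using vtx_in_splx[OF fin(2)] \<pi>[OF i] J(2) by simp
      also have "\<dots> \<longleftrightarrow> vtx i \<in> splx I"
        by (rule inj_on_image_mem_iff[OF inj v[OF i] splx_mono[OF I]]) simp
      finally show ?thesis using vtx_in_splx[OF fin(1)] by simp
    qed
    moreover have "J \<subseteq> \<pi> ` {..n}" using J(1) bij by (simp add: bij_betw_def)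
    ultimately have "J \<subseteq> \<pi> ` I" "\<pi> ` I \<subseteq> J" using I by blast+
    then have "J = \<pi> ` I" by (rule subset_antisym)
    then show ?thesis using J(2) by simp
  qed
  ultimately show ?thesis by (rule that)
qed

text \<open>Relabelling the vertices undoes the permutation, and the composite preserves every face,
  as \<open>face_homeo\<close> demands.\<close>

lemma simplicial_homeomorphism_good:
  assumes H: "simplicial_homeomorphism n H" and f: "affine_on_simplex n f"
    and g: "\<And>x. x \<in> splx {..n} \<Longrightarrow> g (H x) = f x"
  shows "conj_affine {..n} g"
proof -
  obtain \<pi> where bij: "bij_betw \<pi> {..n} {..n}" and \<pi>: "\<And>I. I \<subseteq> {..n} \<Longrightarrow> H ` splx I = splx (\<pi> ` I)"
    using simplicial_homeomorphism_vertices[OF H] by metis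
  let ?A = "{..n}"
  define \<pi>' where "\<pi>' = inv_into ?A \<pi>"
  have r: "reindexing ?A ?A \<pi> \<pi>'"
    using bij unfolding reindexing_def \<pi>'_def
    by (auto simp: bij_betw_def inv_into_f_f f_inv_into_f) (metis atMost_iff imageI inv_into_into)+
  have "homeomorphic_map (top_of_set (splx ?A)) (top_of_set (splx ?A)) H"
    using H by (simp add: simplicial_homeomorphism_def simplex_top_eq)
  then obtain K where K: "homeomorphic_maps (top_of_set (splx ?A)) (top_of_set (splx ?A)) H K"
    by (auto simp: homeomorphic_map_maps)
  have Kc: "continuous_on (splx ?A) H" "continuous_on (splx ?A) K"
    and Kin: "\<And>x. x \<in> splx ?A \<Longrightarrow> H x \<in> splx ?A \<and> K x \<in> splx ?A"
    and KH: "\<And>x. x \<in> splx ?A \<Longrightarrow> K (H x) = x \<and> H (K x) = x"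
    using K by (auto simp: homeomorphic_maps_def continuous_map_in_subtopology)
  let ?h = "\<lambda>x. H (pull \<pi> ?A x)" and ?h' = "\<lambda>x. pull \<pi>' ?A (K x)"
  have "face_homeo ?A ?h ?h'"
    unfolding face_homeo_def
  proof (intro conjI allI impI ballI)
    fix J assume J: "J \<subseteq> ?A"
    have im: "\<pi>' ` J \<subseteq> ?A" "\<pi> ` \<pi>' ` J = J" using reindexing_image[OF r J] by auto
    then have HJ: "H ` splx (\<pi>' ` J) = splx J" using \<pi> by metis
    show "?h ` splx J \<subseteq> splx J"
    proof clarify
      fix x assume "x \<in> splx J"
      then show "?h x \<in> splx J" using pull_splx_preimage[OF r J] HJ by blast
    qed
    show "?h' ` splx J \<subseteq> splx J"
    proof clarify
      fix x assume "x \<in> splx J"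
      then obtain y where y: "y \<in> splx (\<pi>' ` J)" "x = H y" using HJ by blast
      then have "K x = y" using KH splx_mono[OF im(1)] by auto
      then show "?h' x \<in> splx J" using pull_splx_image[OF reindexing_sym[OF r] J] y by simp
    qed
  next
    fix x assume x: "x \<in> splx ?A"
    show "?h' (?h x) = x" using KH[OF pull_splx[OF r x]] pull_inverse[OF r x] by simp
    show "?h (?h' x) = x" using KH[OF x] pull_inverse[OF reindexing_sym[OF r]] Kin[OF x] by simp
  next
    show "continuous_on (splx ?A) ?h"
      by (rule continuous_on_compose2[OF Kc(1) continuous_on_pull]) (use pull_splx[OF r] in auto)
    show "continuous_on (splx ?A) ?h'"
      by (rule continuous_on_compose2[OF continuous_on_pull Kc(2)]) auto
  qed
  then show ?thesis
  proof (rule conj_affineI)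
    fix x assume x: "x \<in> splx ?A"
    show "g (?h x) = lin ?A (\<lambda>b. f (vtx (\<pi>' b))) x"
      using g[OF pull_splx[OF r x]] affine_on_simplex_lin[OF f pull_splx[OF r x]] lin_pull[OF r] by simp
  qed simp
qed

lemma conj_affine_const: "finite J \<Longrightarrow> conj_affine J (\<lambda>x. 0)"
  by (rule conj_affineI[OF face_homeo_id, where a = "\<lambda>i. 0"]) (auto simp: lin_def)

lemma contained_in_leaf_level:
  assumes "contained_in_leaf M F n \<sigma>"
  shows "level_fn M F \<sigma> {..n} (\<lambda>x. 0)"
proof -
  obtain L where "L \<in> leaves M F" "\<sigma> ` splx {..n} \<subseteq> L"
    using assms by (auto simp: contained_in_leaf_def standard_simplex_eq_splx)
  then have "conn_rel M F \<sigma> {..n} x y" if "x \<in> splx {..n}" "y \<in> splx {..n}" for x y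
    using that connected_splx unfolding conn_rel_def by blast
  then show ?thesis using conj_affine_const by (simp add: level_fn_def)
qed

lemma transverse_level_fn:
  assumes t: "transverse M F n \<sigma>" and n: "2 \<le> n"
  obtains f where "level_fn M F \<sigma> {..n} f"
proof (cases "contained_in_leaf M F n \<sigma>")
  case True
  then show ?thesis using that contained_in_leaf_level by blast
next
  case False
  then have "conjugate_to_affine n (induced_rel M F n \<sigma>)" using t n by (simp add: transverse_def)
  then obtain H f where H: "simplicial_homeomorphism n H" and f: "affine_on_simplex n f"
    and eq: "{(x, y). x \<in> standard_simplex n \<and> y \<in> standard_simplex n \<and> (H x, H y) \<in> induced_rel M F n \<sigma>} =
      {(x, y). x \<in> standard_simplex n \<and> y \<in> standard_simplex n \<and> f x = f y}"
    unfolding conjugate_to_affine_def affine_foliation_def by blast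
  have eq': "conn_rel M F \<sigma> {..n} (H x) (H y) \<longleftrightarrow> f x = f y" if xy: "x \<in> splx {..n}" "y \<in> splx {..n}" for x y
  proof -
    have "(x, y) \<in> {(x, y). x \<in> standard_simplex n \<and> y \<in> standard_simplex n \<and> (H x, H y) \<in> induced_rel M F n \<sigma>} \<longleftrightarrow>
      (x, y) \<in> {(x, y). x \<in> standard_simplex n \<and> y \<in> standard_simplex n \<and> f x = f y}"
      by (simp only: eq)
    then show ?thesis using xy by (simp add: standard_simplex_eq_splx induced_rel_iff)
  qed
  have hm: "homeomorphic_map (top_of_set (splx {..n})) (top_of_set (splx {..n})) H"
    using H by (simp add: simplicial_homeomorphism_def simplex_top_eq)
  have inj: "inj_on H (splx {..n})" and surj: "H ` splx {..n} = splx {..n}"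
    using homeomorphic_imp_injective_map[OF hm] homeomorphic_imp_surjective_map[OF hm] by auto
  define g where "g = f \<circ> the_inv_into (splx {..n}) H"
  have g: "g (H x) = f x" if "x \<in> splx {..n}" for x
    using that by (simp add: g_def the_inv_into_f_f[OF inj])
  have "conn_rel M F \<sigma> {..n} u v \<longleftrightarrow> g u = g v" if uv: "u \<in> splx {..n}" "v \<in> splx {..n}" for u v
  proof -
    obtain x y where "x \<in> splx {..n}" "y \<in> splx {..n}" "u = H x" "v = H y" using uv surj by (metis imageE)
    then show ?thesis using eq' g by simp
  qed
  then have "level_fn M F \<sigma> {..n} g"
    using simplicial_homeomorphism_good[OF H f g] by (simp add: level_fn_def)
  then show ?thesis by (rule that)
qed

lemma contained_in_leaf_iff_const:
  assumes lev: "level_fn M F \<sigma> {..n} f" and \<sigma>: "\<sigma> ` splx {..n} \<subseteq> topspace M"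
  shows "contained_in_leaf M F n \<sigma> \<longleftrightarrow> (\<forall>x\<in>splx {..n}. \<forall>y\<in>splx {..n}. f x = f y)"
proof
  assume "contained_in_leaf M F n \<sigma>"
  from level_fnD(2)[OF contained_in_leaf_level[OF this]] show "\<forall>x\<in>splx {..n}. \<forall>y\<in>splx {..n}. f x = f y"
    using level_fnD(2)[OF lev] by blast
next
  assume c: "\<forall>x\<in>splx {..n}. \<forall>y\<in>splx {..n}. f x = f y"
  have v: "vtx 0 \<in> splx {..n}" by (simp add: vtx_in_splx)
  have "\<sigma> x \<in> leaf F (\<sigma> (vtx 0))" if x: "x \<in> splx {..n}" for x
  proof -
    have "f (vtx 0) = f x" using c v x by blast
    from level_fnD(3)[OF lev v x this] show ?thesis by (simp only: mem_leaf_iff)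
  qed
  moreover have "leaf F (\<sigma> (vtx 0)) \<in> leaves M F" using v \<sigma> by (auto simp: leaves_def)
  ultimately show "contained_in_leaf M F n \<sigma>" unfolding contained_in_leaf_def standard_simplex_eq_splx by blast
qed

text \<open>The level function is a single chart for the whole simplex. Its levels are connected, so
  the components in \<open>simplex_foliation\<close> are the levels and their relation is already
  transitive.\<close>

lemma level_fn_transverse:
  assumes lev: "level_fn M F \<sigma> {..n} f" and n: "2 \<le> n"
  shows "transverse M F n \<sigma>"
proof -
  let ?A = "{..n}" and ?R = "{(x, y). x \<in> splx {..n} \<and> y \<in> splx {..n} \<and> f x = f y}"
  obtain h h' where h: "face_homeo ?A h h'" "\<And>x. x \<in> splx ?A \<Longrightarrow> f (h x) = lin ?A (\<lambda>i. f (vtx i)) x"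
    using conj_affineE1[OF level_fnD(1)[OF lev]] by blast
  let ?f = "lin ?A (\<lambda>i. f (vtx i))"
  have hin: "h x \<in> splx ?A" "h' x \<in> splx ?A" if "x \<in> splx ?A" for x
    using face_homeoD(1,2)[OF h(1) order.refl that] by auto
  have aff: "affine_on_simplex n ?f" by (simp add: affine_on_simplex_def lin_convex)
  have hmaps: "homeomorphic_maps (top_of_set (splx ?A)) (top_of_set (splx ?A)) h h'"
    using face_homeoD(3-6)[OF h(1)] hin by (auto simp: homeomorphic_maps_def continuous_map_in_subtopology)
  have R: "induced_rel M F n \<sigma> = ?R"
  proof -
    have "(x, y) \<in> induced_rel M F n \<sigma> \<longleftrightarrow> (x, y) \<in> ?R" for x y
    proof -
      have "x \<in> splx ?A \<and> y \<in> splx ?A" if "conn_rel M F \<sigma> ?A x y" using that unfolding conn_rel_def by blast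
      then show ?thesis using level_fnD(2)[OF lev, of x y] by (auto simp: induced_rel_iff)
    qed
    then show ?thesis by auto
  qed
  have comp: "connected_component_of (subtopology (simplex_top n) {z \<in> splx ?A. f z = f x}) x y \<longleftrightarrow> (x, y) \<in> ?R" for x y
  proof
    assume "connected_component_of (subtopology (simplex_top n) {z \<in> splx ?A. f z = f x}) x y"
    from connected_component_in_topspace[OF this] show "(x, y) \<in> ?R" by (auto simp: simplex_top_eq)
  next
    assume xy: "(x, y) \<in> ?R"
    have "connected {z \<in> splx ?A. f z \<in> {f x..f x}}" by (rule conj_affine_slab_connected[OF level_fnD(1)[OF lev]])
    then have cS: "connectedin (subtopology (simplex_top n) {z \<in> splx ?A. f z = f x}) {z \<in> splx ?A. f z = f x}"
      by (simp add: simplex_top_eq connectedin_subtopology)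
    show "connected_component_of (subtopology (simplex_top n) {z \<in> splx ?A. f z = f x}) x y"
      unfolding connected_component_of_def
      by (rule exI[of _ "{z \<in> splx ?A. f z = f x}"], intro conjI cS) (use xy in auto)
  qed
  have "?R\<^sup>+ = ?R" by (rule trancl_id) (auto simp: trans_def)
  then have "simplex_foliation n ?R"
    unfolding simplex_foliation_def
  proof (intro exI[of _ "{(splx ?A, f)}"] conjI)
    show "\<forall>(W, g)\<in>{(splx ?A, f)}. openin (simplex_top n) W \<and>
           (\<exists>h f. openin (simplex_top n) (h ` W) \<and>
              homeomorphic_map (subtopology (simplex_top n) W) (subtopology (simplex_top n) (h ` W)) h \<and>
              affine_on_simplex n f \<and> (\<forall>x\<in>W. g x = f (h x)))"
    proof (clarsimp, intro conjI exI)
      have im: "h' ` splx ?A = splx ?A" using hin face_homeoD(3)[OF h(1)] by (metis image_subset_iff image_eqI subsetI subset_antisym)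
      show "openin (simplex_top n) (splx ?A)" "openin (simplex_top n) (h' ` splx ?A)"
        by (simp_all add: simplex_top_eq im)
      show "homeomorphic_map (subtopology (simplex_top n) (splx ?A)) (subtopology (simplex_top n) (h' ` splx ?A)) h'"
      proof -
        have "homeomorphic_maps (top_of_set (splx ?A)) (top_of_set (splx ?A)) h' h"
          by (rule homeomorphic_maps_sym[THEN iffD1, OF hmaps])
        then have "homeomorphic_map (top_of_set (splx ?A)) (top_of_set (splx ?A)) h'"
          unfolding homeomorphic_map_maps by (rule exI[of _ h])
        then show ?thesis by (simp add: im simplex_top_eq subtopology_subtopology)
      qed
      show "affine_on_simplex n ?f" by (rule aff)
      show "\<forall>x\<in>splx ?A. f x = ?f (h' x)" using h(2)[OF hin(2)] face_homeoD(4)[OF h(1)] by simp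
    qed
    show "\<forall>(W, g)\<in>{(splx ?A, f)}. \<forall>(W', g')\<in>{(splx ?A, f)}. \<forall>z\<in>W \<inter> W'. \<exists>N. openin (simplex_top n) N \<and> z \<in> N \<and>
           N \<subseteq> W \<inter> W' \<and> (\<forall>x\<in>N. \<forall>y\<in>N. g x = g y \<longleftrightarrow> g' x = g' y)"
      by (auto simp: simplex_top_eq intro!: exI[of _ "splx ?A"])
    show "?R = {(x, y). \<exists>(W, g)\<in>{(splx ?A, f)}. connected_component_of
               (subtopology (simplex_top n) {z \<in> W. g z = g x}) x y}\<^sup>+"
      using \<open>?R\<^sup>+ = ?R\<close> by (simp add: comp)
  qed (simp add: standard_simplex_eq_splx)
  moreover have "conjugate_to_affine n ?R"
    unfolding conjugate_to_affine_def
  proof (intro exI conjI)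
    have "h ` splx I = splx I" if "I \<subseteq> ?A" for I
    proof
      show "h ` splx I \<subseteq> splx I" using face_homeoD(1)[OF h(1) that] by blast
      show "splx I \<subseteq> h ` splx I"
      proof
        fix x assume x: "x \<in> splx I"
        then have "x \<in> splx ?A" using splx_mono[OF that] by auto
        then have "x = h (h' x)" using face_homeoD(4)[OF h(1)] by simp
        then show "x \<in> h ` splx I" using face_homeoD(2)[OF h(1) that x] by (rule image_eqI)
      qed
    qed
    then have "h ` simplex_face n I = simplex_face n I" if "I \<subseteq> ?A" for I
      using that by (simp add: simplex_face_eq_splx)
    then have "\<forall>I\<subseteq>?A. \<exists>J\<subseteq>?A. h ` simplex_face n I = simplex_face n J"
      by blast
    moreover have "homeomorphic_map (top_of_set (splx ?A)) (top_of_set (splx ?A)) h"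
      unfolding homeomorphic_map_maps by (rule exI[of _ h'], rule hmaps)
    ultimately show "simplicial_homeomorphism n h"
      by (simp only: simplicial_homeomorphism_def simplex_top_eq)
    show "affine_foliation n {(x, y). x \<in> standard_simplex n \<and> y \<in> standard_simplex n \<and> (h x, h y) \<in> ?R}"
      unfolding affine_foliation_def
    proof (intro exI[of _ ?f] conjI aff Collect_cong, clarify)
      fix x y
      show "x \<in> standard_simplex n \<and> y \<in> standard_simplex n \<and> (h x, h y) \<in> ?R \<longleftrightarrow>
        x \<in> standard_simplex n \<and> y \<in> standard_simplex n \<and> ?f x = ?f y"
        using hin(1)[of x] hin(1)[of y] h(2)[of x] h(2)[of y] by (auto simp: standard_simplex_eq_splx)
    qed
  qed
  ultimately show ?thesis using n by (simp add: transverse_def foliated_simplex_def R)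
qed

lemma strongly_transverse_iff:
  assumes lev: "level_fn M F \<sigma> {..n} f" and \<sigma>: "\<sigma> ` splx {..n} \<subseteq> topspace M" and n: "2 \<le> n"
  shows "strongly_transverse M F n \<sigma> \<longleftrightarrow> strong_fn F {..n} \<sigma> f"
  using level_fn_transverse[OF lev n] contained_in_leaf_iff_const[OF lev \<sigma>]
  by (simp add: strongly_transverse_def strong_fn_def local_surjectivity_iff)


section \<open>The weak Kan property\<close>

definition skip :: "nat \<Rightarrow> nat \<Rightarrow> nat" where "skip j i = (if i < j then i else Suc i)"
definition unskip :: "nat \<Rightarrow> nat \<Rightarrow> nat" where "unskip j i = (if i < j then i else i - 1)"

lemma reindexing_skip: "j \<le> Suc n \<Longrightarrow> reindexing {..n} ({..Suc n} - {j}) (skip j) (unskip j)"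
  by (auto simp: reindexing_def skip_def unskip_def)

text \<open>The index set leaves out \<open>j\<close>, where \<open>unskip j\<close> gives a
  meaningless index. Beyond \<open>Suc n\<close> both sides vanish because \<open>x\<close> is
  supported on \<open>{..n}\<close>.\<close>

lemma simplical_face_eq_pull:
  assumes "x \<in> splx {..n}" "j \<le> Suc n"
  shows "simplical_face j x = pull (unskip j) ({..Suc n} - {j}) x"
proof
  fix i
  consider "i < j" | "i = j" | "j < i" "i \<le> Suc n" | "j < i" "Suc n < i" by linarith
  then show "simplical_face j x i = pull (unskip j) ({..Suc n} - {j}) x i"
    using assms(2) splxD(2)[OF assms(1), of "i - 1"] by cases (auto simp: simplical_face_def pull_def unskip_def)
qed

lemma singular_face_pull:
  assumes "x \<in> splx {..n}" "j \<le> Suc n"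
  shows "singular_face (Suc n) j \<sigma> x = \<sigma> (pull (unskip j) ({..Suc n} - {j}) x)"
  using assms simplical_face_eq_pull[OF assms] by (simp add: singular_face_def standard_simplex_eq_splx)

locale kan_horn =
  fixes M :: "'a topology" and F :: "('a, 'm::{finite,linorder}) chart set"
    and n k :: nat and \<tau> :: "nat \<Rightarrow> (nat \<Rightarrow> real) \<Rightarrow> 'a" and g :: "nat \<Rightarrow> (nat \<Rightarrow> real) \<Rightarrow> real"
  assumes n: "2 \<le> n" and k: "k \<le> Suc n"
    and simplex: "j \<in> {..Suc n} - {k} \<Longrightarrow> singular_simplex n M (\<tau> j)"
    and match: "i \<in> {..Suc n} - {k} \<Longrightarrow> j \<in> {..Suc n} - {k} \<Longrightarrow> i < j \<Longrightarrow>
      singular_face n i (\<tau> j) = singular_face n (j - 1) (\<tau> i)"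
    and level: "j \<in> {..Suc n} - {k} \<Longrightarrow> level_fn M F (\<tau> j) {..n} (g j)"
begin

abbreviation N :: "nat set" where "N \<equiv> {..Suc n} - {k}"

abbreviation del :: "nat \<Rightarrow> (nat \<Rightarrow> real) \<Rightarrow> nat \<Rightarrow> real" where "del j \<equiv> pull (skip j) {..n}"

lemma N_facts: "finite N" "card N = Suc n" "k \<notin> N" "N \<noteq> {}" "insert k N = {..Suc n}"
proof -
  show c: "card N = Suc n" using k by (simp add: card_Diff_singleton)
  then show "N \<noteq> {}" by (metis card.empty nat.distinct(1))
  show "insert k N = {..Suc n}" using k by auto
qed auto

lemma facet_eq: "j \<in> N \<Longrightarrow> insert k (N - {j}) = {..Suc n} - {j}"
  using k by auto

text \<open>A point of the common face comes from one point \<open>?y\<close> of the simplex of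
  dimension \<open>n - 1\<close> in two ways: deleting \<open>j\<close> and then \<open>i\<close>,
  or \<open>i\<close> and then \<open>j - 1\<close>. The hypothesis \<open>match\<close> is applied
  at \<open>?y\<close>.\<close>

lemma horn_match_less:
  assumes ij: "i \<in> N" "j \<in> N" "i < j" and x: "x \<in> splx ({..Suc n} - {i})" "x \<in> splx ({..Suc n} - {j})"
  shows "\<tau> i (del i x) = \<tau> j (del j x)"
proof -
  obtain n' where n': "n = Suc n'" using n by (cases n) auto
  have le: "i \<le> n" "j \<le> Suc n" "j - 1 \<le> n" "i < j" using ij by auto
  have x0: "x i = 0" "x j = 0" using splxD(2)[OF x(1)] splxD(2)[OF x(2)] by auto
  have dj: "del j x \<in> splx {..n}" and di: "del i x \<in> splx {..n}"
    using pull_splx[OF reindexing_skip] x le by auto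
  have face: "z \<in> splx ({..n} - {l})" if "z \<in> splx {..n}" "z l = 0" for z l
    using splx_subset_support[OF that(1), of "{..n} - {l}"] that(2) by (simp add: Int_absorb1 Diff_subset)
  have dj': "del j x \<in> splx ({..n} - {i})" by (rule face[OF dj]) (use le x0 in \<open>auto simp: pull_def skip_def\<close>)
  have di': "del i x \<in> splx ({..n} - {j - 1})" by (rule face[OF di]) (use le x0 in \<open>auto simp: pull_def skip_def\<close>)
  let ?y = "pull (skip i) {..n'} (del j x)"
  have y_eq: "?y = pull (skip (j - 1)) {..n'} (del i x)"
    using le n' by (auto simp: fun_eq_iff pull_def skip_def)
  have ri: "reindexing {..n'} ({..n} - {i}) (skip i) (unskip i)"
    and rj: "reindexing {..n'} ({..n} - {j - 1}) (skip (j - 1)) (unskip (j - 1))"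
    unfolding n' by (rule reindexing_skip; use le n' in simp)+
  have y: "?y \<in> splx {..n'}" by (rule pull_splx[OF ri dj'])
  have face_y: "singular_face n l \<sigma> ?y = \<sigma> (pull (unskip l) ({..n} - {l}) ?y)" if "l \<le> n" for l and \<sigma> :: "(nat \<Rightarrow> real) \<Rightarrow> 'a"
    using singular_face_pull[OF y, of l \<sigma>] that unfolding n' by simp
  have "\<tau> j (del j x) = singular_face n i (\<tau> j) ?y"
    unfolding face_y[OF le(1)] pull_inverse[OF ri dj'] ..
  also have "\<dots> = singular_face n (j - 1) (\<tau> i) ?y" using match[OF ij] by simp
  also have "\<dots> = \<tau> i (del i x)"
    unfolding face_y[OF le(3)] unfolding y_eq pull_inverse[OF rj di'] ..
  finally show ?thesis by simp
qed

lemma horn_match: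
  assumes ij: "i \<in> N" "j \<in> N" and x: "x \<in> splx ({..Suc n} - {i})" "x \<in> splx ({..Suc n} - {j})"
  shows "\<tau> i (del i x) = \<tau> j (del j x)"
proof (cases i j rule: linorder_cases)
  case less
  then show ?thesis by (rule horn_match_less[OF ij _ x])
next
  case greater
  then show ?thesis by (rule horn_match_less[OF ij(2,1) _ x(2,1), symmetric])
qed simp

lemma face_continuous:
  assumes j: "j \<in> N"
  shows "continuous_map (top_of_set (splx ({..Suc n} - {j}))) M (\<lambda>x. \<tau> j (del j x))"
proof -
  have "continuous_map (top_of_set (splx ({..Suc n} - {j}))) (top_of_set (splx {..n})) (del j)"
    using continuous_on_pull pull_splx[OF reindexing_skip[of j n]] j by (auto simp: continuous_map_in_subtopology)
  moreover have "continuous_map (top_of_set (splx {..n})) M (\<tau> j)"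
    using simplex[OF j] by (simp add: singular_simplex_def simplex_top_eq)
  ultimately have "continuous_map (top_of_set (splx ({..Suc n} - {j}))) M (\<tau> j \<circ> del j)"
    by (rule continuous_map_compose)
  then show ?thesis by (simp add: o_def)
qed

text \<open>The facets are pasted on the horn, and the retraction extends the result to the whole
  simplex. Off the horn the values are auxiliary; a map on the simplex can be lifted by its
  straight-line contraction.\<close>

lemma horn_map:
  obtains \<Sigma> where "continuous_map (top_of_set (splx {..Suc n})) M \<Sigma>"
    "\<And>j x. j \<in> N \<Longrightarrow> x \<in> splx ({..Suc n} - {j}) \<Longrightarrow> \<Sigma> x = \<tau> j (del j x)"
proof -
  let ?T = "\<lambda>j. splx ({..Suc n} - {j})"
  let ?X = "top_of_set (\<Union>j\<in>N. ?T j)"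
  have sub: "subtopology ?X (?T j) = top_of_set (?T j)" if "j \<in> N" for j
  proof -
    have "(\<Union>j\<in>N. ?T j) \<inter> ?T j = ?T j" using that by blast
    then show ?thesis by (simp only: subtopology_subtopology)
  qed
  obtain \<Sigma>0 where \<Sigma>0: "continuous_map ?X M \<Sigma>0"
    "\<And>x j. j \<in> N \<Longrightarrow> x \<in> topspace ?X \<inter> ?T j \<Longrightarrow> \<Sigma>0 x = \<tau> j (del j x)"
  proof (rule pasting_lemma_exists_closed[of N ?X ?T M "\<lambda>j x. \<tau> j (del j x)"])
    show "closedin ?X (?T j)" if "j \<in> N" for j
      by (rule closed_subset[OF _ closed_splx]) (use that in blast)
    show "continuous_map (subtopology ?X (?T j)) M (\<lambda>x. \<tau> j (del j x))" if "j \<in> N" for j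
      using face_continuous[OF that] sub[OF that] by simp
    show "\<tau> i (del i x) = \<tau> j (del j x)" if "i \<in> N" "j \<in> N" "x \<in> topspace ?X \<inter> ?T i \<inter> ?T j" for i j x
      by (rule horn_match[OF that(1,2)]) (use that(3) in auto)
  qed (use N_facts in auto)
  have r: "continuous_map (top_of_set (splx {..Suc n})) ?X (retract N k)"
    unfolding continuous_map_in_subtopology
  proof (intro conjI)
    show "continuous_map (top_of_set (splx {..Suc n})) euclidean (retract N k)"
      using continuous_on_retract[OF N_facts(1,4)] by simp
    show "retract N k \<in> topspace (top_of_set (splx {..Suc n})) \<rightarrow> (\<Union>j\<in>N. ?T j)"
    proof
      fix x assume "x \<in> topspace (top_of_set (splx {..Suc n}))"
      then have x: "x \<in> splx (insert k N)" unfolding N_facts(5) by simp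
      obtain j where "j \<in> N" "retract N k x \<in> splx (insert k (N - {j}))"
        by (rule retract_horn[OF N_facts(1,4,3) x])
      then show "retract N k x \<in> (\<Union>j\<in>N. ?T j)" using facet_eq[of j] by (metis UN_I)
    qed
  qed
  show ?thesis
  proof (rule that)
    show "continuous_map (top_of_set (splx {..Suc n})) M (\<Sigma>0 \<circ> retract N k)"
      by (rule continuous_map_compose[OF r \<Sigma>0(1)])
    fix j x assume jx: "j \<in> N" "x \<in> ?T j"
    have "x \<in> splx (insert k (N - {j}))" using jx facet_eq by simp
    from retract_id[OF N_facts(1,4,3) jx(1) this] have "retract N k x = x" .
    then show "(\<Sigma>0 \<circ> retract N k) x = \<tau> j (del j x)" using \<Sigma>0(2)[OF jx(1), of x] jx by auto
  qed
qed

text \<open>The lift that is filled lives in \<open>E\<close>, whose leaf map is a fibration. The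
  covering \<open>Mt\<close>, whose leaf space is a one-manifold, enters where local surjectivity is
  exploited: to glue levels if \<open>n = 2\<close>, and to pass strong transversality on to the
  missing face.\<close>

lemma filler:
  fixes E :: "'c topology" and p :: "'c \<Rightarrow> 'a" and Mt :: "'b topology" and p' :: "'b \<Rightarrow> 'a"
  assumes fol: "codim_one_foliation M A F" and sc: "second_countable M"
    and E: "covering_map E M p"
    and fib: "locally_trivial_fibration E (leaf_space E (pullback_atlas E M p F)) (leaf (pullback_atlas E M p F))"
    and Mt: "covering_map Mt M p'" and one: "one_manifold (leaf_space Mt (pullback_atlas Mt M p' F))"
    and large: "3 \<le> n \<or> (\<forall>j\<in>N. strong_fn F {..n} (\<tau> j) (g j))"
  obtains \<sigma> \<psi> where "singular_simplex (Suc n) M \<sigma>" "\<And>j. j \<in> N \<Longrightarrow> singular_face (Suc n) j \<sigma> = \<tau> j"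
    "level_fn M F (singular_face (Suc n) k \<sigma>) {..n} \<psi>"
    "(\<forall>j\<in>N. strong_fn F {..n} (\<tau> j) (g j)) \<Longrightarrow> strong_fn F {..n} (singular_face (Suc n) k \<sigma>) \<psi>"
proof -
  let ?T = "insert k N"
  define f where "f j = g j \<circ> del j" for j
  obtain \<Sigma> where \<Sigma>: "continuous_map (top_of_set (splx {..Suc n})) M \<Sigma>"
    "\<And>j x. j \<in> N \<Longrightarrow> x \<in> splx ({..Suc n} - {j}) \<Longrightarrow> \<Sigma> x = \<tau> j (del j x)"
    using horn_map by metis
  have r: "reindexing {..n} ({..Suc n} - {j}) (skip j) (unskip j)" if "j \<in> N" for j
    by (rule reindexing_skip) (use that in simp)
  have finI: "finite (insert k (N - {j}))" for j by simp
  have lev: "level_fn M F \<Sigma> (insert k (N - {j})) (f j)" if j: "j \<in> N" for j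
    unfolding facet_eq[OF j]
    by (rule level_fn_cong[OF level_fn_pull[OF r[OF j] level[OF j]]]) (use \<Sigma>(2)[OF j] in \<open>auto simp: f_def\<close>)
  have \<Sigma>T: "continuous_map (top_of_set (splx ?T)) M \<Sigma>" using \<Sigma>(1) by (simp only: N_facts(5))
  have \<Sigma>M: "\<Sigma> ` splx (insert k (N - {j})) \<subseteq> topspace M" for j
  proof -
    have "splx (insert k (N - {j})) \<subseteq> splx ?T" by (rule splx_mono) auto
    then show ?thesis using continuous_map_image_subset_topspace[OF \<Sigma>T] by auto
  qed
  have "facets N k f"
  proof
    show "3 \<le> card N" using N_facts(2) n by simp
    show "conj_affine (insert k (N - {j})) (f j)" if "j \<in> N" for j by (rule level_fnD(1)[OF lev[OF that]])
    show "f j x = f j y \<longleftrightarrow> f l x = f l y"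
      if "j \<in> N" "l \<in> N" "x \<in> splx (insert k (N - {j}))" "x \<in> splx (insert k (N - {l}))"
        "y \<in> splx (insert k (N - {j}))" "y \<in> splx (insert k (N - {l}))" for j l x y
      using level_fn_agree[OF lev[OF that(1)] lev[OF that(2)] finI finI \<Sigma>M that(3-6)]
        level_fn_agree[OF lev[OF that(2)] lev[OF that(1)] finI finI \<Sigma>M that(4,3,6,5)] by blast
  qed (use N_facts in auto)
  then interpret fc: facets N k f .
  interpret mt: fol_cover M A F Mt p' by (rule fol_cover.intro[OF fol sc Mt])
  interpret ec: fol_cover M A F E p by (rule fol_cover.intro[OF fol sc E])
  have strong: "strong_fn F (insert k (N - {j})) \<Sigma> (f j)"
    if "strong_fn F {..n} (\<tau> j) (g j)" and j: "j \<in> N" for j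
    unfolding facet_eq[OF j]
    by (rule strong_fn_cong[OF strong_fn_pull[OF r[OF j] that(1)]]) (use \<Sigma>(2)[OF j] in \<open>auto simp: f_def\<close>)
  have "fc.edge_trans \<and> fc.edge_dom"
  proof (cases "3 \<le> n")
    case True
    then have "4 \<le> card N" using N_facts(2) by simp
    then show ?thesis using fc.edge_trans_large fc.edge_dom_large by blast
  next
    \<comment> \<open>Now \<open>n = 2\<close> and three edges do not fit into a facet; they are
      compared through a lift to \<open>Mt\<close>.\<close>
    case False
    then have st: "strong_fn F {..n} (\<tau> j) (g j)" if "j \<in> N" for j using large that by blast
    obtain S where S: "continuous_map (top_of_set (splx ?T)) Mt S" "\<And>x. x \<in> splx ?T \<Longrightarrow> p' (S x) = \<Sigma> x"
      using splx_lift[OF Mt _ _ \<Sigma>T] by auto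
    interpret sf: strong_facets N k f M A F Mt p' \<Sigma> S
      by (intro strong_facets.intro fc.facets_axioms mt.fol_cover_axioms strong_facets_axioms.intro one lev strong st S)
    show ?thesis using sf.edge_trans_strong sf.edge_dom_strong by blast
  qed
  then have tr: fc.edge_trans and dom: fc.edge_dom by blast+
  interpret fl: facet_levels N k f M A F E p \<Sigma>
    by (intro facet_levels.intro fc.facets_axioms ec.fol_cover_axioms facet_levels_axioms.intro lev \<Sigma>T fib)
  have "\<exists>\<Sigma>' \<phi>. continuous_map (top_of_set (splx ?T)) M \<Sigma>' \<and> (\<forall>x\<in>fc.horn. \<Sigma>' x = \<Sigma> x) \<and>
    (\<forall>j\<in>N. level_fn M F \<Sigma>' (insert k (N - {j})) \<phi>) \<and> level_fn M F \<Sigma>' N \<phi>"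
    by (rule fl.fill[OF tr dom]) blast
  then obtain \<Sigma>' \<phi> where \<Sigma>'c: "continuous_map (top_of_set (splx ?T)) M \<Sigma>'" and \<Sigma>'h: "\<And>x. x \<in> fc.horn \<Longrightarrow> \<Sigma>' x = \<Sigma> x"
    and \<phi>I: "\<And>j. j \<in> N \<Longrightarrow> level_fn M F \<Sigma>' (insert k (N - {j})) \<phi>" and \<phi>N: "level_fn M F \<Sigma>' N \<phi>"
    by blast
  have \<Sigma>'I: "\<Sigma>' x = \<Sigma> x" if "j \<in> N" "x \<in> splx (insert k (N - {j}))" for j x
    by (rule \<Sigma>'h) (use that in \<open>auto simp: fc.horn_def\<close>)
  \<comment> \<open>Singular simplices are extensional functions, so the map is cut off outside the
    simplex.\<close>
  define \<sigma> where "\<sigma> = restrict \<Sigma>' (standard_simplex (Suc n))"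
  have \<sigma>_eq: "\<sigma> x = \<Sigma>' x" if "x \<in> splx {..Suc n}" for x using that by (simp add: \<sigma>_def standard_simplex_eq_splx)
  have \<sigma>: "singular_simplex (Suc n) M \<sigma>"
    unfolding singular_simplex_def simplex_top_eq
  proof
    show "continuous_map (top_of_set (splx {..Suc n})) M \<sigma>"
      by (rule continuous_map_eq[OF \<Sigma>'c[unfolded N_facts(5)]]) (simp add: \<sigma>_eq)
  qed (simp add: \<sigma>_def)
  have face: "singular_face (Suc n) j \<sigma> x = \<Sigma>' (pull (unskip j) ({..Suc n} - {j}) x)"
    "pull (unskip j) ({..Suc n} - {j}) x \<in> splx ({..Suc n} - {j})" if x: "x \<in> splx {..n}" and j: "j \<le> Suc n" for j x
  proof -
    show *: "pull (unskip j) ({..Suc n} - {j}) x \<in> splx ({..Suc n} - {j})"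
      by (rule pull_splx[OF reindexing_sym[OF reindexing_skip[OF j]] x])
    have "splx ({..Suc n} - {j}) \<subseteq> splx {..Suc n}" by (rule splx_mono) auto
    then show "singular_face (Suc n) j \<sigma> x = \<Sigma>' (pull (unskip j) ({..Suc n} - {j}) x)"
      unfolding singular_face_pull[OF x j] using \<sigma>_eq * by blast
  qed
  have faces: "singular_face (Suc n) j \<sigma> = \<tau> j" if j: "j \<in> N" for j
  proof
    fix x
    show "singular_face (Suc n) j \<sigma> x = \<tau> j x"
    proof (cases "x \<in> splx {..n}")
      case True
      let ?y = "pull (unskip j) ({..Suc n} - {j}) x"
      have jn: "j \<le> Suc n" using j by simp
      have "\<Sigma>' ?y = \<Sigma> ?y" by (rule \<Sigma>'I[OF j]) (use face(2)[OF True jn] facet_eq[OF j] in simp)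
      also have "\<dots> = \<tau> j (del j ?y)" by (rule \<Sigma>(2)[OF j face(2)[OF True jn]])
      also have "del j ?y = x" by (rule pull_inverse[OF reindexing_sym[OF r[OF j]] True])
      finally show ?thesis using face(1)[OF True jn] by simp
    next
      case False
      then show ?thesis
        using simplex[OF j] by (simp add: singular_face_def singular_simplex_def standard_simplex_eq_splx extensional_def)
    qed
  qed
  define \<psi> where "\<psi> x = \<phi> (pull (unskip k) ({..Suc n} - {k}) x)" for x
  have rk: "reindexing N {..n} (unskip k) (skip k)" by (rule reindexing_sym[OF reindexing_skip[OF k]])
  have level_k: "level_fn M F (singular_face (Suc n) k \<sigma>) {..n} \<psi>"
    by (rule level_fn_cong[OF level_fn_pull[OF rk \<phi>N]]) (use face(1)[OF _ k] in \<open>auto simp: \<psi>_def\<close>)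
  have strong_k: "strong_fn F {..n} (singular_face (Suc n) k \<sigma>) \<psi>" if st: "\<forall>j\<in>N. strong_fn F {..n} (\<tau> j) (g j)"
  proof -
    have "strong_fn F (insert k (N - {j})) \<Sigma>' \<phi>" if j: "j \<in> N" for j
    proof -
      have *: "strong_fn F (insert k (N - {j})) \<Sigma>' (f j)"
        by (rule strong_fn_cong[OF strong[OF bspec[OF st j] j]]) (use \<Sigma>'I[OF j] in auto)
      have "level_fn M F \<Sigma>' (insert k (N - {j})) (f j)"
        by (rule level_fn_cong[OF lev[OF j]]) (use \<Sigma>'I[OF j] in auto)
      \<comment> \<open>Both are level functions of the same facet, so one is constant exactly if
        the other is.\<close>
      then have "\<phi> x = \<phi> y \<longleftrightarrow> f j x = f j y" if "x \<in> splx (insert k (N - {j}))" "y \<in> splx (insert k (N - {j}))" for x y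
        using level_fnD(2)[OF \<phi>I[OF j] that] level_fnD(2)[OF _ that] by blast
      then show ?thesis using * unfolding strong_fn_def by blast
    qed
    then have "strong_fn F N \<Sigma>' \<phi>"
      by (intro mt.strong_face[OF one N_facts(1) fc.N(2) \<Sigma>'c \<phi>I \<phi>N])
    from strong_fn_pull[OF rk this] show ?thesis
      by (rule strong_fn_cong) (use face(1)[OF _ k] in \<open>auto simp: \<psi>_def\<close>)
  qed
  show ?thesis by (rule that[OF \<sigma> faces level_k strong_k])
qed

end

theorem theorem2:
  fixes M :: "'a topology" and A F :: "('a, 'm::{finite,linorder}) chart set"
    and Mt :: "'b topology" and p :: "'b \<Rightarrow> 'a"
  assumes "smooth_manifold M A"
    and "orientable M A"
    and "codim_one_foliation M A F"
    and "fibration_covered TYPE('c) M F"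
    and "universal_covering Mt M p"
    and "one_manifold (leaf_space Mt (pullback_atlas Mt M p F))"
    and "simply_connected_space (leaf_space Mt (pullback_atlas Mt M p F))"
  shows "(\<forall>n\<in>{2..CARD('m)}. weak_kan M (strongly_transverse_simplices M F) n) \<and>
         (\<forall>n\<in>{3..CARD('m)}. weak_kan M (transverse_simplices M F) n)"
proof -
  have sc: "second_countable M" using assms(1) by (simp add: smooth_manifold_def)
  have Mt: "covering_map Mt M p" using assms(5) by (simp add: universal_covering_def)
  obtain E :: "'c topology" and p' where E: "covering_map E M p'"
    "locally_trivial_fibration E (leaf_space E (pullback_atlas E M p' F)) (leaf (pullback_atlas E M p' F))"
    using assms(4) unfolding fibration_covered_def by blast
  have image: "\<sigma> ` splx {..n} \<subseteq> topspace M" if "singular_simplex n M \<sigma>" for n \<sigma>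
    using that continuous_map_image_subset_topspace[of "simplex_top n" M \<sigma>]
    by (simp add: singular_simplex_def simplex_top_eq)
  have level: "\<exists>g. \<forall>j\<in>J. level_fn M F (\<tau> j) {..n} (g j)"
    if "\<forall>j\<in>J. transverse M F n (\<tau> j)" "2 \<le> n" for J :: "nat set" and n \<tau>
  proof (rule bchoice, rule ballI)
    fix j assume "j \<in> J"
    then show "\<exists>g. level_fn M F (\<tau> j) {..n} g" using transverse_level_fn[OF bspec[OF that(1)] that(2)] by blast
  qed
  have strong: "weak_kan M (strongly_transverse_simplices M F) n" if n: "2 \<le> n" for n
    unfolding weak_kan_def
  proof (intro allI impI, elim conjE)
    fix k \<tau>
    assume k: "k \<le> n + 1" and \<tau>: "\<forall>j\<in>{..n + 1} - {k}. \<tau> j \<in> strongly_transverse_simplices M F n"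
      and match: "\<forall>i\<in>{..n + 1} - {k}. \<forall>j\<in>{..n + 1} - {k}. i < j \<longrightarrow>
           singular_face n i (\<tau> j) = singular_face n (j - 1) (\<tau> i)"
    obtain g where g: "\<forall>j\<in>{..n + 1} - {k}. level_fn M F (\<tau> j) {..n} (g j)"
      using level[of "{..n + 1} - {k}" n \<tau>] \<tau> n by (auto simp: strongly_transverse_simplices_def strongly_transverse_def)
    interpret kan_horn M F n k \<tau> g
      by unfold_locales (use n k \<tau> match g in \<open>auto simp: strongly_transverse_simplices_def\<close>)
    have st: "\<forall>j\<in>N. strong_fn F {..n} (\<tau> j) (g j)"
    proof
      fix j assume j: "j \<in> N"
      then have "level_fn M F (\<tau> j) {..n} (g j)" "strongly_transverse M F n (\<tau> j)"
        using g \<tau> by (simp_all add: strongly_transverse_simplices_def)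
      then show "strong_fn F {..n} (\<tau> j) (g j)"
        using strongly_transverse_iff[OF _ image[OF simplex[OF j]] n] by blast
    qed
    obtain \<sigma> \<psi> where \<sigma>: "singular_simplex (Suc n) M \<sigma>" "\<And>j. j \<in> N \<Longrightarrow> singular_face (Suc n) j \<sigma> = \<tau> j"
      and \<psi>: "level_fn M F (singular_face (Suc n) k \<sigma>) {..n} \<psi>" "strong_fn F {..n} (singular_face (Suc n) k \<sigma>) \<psi>"
      by (rule filler[OF assms(3) sc E Mt assms(6) disjI2[OF st]]) (use st in blast)
    have "singular_simplex n M (singular_face (Suc n) k \<sigma>)"
      using singular_simplex_singular_face[OF \<sigma>(1)] k by simp
    with \<sigma> \<psi> strongly_transverse_iff[OF \<psi>(1) image n]
    show "\<exists>\<sigma>\<in>singular_simplex_set (n + 1) M. (\<forall>i\<in>{..n + 1} - {k}. singular_face (n + 1) i \<sigma> = \<tau> i) \<and>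
           singular_face (n + 1) k \<sigma> \<in> strongly_transverse_simplices M F n"
      by (auto simp: strongly_transverse_simplices_def intro!: exI[of _ \<sigma>])
  qed
  have weak: "weak_kan M (transverse_simplices M F) n" if n3: "3 \<le> n" for n
    unfolding weak_kan_def
  proof (intro allI impI, elim conjE)
    fix k \<tau>
    assume k: "k \<le> n + 1" and \<tau>: "\<forall>j\<in>{..n + 1} - {k}. \<tau> j \<in> transverse_simplices M F n"
      and match: "\<forall>i\<in>{..n + 1} - {k}. \<forall>j\<in>{..n + 1} - {k}. i < j \<longrightarrow>
           singular_face n i (\<tau> j) = singular_face n (j - 1) (\<tau> i)"
    have n2: "2 \<le> n" using n3 by simp
    obtain g where g: "\<forall>j\<in>{..n + 1} - {k}. level_fn M F (\<tau> j) {..n} (g j)"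
      using level[of "{..n + 1} - {k}" n \<tau>] \<tau> n2 by (auto simp: transverse_simplices_def)
    interpret kan_horn M F n k \<tau> g
      by unfold_locales (use n2 k \<tau> match g in \<open>auto simp: transverse_simplices_def\<close>)
    obtain \<sigma> \<psi> where \<sigma>: "singular_simplex (Suc n) M \<sigma>" "\<And>j. j \<in> N \<Longrightarrow> singular_face (Suc n) j \<sigma> = \<tau> j"
      and \<psi>: "level_fn M F (singular_face (Suc n) k \<sigma>) {..n} \<psi>"
      by (rule filler[OF assms(3) sc E Mt assms(6) disjI1[OF n3]]) blast
    have "singular_simplex n M (singular_face (Suc n) k \<sigma>)"
      using singular_simplex_singular_face[OF \<sigma>(1)] k by simp
    with \<sigma> level_fn_transverse[OF \<psi> n2]
    show "\<exists>\<sigma>\<in>singular_simplex_set (n + 1) M. (\<forall>i\<in>{..n + 1} - {k}. singular_face (n + 1) i \<sigma> = \<tau> i) \<and>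
           singular_face (n + 1) k \<sigma> \<in> transverse_simplices M F n"
      by (auto simp: transverse_simplices_def intro!: exI[of _ \<sigma>])
  qed
  show ?thesis using strong weak by simp
qed

end
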